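(* Consider on $\mathbb{R}_+=[0,\infty)$ (resp. $\mathbb{R}_-=(-\infty,0]$) the weighted matrix Sturm–Liouville (quasi-differential) equation $$Py:=-\frac{d}{dx}\Bigl(A(x)^{-1}\frac{dy}{dx}+Q(x)y\Bigr)+Q(x)^*\frac{dy}{dx}+R(x)y=\lambda\mathcal{H}(x)y,$$ with coefficients as in the context, $A(x)$ positive definite for all $x$ and $\mathcal{H}\ge0$. Let $$c(x)=\begin{cases}\max\bigl(1,\|A(x)^{-1/2}\mathcal{H}(x)^{-1/2}\|\bigr),&\det(A(x)\mathcal{H}(x))\neq0,\\ \infty,&\text{otherwise}.\end{cases}$$ Suppose that $V:=R-Q^*AQ\ge-q\mathcal{H}$ where $q\ge\delta>0$ is a function with $$\int_0^\infty\frac{dx}{c(x)q(x)^{1/2}}=\infty\qquad\Bigl(\text{resp. }\int_{-\infty}^0\frac{dx}{c(x)q(x)^{1/2}}=\infty\Bigr).$$ Assume moreover that one of the following holds: (1) $q^{-1/2}$ is absolutely continuous and, for some constant $C_1$, $\bigl|\frac{d}{dx}q^{-1/2}(x)\bigr|\,c(x)\le C_1$ on $\mathbb{R}_+$ (resp. $\mathbb{R}_-$); (2) $q$ is monotone increasing (resp. monotone decreasing). Then $\mathcal{N}_\pm(P_+)=N_\pm(P_+)=n$ (resp. $\mathcal{N}_\pm(P_-)=N_\pm(P_-)=n$).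
   Context: Let $I=\mathbb{R}_+$ (resp. $\mathbb{R}_-$). Assumptions: $A,Q,R,\mathcal{H}\in L^1_{loc}(I,\mathrm{Mat}(n,\mathbb{C}))$, $R=R^*$, and also $AQ,\ Q^*AQ\in L^1_{loc}(I,\mathrm{Mat}(n,\mathbb{C}))$, so that the equation is equivalent, via $u=y$, $v=i(A^{-1}y'+Qy)$, to the first order system $$\begin{pmatrix}0 & i I \\ {i I} & 0\end{pmatrix}\binom uv'+\begin{pmatrix}R-Q^*AQ & -i Q^*A \\ {i AQ} & -A\end{pmatrix}\binom uv=\lambda\begin{pmatrix}\mathcal H & 0 \\ 0 & 0\end{pmatrix}\binom uv$$ with locally integrable coefficients. A solution $y$ is a function such that $y$ and $A^{-1}y'+Qy$ are absolutely continuous on compact subintervals of $I$ and the equation holds a.e. Conventions: $1/\infty=0$, $0\cdot\infty=0$, so (1) means $|\frac{d}{dx}q^{-1/2}|\le C_1/c(x)$ a.e.; monotone is meant in the non-strict sense. $\mathcal{L}^2_{\mathcal H}(I)$: Borel measurable $f:I\to\mathbb{C}^n$ with $\int_I f^*\mathcal{H}f<\infty$, $\langle f,g\rangle_{\mathcal H}=\int_I f^*\mathcal Hg$; $L^2_{\mathcal H}(I)$ is the quotient Hilbert space by null functions. The formal deficiency indices $\mathcal{N}_\pm(P_+)$ (resp. $\mathcal N_\pm(P_-)$) are the numbers of linearly independent solutions of $Py=\lambda\mathcal{H}y$ in $\mathcal{L}^2_{\mathcal H}(I)$ for $\lambda\in\mathbb{C}_\pm$ (upper/lower half plane; the number does not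 depend on $\lambda\in\mathbb{C}_+$, resp. $\lambda\in\mathbb{C}_-$). The deficiency indices $N_\pm$ are those of the symmetric relation $T$ in $L^2_{\mathcal H}(I)$ consisting of classes of pairs $\{u,v\}$ with $u$, $A^{-1}u'+Qu$ absolutely continuous, $v\in\mathcal{L}^2_{\mathcal H}(I)$, all compactly supported in the interior of $I$, and $-(A^{-1}u'+Qu)'+Q^*u'+Ru=\mathcal{H}v$: $N_\pm=\dim\{\tilde f:\{\tilde f,\pm i\tilde f\}\in T^*\}$, $T^*=\{\{\tilde f,\tilde g\}:\langle\tilde f,\tilde\psi\rangle_{\mathcal H}=\langle\tilde g,\tilde\varphi\rangle_{\mathcal H}\ \forall\{\tilde\varphi,\tilde\psi\}\in T\}$. *)

theory Defs
  imports "HOL-Analysis.Analysis"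
begin

section \<open>Complex matrices\<close>

definition cdot :: "complex^'n \<Rightarrow> complex^'n \<Rightarrow> complex" where
  "cdot v w = (\<Sum>i\<in>UNIV. cnj (v $ i) * w $ i)"

definition ctranspose :: "complex^'n^'m \<Rightarrow> complex^'m^'n" where
  "ctranspose M = (\<chi> i j. cnj (M $ j $ i))"

definition hermitian :: "complex^'n^'n \<Rightarrow> bool" where
  "hermitian M \<longleftrightarrow> ctranspose M = M"

definition pos_semidef :: "complex^'n^'n \<Rightarrow> bool" where
  "pos_semidef M \<longleftrightarrow> hermitian M \<and> (\<forall>v. 0 \<le> Re (cdot v (M *v v)))"

definition pos_def :: "complex^'n^'n \<Rightarrow> bool" where
  "pos_def M \<longleftrightarrow> hermitian M \<and> (\<forall>v. v \<noteq> 0 \<longrightarrow> 0 < Re (cdot v (M *v v)))"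

definition loewner_le :: "complex^'n^'n \<Rightarrow> complex^'n^'n \<Rightarrow> bool" where
  "loewner_le M N \<longleftrightarrow> pos_semidef (N - M)"

text \<open>The positive semidefinite square root; used only for positive semidefinite arguments,
  where it exists and is unique.\<close>

definition matrix_sqrt :: "complex^'n^'n \<Rightarrow> complex^'n^'n" where
  "matrix_sqrt M = (THE S. pos_semidef S \<and> S ** S = M)"

definition matrix_inv_sqrt :: "complex^'n^'n \<Rightarrow> complex^'n^'n" where
  "matrix_inv_sqrt M = matrix_inv (matrix_sqrt M)"

section \<open>Local integrability and absolute continuity\<close>

definition locally_integrable_on :: "real set \<Rightarrow> (real \<Rightarrow> 'a::euclidean_space) \<Rightarrow> bool" where
  "locally_integrable_on I f \<longleftrightarrow> (\<forall>a b. {a..b} \<subseteq> I \<longrightarrow> f absolutely_integrable_on {a..b})"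

definition abs_continuous_on :: "real \<Rightarrow> real \<Rightarrow> (real \<Rightarrow> 'a::real_normed_vector) \<Rightarrow> bool" where
  "abs_continuous_on a b f \<longleftrightarrow>
     (\<forall>\<epsilon>>0. \<exists>\<delta>>0. \<forall>(m::nat) s t.
        (\<forall>i<m. a \<le> s i \<and> s i \<le> t i \<and> t i \<le> b) \<and>
        disjoint_family_on (\<lambda>i. {s i<..<t i}) {..<m} \<and>
        (\<Sum>i<m. t i - s i) < \<delta>
        \<longrightarrow> (\<Sum>i<m. norm (f (t i) - f (s i))) < \<epsilon>)"

definition locally_abs_continuous_on :: "real set \<Rightarrow> (real \<Rightarrow> 'a::real_normed_vector) \<Rightarrow> bool" where
  "locally_abs_continuous_on I f \<longleftrightarrow> (\<forall>a b. {a..b} \<subseteq> I \<longrightarrow> abs_continuous_on a b f)"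

section \<open>The dimension of a complex vector space given by explicit operations\<close>

primrec lin_comb ::
  "('v \<Rightarrow> 'v \<Rightarrow> 'v) \<Rightarrow> (complex \<Rightarrow> 'v \<Rightarrow> 'v) \<Rightarrow> 'v \<Rightarrow> (nat \<Rightarrow> complex) \<Rightarrow> (nat \<Rightarrow> 'v) \<Rightarrow> nat \<Rightarrow> 'v"
where
  "lin_comb add scl z a F 0 = z"
| "lin_comb add scl z a F (Suc k) = add (lin_comb add scl z a F k) (scl (a k) (F k))"

text \<open>The supremum of the lengths of linearly independent families in \<open>V\<close>;
  it is \<open>\<infinity>\<close> when \<open>V\<close> is infinite-dimensional.\<close>

definition complex_dim ::
  "('v \<Rightarrow> 'v \<Rightarrow> 'v) \<Rightarrow> (complex \<Rightarrow> 'v \<Rightarrow> 'v) \<Rightarrow> 'v \<Rightarrow> 'v set \<Rightarrow> enat"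
where
  "complex_dim add scl z V =
     (SUP k \<in> {k. \<exists>F. (\<forall>i<k. F i \<in> V) \<and>
                     (\<forall>a. lin_comb add scl z a F k = z \<longrightarrow> (\<forall>i<k. a i = 0))}. enat k)"

section \<open>The weighted space of square-integrable functions\<close>

type_synonym 'n vfun = "real \<Rightarrow> complex^'n"
type_synonym 'n mfun = "real \<Rightarrow> complex^'n^'n"

text \<open>Functions on \<open>I\<close> are represented by functions on the real line that vanish off \<open>I\<close>.
  The coefficients are only Lebesgue measurable, hence integration is with respect
  to \<^const>\<open>lebesgue\<close>.\<close>

definition L2fun :: "real set \<Rightarrow> 'n::finite mfun \<Rightarrow> 'n vfun set" where
  "L2fun I H = {f. f \<in> borel_measurable borel \<and> (\<forall>x. x \<notin> I \<longrightarrow> f x = 0) \<and>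
                   set_integrable lebesgue I (\<lambda>x. cdot (f x) (H x *v f x))}"

definition ip :: "real set \<Rightarrow> 'n::finite mfun \<Rightarrow> 'n vfun \<Rightarrow> 'n vfun \<Rightarrow> complex" where
  "ip I H f g = (LINT x:I|lebesgue. cdot (f x) (H x *v g x))"

definition fun_add :: "'n vfun \<Rightarrow> 'n vfun \<Rightarrow> 'n::finite vfun" where
  "fun_add f g = (\<lambda>x. f x + g x)"

definition fun_scale :: "complex \<Rightarrow> 'n vfun \<Rightarrow> 'n::finite vfun" where
  "fun_scale a f = (\<lambda>x. a *s f x)"

definition L2rel :: "real set \<Rightarrow> 'n::finite mfun \<Rightarrow> ('n vfun \<times> 'n vfun) set" where
  "L2rel I H = {(f, g). f \<in> L2fun I H \<and> g \<in> L2fun I H \<and>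
                        ip I H (\<lambda>x. f x - g x) (\<lambda>x. f x - g x) = 0}"

text \<open>The quotient Hilbert space: its elements are the classes of \<^const>\<open>L2rel\<close>, and
  its operations are induced by those on representatives.\<close>

definition L2space :: "real set \<Rightarrow> 'n::finite mfun \<Rightarrow> 'n vfun set set" where
  "L2space I H = L2fun I H // L2rel I H"

definition cls :: "real set \<Rightarrow> 'n::finite mfun \<Rightarrow> 'n vfun \<Rightarrow> 'n vfun set" where
  "cls I H f = L2rel I H `` {f}"

definition cls_add ::
  "real set \<Rightarrow> 'n::finite mfun \<Rightarrow> 'n vfun set \<Rightarrow> 'n vfun set \<Rightarrow> 'n vfun set" where
  "cls_add I H F G = (\<Union>f\<in>F. \<Union>g\<in>G. cls I H (fun_add f g))"

definition cls_scale ::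
  "real set \<Rightarrow> 'n::finite mfun \<Rightarrow> complex \<Rightarrow> 'n vfun set \<Rightarrow> 'n vfun set" where
  "cls_scale I H a F = (\<Union>f\<in>F. cls I H (fun_scale a f))"

definition cls_ip ::
  "real set \<Rightarrow> 'n::finite mfun \<Rightarrow> 'n vfun set \<Rightarrow> 'n vfun set \<Rightarrow> complex" where
  "cls_ip I H F G = the_elem (\<Union>f\<in>F. \<Union>g\<in>G. {ip I H f g})"

section \<open>The quasi-differential equation\<close>

text \<open>\<open>A\<^sup>-\<^sup>1 y' + Q y\<close> is defined only almost everywhere, so its absolute continuity means that
  it has an absolutely continuous representative \<open>w\<close> (which is unique on \<open>I\<close>). The
  derivatives below exist for almost all \<open>x\<close> because \<open>y\<close> and \<open>w\<close> are locally absolutely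
  continuous.\<close>

definition quasi_deriv :: "'n::finite mfun \<Rightarrow> 'n mfun \<Rightarrow> real set \<Rightarrow> 'n vfun \<Rightarrow> 'n vfun \<Rightarrow> bool" where
  "quasi_deriv A Q I y w \<longleftrightarrow>
     locally_abs_continuous_on I y \<and> locally_abs_continuous_on I w \<and>
     (AE x in lebesgue. x \<in> I \<longrightarrow>
        w x = matrix_inv (A x) *v vector_derivative y (at x) + Q x *v y x)"

text \<open>\<open>P y = h\<close> almost everywhere on \<open>I\<close>, where \<open>w\<close> is the quasi-derivative of \<open>y\<close>.\<close>

definition quasi_eq ::
  "'n::finite mfun \<Rightarrow> 'n mfun \<Rightarrow> 'n mfun \<Rightarrow> real set \<Rightarrow> 'n vfun \<Rightarrow> 'n vfun \<Rightarrow> 'n vfun \<Rightarrow> bool" where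
  "quasi_eq A Q R I y w h \<longleftrightarrow>
     quasi_deriv A Q I y w \<and>
     (AE x in lebesgue. x \<in> I \<longrightarrow>
        - vector_derivative w (at x) + ctranspose (Q x) *v vector_derivative y (at x) + R x *v y x
          = h x)"

definition is_solution ::
  "'n::finite mfun \<Rightarrow> 'n mfun \<Rightarrow> 'n mfun \<Rightarrow> 'n mfun \<Rightarrow> real set \<Rightarrow> complex \<Rightarrow> 'n vfun \<Rightarrow> bool" where
  "is_solution A Q R H I lam y \<longleftrightarrow> (\<exists>w. quasi_eq A Q R I y w (\<lambda>x. lam *s (H x *v y x)))"

section \<open>Deficiency indices\<close>

text \<open>The number of linearly independent square-integrable solutions for the parameter \<open>lam\<close>:
  here functions are not identified modulo null functions.\<close>

definition formal_deficiency ::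
  "'n::finite mfun \<Rightarrow> 'n mfun \<Rightarrow> 'n mfun \<Rightarrow> 'n mfun \<Rightarrow> real set \<Rightarrow> complex \<Rightarrow> enat" where
  "formal_deficiency A Q R H I lam =
     complex_dim fun_add fun_scale (\<lambda>x. 0) {y \<in> L2fun I H. is_solution A Q R H I lam y}"

definition min_relation ::
  "'n::finite mfun \<Rightarrow> 'n mfun \<Rightarrow> 'n mfun \<Rightarrow> 'n mfun \<Rightarrow> real set \<Rightarrow> ('n vfun set \<times> 'n vfun set) set" where
  "min_relation A Q R H I =
     {(cls I H u, cls I H v) | u v.
        v \<in> L2fun I H \<and>
        (\<exists>w K. compact K \<and> K \<subseteq> interior I \<and>
               (\<forall>x. x \<notin> K \<longrightarrow> u x = 0 \<and> w x = 0 \<and> v x = 0) \<and>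
               quasi_eq A Q R I u w (\<lambda>x. H x *v v x))}"

definition adjoint_relation ::
  "real set \<Rightarrow> 'n::finite mfun \<Rightarrow> ('n vfun set \<times> 'n vfun set) set \<Rightarrow> ('n vfun set \<times> 'n vfun set) set" where
  "adjoint_relation I H T =
     {(F, G). F \<in> L2space I H \<and> G \<in> L2space I H \<and>
              (\<forall>(\<Phi>, \<Psi>) \<in> T. cls_ip I H F \<Psi> = cls_ip I H G \<Phi>)}"

text \<open>The deficiency indices \<open>N\<^sub>+\<close> and \<open>N\<^sub>-\<close> are the values at \<open>z = \<i>\<close> and \<open>z = - \<i>\<close>.\<close>

definition deficiency_index ::
  "'n::finite mfun \<Rightarrow> 'n mfun \<Rightarrow> 'n mfun \<Rightarrow> 'n mfun \<Rightarrow> real set \<Rightarrow> complex \<Rightarrow> enat" where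
  "deficiency_index A Q R H I z =
     complex_dim (cls_add I H) (cls_scale I H) (cls I H (\<lambda>x. 0))
       {F \<in> L2space I H. (F, cls_scale I H z F) \<in> adjoint_relation I H (min_relation A Q R H I)}"

section \<open>The comparison function\<close>

definition c_fun :: "'n::finite mfun \<Rightarrow> 'n mfun \<Rightarrow> real \<Rightarrow> ennreal" where
  "c_fun A H x =
     (if det (A x ** H x) \<noteq> 0
      then max 1 (ennreal (onorm (\<lambda>v. (matrix_inv_sqrt (A x) ** matrix_inv_sqrt (H x)) *v v)))
      else \<infinity>)"

end

theory Submission
  imports Defs
begin

text \<open>Along a solution, \<open>(Im (y\<^sup>* w))' = - Im \<lambda> y\<^sup>* H y\<close>, and up to a factor \<open>Im (y\<^sup>* w)\<close> is
  \<open>|y - i s w|\<^sup>2 - |y + i s w|\<^sup>2\<close> for \<open>s = \<plusminus>1\<close>. Solutions with prescribed \<open>y - i s w\<close> at 0 and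
  \<open>y + i s w = 0\<close> at a far point therefore have uniformly bounded energy, and a compactness argument yields
  \<open>n\<close> independent square-integrable solutions. Conversely, the hypotheses on \<open>q\<close> force \<open>y\<^sup>* w\<close> to come
  arbitrarily close to 0 whenever \<open>y\<close> is a square-integrable solution, so that \<open>Im (y\<^sup>* w)\<close> has a sign at 0 on
  the whole space of these solutions; \<open>n + 1\<close> of them have a combination with \<open>y = i s w\<close> at 0, which must
  vanish. Finally the divergence of the integral makes \<open>det H\<close> nonzero on a set of positive measure, hence
  classes of solutions are nonzero, and every element of the defect space is the class of a solution.\<close>

section \<open>Absolutely continuous functions and their derivatives\<close>

text \<open>Why \<open>y^* w\<close> must come close to 0: put F = y^* w, a = w^* A w and h = y^* H
  y. Along a solution F' = a + y^* V y - lam h, and V >= -q H, so Re F' is at least a - (q + |lam|)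
  h, where h is integrable but q may be unbounded. Cauchy-Schwarz through the square roots of A and
  H gives |F| <= c sqrt(a h), which is how c enters. After division by q, AM-GM bounds |F| / (c sqrt
  q) by (a/q + h)/2; a lower bound for |F| thus makes Re F grow at the rate 1 / (c sqrt q), whose
  integral diverges. The division costs a derivative of 1/q, and this is what alternatives (1) and
  (2) control. Growth of Re F alone is no contradiction; the estimate survives the weight 1/(1 +
  u^2) in the derivative of arctan u, because |u| is at most a multiple of |F|, and arctan is
  bounded. The other obstacle is the epsilon-delta form of absolute continuity in the definitions:
  Lebesgue's fundamental theorem of calculus has to be available for it before solutions can be
  integrated, and its integral form \<open>ac_deriv\<close> is the working notion from then
  on.\<close>

lemma abs_continuous_on_finite_family:
  fixes f :: "real \<Rightarrow> 'a::real_normed_vector"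
  assumes f: "abs_continuous_on a b f" and e: "e > 0"
  obtains d where "d > 0"
    "\<And>(J::'i set) s t. finite J \<Longrightarrow> (\<And>i. i \<in> J \<Longrightarrow> a \<le> s i \<and> s i \<le> t i \<and> t i \<le> b) \<Longrightarrow>
       disjoint_family_on (\<lambda>i. {s i<..<t i}) J \<Longrightarrow> (\<Sum>i\<in>J. t i - s i) < d \<Longrightarrow>
       (\<Sum>i\<in>J. norm (f (t i) - f (s i))) < e"
proof -
  obtain d where d: "d > 0" and D: "\<And>(m::nat) s t. (\<forall>i<m. a \<le> s i \<and> s i \<le> t i \<and> t i \<le> b) \<Longrightarrow>
        disjoint_family_on (\<lambda>i. {s i<..<t i}) {..<m} \<Longrightarrow>
        (\<Sum>i<m. t i - s i) < d
        \<Longrightarrow> (\<Sum>i<m. norm (f (t i) - f (s i))) < e"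
    using f e unfolding abs_continuous_on_def by meson
  have "(\<Sum>i\<in>J. norm (f (t i) - f (s i))) < e"
    if J: "finite J" "\<And>i. i \<in> J \<Longrightarrow> a \<le> s i \<and> s i \<le> t i \<and> t i \<le> b"
      "disjoint_family_on (\<lambda>i. {s i<..<t i}) J" "(\<Sum>i\<in>J. t i - s i) < d" for J :: "'i set" and s t
  proof -
    obtain h where h: "bij_betw h {..<card J} J"
      using ex_bij_betw_nat_finite[OF J(1)] by (auto simp: atLeast0LessThan)
    have "(\<Sum>i<card J. norm (f (t (h i)) - f (s (h i)))) < e"
    proof (rule D)
      show "\<forall>i<card J. a \<le> s (h i) \<and> s (h i) \<le> t (h i) \<and> t (h i) \<le> b"
        using h J(2) by (auto simp: bij_betw_def)
      show "disjoint_family_on (\<lambda>i. {s (h i)<..<t (h i)}) {..<card J}"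
        using h J(3) unfolding disjoint_family_on_def bij_betw_def inj_on_def by (metis imageI)
      show "(\<Sum>i<card J. t (h i) - s (h i)) < d"
        using sum.reindex_bij_betw[OF h, of "\<lambda>i. t i - s i"] J(4) by simp
    qed
    then show ?thesis using sum.reindex_bij_betw[OF h, of "\<lambda>i. norm (f (t i) - f (s i))"] by simp
  qed
  with d that show thesis by blast
qed

text \<open>Every closure property of absolute continuity used below (differences, components,
  products, bounded linear and C1 images) is an instance of this two-term bound on
  increments.\<close>

lemma abs_continuous_on_dominated:
  fixes f :: "real \<Rightarrow> 'a::real_normed_vector" and g :: "real \<Rightarrow> 'b::real_normed_vector"
    and h :: "real \<Rightarrow> 'c::real_normed_vector"
  assumes f: "abs_continuous_on a b f" and g: "abs_continuous_on a b g"
    and dom: "\<And>x y. a \<le> x \<Longrightarrow> x \<le> y \<Longrightarrow> y \<le> b \<Longrightarrow>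
      norm (h y - h x) \<le> C * norm (f y - f x) + D * norm (g y - g x)"
  shows "abs_continuous_on a b h"
  unfolding abs_continuous_on_def
proof (intro allI impI)
  fix e :: real assume e: "e > 0"
  define B where "B = \<bar>C\<bar> + \<bar>D\<bar> + 1"
  have B: "B > 0" "C \<le> B" "D \<le> B" unfolding B_def by auto
  have e': "e / (2 * B) > 0" using e B by simp
  obtain d1 where d1: "d1 > 0" and D1: "\<And>(m::nat) s t. (\<forall>i<m. a \<le> s i \<and> s i \<le> t i \<and> t i \<le> b) \<Longrightarrow>
        disjoint_family_on (\<lambda>i. {s i<..<t i}) {..<m} \<Longrightarrow> (\<Sum>i<m. t i - s i) < d1
        \<Longrightarrow> (\<Sum>i<m. norm (f (t i) - f (s i))) < e / (2 * B)"
    using f e' unfolding abs_continuous_on_def by meson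
  obtain d2 where d2: "d2 > 0" and D2: "\<And>(m::nat) s t. (\<forall>i<m. a \<le> s i \<and> s i \<le> t i \<and> t i \<le> b) \<Longrightarrow>
        disjoint_family_on (\<lambda>i. {s i<..<t i}) {..<m} \<Longrightarrow> (\<Sum>i<m. t i - s i) < d2
        \<Longrightarrow> (\<Sum>i<m. norm (g (t i) - g (s i))) < e / (2 * B)"
    using g e' unfolding abs_continuous_on_def by meson
  show "\<exists>\<delta>>0. \<forall>m s t. (\<forall>i<m. a \<le> s i \<and> s i \<le> t i \<and> t i \<le> b) \<and>
          disjoint_family_on (\<lambda>i. {s i<..<t i}) {..<(m::nat)} \<and> (\<Sum>i<m. t i - s i) < \<delta> \<longrightarrow>
          (\<Sum>i<m. norm (h (t i) - h (s i))) < e"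
  proof (intro exI[of _ "min d1 d2"] conjI allI impI)
    show "0 < min d1 d2" using d1 d2 by simp
    fix m :: nat and s t :: "nat \<Rightarrow> real"
    assume A: "(\<forall>i<m. a \<le> s i \<and> s i \<le> t i \<and> t i \<le> b) \<and>
          disjoint_family_on (\<lambda>i. {s i<..<t i}) {..<m} \<and> (\<Sum>i<m. t i - s i) < min d1 d2"
    have "(\<Sum>i<m. norm (h (t i) - h (s i)))
        \<le> (\<Sum>i<m. B * norm (f (t i) - f (s i)) + B * norm (g (t i) - g (s i)))"
    proof (rule sum_mono)
      fix i assume "i \<in> {..<m}"
      then have "norm (h (t i) - h (s i)) \<le> C * norm (f (t i) - f (s i)) + D * norm (g (t i) - g (s i))"
        using A by (intro dom) auto
      also have "\<dots> \<le> B * norm (f (t i) - f (s i)) + B * norm (g (t i) - g (s i))"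
        using B by (intro add_mono mult_right_mono) auto
      finally show "norm (h (t i) - h (s i)) \<le> B * norm (f (t i) - f (s i)) + B * norm (g (t i) - g (s i))" .
    qed
    also have "\<dots> = B * (\<Sum>i<m. norm (f (t i) - f (s i))) + B * (\<Sum>i<m. norm (g (t i) - g (s i)))"
      by (simp add: sum.distrib sum_distrib_left)
    also have "\<dots> < B * (e / (2 * B)) + B * (e / (2 * B))"
      using D1[of m s t] D2[of m s t] A B by (intro add_strict_mono mult_strict_left_mono) auto
    also have "\<dots> = e" using B by (simp add: field_simps)
    finally show "(\<Sum>i<m. norm (h (t i) - h (s i))) < e" .
  qed
qed

lemma abs_continuous_on_imp_continuous_on:
  fixes f :: "real \<Rightarrow> 'a::real_normed_vector"
  assumes f: "abs_continuous_on a b f"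
  shows "continuous_on {a..b} f"
  unfolding continuous_on_iff
proof (intro ballI allI impI)
  fix x e :: real assume x: "x \<in> {a..b}" and e: "0 < e"
  obtain d where d: "d > 0" and D: "\<And>(J::nat set) s t. finite J \<Longrightarrow> (\<And>i. i \<in> J \<Longrightarrow> a \<le> s i \<and> s i \<le> t i \<and> t i \<le> b) \<Longrightarrow>
       disjoint_family_on (\<lambda>i. {s i<..<t i}) J \<Longrightarrow> (\<Sum>i\<in>J. t i - s i) < d \<Longrightarrow>
       (\<Sum>i\<in>J. norm (f (t i) - f (s i))) < e"
    using abs_continuous_on_finite_family[OF f e, where 'i=nat] by blast
  have "dist (f y) (f x) < e" if y: "y \<in> {a..b}" "dist y x < d" for y
    using D[of "{0}" "\<lambda>_. min x y" "\<lambda>_. max x y"] x y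
    by (cases "x \<le> y") (auto simp: disjoint_family_on_def dist_norm min_def max_def norm_minus_commute abs_if split: if_splits)
  then show "\<exists>d>0. \<forall>x'\<in>{a..b}. dist x' x < d \<longrightarrow> dist (f x') (f x) < e" using d by blast
qed

lemma abs_continuous_on_subinterval:
  assumes "abs_continuous_on a b f" "a \<le> c" "d \<le> b"
  shows "abs_continuous_on c d f"
  using assms unfolding abs_continuous_on_def by (meson order_trans)

section \<open>Positive variation\<close>

lemma disjoint_family_on_subsets:
  "disjoint_family_on A J \<Longrightarrow> (\<And>i. i \<in> J \<Longrightarrow> B i \<subseteq> A i) \<Longrightarrow> disjoint_family_on B J"
  unfolding disjoint_family_on_def by blast

lemma sum_length_disjoint_le:
  fixes s t :: "'i \<Rightarrow> real"
  assumes J: "finite J" "\<And>i. i \<in> J \<Longrightarrow> a \<le> s i \<and> s i \<le> t i \<and> t i \<le> b"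
    "disjoint_family_on (\<lambda>i. {s i<..<t i}) J" and "a \<le> b"
  shows "(\<Sum>i\<in>J. t i - s i) \<le> b - a"
proof -
  have "(\<Sum>i\<in>J. t i - s i) = (\<Sum>i\<in>J. measure lborel {s i<..<t i})"
    using J by (intro sum.cong) auto
  also have "\<dots> = measure lborel (\<Union>i\<in>J. {s i<..<t i})"
    using J by (intro measure_finite_Union[symmetric]) (auto simp: emeasure_lborel_box_eq)
  also have "\<dots> \<le> measure lborel {a..b}"
  proof (rule measure_mono_fmeasurable)
    show "(\<Union>i\<in>J. {s i<..<t i}) \<subseteq> {a..b}"
    proof
      fix x assume "x \<in> (\<Union>i\<in>J. {s i<..<t i})"
      then obtain i where i: "i \<in> J" "s i < x" "x < t i" by auto
      then show "x \<in> {a..b}" using J(2)[OF i(1)] by auto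
    qed
    show "{a..b} \<in> fmeasurable lborel" by (rule fmeasurableI) (auto simp: emeasure_lborel_Icc_eq)
  qed (use J(1) in auto)
  finally show ?thesis using assms by simp
qed

text \<open>The positive variation \<open>P x = Sup (posvar_sums f a x)\<close> of an absolutely continuous \<open>f\<close> makes
  both \<open>P\<close> and \<open>P - f\<close> monotone and absolutely continuous.\<close>

definition posvar_sums :: "(real \<Rightarrow> real) \<Rightarrow> real \<Rightarrow> real \<Rightarrow> real set" where
  "posvar_sums f a x = {(\<Sum>i<(m::nat). f (t i) - f (s i)) | m s t.
     (\<forall>i<m. a \<le> s i \<and> s i \<le> t i \<and> t i \<le> x) \<and> disjoint_family_on (\<lambda>i. {s i<..<t i}) {..<m}}"

text \<open>Each interval is cut at c by \<open>min\<close> and \<open>max\<close>; the halves stay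
  disjoint, and degenerate ones contribute 0. Together with \<open>posvar_sums_append\<close> this
  makes the suprema additive over adjacent intervals.\<close>

lemma posvar_sums_split:
  assumes r: "r \<in> posvar_sums f a x" and c: "a \<le> c" "c \<le> x"
  obtains r1 r2 where "r = r1 + r2" "r1 \<in> posvar_sums f a c" "r2 \<in> posvar_sums f c x"
proof -
  obtain m s t where r: "r = (\<Sum>i<(m::nat). f (t i) - f (s i))"
    and st: "\<forall>i<m. a \<le> s i \<and> s i \<le> t i \<and> t i \<le> x" "disjoint_family_on (\<lambda>i. {s i<..<t i}) {..<m}"
    using r unfolding posvar_sums_def by blast
  show thesis
  proof
    show "r = (\<Sum>i<m. f (min (t i) c) - f (min (s i) c)) + (\<Sum>i<m. f (max (t i) c) - f (max (s i) c))"
      unfolding r sum.distrib[symmetric] by (intro sum.cong refl) (auto simp: min_def max_def)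
    show "(\<Sum>i<m. f (min (t i) c) - f (min (s i) c)) \<in> posvar_sums f a c"
      unfolding posvar_sums_def
      by (rule CollectI, rule exI[of _ m], rule exI[of _ "\<lambda>i. min (s i) c"],
          rule exI[of _ "\<lambda>i. min (t i) c"], intro conjI, rule refl)
         (use st(1) c in fastforce, rule disjoint_family_on_subsets[OF st(2)], auto simp: min_less_iff_disj)
    show "(\<Sum>i<m. f (max (t i) c) - f (max (s i) c)) \<in> posvar_sums f c x"
      unfolding posvar_sums_def
      by (rule CollectI, rule exI[of _ m], rule exI[of _ "\<lambda>i. max (s i) c"],
          rule exI[of _ "\<lambda>i. max (t i) c"], intro conjI, rule refl) (use st(1) c in fastforce, rule disjoint_family_on_subsets[OF st(2)], auto simp: less_max_iff_disj)
  qed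
qed

lemma posvar_sums_append:
  assumes "r1 \<in> posvar_sums f a c" "r2 \<in> posvar_sums f c x" "a \<le> c" "c \<le> x"
  shows "r1 + r2 \<in> posvar_sums f a x"
proof -
  obtain m s t where r: "r1 = (\<Sum>i<(m::nat). f (t i) - f (s i))"
    and st: "\<forall>i<m. a \<le> s i \<and> s i \<le> t i \<and> t i \<le> c" "disjoint_family_on (\<lambda>i. {s i<..<t i}) {..<m}"
    using assms(1) unfolding posvar_sums_def by blast
  obtain m' s' t' where r': "r2 = (\<Sum>i<(m'::nat). f (t' i) - f (s' i))"
    and st': "\<forall>i<m'. c \<le> s' i \<and> s' i \<le> t' i \<and> t' i \<le> x" "disjoint_family_on (\<lambda>i. {s' i<..<t' i}) {..<m'}"
    using assms(2) unfolding posvar_sums_def by blast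
  define S where "S i = (if i < m then s i else s' (i - m))" for i
  define T where "T i = (if i < m then t i else t' (i - m))" for i
  have "r1 + r2 = (\<Sum>i<m + m'. f (T i) - f (S i))"
  proof -
    have "(\<Sum>i<m + m'. f (T i) - f (S i)) = (\<Sum>i<m. f (T i) - f (S i)) + (\<Sum>i=m..<m+m'. f (T i) - f (S i))"
      by (simp add: lessThan_atLeast0 sum.atLeastLessThan_concat)
    also have "(\<Sum>i=m..<m+m'. f (T i) - f (S i)) = (\<Sum>i<m'. f (T (i + m)) - f (S (i + m)))"
      using sum.shift_bounds_nat_ivl[of "\<lambda>i. f (T i) - f (S i)" 0 m m'] by (simp add: lessThan_atLeast0 add.commute)
    finally show ?thesis unfolding r r' S_def T_def by simp
  qed
  moreover have "\<forall>i<m+m'. a \<le> S i \<and> S i \<le> T i \<and> T i \<le> x"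
  proof (intro allI impI)
    fix i assume i: "i < m + m'"
    show "a \<le> S i \<and> S i \<le> T i \<and> T i \<le> x"
    proof (cases "i < m")
      case True then show ?thesis using st(1) assms(3,4) unfolding S_def T_def by fastforce
    next
      case False
      then have "i - m < m'" using i by auto
      then show ?thesis using False st'(1) assms(3,4) unfolding S_def T_def by fastforce
    qed
  qed
  moreover have "disjoint_family_on (\<lambda>i. {S i<..<T i}) {..<m+m'}"
    unfolding disjoint_family_on_def
  proof (intro ballI impI)
    fix i j assume ij: "i \<in> {..<m+m'}" "j \<in> {..<m+m'}" "i \<noteq> j"
    consider "i < m" "j < m" | "i < m" "\<not> j < m" | "\<not> i < m" "j < m" | "\<not> i < m" "\<not> j < m" by blast
    then show "{S i<..<T i} \<inter> {S j<..<T j} = {}"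
    proof cases
      case 1 then show ?thesis using st(2) ij unfolding disjoint_family_on_def S_def T_def by auto
    next
      case 2 then have "j - m < m'" using ij by auto
      then have "t i \<le> c" "c \<le> s' (j - m)" using 2 st(1) st'(1) by auto
      then show ?thesis using 2 unfolding S_def T_def by auto
    next
      case 3 then have "i - m < m'" using ij by auto
      then have "t j \<le> c" "c \<le> s' (i - m)" using 3 st(1) st'(1) by auto
      then show ?thesis using 3 unfolding S_def T_def by auto
    next
      case 4 then have "i - m < m'" "j - m < m'" "i - m \<noteq> j - m" using ij by auto
      then show ?thesis using 4 st'(2) unfolding disjoint_family_on_def S_def T_def by auto
    qed
  qed
  ultimately show ?thesis unfolding posvar_sums_def by blast
qed

lemma posvar_sums_0: "0 \<in> posvar_sums f a x"
  unfolding posvar_sums_def by (rule CollectI, rule exI[of _ 0]) (auto simp: disjoint_family_on_def)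

lemma posvar_sums_1: "a \<le> x \<Longrightarrow> f x - f a \<in> posvar_sums f a x"
  unfolding posvar_sums_def
  by (intro CollectI exI[of _ 1] exI[of _ "\<lambda>_. a"] exI[of _ "\<lambda>_. x"]) (auto simp: disjoint_family_on_def)

text \<open>On an interval shorter than the d that belongs to epsilon = 1 every sum is at most 1,
  and finitely many steps of length d/2 lead from a to b.\<close>

lemma bdd_above_posvar_sums:
  assumes f: "abs_continuous_on a b f"
  shows "bdd_above (posvar_sums f a b)"
proof -
  obtain d where d: "d > 0" and D: "\<And>(J::nat set) s t. finite J \<Longrightarrow> (\<And>i. i \<in> J \<Longrightarrow> a \<le> s i \<and> s i \<le> t i \<and> t i \<le> b) \<Longrightarrow>
       disjoint_family_on (\<lambda>i. {s i<..<t i}) J \<Longrightarrow> (\<Sum>i\<in>J. t i - s i) < d \<Longrightarrow>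
       (\<Sum>i\<in>J. norm (f (t i) - f (s i))) < 1"
    using abs_continuous_on_finite_family[OF f zero_less_one, where 'i=nat] by blast
  have short: "r \<le> 1" if "r \<in> posvar_sums f c x" "a \<le> c" "c \<le> x" "x \<le> b" "x - c < d" for r c x
  proof -
    obtain m s t where r: "r = (\<Sum>i<(m::nat). f (t i) - f (s i))"
      and st: "\<forall>i<m. c \<le> s i \<and> s i \<le> t i \<and> t i \<le> x" "disjoint_family_on (\<lambda>i. {s i<..<t i}) {..<m}"
      using \<open>r \<in> posvar_sums f c x\<close> unfolding posvar_sums_def by blast
    have "(\<Sum>i<m. t i - s i) \<le> x - c" using st that by (intro sum_length_disjoint_le) auto
    then have "(\<Sum>i<m. norm (f (t i) - f (s i))) < 1" using st that by (intro D) fastforce+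
    moreover have "r \<le> (\<Sum>i<m. norm (f (t i) - f (s i)))" unfolding r by (intro sum_mono) auto
    ultimately show ?thesis by linarith
  qed
  have "\<forall>x r. a \<le> x \<longrightarrow> x \<le> b \<longrightarrow> x \<le> a + real n * (d/2) \<longrightarrow> r \<in> posvar_sums f a x \<longrightarrow> r \<le> real n + 1" for n
  proof (induction n)
    case 0
    show ?case using short[of _ a] d by force
  next
    case (Suc n)
    show ?case
    proof (intro allI impI)
      fix x r assume x: "a \<le> x" "x \<le> b" "x \<le> a + real (Suc n) * (d/2)" and r: "r \<in> posvar_sums f a x"
      define c where "c = max a (x - d/2)"
      have c: "a \<le> c" "c \<le> x" "x - c < d" "c \<le> b" using x d unfolding c_def by auto
      have cn: "c \<le> a + real n * (d/2)"
      proof -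
        have "real (Suc n) * (d/2) = d/2 + real n * (d/2)" by (simp add: distrib_right)
        moreover have "0 \<le> real n * (d/2)" using d by simp
        ultimately show ?thesis using x(3) d unfolding c_def by (intro max.boundedI) linarith+
      qed
      obtain r1 r2 where rr: "r = r1 + r2" "r1 \<in> posvar_sums f a c" "r2 \<in> posvar_sums f c x"
        using posvar_sums_split[OF r c(1,2)] .
      have "r1 \<le> real n + 1" using Suc rr(2) c cn by blast
      moreover have "r2 \<le> 1" using short[OF rr(3) c(1,2) x(2) c(3)] .
      ultimately show "r \<le> real (Suc n) + 1" using rr by simp
    qed
  qed
  moreover obtain n where n: "b \<le> a + real n * (d/2)"
    using reals_Archimedean3[of "d/2"] d by (metis add.commute diff_le_eq half_gt_zero less_imp_le)
  ultimately have "r \<le> real n + 1" if "r \<in> posvar_sums f a b" "a \<le> b" for r using that by blast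
  \<comment> \<open>If b < a, only the empty family is admissible, and its sum is 0.\<close>
  moreover have "r \<le> 0" if "r \<in> posvar_sums f a b" "\<not> a \<le> b" for r
  proof -
    obtain m s t where r: "r = (\<Sum>i<(m::nat). f (t i) - f (s i))"
      and st: "\<forall>i<m. a \<le> s i \<and> s i \<le> t i \<and> t i \<le> b"
      using \<open>r \<in> posvar_sums f a b\<close> unfolding posvar_sums_def by blast
    have "m = 0" using st that by (meson order_trans gr0I)
    then show ?thesis using r by simp
  qed
  ultimately show ?thesis unfolding bdd_above_def by (meson le_cases)
qed

text \<open>By additivity P y - P x is the supremum over [x, y], hence at least 0 and at least f y -
  f x. For the absolute continuity of P, each interval is refined by a family that nearly attains
  its positive variation; the refinement is not longer than the original family, so the d found for
  f also serves P.\<close>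

lemma abs_continuous_on_posvar:
  assumes f: "abs_continuous_on a b f"
  obtains P :: "real \<Rightarrow> real" where
    "abs_continuous_on a b P" "\<And>x y. a \<le> x \<Longrightarrow> x \<le> y \<Longrightarrow> y \<le> b \<Longrightarrow> P x \<le> P y \<and> f y - f x \<le> P y - P x"
proof
  define P where "P x = Sup (posvar_sums f a x)" for x
  have bdd: "bdd_above (posvar_sums f x y)" if "a \<le> x" "x \<le> y" "y \<le> b" for x y
    using that by (intro bdd_above_posvar_sums abs_continuous_on_subinterval[OF f]) auto
  have ne: "posvar_sums f x y \<noteq> {}" for x y using posvar_sums_0 by blast
  have diff: "P y - P x = Sup (posvar_sums f x y)" if xy: "a \<le> x" "x \<le> y" "y \<le> b" for x y
  proof (rule antisym)
    have "P y \<le> P x + Sup (posvar_sums f x y)"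
      unfolding P_def
    proof (rule cSup_least[OF ne])
      fix r assume "r \<in> posvar_sums f a y"
      then obtain r1 r2 where rr: "r = r1 + r2" "r1 \<in> posvar_sums f a x" "r2 \<in> posvar_sums f x y"
        using posvar_sums_split xy by blast
      then show "r \<le> Sup (posvar_sums f a x) + Sup (posvar_sums f x y)"
        using bdd[of a x] bdd[of x y] xy by (auto intro!: add_mono cSup_upper)
    qed
    then show "P y - P x \<le> Sup (posvar_sums f x y)" by simp
    have "Sup (posvar_sums f x y) \<le> P y - r1" if r1: "r1 \<in> posvar_sums f a x" for r1
    proof (rule cSup_least[OF ne])
      fix r2 assume "r2 \<in> posvar_sums f x y"
      then have "r1 + r2 \<in> posvar_sums f a y" using posvar_sums_append r1 xy by blast
      then have "r1 + r2 \<le> P y" unfolding P_def using bdd[of a y] xy by (intro cSup_upper) auto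
      then show "r2 \<le> P y - r1" by simp
    qed
    then have "r1 \<le> P y - Sup (posvar_sums f x y)" if "r1 \<in> posvar_sums f a x" for r1
      using that by (simp add: algebra_simps)
    then have "P x \<le> P y - Sup (posvar_sums f x y)" unfolding P_def by (rule cSup_least[OF ne])
    then show "Sup (posvar_sums f x y) \<le> P y - P x" by simp
  qed
  show *: "P x \<le> P y \<and> f y - f x \<le> P y - P x" if xy: "a \<le> x" "x \<le> y" "y \<le> b" for x y
    using diff[OF xy] bdd[OF xy] posvar_sums_1[OF xy(2), of f] posvar_sums_0[of f x y] cSup_upper by (smt (verit))
  show "abs_continuous_on a b P"
    unfolding abs_continuous_on_def
  proof (intro allI impI)
    fix e :: real assume e: "e > 0"
    then have e2: "e / 2 > 0" by simp
    obtain d where d: "d > 0" and D: "\<And>(J::(nat\<times>nat) set) s t. finite J \<Longrightarrow>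
       (\<And>i. i \<in> J \<Longrightarrow> a \<le> s i \<and> s i \<le> t i \<and> t i \<le> b) \<Longrightarrow>
       disjoint_family_on (\<lambda>i. {s i<..<t i}) J \<Longrightarrow> (\<Sum>i\<in>J. t i - s i) < d \<Longrightarrow>
       (\<Sum>i\<in>J. norm (f (t i) - f (s i))) < e / 2"
      using abs_continuous_on_finite_family[OF f e2, where 'i="nat\<times>nat"] by blast
    show "\<exists>\<delta>>0. \<forall>m s t. (\<forall>i<m. a \<le> s i \<and> s i \<le> t i \<and> t i \<le> b) \<and>
          disjoint_family_on (\<lambda>i. {s i<..<t i}) {..<(m::nat)} \<and> (\<Sum>i<m. t i - s i) < \<delta> \<longrightarrow>
          (\<Sum>i<m. norm (P (t i) - P (s i))) < e"
    proof (intro exI[of _ d] conjI allI impI d)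
      fix m :: nat and s t :: "nat \<Rightarrow> real"
      assume A: "(\<forall>i<m. a \<le> s i \<and> s i \<le> t i \<and> t i \<le> b) \<and>
          disjoint_family_on (\<lambda>i. {s i<..<t i}) {..<m} \<and> (\<Sum>i<m. t i - s i) < d"
      \<comment> \<open>The error allowed in each of the m suprema; they add up to at most e/2, and
        the added 1 covers m = 0.\<close>
      define \<eta> where "\<eta> = e / (2 * (real m + 1))"
      have \<eta>: "\<eta> > 0" "real m * \<eta> \<le> e / 2" using e unfolding \<eta>_def by (auto simp: field_simps)
      define good where "good i k u v \<longleftrightarrow> (\<forall>j<k. s i \<le> u j \<and> u j \<le> v j \<and> v j \<le> t i) \<and>
          disjoint_family_on (\<lambda>j. {u j<..<v j}) {..<(k::nat)} \<and>
          P (t i) - P (s i) - \<eta> < (\<Sum>j<k. f (v j) - f (u j))" for i k u v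
      have "\<exists>k u v. good i k u v" if "i < m" for i
      proof -
        have "P (t i) - P (s i) - \<eta> < Sup (posvar_sums f (s i) (t i))"
          using diff[of "s i" "t i"] A that \<eta> by auto
        then obtain r where "r \<in> posvar_sums f (s i) (t i)" "P (t i) - P (s i) - \<eta> < r"
          by (rule less_cSupE[OF _ ne]) blast
        then show ?thesis unfolding posvar_sums_def good_def by blast
      qed
      then obtain k u v where "\<And>i. i < m \<Longrightarrow> good i (k i) (u i) (v i)" by metis
      then have kuv: "\<And>i. i < m \<Longrightarrow> (\<forall>j<k i. s i \<le> u i j \<and> u i j \<le> v i j \<and> v i j \<le> t i) \<and>
          disjoint_family_on (\<lambda>j. {u i j<..<v i j}) {..<(k i::nat)} \<and>
          P (t i) - P (s i) - \<eta> < (\<Sum>j<k i. f (v i j) - f (u i j))" unfolding good_def by blast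
      define J where "J = (SIGMA i:{..<m}. {..<k i})"
      have fin: "finite J" unfolding J_def by auto
      have J: "i < m" "j < k i" "s i \<le> u i j" "u i j \<le> v i j" "v i j \<le> t i" "a \<le> s i" "s i \<le> t i" "t i \<le> b"
        if "(i,j) \<in> J" for i j using that kuv A unfolding J_def by auto
      have "(\<Sum>p\<in>J. norm (f (case_prod v p) - f (case_prod u p))) < e / 2"
      proof (rule D[OF fin])
        show "a \<le> case_prod u p \<and> case_prod u p \<le> case_prod v p \<and> case_prod v p \<le> b" if "p \<in> J" for p
          using J[of "fst p" "snd p"] that unfolding case_prod_unfold prod.collapse by linarith
        show "disjoint_family_on (\<lambda>p. {case_prod u p<..<case_prod v p}) J"
          unfolding disjoint_family_on_def
        proof (intro ballI impI, rule ccontr)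
          fix p p' assume "p \<in> J" "p' \<in> J" "p \<noteq> p'"
            "{case_prod u p<..<case_prod v p} \<inter> {case_prod u p'<..<case_prod v p'} \<noteq> {}"
          moreover from this obtain x where "x \<in> {case_prod u p<..<case_prod v p} \<inter> {case_prod u p'<..<case_prod v p'}"
            by blast
          ultimately obtain i j i' j' where p: "(i,j) \<in> J" "(i',j') \<in> J" "i = i' \<longrightarrow> j \<noteq> j'"
            "u i j < x" "x < v i j" "u i' j' < x" "x < v i' j'"
            by (cases p; cases p') (auto simp del: greaterThanLessThan_empty_iff2 Int_greaterThanLessThan)
          note J1 = J[OF p(1)] and J2 = J[OF p(2)]
          show False
          proof (cases "i = i'")
            case True
            have "disjoint_family_on (\<lambda>j. {u i j<..<v i j}) {..<k i}" using kuv J1(1) by blast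
            moreover have "j \<in> {..<k i}" "j' \<in> {..<k i}" "j \<noteq> j'" using J1 J2 p(3) True by auto
            ultimately have "{u i j<..<v i j} \<inter> {u i j'<..<v i j'} = {}" by (rule disjoint_family_onD)
            moreover have "x \<in> {u i j<..<v i j}" "x \<in> {u i j'<..<v i j'}" using p True by auto
            ultimately show False by blast
          next
            case False
            have "x \<in> {s i<..<t i}" "x \<in> {s i'<..<t i'}" using J1(3,5) J2(3,5) p(4-7) by simp_all
            moreover have "{s i<..<t i} \<inter> {s i'<..<t i'} = {}"
              using A False J1(1) J2(1) by (intro disjoint_family_onD[of _ "{..<m}"]) simp_all
            ultimately show False by blast
          qed
        qed
        have "(\<Sum>p\<in>J. case_prod v p - case_prod u p) = (\<Sum>i<m. \<Sum>j<k i. v i j - u i j)"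
          unfolding J_def by (subst sum.Sigma) (auto simp: case_prod_unfold)
        also have "\<dots> \<le> (\<Sum>i<m. t i - s i)"
        proof (rule sum_mono, rule sum_length_disjoint_le)
          fix i assume i: "i \<in> {..<m}"
          show "s i \<le> t i" using A i by auto
          show "disjoint_family_on (\<lambda>j. {u i j<..<v i j}) {..<k i}" using kuv i by blast
          show "s i \<le> u i j \<and> u i j \<le> v i j \<and> v i j \<le> t i" if "j \<in> {..<k i}" for j
            using kuv i that by blast
        qed auto
        finally show "(\<Sum>p\<in>J. case_prod v p - case_prod u p) < d" using A by linarith
      qed
      moreover have "(\<Sum>i<m. norm (P (t i) - P (s i))) \<le> (\<Sum>p\<in>J. norm (f (case_prod v p) - f (case_prod u p))) + e / 2"
      proof -
        have "(\<Sum>i<m. norm (P (t i) - P (s i))) = (\<Sum>i<m. P (t i) - P (s i))"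
          using A * by (intro sum.cong) auto
        also have "\<dots> \<le> (\<Sum>i<m. (\<Sum>j<k i. norm (f (v i j) - f (u i j))) + \<eta>)"
        proof (rule sum_mono)
          fix i assume "i \<in> {..<m}"
          moreover have "(\<Sum>j<k i. f (v i j) - f (u i j)) \<le> (\<Sum>j<k i. norm (f (v i j) - f (u i j)))"
            by (intro sum_mono) auto
          ultimately show "P (t i) - P (s i) \<le> (\<Sum>j<k i. norm (f (v i j) - f (u i j))) + \<eta>"
            using kuv[of i] by auto
        qed
        also have "\<dots> = (\<Sum>i<m. \<Sum>j<k i. norm (f (v i j) - f (u i j))) + real m * \<eta>" by (simp add: sum.distrib)
        also have "(\<Sum>i<m. \<Sum>j<k i. norm (f (v i j) - f (u i j))) = (\<Sum>p\<in>J. norm (f (case_prod v p) - f (case_prod u p)))"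
          unfolding J_def by (subst sum.Sigma) (auto simp: case_prod_unfold)
        finally show ?thesis using \<eta> by linarith
      qed
      ultimately show "(\<Sum>i<m. norm (P (t i) - P (s i))) < e" by linarith
    qed
  qed
qed

text \<open>Reduces a countable cover to its finite subfamilies. Only on these can the absolute
  continuity of f, and later Henstock's lemma, be applied.\<close>

lemma emeasure_Union_le_of_finite:
  assumes "countable D" "\<And>K. K \<in> D \<Longrightarrow> K \<in> sets M"
    and le: "\<And>F. finite F \<Longrightarrow> F \<subseteq> D \<Longrightarrow> (\<Sum>K\<in>F. emeasure M K) \<le> e"
  shows "emeasure M (\<Union>D) \<le> e"
proof (cases "D = {}")
  case False
  define U where "U n = (\<Union>i<n. from_nat_into D i)" for n
  have mem: "from_nat_into D i \<in> D" for i using False by (rule from_nat_into)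
  have "(SUP n. emeasure M (U n)) = emeasure M (\<Union>n. U n)"
    using assms(2)[OF mem] unfolding U_def
    by (intro SUP_emeasure_incseq) (force simp: incseq_def)+
  moreover have "(\<Union>n. U n) = \<Union>D"
  proof -
    have "(\<Union>n. U n) = (\<Union>i. from_nat_into D i)" unfolding U_def by auto
    then show ?thesis using range_from_nat_into[OF False assms(1)] by simp
  qed
  moreover have "emeasure M (U n) \<le> e" for n
  proof -
    have "U n = (\<Union>K\<in>from_nat_into D ` {..<n}. K)" unfolding U_def by auto
    then have "emeasure M (U n) \<le> (\<Sum>K\<in>from_nat_into D ` {..<n}. emeasure M K)"
      using assms(2)[OF mem] emeasure_subadditive_finite[of "from_nat_into D ` {..<n}" "\<lambda>K. K" M] by auto
    also have "\<dots> \<le> e" using mem by (intro le) auto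
    finally show ?thesis .
  qed
  ultimately show ?thesis by (metis SUP_least)
qed simp

text \<open>Absolute continuity of \<open>f\<close> means that its Stieltjes measure is absolutely continuous, hence has
  a Radon-Nikodym density.\<close>

lemma abs_continuous_on_mono_imp_integral:
  fixes f :: "real \<Rightarrow> real"
  assumes ac: "abs_continuous_on a b f" and ab: "a \<le> b"
    and mono: "\<And>x y. a \<le> x \<Longrightarrow> x \<le> y \<Longrightarrow> y \<le> b \<Longrightarrow> f x \<le> f y"
  obtains g where "g absolutely_integrable_on {a..b}"
    "\<And>x. a \<le> x \<Longrightarrow> x \<le> b \<Longrightarrow> (g has_integral (f x - f a)) {a..x}"
proof -
  \<comment> \<open>Clamping to [a, b] continues f by constants, so that a Stieltjes measure on the
    whole line can be formed.\<close>
  define cl where "cl x = max a (min b x)" for x :: real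
  define F where "F x = f (cl x)" for x
  have cl: "a \<le> cl x" "cl x \<le> b" "x \<le> y \<Longrightarrow> cl x \<le> cl y" for x y using ab unfolding cl_def by auto
  have cl_id: "cl x = x" if "a \<le> x" "x \<le> b" for x using that unfolding cl_def by auto
  have F_mono: "F x \<le> F y" if "x \<le> y" for x y unfolding F_def using mono cl that by blast
  have F_cont: "continuous_on UNIV F"
    unfolding F_def
  proof (rule continuous_on_compose2[OF abs_continuous_on_imp_continuous_on[OF ac], of UNIV cl])
    show "continuous_on UNIV cl" unfolding cl_def by (intro continuous_intros)
  qed (use cl in auto)
  then have F_rc: "continuous (at_right x) F" for x
    by (simp add: continuous_on_eq_continuous_at continuous_at_imp_continuous_at_within)
  define \<mu> where "\<mu> = interval_measure F"
  have Icc: "emeasure \<mu> {x..y} = ennreal (F y - F x)" if "x \<le> y" for x y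
    unfolding \<mu>_def using emeasure_interval_measure_Icc[OF that F_mono F_cont] by simp
  have Ioc: "emeasure \<mu> {x<..y} = ennreal (F y - F x)" if "x \<le> y" for x y
    unfolding \<mu>_def using emeasure_interval_measure_Ioc[OF that F_mono F_rc] by simp
  have sets: "sets \<mu> = sets borel" unfolding \<mu>_def by simp
  \<comment> \<open>A bounded null set has a cover by nonoverlapping closed intervals of total
    length below d. The Stieltjes measure of such an interval is the increment of F over it, so
    absolute continuity of f bounds the measure of the cover by e.\<close>
  have null: "emeasure \<mu> N = 0" if N: "N \<in> null_sets lborel" "N \<subseteq> cbox (-r) r" "r > 0" for N and r :: real
  proof (rule antisym[OF _ zero_le], rule ennreal_le_epsilon)
    fix e :: real assume e: "0 < e"
    obtain d where d: "d > 0" and D: "\<And>(J::real set set) s t. finite J \<Longrightarrow> (\<And>i. i \<in> J \<Longrightarrow> a \<le> s i \<and> s i \<le> t i \<and> t i \<le> b) \<Longrightarrow>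
       disjoint_family_on (\<lambda>i. {s i<..<t i}) J \<Longrightarrow> (\<Sum>i\<in>J. t i - s i) < d \<Longrightarrow>
       (\<Sum>i\<in>J. norm (f (t i) - f (s i))) < e"
      using abs_continuous_on_finite_family[OF ac e, where 'i="real set"] by blast
    have Nleb: "N \<in> null_sets lebesgue" using N(1) by (simp add: null_sets_completionI)
    then have Nneg: "negligible N" by (simp add: negligible_iff_null_sets)
    obtain \<D> where cD: "countable \<D>"
      and D1: "\<And>K. K \<in> \<D> \<Longrightarrow> K \<subseteq> cbox (-r) r \<and> K \<noteq> {} \<and> (\<exists>c d. K = cbox c d)"
      and D2: "pairwise (\<lambda>A B. interior A \<inter> interior B = {}) \<D>"
      and ND: "N \<subseteq> \<Union>\<D>" and lD: "\<Union>\<D> \<in> lmeasurable" and mD: "measure lebesgue (\<Union>\<D>) \<le> measure lebesgue N + d/2"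
    proof (rule measurable_outer_intervals_bounded[OF negligible_imp_measurable[OF Nneg] N(2) half_gt_zero[OF d]])
      fix \<D> :: "real set set"
      assume "countable \<D>" "\<And>K. K \<in> \<D> \<Longrightarrow> K \<subseteq> cbox (-r) r \<and> K \<noteq> {} \<and> (\<exists>c d. K = cbox c d)"
        "pairwise (\<lambda>A B. interior A \<inter> interior B = {}) \<D>" "N \<subseteq> \<Union>\<D>" "\<Union>\<D> \<in> lmeasurable"
        "measure lebesgue (\<Union>\<D>) \<le> measure lebesgue N + d/2"
      then show thesis by (rule that)
    qed
    have mD': "measure lebesgue (\<Union>\<D>) < d" using mD negligible_imp_measure0[OF Nneg] d by simp
    have K: "\<exists>c d. c \<le> d \<and> K = {c..d}" if "K \<in> \<D>" for K using D1[OF that] by fastforce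
    have "emeasure \<mu> (\<Union>\<D>) \<le> ennreal e"
    proof (rule emeasure_Union_le_of_finite[OF cD])
      show "K \<in> sets \<mu>" if "K \<in> \<D>" for K
      proof -
        obtain c d where "K = {c..d}" using K \<open>K \<in> \<D>\<close> by blast
        then show ?thesis unfolding sets by simp
      qed
      fix J assume J: "finite J" "J \<subseteq> \<D>"
      have Inf_Sup: "K = {Inf K..Sup K}" "Inf K \<le> Sup K" if "K \<in> J" for K
      proof -
        have "K \<in> \<D>" using J(2) \<open>K \<in> J\<close> by blast
        from K[OF this] obtain c d where "c \<le> d" "K = {c..d}" by blast
        then show "K = {Inf K..Sup K}" "Inf K \<le> Sup K" by simp_all
      qed
      have dis: "disjoint_family_on (\<lambda>K. {Inf K<..<Sup K}) J"
        unfolding disjoint_family_on_def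
      proof (intro ballI impI)
        fix A B assume AB: "A \<in> J" "B \<in> J" "A \<noteq> B"
        have "interior A = {Inf A<..<Sup A}" "interior B = {Inf B<..<Sup B}"
          using Inf_Sup(1)[OF AB(1)] Inf_Sup(1)[OF AB(2)] by (metis interior_atLeastAtMost_real)+
        then show "{Inf A<..<Sup A} \<inter> {Inf B<..<Sup B} = {}" using D2 AB J(2) unfolding pairwise_def by blast
      qed
      have "(\<Sum>K\<in>J. Sup K - Inf K) = (\<Sum>K\<in>J. measure lebesgue {Inf K<..<Sup K})"
        using Inf_Sup(2) by (intro sum.cong) (auto simp: measure_completion)
      also have "\<dots> = measure lebesgue (\<Union>K\<in>J. {Inf K<..<Sup K})"
        using J(1) dis Inf_Sup(2) by (intro measure_finite_Union[symmetric]) auto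
      also have "\<dots> \<le> measure lebesgue (\<Union>\<D>)"
      proof (rule measure_mono_fmeasurable[OF _ _ lD])
        show "(\<Union>K\<in>J. {Inf K<..<Sup K}) \<subseteq> \<Union>\<D>"
        proof
          fix x assume "x \<in> (\<Union>K\<in>J. {Inf K<..<Sup K})"
          then obtain K where "K \<in> J" "x \<in> {Inf K..Sup K}" by force
          then show "x \<in> \<Union>\<D>" using Inf_Sup(1) J(2) by blast
        qed
      qed (use J(1) in auto)
      finally have len: "(\<Sum>K\<in>J. Sup K - Inf K) < d" using mD' by simp
      have "(\<Sum>K\<in>J. norm (f (cl (Sup K)) - f (cl (Inf K)))) < e"
      proof (rule D[OF J(1)])
        show "a \<le> cl (Inf K) \<and> cl (Inf K) \<le> cl (Sup K) \<and> cl (Sup K) \<le> b" if "K \<in> J" for K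
          using cl Inf_Sup(2)[OF that] by auto
        show "disjoint_family_on (\<lambda>K. {cl (Inf K)<..<cl (Sup K)}) J"
          by (rule disjoint_family_on_subsets[OF dis]) (auto simp: cl_def)
        have "(\<Sum>K\<in>J. cl (Sup K) - cl (Inf K)) \<le> (\<Sum>K\<in>J. Sup K - Inf K)"
          using Inf_Sup(2) unfolding cl_def by (intro sum_mono) (smt (verit))
        then show "(\<Sum>K\<in>J. cl (Sup K) - cl (Inf K)) < d" using len by linarith
      qed
      moreover have "(\<Sum>K\<in>J. emeasure \<mu> K) = (\<Sum>K\<in>J. ennreal (norm (f (cl (Sup K)) - f (cl (Inf K)))))"
      proof (rule sum.cong[OF refl])
        fix K assume KJ: "K \<in> J"
        have "emeasure \<mu> K = ennreal (F (Sup K) - F (Inf K))"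
          using Inf_Sup(1)[OF KJ] Icc[OF Inf_Sup(2)[OF KJ]] by metis
        then show "emeasure \<mu> K = ennreal (norm (f (cl (Sup K)) - f (cl (Inf K))))"
          using F_mono[OF Inf_Sup(2)[OF KJ]] by (simp add: F_def)
      qed
      ultimately show "(\<Sum>K\<in>J. emeasure \<mu> K) \<le> ennreal e" by (simp add: ennreal_leI)
    qed
    moreover have "\<Union>\<D> \<in> sets \<mu>" unfolding sets
    proof (rule sets.countable_Union[OF cD], rule subsetI)
      fix K' assume "K' \<in> \<D>"
      then obtain c d where "K' = {c..d}" using K by blast
      then show "K' \<in> sets borel" by simp
    qed
    ultimately show "emeasure \<mu> N \<le> 0 + ennreal e" using ND emeasure_mono[of N "\<Union>\<D>" \<mu>] by simp
  qed
  have "absolutely_continuous lborel \<mu>"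
    unfolding absolutely_continuous_def
  proof
    fix N :: "real set" assume N: "N \<in> null_sets lborel"
    have "N = (\<Union>n. N \<inter> cbox (- real (Suc n)) (real (Suc n)))"
    proof -
      have "\<exists>n. x \<in> cbox (- real (Suc n)) (real (Suc n))" for x :: real
      proof -
        obtain n where "\<bar>x\<bar> \<le> real n" using real_arch_simple by blast
        then show ?thesis by (intro exI[of _ n]) auto
      qed
      then show ?thesis by blast
    qed
    moreover have "N \<inter> cbox (- real (Suc n)) (real (Suc n)) \<in> null_sets \<mu>" for n
    proof -
      have "N \<inter> cbox (- real (Suc n)) (real (Suc n)) \<in> null_sets lborel" using N by (intro null_set_Int2) auto
      then show ?thesis using null[of _ "real (Suc n)"] sets unfolding null_sets_def by auto
    qed
    then have "(\<Union>n. N \<inter> cbox (- real (Suc n)) (real (Suc n))) \<in> null_sets \<mu>" by (intro null_sets_UN)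
    ultimately show "N \<in> null_sets \<mu>" by (simp only:)
  qed
  then obtain h where hm: "h \<in> borel_measurable lborel" and h: "density lborel h = \<mu>"
    using sigma_finite_measure.Radon_Nikodym[OF lborel.sigma_finite_measure_axioms, of \<mu>] sets
    by (auto simp: sets_lborel)
  define g where "g x = enn2real (h x)" for x
  have hI: "(\<integral>\<^sup>+x. h x * indicator {a..x'} x \<partial>lborel) = ennreal (f x' - f a)" if "a \<le> x'" "x' \<le> b" for x'
  proof -
    have "emeasure \<mu> {a..x'} = (\<integral>\<^sup>+x. h x * indicator {a..x'} x \<partial>lborel)"
      unfolding h[symmetric] using hm by (intro emeasure_density) auto
    then show ?thesis using Icc[OF that(1)] cl_id that ab unfolding F_def by auto
  qed
  \<comment> \<open>The density takes extended values; its integral over [a, b] is f b - f a, so it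
    is finite almost everywhere there and passing to the real-valued g loses nothing.\<close>
  have hfin: "AE x in lborel. x \<in> {a..b} \<longrightarrow> h x \<noteq> \<infinity>"
  proof -
    have "AE x in lborel. h x * indicator {a..b} x \<noteq> \<infinity>"
      using hI[of b] ab hm by (intro nn_integral_PInf_AE) auto
    then show ?thesis by eventually_elim (auto simp: indicator_def)
  qed
  have int: "(g has_integral (f x - f a)) {a..x}" if x: "a \<le> x" "x \<le> b" for x
  proof -
    have "(\<integral>\<^sup>+y. ennreal (indicator {a..x} y * g y) \<partial>lborel) = (\<integral>\<^sup>+y. h y * indicator {a..x} y \<partial>lborel)"
      using hfin x by (intro nn_integral_cong_AE) (auto elim!: eventually_mono simp: indicator_def g_def less_top)
    then have "(\<integral>\<^sup>+y. ennreal (indicator {a..x} y * g y) \<partial>lborel) = ennreal (f x - f a)" using hI x by simp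
    then have "((\<lambda>y. indicator {a..x} y * g y) has_integral (f x - f a)) UNIV"
      using mono[of a x] x hm unfolding g_def by (intro nn_integral_has_integral) auto
    moreover have "(\<lambda>y. indicator {a..x} y * g y) = (\<lambda>y. if y \<in> {a..x} then g y else 0)" by (auto simp: indicator_def)
    ultimately show ?thesis by (simp only: has_integral_restrict_UNIV)
  qed
  moreover have "g absolutely_integrable_on {a..b}"
    using int[of b] ab unfolding g_def by (intro nonnegative_absolutely_integrable_1) auto
  ultimately show thesis using that by blast
qed

text \<open>The Jordan decomposition f = P - (P - f), in which both parts are monotone and
  absolutely continuous.\<close>

lemma abs_continuous_on_imp_integral_real:
  fixes f :: "real \<Rightarrow> real"
  assumes ac: "abs_continuous_on a b f" and ab: "a \<le> b"
  obtains g where "g absolutely_integrable_on {a..b}"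
    "\<And>x. a \<le> x \<Longrightarrow> x \<le> b \<Longrightarrow> (g has_integral (f x - f a)) {a..x}"
proof -
  obtain P where P: "abs_continuous_on a b P" "\<And>x y. a \<le> x \<Longrightarrow> x \<le> y \<Longrightarrow> y \<le> b \<Longrightarrow> P x \<le> P y \<and> f y - f x \<le> P y - P x"
    using abs_continuous_on_posvar[OF ac] by metis
  have Pf: "abs_continuous_on a b (\<lambda>x. P x - f x)"
  proof (rule abs_continuous_on_dominated[OF P(1) ac, where C=1 and D=1])
    show "norm (P y - f y - (P x - f x)) \<le> 1 * norm (P y - P x) + 1 * norm (f y - f x)" for x y
      by (simp add: abs_if)
  qed
  obtain g1 where g1: "g1 absolutely_integrable_on {a..b}"
    "\<And>x. a \<le> x \<Longrightarrow> x \<le> b \<Longrightarrow> (g1 has_integral (P x - P a)) {a..x}"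
    using abs_continuous_on_mono_imp_integral[OF P(1) ab] P(2) by metis
  obtain g2 where g2: "g2 absolutely_integrable_on {a..b}"
    "\<And>x. a \<le> x \<Longrightarrow> x \<le> b \<Longrightarrow> (g2 has_integral ((P x - f x) - (P a - f a))) {a..x}"
  proof (rule abs_continuous_on_mono_imp_integral[OF Pf ab])
    show "P x - f x \<le> P y - f y" if "a \<le> x" "x \<le> y" "y \<le> b" for x y using P(2)[OF that] by linarith
  qed blast
  show thesis
  proof
    show "(\<lambda>x. g1 x - g2 x) absolutely_integrable_on {a..b}" using g1(1) g2(1) by (rule set_integral_diff)
    show "((\<lambda>x. g1 x - g2 x) has_integral (f x - f a)) {a..x}" if "a \<le> x" "x \<le> b" for x
      using has_integral_diff[OF g1(2)[OF that] g2(2)[OF that]] by (simp add: algebra_simps)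
  qed
qed

lemma abs_continuous_on_imp_integral:
  fixes f :: "real \<Rightarrow> 'a::euclidean_space"
  assumes ac: "abs_continuous_on a b f" and ab: "a \<le> b"
  obtains g where "g absolutely_integrable_on {a..b}"
    "\<And>x. a \<le> x \<Longrightarrow> x \<le> b \<Longrightarrow> (g has_integral (f x - f a)) {a..x}"
proof -
  have "\<exists>g. g absolutely_integrable_on {a..b} \<and> (\<forall>x. a \<le> x \<longrightarrow> x \<le> b \<longrightarrow> (g has_integral (f x \<bullet> i - f a \<bullet> i)) {a..x})"
    if i: "i \<in> Basis" for i
  proof -
    have "abs_continuous_on a b (\<lambda>x. f x \<bullet> i)"
    proof (rule abs_continuous_on_dominated[OF ac ac, where C=1 and D=0])
      show "norm (f y \<bullet> i - f x \<bullet> i) \<le> 1 * norm (f y - f x) + 0 * norm (f y - f x)" for x y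
        using Basis_le_norm[OF i, of "f y - f x"] by (simp add: inner_diff_left)
    qed
    then show ?thesis by (rule abs_continuous_on_imp_integral_real[OF _ ab]) blast
  qed
  then obtain g where g: "\<And>i. i \<in> Basis \<Longrightarrow> g i absolutely_integrable_on {a..b}"
    "\<And>i x. i \<in> Basis \<Longrightarrow> a \<le> x \<Longrightarrow> x \<le> b \<Longrightarrow> (g i has_integral (f x \<bullet> i - f a \<bullet> i)) {a..x}" by metis
  show thesis
  proof
    show "(\<lambda>x. \<Sum>i\<in>Basis. g i x *\<^sub>R i) absolutely_integrable_on {a..b}"
      using g(1) by (intro absolutely_integrable_sum absolutely_integrable_scaleR_right absolutely_integrable_scaleR_left) auto
    show "((\<lambda>x. \<Sum>i\<in>Basis. g i x *\<^sub>R i) has_integral (f x - f a)) {a..x}" if "a \<le> x" "x \<le> b" for x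
      using g(2) that by (subst has_integral_componentwise_iff)
        (auto simp: inner_sum_left inner_Basis inner_diff_left if_distrib cong: if_cong)
  qed
qed

text \<open>A disjoint Vitali cover of the exceptional set by intervals \<open>[x, y]\<close> tagged at the end point \<open>x\<close>
  has small total length by Henstock's lemma.\<close>

lemma negligible_not_differentiable_integral:
  fixes f F :: "real \<Rightarrow> 'a::euclidean_space"
  assumes f: "f integrable_on {a..b}" and F: "\<And>x y. a \<le> x \<Longrightarrow> x \<le> y \<Longrightarrow> y \<le> b \<Longrightarrow> integral {x..y} f = F y - F x"
    and e: "e > 0"
  defines "E \<equiv> {x \<in> {a<..<b}. \<forall>d>0. \<exists>y. \<bar>y - x\<bar> < d \<and> norm (F y - F x - (y - x) *\<^sub>R f x) > e * \<bar>y - x\<bar>}"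
  shows "negligible E"
  unfolding negligible_outer_le
proof (intro allI impI)
  fix \<eta> :: real assume \<eta>: "0 < \<eta>"
  have fi: "f integrable_on cbox a b" using f by simp
  obtain \<gamma> where \<gamma>: "gauge \<gamma>"
    and H: "\<And>p. p tagged_partial_division_of (cbox a b) \<Longrightarrow> \<gamma> fine p \<Longrightarrow>
             (\<Sum>(x,k)\<in>p. norm (measure lborel k *\<^sub>R f x - integral k f)) < e * \<eta>"
    by (rule Henstock_lemma[OF fi mult_pos_pos[OF e \<eta>]]) blast
  \<comment> \<open>A pair p consists of the tag \<open>fst p\<close> and the other end point.
    \<open>cc p\<close> and \<open>rr p\<close> are centre and radius of the same interval, since
    the Vitali covering theorem is applied to closed balls.\<close>
  define I where "I p = {min (fst p) (snd p)..max (fst p) (snd p)}" for p :: "real \<times> real"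
  define cc where "cc p = (fst p + snd p) / 2" for p :: "real \<times> real"
  define rr where "rr p = \<bar>snd p - fst p\<bar> / 2" for p :: "real \<times> real"
  have I_cball: "cball (cc p) (rr p) = I p" for p
    unfolding cball_eq_atLeastAtMost I_def cc_def rr_def
    by (cases "fst p \<le> snd p") (simp_all add: field_simps min_def max_def)
  have cI: "measure lborel (I p) = \<bar>snd p - fst p\<bar>" for p unfolding I_def by (auto simp: min_def max_def)
  define K where "K = {(x,y). x \<in> E \<and> y \<in> {a..b} \<and> y \<noteq> x \<and> I (x,y) \<subseteq> \<gamma> x \<and> norm (F y - F x - (y - x) *\<^sub>R f x) > e * \<bar>y - x\<bar>}"
  have Kr: "0 < rr p" if "p \<in> K" for p using that unfolding K_def rr_def by auto
  obtain C where C: "countable C" "C \<subseteq> K" "pairwise (\<lambda>i j. disjnt (I i) (I j)) C" "negligible (E - (\<Union>i\<in>C. I i))"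
  proof (rule Vitali_covering_theorem_cballs[of K rr E cc, unfolded I_cball, OF Kr])
    fix x d :: real assume x: "x \<in> E" and d: "0 < d"
    have ox: "open (\<gamma> x)" "x \<in> \<gamma> x" using \<gamma> unfolding gauge_def by auto
    obtain r where r: "r > 0" "ball x r \<subseteq> \<gamma> x" using ox open_contains_ball by blast
    have ab: "a < x" "x < b" using x unfolding E_def by auto
    obtain y where y: "\<bar>y - x\<bar> < min (min d r) (min (x - a) (b - x))"
      "norm (F y - F x - (y - x) *\<^sub>R f x) > e * \<bar>y - x\<bar>"
    proof -
      have "\<forall>d>0. \<exists>y. \<bar>y - x\<bar> < d \<and> norm (F y - F x - (y - x) *\<^sub>R f x) > e * \<bar>y - x\<bar>"
        using x unfolding E_def by blast
      moreover have "0 < min (min d r) (min (x - a) (b - x))" using d r ab by simp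
      ultimately show thesis using that by blast
    qed
    have "y \<noteq> x" using y(2) by auto
    moreover have "y \<in> {a..b}" using y(1) by auto
    moreover have "I (x,y) \<subseteq> \<gamma> x"
    proof -
      have "I (x,y) \<subseteq> ball x r" unfolding I_def using y(1) by (auto simp: dist_real_def)
      then show ?thesis using r by blast
    qed
    ultimately have "(x,y) \<in> K" using x y(2) unfolding K_def by simp
    moreover have "x \<in> I (x,y)" unfolding I_def by simp
    moreover have "rr (x,y) < d"
    proof -
      have "\<bar>y - x\<bar> < d" using y(1) by simp
      then show ?thesis unfolding rr_def fst_conv snd_conv by (rule le_less_trans[rotated]) simp
    qed
    ultimately show "\<exists>i. i \<in> K \<and> x \<in> I i \<and> rr i < d" by (intro exI[of _ "(x,y)"] conjI)
  qed
  \<comment> \<open>Finitely many disjoint intervals of the cover form a fine tagged partial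
    division. Each contributes an error above e times its length, while Henstock's lemma bounds the
    sum of the errors by e \<eta>.\<close>
  have fin: "(\<Sum>p\<in>J. \<bar>snd p - fst p\<bar>) \<le> \<eta>" if J: "finite J" "J \<subseteq> C" for J
  proof -
    have injI: "inj_on (\<lambda>p. (fst p, I p)) J"
    proof (rule inj_onI)
      fix p q assume pq: "p \<in> J" "q \<in> J" "(fst p, I p) = (fst q, I q)"
      have "fst p \<in> I p" unfolding I_def by simp
      then have "\<not> disjnt (I p) (I q)" using pq(3) unfolding disjnt_def by auto
      then show "p = q" using C(3) pq(1,2) J(2) unfolding pairwise_def by blast
    qed
    define P where "P = (\<lambda>p. (fst p, I p)) ` J"
    have part: "P tagged_partial_division_of cbox a b"
      unfolding tagged_partial_division_of_def
    proof (intro conjI allI impI)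
      show "finite P" unfolding P_def using J by simp
    next
      fix x k assume "(x, k) \<in> P"
      then obtain p where p: "p \<in> J" "x = fst p" "k = I p" unfolding P_def by auto
      have pK: "p \<in> K" using p J C by blast
      then have "fst p \<in> {a..b}" "snd p \<in> {a..b}" unfolding K_def E_def by auto
      then show "k \<subseteq> cbox a b" unfolding p I_def by auto
      show "x \<in> k" unfolding p I_def by simp
      show "\<exists>a b. k = cbox a b" unfolding p I_def by auto
    next
      fix x k x' k' assume xk: "(x, k) \<in> P \<and> (x', k') \<in> P \<and> (x, k) \<noteq> (x', k')"
      then obtain p where p: "p \<in> J" "x = fst p" "k = I p" unfolding P_def by auto
      obtain q where q: "q \<in> J" "x' = fst q" "k' = I q" using xk unfolding P_def by auto
      have "p \<noteq> q" using p q xk by auto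
      then have "disjnt (I p) (I q)" using C(3) p(1) q(1) J(2) unfolding pairwise_def by blast
      then show "interior k \<inter> interior k' = {}"
        unfolding p q disjnt_def using interior_subset by blast
    qed
    have fine: "\<gamma> fine P"
    proof (rule fineI)
      fix x k assume "(x, k) \<in> P"
      then obtain p where p: "p \<in> J" "x = fst p" "k = I p" unfolding P_def by auto
      have "p \<in> K" using p J C by blast
      then show "k \<subseteq> \<gamma> x" unfolding p K_def by auto
    qed
    have "e * (\<Sum>p\<in>J. \<bar>snd p - fst p\<bar>) = (\<Sum>p\<in>J. e * \<bar>snd p - fst p\<bar>)" by (rule sum_distrib_left)
    also have "\<dots> \<le> (\<Sum>p\<in>J. norm (measure lborel (I p) *\<^sub>R f (fst p) - integral (I p) f))"
    proof (rule sum_mono)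
      fix p assume p: "p \<in> J"
      have "p \<in> K" using p J C by blast
      then have p: "fst p \<in> {a..b}" "snd p \<in> {a..b}"
        "norm (F (snd p) - F (fst p) - (snd p - fst p) *\<^sub>R f (fst p)) > e * \<bar>snd p - fst p\<bar>"
        unfolding K_def E_def by auto
      have "norm (measure lborel (I p) *\<^sub>R f (fst p) - integral (I p) f)
         = norm (F (snd p) - F (fst p) - (snd p - fst p) *\<^sub>R f (fst p))"
      proof (cases "fst p \<le> snd p")
        case True
        then have "integral (I p) f = F (snd p) - F (fst p)" unfolding I_def using F p by (simp add: min_def max_def)
        then show ?thesis using True unfolding cI by (simp add: norm_minus_commute)
      next
        case False
        then have *: "integral (I p) f = F (fst p) - F (snd p)" unfolding I_def using F p by (simp add: min_def max_def)
        have m: "measure lborel (I p) = fst p - snd p" using False unfolding cI by simp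
        show ?thesis unfolding * m by (simp add: algebra_simps)
      qed
      then show "e * \<bar>snd p - fst p\<bar> \<le> norm (measure lborel (I p) *\<^sub>R f (fst p) - integral (I p) f)" using p(3) by linarith
    qed
    also have "\<dots> = (\<Sum>(x,k)\<in>P. norm (measure lborel k *\<^sub>R f x - integral k f))"
      unfolding P_def by (subst sum.reindex[OF injI]) (simp add: o_def)
    also have "\<dots> < e * \<eta>" using H[OF part fine] .
    finally show ?thesis using e by simp
  qed
  have Csets: "I p \<in> sets lebesgue" for p unfolding I_def by simp
  have inj: "inj_on I C"
  proof (rule inj_onI)
    fix p q assume pq: "p \<in> C" "q \<in> C" "I p = I q"
    have "fst p \<in> I p" unfolding I_def by simp
    then have "\<not> disjnt (I p) (I q)" using pq(3) unfolding disjnt_def by auto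
    then show "p = q" using C(3) pq(1,2) unfolding pairwise_def by blast
  qed
  define U where "U = \<Union>(I ` C)"
  have U: "emeasure lebesgue U \<le> ennreal \<eta>"
    unfolding U_def
  proof (rule emeasure_Union_le_of_finite)
    show "countable (I ` C)" using C(1) by simp
    show "K' \<in> sets lebesgue" if "K' \<in> I ` C" for K' using that Csets by blast
    fix G assume "finite G" "G \<subseteq> I ` C"
    then obtain J where J: "finite J" "J \<subseteq> C" "G = I ` J" by (metis finite_subset_image)
    have "(\<Sum>k\<in>G. emeasure lebesgue k) = (\<Sum>p\<in>J. emeasure lebesgue (I p))"
      unfolding J(3) using sum.reindex[OF inj_on_subset[OF inj J(2)]] by (simp add: o_def)
    also have "\<dots> = (\<Sum>p\<in>J. ennreal \<bar>snd p - fst p\<bar>)"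
      by (intro sum.cong refl) (auto simp: I_def min_def max_def)
    also have "\<dots> = ennreal (\<Sum>p\<in>J. \<bar>snd p - fst p\<bar>)" by simp
    also have "\<dots> \<le> ennreal \<eta>" using fin[OF J(1,2)] by (rule ennreal_leI)
    finally show "(\<Sum>k\<in>G. emeasure lebesgue k) \<le> ennreal \<eta>" .
  qed
  have Us: "U \<in> sets lebesgue" unfolding U_def using C(1) Csets by (intro sets.countable_Union) auto
  have N: "E - U \<in> null_sets lebesgue" using C(4) unfolding U_def negligible_iff_null_sets by simp
  have eT: "emeasure lebesgue (U \<union> (E - U)) \<le> ennreal \<eta>" using U emeasure_Un_null_set[OF Us N] by simp
  show "\<exists>T. E \<subseteq> T \<and> T \<in> lmeasurable \<and> measure lebesgue T \<le> \<eta>"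
  proof (intro exI conjI)
    show "E \<subseteq> U \<union> (E - U)" by blast
    show "U \<union> (E - U) \<in> lmeasurable"
    proof (rule fmeasurableI)
      show "U \<union> (E - U) \<in> sets lebesgue" using Us null_setsD2[OF N] by (rule sets.Un)
      show "emeasure lebesgue (U \<union> (E - U)) < \<infinity>" using eT by (rule le_less_trans) simp
    qed
    show "measure lebesgue (U \<union> (E - U)) \<le> \<eta>" unfolding measure_def using eT \<eta> by (simp add: enn2real_leI)
  qed
qed

text \<open>If f x is not the derivative of F at x, then x belongs to the exceptional set of the
  preceding lemma for some e = 1/(n+1); these are countably many negligible sets.\<close>

lemma AE_has_vector_derivative_integral:
  fixes f F :: "real \<Rightarrow> 'a::euclidean_space"
  assumes f: "f integrable_on {a..b}" and F: "\<And>x y. a \<le> x \<Longrightarrow> x \<le> y \<Longrightarrow> y \<le> b \<Longrightarrow> integral {x..y} f = F y - F x"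
  shows "AE x in lebesgue. x \<in> {a<..<b} \<longrightarrow> (F has_vector_derivative f x) (at x)"
proof -
  define E where "E e = {x \<in> {a<..<b}. \<forall>d>0. \<exists>y. \<bar>y - x\<bar> < d \<and> norm (F y - F x - (y - x) *\<^sub>R f x) > e * \<bar>y - x\<bar>}" for e
  have "negligible (E (inverse (real (Suc n))))" for n
    unfolding E_def by (rule negligible_not_differentiable_integral[OF f F]) auto
  then have "AE x in lebesgue. x \<notin> E (inverse (real (Suc n)))" for n
    by (intro AE_not_in) (simp add: negligible_iff_null_sets)
  then have "AE x in lebesgue. \<forall>n. x \<notin> E (inverse (real (Suc n)))" by (simp add: AE_all_countable)
  then show ?thesis
  proof eventually_elim
    case (elim x)
    show ?case
      unfolding has_vector_derivative_def has_derivative_at_alt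
    proof (intro impI conjI allI)
      show "bounded_linear (\<lambda>h. h *\<^sub>R f x)" by (rule bounded_linear_scaleR_left)
      fix e :: real assume x: "x \<in> {a<..<b}" and e: "0 < e"
      obtain n where n: "inverse (real (Suc n)) < e" using reals_Archimedean[OF e] by auto
      have "x \<notin> E (inverse (real (Suc n)))" using elim by blast
      then have "\<exists>d>0. \<forall>y. \<not> (\<bar>y - x\<bar> < d \<and> norm (F y - F x - (y - x) *\<^sub>R f x) > inverse (real (Suc n)) * \<bar>y - x\<bar>)"
        using x unfolding E_def by blast
      then obtain d where d: "d > 0" "\<And>y. \<bar>y - x\<bar> < d \<Longrightarrow> norm (F y - F x - (y - x) *\<^sub>R f x) \<le> inverse (real (Suc n)) * \<bar>y - x\<bar>"
        by (meson not_less)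
      have "norm (F y - F x - (y - x) *\<^sub>R f x) \<le> e * norm (y - x)" if "norm (y - x) < d" for y
      proof -
        have "inverse (real (Suc n)) * \<bar>y - x\<bar> \<le> e * \<bar>y - x\<bar>" using n by (intro mult_right_mono) auto
        then show ?thesis using d(2)[of y] that by simp
      qed
      then show "\<exists>d>0. \<forall>y. norm (y - x) < d \<longrightarrow> norm (F y - F x - (y - x) *\<^sub>R f x) \<le> e * norm (y - x)"
        using d(1) by blast
    qed
  qed
qed

text \<open>Truncation: |g| = \<psi> + min(|g|, N), where by dominated convergence N can be chosen
  such that \<psi> has integral below e/2 over [a, b]. The truncated part contributes at most N
  times the total length, which explains the bound e / (2 (N + 1)) on that length.\<close>

lemma abs_continuous_on_integral:
  fixes g F :: "real \<Rightarrow> 'a::euclidean_space"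
  assumes g: "g absolutely_integrable_on {a..b}"
    and F: "\<And>x y. a \<le> x \<Longrightarrow> x \<le> y \<Longrightarrow> y \<le> b \<Longrightarrow> (g has_integral (F y - F x)) {x..y}"
  shows "abs_continuous_on a b F"
  unfolding abs_continuous_on_def
proof (intro allI impI)
  fix e :: real assume e: "0 < e"
  define \<phi> where "\<phi> N x = min (norm (g x)) (real N)" for N x
  have ng: "(\<lambda>x. norm (g x)) absolutely_integrable_on {a..b}" using g by (rule set_integrable_norm)
  then have ngi: "(\<lambda>x. norm (g x)) integrable_on {a..b}" by (simp add: absolutely_integrable_on_def)
  have \<phi>a: "\<phi> N absolutely_integrable_on {a..b}" for N
    unfolding \<phi>_def using ng by (intro absolutely_integrable_min_1 absolutely_integrable_on_const) (auto simp: fmeasurable_cbox)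
  then have \<phi>i: "\<phi> N integrable_on {a..b}" for N by (simp add: absolutely_integrable_on_def)
  have "(\<lambda>N. integral {a..b} (\<phi> N)) \<longlonglongrightarrow> integral {a..b} (\<lambda>x. norm (g x))"
  proof (rule dominated_convergence(2)[OF \<phi>i ngi])
    show "norm (\<phi> N x) \<le> norm (g x)" for N x unfolding \<phi>_def by simp
    fix x
    obtain n where n: "norm (g x) \<le> real n" using real_arch_simple by blast
    have "\<forall>\<^sub>F N in sequentially. norm (g x) = \<phi> N x"
      by (rule eventually_mono[OF eventually_ge_at_top[of n]]) (use n in \<open>auto simp: \<phi>_def min_def\<close>)
    then have "\<forall>\<^sub>F N in sequentially. \<phi> N x = norm (g x)" by (rule eventually_mono) simp
    then show "(\<lambda>N. \<phi> N x) \<longlonglongrightarrow> norm (g x)" by (rule tendsto_eventually)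
  qed
  then have "\<forall>\<^sub>F N in sequentially. dist (integral {a..b} (\<phi> N)) (integral {a..b} (\<lambda>x. norm (g x))) < e/2"
    using e by (intro tendstoD) auto
  then obtain N where N: "dist (integral {a..b} (\<phi> N)) (integral {a..b} (\<lambda>x. norm (g x))) < e/2"
    by (auto dest: eventually_happens)
  define \<psi> where "\<psi> x = norm (g x) - \<phi> N x" for x
  have \<psi>a: "\<psi> absolutely_integrable_on {a..b}" unfolding \<psi>_def using ng \<phi>a by (intro set_integral_diff)
  have \<psi>0: "0 \<le> \<psi> x" for x unfolding \<psi>_def \<phi>_def by simp
  have \<psi>int: "(LINT x:{a..b}|lebesgue. \<psi> x) < e/2"
  proof -
    have "integral {a..b} \<psi> = integral {a..b} (\<lambda>x. norm (g x)) - integral {a..b} (\<phi> N)"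
      unfolding \<psi>_def using ngi \<phi>i by (intro integral_diff)
    then show ?thesis using N set_lebesgue_integral_eq_integral(2)[OF \<psi>a] unfolding dist_real_def by linarith
  qed
  show "\<exists>\<delta>>0. \<forall>m s t. (\<forall>i<m. a \<le> s i \<and> s i \<le> t i \<and> t i \<le> b) \<and>
          disjoint_family_on (\<lambda>i. {s i<..<t i}) {..<(m::nat)} \<and> (\<Sum>i<m. t i - s i) < \<delta> \<longrightarrow>
          (\<Sum>i<m. norm (F (t i) - F (s i))) < e"
  proof (intro exI[of _ "e / (2 * (real N + 1))"] conjI allI impI)
    show "0 < e / (2 * (real N + 1))" using e by simp
    fix m :: nat and s t :: "nat \<Rightarrow> real"
    assume A: "(\<forall>i<m. a \<le> s i \<and> s i \<le> t i \<and> t i \<le> b) \<and>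
          disjoint_family_on (\<lambda>i. {s i<..<t i}) {..<m} \<and> (\<Sum>i<m. t i - s i) < e / (2 * (real N + 1))"
    have sub: "{s i..t i} \<subseteq> {a..b}" "{s i<..<t i} \<subseteq> {a..b}" if "i < m" for i using A that by auto
    have "norm (F (t i) - F (s i)) \<le> (LINT x:{s i<..<t i}|lebesgue. \<psi> x) + real N * (t i - s i)" if i: "i < m" for i
    proof -
      have gi: "(g has_integral (F (t i) - F (s i))) {s i..t i}" using A i by (intro F) auto
      have subi: "h absolutely_integrable_on {s i..t i}" if "h absolutely_integrable_on {a..b}" for h :: "real \<Rightarrow> real"
        using absolutely_integrable_on_subinterval[OF that sub(1)[OF i]] .
      have ni: "(\<lambda>x. norm (g x)) integrable_on {s i..t i}" using subi[OF ng] by (simp add: absolutely_integrable_on_def)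
      have \<psi>i: "\<psi> integrable_on {s i..t i}" using subi[OF \<psi>a] by (simp add: absolutely_integrable_on_def)
      have "norm (F (t i) - F (s i)) \<le> integral {s i..t i} (\<lambda>x. norm (g x))"
        using integral_norm_bound_integral[of g "{s i..t i}" "\<lambda>x. norm (g x)"] gi ni
        by (auto simp: has_integral_integrable_integral)
      also have "\<dots> \<le> integral {s i..t i} (\<lambda>x. \<psi> x + real N)"
      proof (rule integral_le[OF ni])
        show "(\<lambda>x. \<psi> x + real N) integrable_on {s i..t i}" using \<psi>i by (intro integrable_add) auto
      qed (simp add: \<psi>_def \<phi>_def)
      also have "\<dots> = integral {s i..t i} \<psi> + real N * (t i - s i)"
        using \<psi>i A i by (subst integral_add) auto
      also have "integral {s i..t i} \<psi> = integral {s i<..<t i} \<psi>"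
        by (rule integral_open_interval_real)
      also have "\<dots> = (LINT x:{s i<..<t i}|lebesgue. \<psi> x)"
        using set_integrable_subset[OF \<psi>a _ sub(2)[OF i]] by (intro set_lebesgue_integral_eq_integral(2)[symmetric]) auto
      finally show ?thesis .
    qed
    then have "(\<Sum>i<m. norm (F (t i) - F (s i))) \<le> (\<Sum>i<m. (LINT x:{s i<..<t i}|lebesgue. \<psi> x) + real N * (t i - s i))"
      by (intro sum_mono) auto
    also have "\<dots> = (\<Sum>i<m. LINT x:{s i<..<t i}|lebesgue. \<psi> x) + real N * (\<Sum>i<m. t i - s i)"
      by (simp add: sum.distrib sum_distrib_left)
    also have "(\<Sum>i<m. LINT x:{s i<..<t i}|lebesgue. \<psi> x) = (LINT x:(\<Union>i<m. {s i<..<t i})|lebesgue. \<psi> x)"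
      using A set_integrable_subset[OF \<psi>a _ sub(2)] by (intro set_integral_finite_Union[symmetric]) auto
    also have "\<dots> \<le> (LINT x:{a..b}|lebesgue. \<psi> x)"
    proof -
      have U: "(\<Union>i<m. {s i<..<t i}) \<subseteq> {a..b}" using sub(2) by (intro UN_least) auto
      have \<psi>U: "\<psi> absolutely_integrable_on (\<Union>i<m. {s i<..<t i})"
        by (rule set_integrable_subset[OF \<psi>a _ U]) auto
      show ?thesis
        unfolding set_lebesgue_integral_eq_integral(2)[OF \<psi>a] set_lebesgue_integral_eq_integral(2)[OF \<psi>U]
        using \<psi>a \<psi>U U \<psi>0 by (intro integral_subset_le) (simp_all add: absolutely_integrable_on_def)
    qed
    also note \<psi>int
    also have "real N * (\<Sum>i<m. t i - s i) \<le> (real N + 1) * (e / (2 * (real N + 1)))"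
      using A by (intro mult_mono sum_nonneg) auto
    also have "\<dots> = e/2" by (simp add: field_simps)
    finally show "(\<Sum>i<m. norm (F (t i) - F (s i))) < e" by simp
  qed
qed

section \<open>Absolutely continuous functions as indefinite integrals\<close>

lemma AE_lebesgue_negligibleE:
  assumes "AE x in lebesgue. P x"
  obtains N where "negligible N" "\<And>x. x \<notin> N \<Longrightarrow> P x"
  using assms unfolding eventually_ae_filter_negligible by blast

lemma absolutely_integrable_cong_AE:
  fixes f g :: "'a::euclidean_space \<Rightarrow> 'b::euclidean_space"
  assumes "AE x in lebesgue. x \<in> S \<longrightarrow> g x = f x" "f absolutely_integrable_on S"
  shows "g absolutely_integrable_on S"
proof -
  obtain N where N: "negligible N" "\<And>x. x \<notin> N \<Longrightarrow> x \<in> S \<longrightarrow> g x = f x"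
    using AE_lebesgue_negligibleE[OF assms(1)] by blast
  show ?thesis by (rule absolutely_integrable_spike[OF assms(2) N(1)]) (use N(2) in auto)
qed

lemma has_integral_cong_AE:
  fixes f g :: "'a::euclidean_space \<Rightarrow> 'b::euclidean_space"
  assumes "AE x in lebesgue. x \<in> S \<longrightarrow> g x = f x" "(f has_integral r) S"
  shows "(g has_integral r) S"
proof -
  obtain N where N: "negligible N" "\<And>x. x \<notin> N \<Longrightarrow> x \<in> S \<longrightarrow> g x = f x"
    using AE_lebesgue_negligibleE[OF assms(1)] by blast
  show ?thesis by (rule has_integral_spike[OF N(1) _ assms(2)]) (use N(2) in auto)
qed

lemma integral_le_AE:
  fixes f g :: "real \<Rightarrow> real"
  assumes "f integrable_on S" "g integrable_on S" "AE x in lebesgue. x \<in> S \<longrightarrow> f x \<le> g x"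
  shows "integral S f \<le> integral S g"
proof -
  obtain N where N: "negligible N" "\<And>x. x \<notin> N \<Longrightarrow> x \<in> S \<longrightarrow> f x \<le> g x"
    using AE_lebesgue_negligibleE[OF assms(3)] by blast
  define f' where "f' x = (if x \<in> N then g x else f x)" for x
  have "(f' has_integral integral S f) S"
    by (rule has_integral_spike[OF N(1) _ integrable_integral[OF assms(1)]]) (auto simp: f'_def)
  moreover have "(g has_integral integral S g) S" using assms(2) by (rule integrable_integral)
  ultimately show ?thesis by (rule has_integral_le) (use N(2) in \<open>auto simp: f'_def\<close>)
qed

text \<open>The interior of I is covered by the countably many intervals with rational end points
  whose closure lies in I, and the frontier of a convex set is negligible.\<close>

lemma AE_convex_localI:
  fixes I :: "real set"
  assumes I: "convex I" and loc: "\<And>a b. a < b \<Longrightarrow> {a..b} \<subseteq> I \<Longrightarrow> AE x in lebesgue. x \<in> {a<..<b} \<longrightarrow> P x"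
  shows "AE x in lebesgue. x \<in> I \<longrightarrow> P x"
proof -
  have "negligible (I - interior I)"
    by (rule negligible_subset[OF negligible_convex_frontier[OF I]]) (use closure_subset in \<open>auto simp: frontier_def\<close>)
  then have 1: "AE x in lebesgue. x \<notin> I - interior I"
    by (intro AE_not_in) (simp add: negligible_iff_null_sets)
  have 2: "AE x in lebesgue. \<forall>p\<in>\<rat> \<times> \<rat>. fst p < snd p \<and> {fst p..snd p} \<subseteq> I \<longrightarrow> x \<in> {fst p<..<snd p} \<longrightarrow> P x"
  proof (subst AE_ball_countable)
    show "countable ((\<rat>::real set) \<times> (\<rat>::real set))" by (intro countable_SIGMA countable_rat)
    show "\<forall>p\<in>\<rat> \<times> \<rat>. AE x in lebesgue. fst p < snd p \<and> {fst p..snd p} \<subseteq> I \<longrightarrow> x \<in> {fst p<..<snd p} \<longrightarrow> P x"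
    proof
      fix p :: "real \<times> real"
      show "AE x in lebesgue. fst p < snd p \<and> {fst p..snd p} \<subseteq> I \<longrightarrow> x \<in> {fst p<..<snd p} \<longrightarrow> P x"
      proof (cases "fst p < snd p \<and> {fst p..snd p} \<subseteq> I")
        case True
        then show ?thesis using loc[of "fst p" "snd p"] by simp
      next
        case False
        then show ?thesis by (intro AE_I2) blast
      qed
    qed
  qed
  from 1 2 show ?thesis
  proof eventually_elim
    case (elim x)
    show ?case
    proof
      assume "x \<in> I"
      then have "x \<in> interior I" using elim(1) by blast
      then obtain e where e: "e > 0" "cball x e \<subseteq> interior I" using open_contains_cball[of "interior I"] by auto
      obtain r where r: "r \<in> \<rat>" "x - e < r" "r < x" using Rats_dense_in_real[of "x - e" x] e by auto
      obtain s where s: "s \<in> \<rat>" "x < s" "s < x + e" using Rats_dense_in_real[of x "x + e"] e by auto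
      have "{r..s} \<subseteq> cball x e" using r s by (auto simp: dist_real_def)
      then have "{r..s} \<subseteq> I" using e(2) interior_subset by blast
      then show "P x" using elim(2)[rule_format, of "(r,s)"] r s by auto
    qed
  qed
qed

text \<open>The integral form of absolute continuity. On convex I it amounts to local absolute
  continuity together with f' = g almost everywhere, but it prescribes the density g and involves no
  pointwise derivative, so values of f off I do not matter.\<close>

definition ac_deriv :: "real set \<Rightarrow> (real \<Rightarrow> 'a::euclidean_space) \<Rightarrow> (real \<Rightarrow> 'a) \<Rightarrow> bool" where
  "ac_deriv I f g \<longleftrightarrow> (\<forall>a b. {a..b} \<subseteq> I \<longrightarrow> g absolutely_integrable_on {a..b}) \<and>
     (\<forall>a b. a \<le> b \<longrightarrow> {a..b} \<subseteq> I \<longrightarrow> (g has_integral (f b - f a)) {a..b})"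

lemma ac_derivI:
  assumes "\<And>a b. a \<le> b \<Longrightarrow> {a..b} \<subseteq> I \<Longrightarrow> g absolutely_integrable_on {a..b}"
    "\<And>a b. a \<le> b \<Longrightarrow> {a..b} \<subseteq> I \<Longrightarrow> (g has_integral (f b - f a)) {a..b}"
  shows "ac_deriv I f g"
  unfolding ac_deriv_def
proof (intro conjI allI impI)
  fix a b assume "{a..b} \<subseteq> I"
  then show "g absolutely_integrable_on {a..b}" using assms(1)[of a b] by (cases "a \<le> b") auto
qed (use assms(2) in auto)

lemma ac_derivD:
  assumes "ac_deriv I f g" "{a..b} \<subseteq> I"
  shows "g absolutely_integrable_on {a..b}" "a \<le> b \<Longrightarrow> (g has_integral (f b - f a)) {a..b}"
    "a \<le> b \<Longrightarrow> integral {a..b} g = f b - f a"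
  using assms unfolding ac_deriv_def by (auto intro: integral_unique)

lemma ac_deriv_imp_AE:
  assumes ac: "ac_deriv I f g" and I: "convex I"
  shows "AE x in lebesgue. x \<in> I \<longrightarrow> (f has_vector_derivative g x) (at x)"
proof (rule AE_convex_localI[OF I])
  fix a b assume ab: "a < b" "{a..b} \<subseteq> I"
  show "AE x in lebesgue. x \<in> {a<..<b} \<longrightarrow> (f has_vector_derivative g x) (at x)"
  proof (rule AE_has_vector_derivative_integral)
    show "g integrable_on {a..b}" using ac_derivD(1)[OF ac ab(2)] by (simp add: absolutely_integrable_on_def)
    fix x y assume xy: "a \<le> x" "x \<le> y" "y \<le> b"
    then have "{x..y} \<subseteq> I" using ab(2) by auto
    then show "integral {x..y} g = f y - f x" using ac_derivD(3)[OF ac] xy by blast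
  qed
qed

lemma ac_deriv_imp_locally_ac:
  assumes ac: "ac_deriv I f g"
  shows "locally_abs_continuous_on I f"
  unfolding locally_abs_continuous_on_def
proof (intro allI impI)
  fix a b assume ab: "{a..b} \<subseteq> I"
  show "abs_continuous_on a b f"
  proof (rule abs_continuous_on_integral)
    show "g absolutely_integrable_on {a..b}" using ac_derivD(1)[OF ac ab] .
    fix x y assume xy: "a \<le> x" "x \<le> y" "y \<le> b"
    then have "{x..y} \<subseteq> I" using ab by auto
    then show "(g has_integral (f y - f x)) {x..y}" using ac_derivD(2)[OF ac] xy by blast
  qed
qed

lemma abs_continuous_on_imp_AE_primitive:
  fixes f :: "real \<Rightarrow> 'a::euclidean_space"
  assumes ac: "abs_continuous_on a b f" and ab: "a \<le> b"
  obtains g where "g absolutely_integrable_on {a..b}"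
    "\<And>x y. a \<le> x \<Longrightarrow> x \<le> y \<Longrightarrow> y \<le> b \<Longrightarrow> (g has_integral (f y - f x)) {x..y}"
    "AE x in lebesgue. x \<in> {a<..<b} \<longrightarrow> (f has_vector_derivative g x) (at x)"
proof -
  obtain g where g: "g absolutely_integrable_on {a..b}"
    "\<And>x. a \<le> x \<Longrightarrow> x \<le> b \<Longrightarrow> (g has_integral (f x - f a)) {a..x}"
    by (rule abs_continuous_on_imp_integral[OF ac ab]) blast
  have gi: "g integrable_on {a..b}" using g(1) by (simp add: absolutely_integrable_on_def)
  have int: "(g has_integral (f y - f x)) {x..y}" if xy: "a \<le> x" "x \<le> y" "y \<le> b" for x y
  proof -
    have "g integrable_on {a..y}" using g(2)[of y] xy by (auto intro: has_integral_integrable)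
    from Henstock_Kurzweil_Integration.integral_combine[OF xy(1,2) this]
    moreover have "integral {a..x} g = f x - f a" "integral {a..y} g = f y - f a"
      using g(2)[of x] g(2)[of y] xy by (auto intro: integral_unique)
    ultimately have "integral {x..y} g = f y - f x" by (simp add: algebra_simps)
    moreover have "g integrable_on {x..y}" using xy by (intro integrable_subinterval_real[OF gi]) auto
    ultimately show ?thesis by (simp add: has_integral_integrable_integral)
  qed
  have "AE x in lebesgue. x \<in> {a<..<b} \<longrightarrow> (f has_vector_derivative g x) (at x)"
    by (rule AE_has_vector_derivative_integral[OF gi]) (use int in \<open>auto intro: integral_unique\<close>)
  with g(1) int that show thesis by blast
qed

text \<open>The densities found on the various compact intervals are glued through the canonical
  function \<open>vector_derivative f\<close>, with which each of them agrees almost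
  everywhere.\<close>

lemma locally_ac_vector_derivative:
  fixes f :: "real \<Rightarrow> 'a::euclidean_space"
  assumes lac: "locally_abs_continuous_on I f" and I: "convex I"
  shows "AE x in lebesgue. x \<in> I \<longrightarrow> (f has_vector_derivative vector_derivative f (at x)) (at x)"
    and "ac_deriv I f (\<lambda>x. vector_derivative f (at x))"
proof -
  have ac: "abs_continuous_on a b f" if "{a..b} \<subseteq> I" for a b
    using lac that unfolding locally_abs_continuous_on_def by blast
  show AE: "AE x in lebesgue. x \<in> I \<longrightarrow> (f has_vector_derivative vector_derivative f (at x)) (at x)"
  proof (rule AE_convex_localI[OF I])
    fix a b assume ab: "a < b" "{a..b} \<subseteq> I"
    obtain g where "AE x in lebesgue. x \<in> {a<..<b} \<longrightarrow> (f has_vector_derivative g x) (at x)"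
      by (rule abs_continuous_on_imp_AE_primitive[OF ac[OF ab(2)]]) (use ab in auto)
    then show "AE x in lebesgue. x \<in> {a<..<b} \<longrightarrow> (f has_vector_derivative vector_derivative f (at x)) (at x)"
      by eventually_elim (auto simp: vector_derivative_at)
  qed
  show "ac_deriv I f (\<lambda>x. vector_derivative f (at x))"
  proof (rule ac_derivI)
    fix a b assume ab: "a \<le> b" "{a..b} \<subseteq> I"
    obtain g where g: "g absolutely_integrable_on {a..b}"
      "\<And>x y. a \<le> x \<Longrightarrow> x \<le> y \<Longrightarrow> y \<le> b \<Longrightarrow> (g has_integral (f y - f x)) {x..y}"
      "AE x in lebesgue. x \<in> {a<..<b} \<longrightarrow> (f has_vector_derivative g x) (at x)"
      by (rule abs_continuous_on_imp_AE_primitive[OF ac[OF ab(2)] ab(1)]) blast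
    have "AE x in lebesgue. x \<notin> {a, b}" by (intro AE_not_in) (simp add: negligible_iff_null_sets[symmetric])
    with g(3) have eq: "AE x in lebesgue. x \<in> {a..b} \<longrightarrow> vector_derivative f (at x) = g x"
      by eventually_elim (auto simp: vector_derivative_at)
    show "(\<lambda>x. vector_derivative f (at x)) absolutely_integrable_on {a..b}"
      by (rule absolutely_integrable_cong_AE[OF eq g(1)])
    show "((\<lambda>x. vector_derivative f (at x)) has_integral (f b - f a)) {a..b}"
      by (rule has_integral_cong_AE[OF eq]) (use g(2)[of a b] ab in auto)
  qed
qed

lemma locally_ac_imp_ac_deriv:
  fixes f :: "real \<Rightarrow> 'a::euclidean_space"
  assumes lac: "locally_abs_continuous_on I f" and I: "convex I"
    and d: "AE x in lebesgue. x \<in> I \<longrightarrow> (f has_vector_derivative g x) (at x)"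
  shows "ac_deriv I f g"
proof (rule ac_derivI)
  fix a b assume ab: "a \<le> b" "{a..b} \<subseteq> I"
  note v = locally_ac_vector_derivative(2)[OF lac I]
  from d have eq: "AE x in lebesgue. x \<in> {a..b} \<longrightarrow> g x = vector_derivative f (at x)"
    by eventually_elim (use ab(2) in \<open>auto simp: vector_derivative_at\<close>)
  show "g absolutely_integrable_on {a..b}"
    by (rule absolutely_integrable_cong_AE[OF eq ac_derivD(1)[OF v ab(2)]])
  show "(g has_integral (f b - f a)) {a..b}"
    by (rule has_integral_cong_AE[OF eq ac_derivD(2)[OF v ab(2,1)]])
qed

lemma locally_ac_imp_continuous_on:
  fixes f :: "real \<Rightarrow> 'a::real_normed_vector"
  assumes "locally_abs_continuous_on I f" "{a..b} \<subseteq> I"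
  shows "continuous_on {a..b} f"
  using assms abs_continuous_on_imp_continuous_on unfolding locally_abs_continuous_on_def by blast

lemma locally_ac_dominated:
  fixes f :: "real \<Rightarrow> 'a::real_normed_vector" and g :: "real \<Rightarrow> 'b::real_normed_vector"
    and h :: "real \<Rightarrow> 'c::real_normed_vector"
  assumes "locally_abs_continuous_on I f" "locally_abs_continuous_on I g"
    and "\<And>a b. a \<le> b \<Longrightarrow> {a..b} \<subseteq> I \<Longrightarrow> \<exists>C D. \<forall>x y. a \<le> x \<longrightarrow> x \<le> y \<longrightarrow> y \<le> b \<longrightarrow>
      norm (h y - h x) \<le> C * norm (f y - f x) + D * norm (g y - g x)"
  shows "locally_abs_continuous_on I h"
  unfolding locally_abs_continuous_on_def
proof (intro allI impI)
  fix a b assume ab: "{a..b} \<subseteq> I"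
  have fg: "abs_continuous_on a b f" "abs_continuous_on a b g"
    using assms ab unfolding locally_abs_continuous_on_def by auto
  show "abs_continuous_on a b h"
  proof (cases "a \<le> b")
    case True
    obtain C D where CD: "\<forall>x y. a \<le> x \<longrightarrow> x \<le> y \<longrightarrow> y \<le> b \<longrightarrow>
      norm (h y - h x) \<le> C * norm (f y - f x) + D * norm (g y - g x)"
      using assms(3)[OF True ab] by blast
    show ?thesis by (rule abs_continuous_on_dominated[OF fg, of h C D]) (use CD in blast)
  next
    case False
    show ?thesis
      by (rule abs_continuous_on_dominated[OF fg, of h 0 0]) (use False in linarith)
  qed
qed

lemma locally_ac_bilinear:
  fixes f :: "real \<Rightarrow> 'a::real_normed_vector" and g :: "real \<Rightarrow> 'b::real_normed_vector"
    and prod :: "'a \<Rightarrow> 'b \<Rightarrow> 'c::real_normed_vector"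
  assumes bl: "bounded_bilinear prod" and f: "locally_abs_continuous_on I f" and g: "locally_abs_continuous_on I g"
  shows "locally_abs_continuous_on I (\<lambda>x. prod (f x) (g x))"
proof (rule locally_ac_dominated[OF f g])
  fix a b :: real assume ab: "a \<le> b" "{a..b} \<subseteq> I"
  interpret bounded_bilinear prod by fact
  obtain K where K: "K > 0" "\<And>u v. norm (prod u v) \<le> norm u * norm v * K" using pos_bounded by blast
  have "bounded (f ` {a..b})" "bounded (g ` {a..b})"
    using f g ab by (auto intro!: compact_imp_bounded compact_continuous_image locally_ac_imp_continuous_on)
  then obtain Bf Bg where B: "\<And>x. x \<in> {a..b} \<Longrightarrow> norm (f x) \<le> Bf" "\<And>x. x \<in> {a..b} \<Longrightarrow> norm (g x) \<le> Bg"
    unfolding bounded_iff by blast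
  show "\<exists>C D. \<forall>x y. a \<le> x \<longrightarrow> x \<le> y \<longrightarrow> y \<le> b \<longrightarrow>
      norm (prod (f y) (g y) - prod (f x) (g x)) \<le> C * norm (f y - f x) + D * norm (g y - g x)"
  proof (rule exI[of _ "Bg * K"], rule exI[of _ "Bf * K"], intro allI impI)
    fix x y assume xy: "a \<le> x" "x \<le> y" "y \<le> b"
    have "prod (f y) (g y) - prod (f x) (g x) = prod (f y - f x) (g y) + prod (f x) (g y - g x)"
      by (simp add: diff_left diff_right)
    then have "norm (prod (f y) (g y) - prod (f x) (g x)) \<le> norm (prod (f y - f x) (g y)) + norm (prod (f x) (g y - g x))"
      by (simp add: norm_triangle_ineq)
    also have "\<dots> \<le> norm (f y - f x) * norm (g y) * K + norm (f x) * norm (g y - g x) * K"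
      by (intro add_mono K(2))
    also have "\<dots> \<le> norm (f y - f x) * Bg * K + Bf * norm (g y - g x) * K"
      using K(1) B xy by (intro add_mono mult_right_mono mult_left_mono) auto
    finally show "norm (prod (f y) (g y) - prod (f x) (g x)) \<le> Bg * K * norm (f y - f x) + Bf * K * norm (g y - g x)"
      by (simp add: mult_ac)
  qed
qed

text \<open>On a compact interval u takes values in some [-B, B], where T is Lipschitz by the mean
  value inequality. The instances needed are arctan and exp(2 y).\<close>

lemma locally_ac_C1:
  fixes u T T' :: "real \<Rightarrow> real"
  assumes u: "locally_abs_continuous_on I u" and T: "\<And>x. (T has_real_derivative T' x) (at x)"
    and T': "continuous_on UNIV T'"
  shows "locally_abs_continuous_on I (\<lambda>x. T (u x))"
proof (rule locally_ac_dominated[OF u u])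
  fix a b :: real assume ab: "a \<le> b" "{a..b} \<subseteq> I"
  have "bounded (u ` {a..b})"
    using u ab by (auto intro!: compact_imp_bounded compact_continuous_image locally_ac_imp_continuous_on)
  then obtain B where B: "\<And>x. x \<in> {a..b} \<Longrightarrow> \<bar>u x\<bar> \<le> B" unfolding bounded_iff real_norm_def by blast
  have "bounded (T' ` {-B..B})"
    by (intro compact_imp_bounded compact_continuous_image continuous_on_subset[OF T']) auto
  then obtain C where C: "\<And>x. x \<in> {-B..B} \<Longrightarrow> norm (T' x) \<le> C" unfolding bounded_iff by blast
  have "norm (T (u y) - T (u x)) \<le> C * norm (u y - u x)" if "x \<in> {a..b}" "y \<in> {a..b}" for x y
  proof (rule field_differentiable_bound[of "{-B..B}" T T'])
    show "(T has_field_derivative T' z) (at z within {-B..B})" for z using T by (rule has_field_derivative_at_within)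
    show "u y \<in> {-B..B}" "u x \<in> {-B..B}" using B[OF that(1)] B[OF that(2)] by auto
  qed (use C in auto)
  then show "\<exists>C D. \<forall>x y. a \<le> x \<longrightarrow> x \<le> y \<longrightarrow> y \<le> b \<longrightarrow>
      norm (T (u y) - T (u x)) \<le> C * norm (u y - u x) + D * norm (u y - u x)"
    by (intro exI[of _ C] exI[of _ 0]) auto
qed

lemma locally_ac_bounded_linear:
  assumes T: "bounded_linear T" and f: "locally_abs_continuous_on I f"
  shows "locally_abs_continuous_on I (\<lambda>x. T (f x))"
proof (rule locally_ac_dominated[OF f f])
  interpret bounded_linear T by fact
  obtain K where K: "\<And>x. norm (T x) \<le> norm x * K" using bounded by blast
  show "\<exists>C D. \<forall>x y. a \<le> x \<longrightarrow> x \<le> y \<longrightarrow> y \<le> b \<longrightarrow>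
      norm (T (f y) - T (f x)) \<le> C * norm (f y - f x) + D * norm (f y - f x)" for a b
    by (rule exI[of _ K], rule exI[of _ 0]) (use K in \<open>auto simp: diff[symmetric] mult.commute\<close>)
qed

lemma locally_ac_add:
  assumes f: "locally_abs_continuous_on I f" and g: "locally_abs_continuous_on I g"
  shows "locally_abs_continuous_on I (\<lambda>x. f x + g x)"
proof (rule locally_ac_dominated[OF f g])
  have "norm (f y + g y - (f x + g x)) \<le> 1 * norm (f y - f x) + 1 * norm (g y - g x)" for x y
    using norm_triangle_ineq[of "f y - f x" "g y - g x"] by (simp add: algebra_simps)
  then show "\<exists>C D. \<forall>x y. a \<le> x \<longrightarrow> x \<le> y \<longrightarrow> y \<le> b \<longrightarrow>
      norm (f y + g y - (f x + g x)) \<le> C * norm (f y - f x) + D * norm (g y - g x)" for a b by blast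
qed

section \<open>The scalar limit point estimate\<close>

text \<open>AM-GM for the numbers p sqrt(a) / s and sqrt(h). Later s^2 is the denominator 1 + u^2 in
  the derivative of arctan u, and it is put entirely under the term with a.\<close>

lemma amgm_weighted:
  fixes a h p s :: real
  assumes "0 \<le> a" "0 \<le> h" "0 < s" "0 \<le> p"
  shows "p * sqrt (a * h) / s \<le> p\<^sup>2 * a / (2 * s\<^sup>2) + h / 2"
proof -
  define x where "x = p * sqrt a / s"
  have x: "x * sqrt h = p * sqrt (a * h) / s" "x\<^sup>2 = p\<^sup>2 * a / s\<^sup>2"
    using assms unfolding x_def by (simp_all add: real_sqrt_mult power_divide power_mult_distrib)
  have "0 \<le> (x - sqrt h)\<^sup>2" by simp
  then have "2 * (x * sqrt h) \<le> x\<^sup>2 + h" using assms by (simp add: power2_diff)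
  then show ?thesis unfolding x by (simp add: field_simps)
qed

text \<open>This is how the lower bound for |F| is used: the weight s = sqrt(1 + u^2) is at most a
  multiple of |F|, hence k is at most a multiple of k |F| / s.\<close>

lemma sqrt_1_plus_sq_le:
  fixes u :: real
  assumes "\<bar>u\<bar> \<le> C * F" "\<epsilon> \<le> F" "0 < \<epsilon>"
  shows "sqrt (1 + u\<^sup>2) \<le> (1/\<epsilon> + C) * F"
proof -
  have "1 \<le> F / \<epsilon>" using assms by simp
  have "sqrt (1 + u\<^sup>2) \<le> 1 + \<bar>u\<bar>" by (rule real_le_lsqrt) (auto simp: power2_sum)
  also have "\<dots> \<le> F/\<epsilon> + C * F" using assms \<open>1 \<le> F / \<epsilon>\<close> by linarith
  finally show ?thesis by (simp add: algebra_simps)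
qed

text \<open>Common end of both cases of the limit point estimate. There \<phi> is the derivative of
  an arctan, possibly multiplied by 1/q, so its integrals are bounded by B, whereas the integrals of
  k diverge and h contributes a finite amount.\<close>

lemma scalar_blowup:
  fixes \<phi> k h :: "real \<Rightarrow> real"
  assumes X: "0 \<le> X"
    and int: "\<And>x. X \<le> x \<Longrightarrow> \<phi> integrable_on {X..x}" "\<And>x. X \<le> x \<Longrightarrow> integral {X..x} \<phi> \<le> B"
    and ge: "AE x in lebesgue. X \<le> x \<longrightarrow> \<kappa> * k x - C * h x \<le> \<phi> x"
    and \<kappa>: "0 < \<kappa>" and C: "0 \<le> C"
    and h: "AE x in lebesgue. 0 \<le> x \<longrightarrow> 0 \<le> h x" "h absolutely_integrable_on {0..}"
    and k: "\<And>x. 0 \<le> x \<Longrightarrow> k integrable_on {0..x}" "\<And>M. \<exists>x\<ge>0. integral {0..x} k > M"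
      "\<And>x. 0 \<le> x \<Longrightarrow> 0 \<le> k x"
  shows False
proof -
  \<comment> \<open>Chosen such that after removal of the initial piece [0, X] the integral of
    \<kappa> k still exceeds B + C times the integral of h.\<close>
  define M where "M = (B + C * integral {0..} h) / \<kappa> + integral {0..X} k"
  obtain x where x: "0 \<le> x" "integral {0..x} k > M" using k(2) by blast
  define y where "y = max x X"
  have y: "X \<le> y" "0 \<le> y" "x \<le> y" using X unfolding y_def by auto
  have ky: "integral {0..y} k = integral {0..X} k + integral {X..y} k"
    using Henstock_Kurzweil_Integration.integral_combine[OF X y(1) k(1)[OF y(2)]] by simp
  have "integral {0..x} k \<le> integral {0..y} k"
    using k x y by (intro integral_subset_le) auto
  then have "(B + C * integral {0..} h) / \<kappa> < integral {X..y} k" using x ky unfolding M_def by linarith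
  then have 1: "B + C * integral {0..} h < \<kappa> * integral {X..y} k" using \<kappa> by (simp add: field_simps)
  have hX: "h absolutely_integrable_on {X..y}" using X by (intro set_integrable_subset[OF h(2)]) auto
  then have hXi: "h integrable_on {X..y}" by (simp add: absolutely_integrable_on_def)
  have h0i: "h integrable_on {0..}" using h(2) by (simp add: absolutely_integrable_on_def)
  have kX: "k integrable_on {X..y}" using X by (intro integrable_subinterval_real[OF k(1)[OF y(2)]]) auto
  obtain N where N: "negligible N" "\<And>x. x \<notin> N \<Longrightarrow> 0 \<le> x \<longrightarrow> 0 \<le> h x"
    using AE_lebesgue_negligibleE[OF h(1)] by blast
  have h2: "integral {X..y} h \<le> integral {0..} h"
  proof -
    define h' where "h' x = (if x \<in> N then 0 else h x)" for x
    have eq: "h' x = h x" if "x \<in> S - N" for x S using that unfolding h'_def by simp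
    have e: "integral S h' = integral S h" "h' integrable_on S \<longleftrightarrow> h integrable_on S" for S
    proof -
      show "integral S h' = integral S h" by (rule integral_spike[OF N(1)]) (simp add: h'_def)
      show "h' integrable_on S \<longleftrightarrow> h integrable_on S"
      proof
        show "h integrable_on S" if "h' integrable_on S" by (rule integrable_spike[OF that N(1)]) (simp add: h'_def)
        show "h' integrable_on S" if "h integrable_on S" by (rule integrable_spike[OF that N(1)]) (simp add: h'_def)
      qed
    qed
    have "integral {X..y} h' \<le> integral {0..} h'"
      using hXi h0i X N(2) e by (intro integral_subset_le) (auto simp: h'_def)
    then show ?thesis using e by simp
  qed
  have "integral {X..y} (\<lambda>x. \<kappa> * k x - C * h x) \<le> integral {X..y} \<phi>"
  proof (rule integral_le_AE)
    show "(\<lambda>x. \<kappa> * k x - C * h x) integrable_on {X..y}"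
      using kX hXi by (intro integrable_diff integrable_on_mult_right)
    show "\<phi> integrable_on {X..y}" using int(1) y by blast
    show "AE x in lebesgue. x \<in> {X..y} \<longrightarrow> \<kappa> * k x - C * h x \<le> \<phi> x" using ge by eventually_elim auto
  qed
  moreover have "integral {X..y} (\<lambda>x. \<kappa> * k x - C * h x) = \<kappa> * integral {X..y} k - C * integral {X..y} h"
    using kX hXi by (subst integral_diff) (auto intro: integrable_on_mult_right)
  moreover have "C * integral {X..y} h \<le> C * integral {0..} h" using C h2 by (intro mult_left_mono)
  ultimately show False using 1 int(2)[OF y(1)] by linarith
qed

text \<open>If \<open>|F|\<close> stayed away from 0, then \<open>arctan (Re F / q)\<close> (when \<open>1/\<surd>q\<close> is absolutely
  continuous) or \<open>arctan (Re F)\<close>, weighted by the decreasing function \<open>1/q\<close> (when \<open>q\<close> is monotone),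
  would be forced to grow beyond all bounds.\<close>

lemma scalar_limit_point:
  fixes F :: "real \<Rightarrow> complex" and a h v p k q :: "real \<Rightarrow> real"
  assumes F: "locally_abs_continuous_on {0..} F"
    and dF: "AE x in lebesgue. 0 \<le> x \<longrightarrow>
      (F has_vector_derivative (complex_of_real (a x + v x) - lam * complex_of_real (h x))) (at x)"
    and pos: "AE x in lebesgue. 0 \<le> x \<longrightarrow> 0 \<le> a x \<and> 0 \<le> h x \<and> - (q x * h x) \<le> v x"
    and h: "h absolutely_integrable_on {0..}"
    and d: "0 < d" "\<And>x. 0 \<le> x \<Longrightarrow> d \<le> q x"
    and p: "\<And>x. 0 \<le> x \<Longrightarrow> p x = 1 / sqrt (q x)"
    and k: "\<And>x. 0 \<le> x \<Longrightarrow> k integrable_on {0..x}" "\<And>M. \<exists>x\<ge>0. integral {0..x} k > M"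
      "\<And>x. 0 \<le> x \<Longrightarrow> 0 \<le> k x"
    and kF: "AE x in lebesgue. 0 \<le> x \<longrightarrow> k x * norm (F x) \<le> p x * sqrt (a x * h x)"
    and cases: "(locally_abs_continuous_on {0..} p \<and>
        (\<exists>C\<ge>0. AE x in lebesgue. 0 \<le> x \<longrightarrow> \<bar>vector_derivative p (at x)\<bar> * norm (F x) \<le> C * sqrt (a x * h x)))
      \<or> mono_on {0..} q"
    and \<epsilon>: "0 < \<epsilon>" "0 \<le> X" "\<And>x. X \<le> x \<Longrightarrow> \<epsilon> \<le> norm (F x)"
  shows False
proof -
  have cv: "convex {0::real..}" by simp
  have q0: "0 < q x" if "0 \<le> x" for x using d(1) d(2)[OF that] by linarith
  have p2: "(p x)\<^sup>2 = 1 / q x" "0 < p x" "(p x)\<^sup>2 \<le> 1/d" if "0 \<le> x" for x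
  proof -
    show "(p x)\<^sup>2 = 1 / q x" using p[OF that] q0[OF that] by (simp add: power_divide)
    then show "(p x)\<^sup>2 \<le> 1/d" using d(1) d(2)[OF that] by (simp add: frac_le)
    show "0 < p x" using p[OF that] q0[OF that] by simp
  qed
  define G where "G x = Re (F x)" for x
  define G' where "G' x = a x + v x - Re lam * h x" for x
  have Glac: "locally_abs_continuous_on {0..} G"
    unfolding G_def by (rule locally_ac_bounded_linear[OF bounded_linear_Re F])
  have dG: "AE x in lebesgue. 0 \<le> x \<longrightarrow> (G has_vector_derivative G' x) (at x)"
    using dF
  proof eventually_elim
    case (elim x)
    show ?case
    proof
      assume "0 \<le> x"
      then have "(F has_vector_derivative (complex_of_real (a x + v x) - lam * complex_of_real (h x))) (at x)" using elim by blast
      from bounded_linear.has_vector_derivative[OF bounded_linear_Re this]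
      show "(G has_vector_derivative G' x) (at x)" unfolding G_def G'_def by simp
    qed
  qed
  have GF: "\<bar>G x\<bar> \<le> norm (F x)" for x unfolding G_def by (rule abs_Re_le_cmod)
  \<comment> \<open>The 1 comes from v >= -q h multiplied by p^2 = 1/q, the other summand from Re
    lam h together with p^2 <= 1/d.\<close>
  define C0 where "C0 = 1 + norm lam / d"
  have C0: "0 \<le> C0" unfolding C0_def using d by simp
  have G'ge: "(p x)\<^sup>2 * a x - C0 * h x \<le> (p x)\<^sup>2 * G' x"
    if "0 \<le> x" "0 \<le> a x \<and> 0 \<le> h x \<and> - (q x * h x) \<le> v x" for x
  proof -
    have "(p x)\<^sup>2 * - (q x * h x) \<le> (p x)\<^sup>2 * v x" using that by (intro mult_left_mono) auto
    then have 1: "- h x \<le> (p x)\<^sup>2 * v x" using p2(1)[OF that(1)] q0[OF that(1)] by simp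
    have "(p x)\<^sup>2 * (Re lam * h x) \<le> (1/d) * (norm lam * h x)"
      using that complex_Re_le_cmod[of lam] p2(3)[OF that(1)] d(1)
      by (intro order_trans[OF mult_left_mono mult_right_mono] mult_right_mono) auto
    then show ?thesis unfolding G'_def C0_def using 1 by (simp add: algebra_simps)
  qed
  from cases show False
  proof
    assume "locally_abs_continuous_on {0..} p \<and>
        (\<exists>C\<ge>0. AE x in lebesgue. 0 \<le> x \<longrightarrow> \<bar>vector_derivative p (at x)\<bar> * norm (F x) \<le> C * sqrt (a x * h x))"
    then obtain C where plac: "locally_abs_continuous_on {0..} p" and C: "0 \<le> C"
      and pC: "AE x in lebesgue. 0 \<le> x \<longrightarrow> \<bar>vector_derivative p (at x)\<bar> * norm (F x) \<le> C * sqrt (a x * h x)" by blast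
    define p' where "p' x = vector_derivative p (at x)" for x
    \<comment> \<open>u = Re F / q. Its derivative contains p', for which the bound with C is
      available in this case.\<close>
    define u where "u x = (p x)\<^sup>2 * G x" for x
    define u' where "u' x = (p x)\<^sup>2 * G' x + 2 * p x * p' x * G x" for x
    have p2lac: "locally_abs_continuous_on {0..} (\<lambda>x. (p x)\<^sup>2)"
      unfolding power2_eq_square by (rule locally_ac_bilinear[OF bounded_bilinear_mult plac plac])
    have ulac: "locally_abs_continuous_on {0..} u"
      unfolding u_def by (rule locally_ac_bilinear[OF bounded_bilinear_mult p2lac Glac])
    define \<theta> where "\<theta> x = arctan (u x)" for x
    have \<theta>lac: "locally_abs_continuous_on {0..} \<theta>"
      unfolding \<theta>_def
    proof (rule locally_ac_C1[OF ulac])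
      show "(arctan has_real_derivative inverse (1 + x\<^sup>2)) (at x)" for x by (rule DERIV_arctan)
      show "continuous_on UNIV (\<lambda>x::real. inverse (1 + x\<^sup>2))"
        by (intro continuous_intros) (simp add: sum_power2_gt_zero_iff add_pos_nonneg less_imp_neq[symmetric])
    qed
    define \<phi> where "\<phi> x = inverse (1 + (u x)\<^sup>2) * u' x" for x
    have d\<theta>: "AE x in lebesgue. x \<in> {0..} \<longrightarrow> (\<theta> has_vector_derivative \<phi> x) (at x)"
      using dG locally_ac_vector_derivative(1)[OF plac cv]
    proof eventually_elim
      case (elim x)
      show ?case
      proof
        assume x: "x \<in> {0..}"
        have "(G has_real_derivative G' x) (at x)" "(p has_real_derivative p' x) (at x)"
          using elim x by (auto simp: has_real_derivative_iff_has_vector_derivative p'_def)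
        then have "(u has_real_derivative u' x) (at x)"
          unfolding u_def u'_def by (auto intro!: derivative_eq_intros simp: algebra_simps power2_eq_square)
        then have "(\<theta> has_real_derivative \<phi> x) (at x)"
          unfolding \<theta>_def \<phi>_def by (rule DERIV_chain2[OF DERIV_arctan])
        then show "(\<theta> has_vector_derivative \<phi> x) (at x)" by (simp add: has_real_derivative_iff_has_vector_derivative)
      qed
    qed
    have ac: "ac_deriv {0..} \<theta> \<phi>" by (rule locally_ac_imp_ac_deriv[OF \<theta>lac cv d\<theta>])
    \<comment> \<open>The constant of \<open>sqrt_1_plus_sq_le\<close>: here |u| <= |F| / d because
      p^2 <= 1/d.\<close>
    define K where "K = 1/\<epsilon> + 1/d"
    have K: "0 < K" unfolding K_def using \<epsilon> d by (simp add: add_pos_pos)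
    \<comment> \<open>C0 from the lower bound for p^2 G', 2 C^2 from absorbing the term with p', and
      1/2 from the AM-GM estimate of k.\<close>
    define D where "D = C0 + 2 * C\<^sup>2 + 1/2"
    have D: "0 \<le> D" unfolding D_def using C0 by simp
    show False
    proof (rule scalar_blowup[OF \<epsilon>(2), of \<phi> pi "1/K" k D h])
      fix x assume x: "X \<le> x"
      then have sub: "{X..x} \<subseteq> {0..}" using \<epsilon>(2) by auto
      show "\<phi> integrable_on {X..x}" using ac_derivD(1)[OF ac sub] by (simp add: absolutely_integrable_on_def)
      have "integral {X..x} \<phi> = \<theta> x - \<theta> X" using ac_derivD(3)[OF ac sub x] .
      also have "\<dots> \<le> pi" unfolding \<theta>_def using arctan_bounded[of "u x"] arctan_bounded[of "u X"] by linarith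
      finally show "integral {X..x} \<phi> \<le> pi" .
    next
      show "AE x in lebesgue. X \<le> x \<longrightarrow> 1/K * k x - D * h x \<le> \<phi> x"
        using pos kF pC
      proof eventually_elim
        case (elim x)
        show ?case
        proof
          assume Xx: "X \<le> x"
          then have x: "0 \<le> x" using \<epsilon>(2) by linarith
          have ph: "0 \<le> a x" "0 \<le> h x" "- (q x * h x) \<le> v x" using elim(1) x by auto
          note pp = p2[OF x]
          define s where "s = sqrt (1 + (u x)\<^sup>2)"
          have s: "1 \<le> s" "s\<^sup>2 = 1 + (u x)\<^sup>2" unfolding s_def by auto
          \<comment> \<open>AM-GM with p / sqrt 2 and 2 C^2 h, balanced such that the term with p'
            consumes only half of p^2 a. The other half is what dominates k below.\<close>
          have "2 * p x * p' x * G x \<ge> - ((p x)\<^sup>2 * a x / 2 + 2 * C\<^sup>2 * h x)"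
          proof -
            have "\<bar>2 * p x * p' x * G x\<bar> \<le> 2 * p x * (\<bar>p' x\<bar> * norm (F x))"
              using pp(2) GF[of x] by (simp add: abs_mult mult.assoc mult_left_mono)
            also have "\<dots> \<le> 2 * p x * (C * sqrt (a x * h x))"
              using elim(3) x pp(2) unfolding p'_def by (intro mult_left_mono) auto
            also have "\<dots> = 2 * (p x * sqrt (a x * (C\<^sup>2 * h x)) / 1)"
              using C by (simp add: real_sqrt_mult)
            also have "\<dots> \<le> 2 * ((p x / sqrt 2)\<^sup>2 * a x / (2 * 1\<^sup>2) + (2 * C\<^sup>2 * h x) / 2)"
            proof -
              have "p x / sqrt 2 * sqrt (a x * (2 * C\<^sup>2 * h x)) / 1 \<le> (p x / sqrt 2)\<^sup>2 * a x / (2 * 1\<^sup>2) + (2 * C\<^sup>2 * h x) / 2"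
                using ph pp(2) by (intro amgm_weighted) auto
              moreover have "p x / sqrt 2 * sqrt (a x * (2 * C\<^sup>2 * h x)) = p x * sqrt (a x * (C\<^sup>2 * h x))"
                by (simp add: real_sqrt_mult)
              ultimately have "p x * sqrt (a x * (C\<^sup>2 * h x)) / 1 \<le> (p x / sqrt 2)\<^sup>2 * a x / (2 * 1\<^sup>2) + (2 * C\<^sup>2 * h x) / 2"
                by (simp only: div_by_1)
              then show ?thesis by (rule mult_left_mono) simp
            qed
            also have "\<dots> = (p x)\<^sup>2 * a x / 2 + 2 * C\<^sup>2 * h x" by (simp add: power_divide)
            finally show ?thesis by linarith
          qed
          then have u'ge: "(p x)\<^sup>2 * a x / 2 - (C0 + 2 * C\<^sup>2) * h x \<le> u' x"
            unfolding u'_def using G'ge[OF x] ph by (simp add: algebra_simps)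
          have hs: "(C0 + 2 * C\<^sup>2) * h x / s\<^sup>2 \<le> (C0 + 2 * C\<^sup>2) * h x"
          proof -
            have "0 \<le> (C0 + 2 * C\<^sup>2) * h x" using C0 ph by simp
            moreover have "1 \<le> s\<^sup>2" unfolding s(2) by simp
            ultimately show ?thesis by (simp add: divide_le_eq mult_le_cancel_left1)
          qed
          have "\<bar>u x\<bar> \<le> (1/d) * norm (F x)"
          proof -
            have "\<bar>(p x)\<^sup>2\<bar> * \<bar>G x\<bar> \<le> (1/d) * norm (F x)"
            proof (rule mult_mono)
              show "\<bar>(p x)\<^sup>2\<bar> \<le> 1/d" using pp(3) by (simp only: abs_power2)
            qed (use GF[of x] d(1) in auto)
            then show ?thesis unfolding u_def abs_mult .
          qed
          then have sK: "s \<le> K * norm (F x)"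
            unfolding s_def K_def by (rule sqrt_1_plus_sq_le) (use \<epsilon> Xx in auto)
          have "1/K * k x \<le> k x * norm (F x) / s"
          proof -
            have "k x * s \<le> k x * (K * norm (F x))" using sK k(3)[OF x] by (intro mult_left_mono)
            then show ?thesis using K s(1) by (simp add: field_simps)
          qed
          also have "\<dots> \<le> p x * sqrt (a x * h x) / s"
            using elim(2) x s(1) by (intro divide_right_mono) auto
          also have "\<dots> \<le> (p x)\<^sup>2 * a x / (2 * s\<^sup>2) + h x / 2"
            using ph pp(2) s(1) by (intro amgm_weighted) auto
          finally have A: "1/K * k x \<le> (p x)\<^sup>2 * a x / (2 * s\<^sup>2) + h x / 2" .
          have "(p x)\<^sup>2 * a x / (2 * s\<^sup>2) = (p x)\<^sup>2 * a x / 2 / s\<^sup>2" by simp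
          also have "\<dots> \<le> (u' x + (C0 + 2 * C\<^sup>2) * h x) / s\<^sup>2"
            using u'ge by (intro divide_right_mono) auto
          also have "\<dots> = \<phi> x + (C0 + 2 * C\<^sup>2) * h x / s\<^sup>2"
            unfolding \<phi>_def s(2)[symmetric] by (simp add: add_divide_distrib field_simps)
          finally have "1/K * k x \<le> \<phi> x + (C0 + 2 * C\<^sup>2) * h x / s\<^sup>2 + h x / 2" using A by linarith
          then show "1/K * k x - D * h x \<le> \<phi> x" unfolding D_def using hs by (simp add: algebra_simps)
        qed
      qed
    next
      show "AE x in lebesgue. 0 \<le> x \<longrightarrow> 0 \<le> h x" using pos by eventually_elim auto
    qed (use K D h k in auto)
  next
    assume mono: "mono_on {0..} q"
    define g where "g x = arctan (G x)" for x
    have glac: "locally_abs_continuous_on {0..} g"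
      unfolding g_def
    proof (rule locally_ac_C1[OF Glac])
      show "(arctan has_real_derivative inverse (1 + x\<^sup>2)) (at x)" for x by (rule DERIV_arctan)
      show "continuous_on UNIV (\<lambda>x::real. inverse (1 + x\<^sup>2))"
        by (intro continuous_intros) (simp add: sum_power2_gt_zero_iff add_pos_nonneg less_imp_neq[symmetric])
    qed
    define g' where "g' x = inverse (1 + (G x)\<^sup>2) * G' x" for x
    have "AE x in lebesgue. x \<in> {0..} \<longrightarrow> (g has_vector_derivative g' x) (at x)"
      using dG
    proof eventually_elim
      case (elim x)
      show ?case
      proof
        assume x: "x \<in> {0..}"
        have "(G has_real_derivative G' x) (at x)"
          using elim x by (auto simp: has_real_derivative_iff_has_vector_derivative)
        then have "(g has_real_derivative g' x) (at x)"
          unfolding g_def g'_def by (rule DERIV_chain2[OF DERIV_arctan])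
        then show "(g has_vector_derivative g' x) (at x)" by (simp add: has_real_derivative_iff_has_vector_derivative)
      qed
    qed
    then have ac: "ac_deriv {0..} g g'" by (rule locally_ac_imp_ac_deriv[OF glac cv])
    \<comment> \<open>A merely monotone 1/q need not be absolutely continuous, so it is not put
      inside the arctan; the second mean value theorem takes the place of integration by parts. It
      requires an increasing weight, hence the minus sign.\<close>
    define w where "w x = - ((p x)\<^sup>2)" for x
    have wmono: "w x \<le> w y" if "0 \<le> x" "x \<le> y" for x y
    proof -
      have "q x \<le> q y" using mono_onD[OF mono, of x y] that by auto
      then show ?thesis unfolding w_def using p2(1)[of x] p2(1)[of y] q0[of x] that by (simp add: frac_le)
    qed
    \<comment> \<open>Here the arctan is taken of G itself, and |G| <= |F|, so the second summand is
      1.\<close>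
    define K where "K = 1/\<epsilon> + 1"
    have K: "0 < K" unfolding K_def using \<epsilon> by (simp add: add_pos_pos)
    define D where "D = C0 + 1/2"
    have D: "0 \<le> D" unfolding D_def using C0 by simp
    \<comment> \<open>The second mean value theorem leaves two terms, each the product of a weight
      of modulus at most 1/d and an increment of arctan of modulus at most pi.\<close>
    have smv: "(\<lambda>x. (p x)\<^sup>2 * g' x) integrable_on {X..x} \<and> integral {X..x} (\<lambda>x. (p x)\<^sup>2 * g' x) \<le> 2 * pi / d"
      if x: "X \<le> x" for x
    proof -
      have sub: "{X..x} \<subseteq> {0..}" using \<epsilon>(2) by auto
      have gi: "g' integrable_on {X..x}" using ac_derivD(1)[OF ac sub] by (simp add: absolutely_integrable_on_def)
      obtain c where c: "c \<in> {X..x}"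
        "((\<lambda>y. w y * g' y) has_integral (w X * integral {X..c} g' + w x * integral {c..x} g')) {X..x}"
        by (rule second_mean_value_theorem_full[OF gi x, of w]) (use wmono \<epsilon>(2) in auto)
      have i: "integral {X..c} g' = g c - g X" "integral {c..x} g' = g x - g c"
        using ac_derivD(3)[OF ac, of X c] ac_derivD(3)[OF ac, of c x] c(1) sub by auto
      have gb: "\<bar>g y - g z\<bar> \<le> pi" for y z
        unfolding g_def using arctan_bounded[of "G y"] arctan_bounded[of "G z"] by linarith
      have wb: "\<bar>w y\<bar> \<le> 1/d" if "0 \<le> y" for y unfolding w_def using p2(3)[OF that] by simp
      have "((\<lambda>y. (p y)\<^sup>2 * g' y) has_integral - (w X * (g c - g X) + w x * (g x - g c))) {X..x}"
        using has_integral_neg[OF c(2)] unfolding i w_def by simp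
      moreover have "- (w X * (g c - g X) + w x * (g x - g c)) \<le> 2 * pi / d"
      proof -
        have "\<bar>w X * (g c - g X)\<bar> \<le> 1/d * pi" "\<bar>w x * (g x - g c)\<bar> \<le> 1/d * pi"
          unfolding abs_mult by (rule mult_mono; use wb[of X] wb[of x] gb \<epsilon>(2) x d(1) in simp)+
        moreover have "2 * pi / d = 1/d * pi + 1/d * pi" by simp
        ultimately show ?thesis by linarith
      qed
      ultimately show ?thesis by (auto intro: has_integral_integrable simp: integral_unique)
    qed
    show False
    proof (rule scalar_blowup[OF \<epsilon>(2), of "\<lambda>x. (p x)\<^sup>2 * g' x" "2 * pi / d" "1/K" k D h])
      show "AE x in lebesgue. X \<le> x \<longrightarrow> 1/K * k x - D * h x \<le> (p x)\<^sup>2 * g' x"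
        using pos kF
      proof eventually_elim
        case (elim x)
        show ?case
        proof
          assume Xx: "X \<le> x"
          then have x: "0 \<le> x" using \<epsilon>(2) by linarith
          have ph: "0 \<le> a x" "0 \<le> h x" "- (q x * h x) \<le> v x" using elim(1) x by auto
          note pp = p2[OF x]
          define s where "s = sqrt (1 + (G x)\<^sup>2)"
          have s: "1 \<le> s" "s\<^sup>2 = 1 + (G x)\<^sup>2" unfolding s_def by auto
          have hs: "C0 * h x / s\<^sup>2 \<le> C0 * h x"
          proof -
            have "0 \<le> C0 * h x" using C0 ph by simp
            moreover have "1 \<le> s\<^sup>2" unfolding s(2) by simp
            ultimately show ?thesis by (simp add: divide_le_eq mult_le_cancel_left1)
          qed
          have sK: "s \<le> K * norm (F x)"
            unfolding s_def K_def by (rule sqrt_1_plus_sq_le) (use \<epsilon> Xx GF in auto)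
          have "1/K * k x \<le> k x * norm (F x) / s"
          proof -
            have "k x * s \<le> k x * (K * norm (F x))" using sK k(3)[OF x] by (intro mult_left_mono)
            then show ?thesis using K s(1) by (simp add: field_simps)
          qed
          also have "\<dots> \<le> p x * sqrt (a x * h x) / s"
            using elim(2) x s(1) by (intro divide_right_mono) auto
          also have "\<dots> \<le> (p x)\<^sup>2 * a x / (2 * s\<^sup>2) + h x / 2"
            using ph pp(2) s(1) by (intro amgm_weighted) auto
          finally have A: "1/K * k x \<le> (p x)\<^sup>2 * a x / (2 * s\<^sup>2) + h x / 2" .
          have "(p x)\<^sup>2 * a x / (2 * s\<^sup>2) \<le> (p x)\<^sup>2 * a x / s\<^sup>2"
            using ph s(1) by (intro divide_left_mono) auto
          also have "\<dots> \<le> ((p x)\<^sup>2 * G' x + C0 * h x) / s\<^sup>2"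
            using G'ge[OF x] ph by (intro divide_right_mono) auto
          also have "\<dots> = (p x)\<^sup>2 * g' x + C0 * h x / s\<^sup>2"
            unfolding g'_def s(2)[symmetric] by (simp add: add_divide_distrib field_simps)
          finally have "1/K * k x \<le> (p x)\<^sup>2 * g' x + C0 * h x / s\<^sup>2 + h x / 2" using A by linarith
          then show "1/K * k x - D * h x \<le> (p x)\<^sup>2 * g' x" unfolding D_def using hs by (simp add: algebra_simps)
        qed
      qed
    next
      show "AE x in lebesgue. 0 \<le> x \<longrightarrow> 0 \<le> h x" using pos by eventually_elim auto
    qed (use K D h k smv in auto)
  qed
qed

section \<open>Linear Caratheodory equations\<close>

text \<open>The fixed point argument takes place among bounded continuous functions on the whole
  line; \<open>max 0\<close> continues indefinite integrals by a constant to the left of 0.\<close>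

lemma continuous_on_indefinite_integral_max:
  fixes g :: "real \<Rightarrow> 'a::euclidean_space"
  assumes g: "\<And>b. g integrable_on {0..b}"
  shows "continuous_on UNIV (\<lambda>x. integral {0..max 0 x} g)"
  unfolding continuous_on_eq_continuous_at[OF open_UNIV]
proof
  fix x :: real
  have "continuous_on {..<x + 1} (\<lambda>x. integral {0..max 0 x} g)"
  proof (rule continuous_on_compose2[of "{0..max 0 (x+1)}" "\<lambda>x. integral {0..x} g" "{..<x+1}" "max 0"])
    show "continuous_on {0..max 0 (x+1)} (\<lambda>x. integral {0..x} g)" by (rule indefinite_integral_continuous_1[OF g])
    show "continuous_on {..<x+1} (max (0::real))" by (intro continuous_intros)
  qed auto
  then show "isCont (\<lambda>x. integral {0..max 0 x} g) x"
    by (rule continuous_on_interior) (simp add: interior_open)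
qed

text \<open>The integral operator is a contraction for the norm \<open>sup |z x| exp (- 2 \<integral>\<^sub>0\<^sup>x l)\<close>, which gives existence
  on the whole half line in one step.\<close>

lemma caratheodory_ode_exists:
  fixes M :: "real \<Rightarrow> 'e::euclidean_space \<Rightarrow> 'e" and h :: "real \<Rightarrow> 'e" and l :: "real \<Rightarrow> real"
  assumes l: "\<And>b. l absolutely_integrable_on {0..b}" "\<And>t. 0 \<le> l t"
    and lip: "\<And>t u v. 0 \<le> t \<Longrightarrow> norm (M t u - M t v) \<le> l t * norm (u - v)"
    and M0: "\<And>t. M t 0 = 0"
    and Mint: "\<And>z b. continuous_on UNIV z \<Longrightarrow> (\<lambda>t. M t (z t)) absolutely_integrable_on {0..b}"
    and h: "\<And>b. h absolutely_integrable_on {0..b}" and hB: "\<And>b. norm (integral {0..b} h) \<le> B"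
  obtains z where "continuous_on UNIV z" "\<And>x. 0 \<le> x \<Longrightarrow> z x = z0 + integral {0..x} (\<lambda>t. M t (z t) + h t)"
proof -
  define L where "L x = integral {0..max 0 x} l" for x
  have li: "l integrable_on {0..b}" for b using l(1) by (simp add: absolutely_integrable_on_def)
  have hi: "h integrable_on {0..b}" for b using h by (simp add: absolutely_integrable_on_def)
  have Mi: "(\<lambda>t. M t (z t)) integrable_on {0..b}" if "continuous_on UNIV z" for z b
    using Mint[OF that] by (simp add: absolutely_integrable_on_def)
  have Lcont: "continuous_on UNIV L" unfolding L_def by (rule continuous_on_indefinite_integral_max[OF li])
  have L0: "0 \<le> L x" for x unfolding L_def using l(2) by (intro integral_nonneg li) auto
  have Lac: "ac_deriv {0..} L l"
  proof (rule ac_derivI)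
    fix a b :: real assume ab: "a \<le> b" "{a..b} \<subseteq> {0..}"
    then have a: "0 \<le> a" by auto
    show "l absolutely_integrable_on {a..b}" using ab by (intro set_integrable_subset[OF l(1)[of b]]) auto
    then have "l integrable_on {a..b}" by (simp add: absolutely_integrable_on_def)
    moreover have "integral {a..b} l = L b - L a"
      unfolding L_def using Henstock_Kurzweil_Integration.integral_combine[OF a ab(1) li] a ab(1) by (simp add: max_def)
    ultimately show "(l has_integral (L b - L a)) {a..b}" by (simp add: has_integral_integrable_integral)
  qed
  have cv: "convex {0::real..}" by simp
  \<comment> \<open>Since W' = 2 l W, the integral of l W over [0, x] is at most W x / 2. The factor
    2 in the exponent thus makes the contraction constant 1/2.\<close>
  define W where "W x = exp (2 * L x)" for x
  have Wcont: "continuous_on UNIV W" unfolding W_def by (intro continuous_intros Lcont)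
  have W1: "1 \<le> W x" for x unfolding W_def using L0 by simp
  have Wac: "ac_deriv {0..} W (\<lambda>x. 2 * l x * W x)"
  proof (rule locally_ac_imp_ac_deriv)
    have "locally_abs_continuous_on {0..} (\<lambda>x. exp (2 * L x))"
      by (rule locally_ac_C1[OF ac_deriv_imp_locally_ac[OF Lac], of "\<lambda>y. exp (2 * y)" "\<lambda>y. 2 * exp (2 * y)"])
         (auto intro!: derivative_eq_intros continuous_intros)
    then show "locally_abs_continuous_on {0..} W" unfolding W_def .
    show "AE x in lebesgue. x \<in> {0..} \<longrightarrow> (W has_vector_derivative 2 * l x * W x) (at x)"
      using ac_deriv_imp_AE[OF Lac cv]
    proof eventually_elim
      case (elim x)
      then show ?case
        unfolding W_def has_real_derivative_iff_has_vector_derivative[symmetric]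
        by (auto intro!: derivative_eq_intros)
    qed
  qed simp
  have lW: "(\<lambda>t. l t * W t) integrable_on {0..x}" "integral {0..x} (\<lambda>t. l t * W t) \<le> W x / 2" if "0 \<le> x" for x
  proof -
    have *: "((\<lambda>t. 2 * l t * W t) has_integral (W x - W 0)) {0..x}" using ac_derivD(2)[OF Wac, of 0 x] that by auto
    have "((\<lambda>t. 1/2 * (2 * l t * W t)) has_integral (1/2 * (W x - W 0))) {0..x}"
      by (rule has_integral_mult_right[OF *])
    then have "((\<lambda>t. l t * W t) has_integral ((W x - W 0) / 2)) {0..x}" by simp
    moreover have "(W x - W 0) / 2 \<le> W x / 2" using W1[of 0] by simp
    ultimately show "(\<lambda>t. l t * W t) integrable_on {0..x}" "integral {0..x} (\<lambda>t. l t * W t) \<le> W x / 2"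
      by (auto intro: has_integral_integrable simp: integral_unique)
  qed
  have cz: "continuous_on UNIV (\<lambda>t. W t *\<^sub>R f t)" for f :: "real \<Rightarrow>\<^sub>C 'e"
    by (intro continuous_intros Wcont) simp
  define J where "J f x = integral {0..x} (\<lambda>t. M t (W t *\<^sub>R apply_bcontfun f t))" for f :: "real \<Rightarrow>\<^sub>C 'e" and x
  have J: "norm (J f x - J g x) \<le> dist f g * (W x / 2)" if x: "0 \<le> x" for f g x
  proof -
    have "J f x - J g x = integral {0..x} (\<lambda>t. M t (W t *\<^sub>R f t) - M t (W t *\<^sub>R g t))"
      unfolding J_def by (rule integral_diff[symmetric]) (intro Mi cz)+
    also have "norm \<dots> \<le> integral {0..x} (\<lambda>t. dist f g * (l t * W t))"
    proof (rule integral_norm_bound_integral)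
      show "(\<lambda>t. M t (W t *\<^sub>R f t) - M t (W t *\<^sub>R g t)) integrable_on {0..x}" by (intro integrable_diff Mi cz)
      show "(\<lambda>t. dist f g * (l t * W t)) integrable_on {0..x}" by (intro integrable_on_mult_right lW(1) x)
      fix t assume t: "t \<in> {0..x}"
      have "norm (M t (W t *\<^sub>R f t) - M t (W t *\<^sub>R g t)) \<le> l t * norm (W t *\<^sub>R f t - W t *\<^sub>R g t)"
        using t by (intro lip) auto
      also have "norm (W t *\<^sub>R f t - W t *\<^sub>R g t) = W t * dist (f t) (g t)"
        using W1[of t] by (simp add: dist_norm scaleR_diff_right[symmetric])
      also have "l t * \<dots> \<le> l t * (W t * dist f g)"
        using l(2) W1[of t] by (intro mult_left_mono dist_bounded) auto
      finally show "norm (M t (W t *\<^sub>R f t) - M t (W t *\<^sub>R g t)) \<le> dist f g * (l t * W t)" by (simp add: mult_ac)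
    qed
    also have "\<dots> = dist f g * integral {0..x} (\<lambda>t. l t * W t)" by simp
    also have "\<dots> \<le> dist f g * (W x / 2)" using lW(2)[OF x] by (intro mult_left_mono) auto
    finally show ?thesis .
  qed
  \<comment> \<open>The integral equation rewritten for the bounded unknown f = z / W. Boundedness
    of T f uses the estimate of J and the uniform bound B on the primitives of h.\<close>
  define T where "T f x = (1 / W x) *\<^sub>R (z0 + J f (max 0 x) + integral {0..max 0 x} h)" for f :: "real \<Rightarrow>\<^sub>C 'e" and x
  have Wmax: "W (max 0 x) = W x" for x unfolding W_def L_def by simp
  have Jn: "norm (J f (max 0 x)) \<le> dist f 0 * (W x / 2)" for f x
  proof -
    have "J 0 (max 0 x) = 0" unfolding J_def by (simp add: M0)
    then show ?thesis using J[of "max 0 x" f 0] Wmax[of x] by simp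
  qed
  have Tb: "T f \<in> bcontfun" for f
  proof (rule bcontfun_normI)
    show "continuous_on UNIV (T f)"
      unfolding T_def J_def using W1
      by (intro continuous_intros Wcont continuous_on_indefinite_integral_max Mi cz hi) (smt (verit))
    fix x
    have "norm (T f x) = (1 / W x) * norm (z0 + J f (max 0 x) + integral {0..max 0 x} h)"
      unfolding T_def using W1[of x] by simp
    also have "\<dots> \<le> (1 / W x) * (norm z0 + dist f 0 * (W x / 2) + B)"
      using W1[of x] Jn[of f x] hB[of "max 0 x"]
      by (intro mult_left_mono order_trans[OF norm_triangle_ineq] add_mono) auto
    also have "\<dots> = (1 / W x) * (norm z0 + B) + dist f 0 / 2" using W1[of x] by (simp add: field_simps)
    also have "\<dots> \<le> 1 * (norm z0 + B) + dist f 0 / 2"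
    proof -
      have "0 \<le> B" using hB[of 0] norm_ge_zero order_trans by blast
      then show ?thesis using W1[of x] by (intro add_mono mult_right_mono) auto
    qed
    finally show "norm (T f x) \<le> 1 * (norm z0 + B) + dist f 0 / 2" .
  qed
  define TT where "TT f = Bcontfun (T f)" for f
  have TT: "apply_bcontfun (TT f) = T f" for f unfolding TT_def using Tb by (simp add: Bcontfun_inverse)
  have "\<exists>!f. TT f = f"
  proof (rule banach_fix_type[of "1/2"])
    show "\<forall>f g. dist (TT f) (TT g) \<le> 1/2 * dist f g"
    proof (intro allI dist_bound)
      fix f g x
      have "T f x - T g x = (1 / W x) *\<^sub>R (J f (max 0 x) - J g (max 0 x))"
        unfolding T_def by (simp add: scaleR_diff_right[symmetric])
      then have "dist (TT f x) (TT g x) = (1 / W x) * norm (J f (max 0 x) - J g (max 0 x))"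
        unfolding TT dist_norm using W1[of x] by simp
      also have "\<dots> \<le> (1 / W x) * (dist f g * (W x / 2))"
        using J[of "max 0 x" f g] W1[of x] Wmax[of x] by (intro mult_left_mono) auto
      also have "\<dots> = 1/2 * dist f g" using W1[of x] by simp
      finally show "dist (TT f x) (TT g x) \<le> 1/2 * dist f g" .
    qed
  qed auto
  then obtain f where f: "TT f = f" by blast
  define z where "z t = W t *\<^sub>R f t" for t
  show thesis
  proof
    show zc: "continuous_on UNIV z" unfolding z_def by (rule cz)
    fix x :: real assume x: "0 \<le> x"
    have "f x = T f x" using TT[of f] f by simp
    then have "z x = W x *\<^sub>R T f x" unfolding z_def by simp
    also have "\<dots> = z0 + J f x + integral {0..x} h" unfolding T_def using x W1[of x] by (simp add: max_def)
    also have "J f x = integral {0..x} (\<lambda>t. M t (z t))" unfolding J_def z_def ..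
    finally show "z x = z0 + integral {0..x} (\<lambda>t. M t (z t) + h t)"
      using integral_add[OF Mi[OF zc] hi, of x] by (simp add: add.assoc)
  qed
qed

section \<open>Positive semidefinite matrices\<close>

lemma cdot_simps:
  fixes u v w :: "complex^'n"
  shows cdot_add_right: "cdot u (v + w) = cdot u v + cdot u w"
    and cdot_add_left: "cdot (u + v) w = cdot u w + cdot v w"
    and cdot_diff_right: "cdot u (v - w) = cdot u v - cdot u w"
    and cdot_diff_left: "cdot (u - v) w = cdot u w - cdot v w"
    and cdot_scale_right: "cdot u (c *s w) = c * cdot u w"
    and cdot_scale_left: "cdot (c *s u) w = cnj c * cdot u w"
    and cdot_scaleR_right: "cdot u (r *\<^sub>R w) = of_real r * cdot u w"
    and cdot_scaleR_left: "cdot (r *\<^sub>R u) w = of_real r * cdot u w"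
    and cdot_zero_right: "cdot u 0 = 0"
    and cdot_zero_left: "cdot 0 u = 0"
    and cdot_minus_right: "cdot u (- w) = - cdot u w"
    and cdot_minus_left: "cdot (- u) w = - cdot u w"
  unfolding cdot_def
  by (simp_all add: sum.distrib sum_subtractf sum_distrib_left algebra_simps sum_negf
      scaleR_conv_of_real[where 'a=complex])

lemma matrix_vector_mult_scaleR_complex: "(M::complex^'n^'m) *v (t *\<^sub>R w) = t *\<^sub>R (M *v w)"
  unfolding matrix_vector_mult_def
  by (simp add: vec_eq_iff sum_distrib_left scaleR_conv_of_real[where 'a=complex] mult_ac)

lemma cdot_cnj: "cnj (cdot v w) = cdot w v"
  unfolding cdot_def by (simp add: mult.commute)

lemma Re_cdot: "Re (cdot v w) = v \<bullet> w"
  unfolding cdot_def by (simp add: inner_vec_def inner_complex_def)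

lemma cdot_self: "cdot v v = of_real ((norm v)\<^sup>2)"
proof -
  have "Im (cdot v v) = 0" using arg_cong[OF cdot_cnj[of v v], of Im] by simp
  moreover have "Re (cdot v v) = (norm v)\<^sup>2" by (simp add: Re_cdot power2_norm_eq_inner)
  ultimately show ?thesis by (simp add: complex_eq_iff)
qed

text \<open>A phase factor c makes \<open>cdot v (c *s w)\<close> real and nonnegative. The real
  part of \<open>cdot\<close> is the real inner product, so the real Cauchy-Schwarz inequality
  applies.\<close>

lemma norm_cdot_le: "norm (cdot v w) \<le> norm v * norm w"
proof (cases "cdot v w = 0")
  case False
  define c where "c = cnj (cdot v w) / of_real (norm (cdot v w))"
  have c: "norm c = 1" "c * cdot v w = of_real (norm (cdot v w))"
    using False unfolding c_def
    by (simp_all add: norm_divide mult.commute complex_norm_square[symmetric] power2_eq_square field_simps)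
  have nc: "norm (c *s w) = norm w"
  proof -
    have "of_real ((norm (c *s w))\<^sup>2) = (of_real ((norm w)\<^sup>2) :: complex)"
    proof -
      have "cnj c * c = 1" "c * cnj c = 1" using c(1) complex_norm_square[of c] by (simp_all add: mult.commute)
      then show ?thesis unfolding cdot_self[symmetric] by (simp add: cdot_simps mult.assoc[symmetric])
    qed
    then have "(norm (c *s w))\<^sup>2 = (norm w)\<^sup>2" using of_real_eq_iff by blast
    then show ?thesis by simp
  qed
  have "norm (cdot v w) = Re (cdot v (c *s w))" by (simp add: cdot_simps c(2))
  also have "\<dots> \<le> norm v * norm (c *s w)" unfolding Re_cdot by (rule norm_cauchy_schwarz)
  finally show ?thesis unfolding nc .
qed simp

lemma bounded_bilinear_cdot: "bounded_bilinear cdot"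
  by (rule bounded_bilinear.intro)
     (auto simp: cdot_simps scaleR_conv_of_real[where 'a=complex] intro!: exI[of _ 1] order_trans[OF norm_cdot_le])

lemma cdot_mult: "cdot v (M *v w) = cdot (ctranspose M *v v) w"
proof -
  have "cdot v (M *v w) = (\<Sum>i\<in>UNIV. \<Sum>j\<in>UNIV. cnj (v $ i) * (M $ i $ j * w $ j))"
    unfolding cdot_def matrix_vector_mult_def by (simp add: sum_distrib_left)
  also have "\<dots> = (\<Sum>j\<in>UNIV. \<Sum>i\<in>UNIV. cnj (v $ i) * (M $ i $ j * w $ j))" by (rule sum.swap)
  also have "\<dots> = cdot (ctranspose M *v v) w"
    unfolding cdot_def matrix_vector_mult_def ctranspose_def by (simp add: sum_distrib_left sum_distrib_right mult_ac)
  finally show ?thesis .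
qed

lemma ctranspose_ctranspose: "ctranspose (ctranspose M) = M"
  unfolding ctranspose_def by (simp add: vec_eq_iff)

lemma cdot_mult_left: "cdot (M *v v) w = cdot v (ctranspose M *v w)"
  using cdot_mult[of v "ctranspose M" w] by (simp add: ctranspose_ctranspose)

lemma hermitian_cdot: "hermitian M \<Longrightarrow> cdot v (M *v w) = cdot (M *v v) w"
  using cdot_mult[of v M w] by (simp add: hermitian_def)

lemma hermitian_cdot_real: "hermitian M \<Longrightarrow> cdot v (M *v v) = of_real (Re (cdot v (M *v v)))"
  using hermitian_cdot[of M v v] cdot_cnj[of v "M *v v"] by (simp add: complex_eq_iff)

text \<open>First-order condition at the minimum t = 0. It is used twice: to find the kernel of a
  semidefinite form, and to see that a maximiser of the Rayleigh quotient is an eigenvector.\<close>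

lemma linear_nonneg_imp_zero:
  fixes b c :: real
  assumes "\<And>t. 0 \<le> 2 * t * b + t\<^sup>2 * c"
  shows "b = 0"
proof (rule ccontr)
  assume b: "b \<noteq> 0"
  define t where "t = - b / (\<bar>c\<bar> + 1)"
  have "2 * t * b + t\<^sup>2 * c \<le> 2 * t * b + t\<^sup>2 * (\<bar>c\<bar> + 1)" by (intro add_left_mono mult_left_mono) auto
  also have "\<dots> = 2 * t * b + t * (t * (\<bar>c\<bar> + 1))" by (simp add: power2_eq_square)
  also have "t * (\<bar>c\<bar> + 1) = - b" unfolding t_def by (simp add: add_nonneg_eq_0_iff)
  also have "2 * t * b + t * - b = - (b\<^sup>2 / (\<bar>c\<bar> + 1))" unfolding t_def by (simp add: power2_eq_square)
  also have "\<dots> < 0" using b by (simp add: add_nonneg_pos)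
  finally show False using assms[of t] by linarith
qed

lemma quadratic_form_add:
  assumes "hermitian M"
  shows "Re (cdot (v + t *\<^sub>R w) (M *v (v + t *\<^sub>R w)))
       = Re (cdot v (M *v v)) + 2 * t * Re (cdot w (M *v v)) + t\<^sup>2 * Re (cdot w (M *v w))"
proof -
  have "Re (cdot v (M *v w)) = Re (cdot w (M *v v))"
    using hermitian_cdot[OF assms, of v w] cdot_cnj[of "M *v v" w] by (metis cnj.simps(1))
  then show ?thesis
    by (simp add: matrix_vector_right_distrib matrix_vector_mult_scaleR_complex cdot_simps power2_eq_square algebra_simps)
qed

text \<open>The form is minimal at v, so its first variation in the direction M v, which is |M v|^2,
  vanishes.\<close>

lemma pos_semidef_null:
  assumes "pos_semidef M" "Re (cdot v (M *v v)) = 0"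
  shows "M *v v = 0"
proof -
  have h: "hermitian M" using assms unfolding pos_semidef_def by blast
  have "Re (cdot (M *v v) (M *v v)) = 0"
  proof (rule linear_nonneg_imp_zero)
    fix t
    have "0 \<le> Re (cdot (v + t *\<^sub>R (M *v v)) (M *v (v + t *\<^sub>R (M *v v))))"
      using assms unfolding pos_semidef_def by blast
    then show "0 \<le> 2 * t * Re (cdot (M *v v) (M *v v)) + t\<^sup>2 * Re (cdot (M *v v) (M *v (M *v v)))"
      unfolding quadratic_form_add[OF h] assms(2) by simp
  qed
  then show ?thesis by (simp add: cdot_self)
qed

lemma pos_def_imp_pos_semidef: "pos_def M \<Longrightarrow> pos_semidef M"
  unfolding pos_def_def pos_semidef_def by (metis cdot_zero_left complex.sel(1) less_eq_real_def zero_complex.sel(1))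

text \<open>On the orthogonal complement of a maximal orthonormal system of eigenvectors, a maximiser of the
  Rayleigh quotient would be a further eigenvector.\<close>

lemma orthonormal_eigenbasis:
  fixes M :: "complex^'n^'n"
  assumes M: "hermitian M"
  obtains B :: "(complex^'n) set" and \<mu> where "finite B" "\<And>b. b \<in> B \<Longrightarrow> cdot b b = 1"
    "\<And>b c. b \<in> B \<Longrightarrow> c \<in> B \<Longrightarrow> b \<noteq> c \<Longrightarrow> cdot b c = 0"
    "\<And>b. b \<in> B \<Longrightarrow> M *v b = of_real (\<mu> b) *s b"
    "\<And>v. v = (\<Sum>b\<in>B. cdot b v *s b)"
proof -
  define good where "good B \<longleftrightarrow> (\<forall>b\<in>B. cdot b b = 1) \<and> (\<forall>b\<in>B. \<forall>c\<in>B. b \<noteq> c \<longrightarrow> cdot b c = 0) \<and>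
     (\<forall>b\<in>B. \<exists>r::real. M *v b = of_real r *s b)" for B :: "(complex^'n) set"
  \<comment> \<open>An orthonormal system is also orthogonal for the real inner product, hence
    independent over the reals. This bounds its cardinality, so a system of maximal cardinality
    exists.\<close>
  have bd: "finite B \<and> card B \<le> DIM(complex^'n)" if "good B" for B
  proof -
    have "independent B"
    proof (rule pairwise_orthogonal_independent)
      show "pairwise orthogonal B"
        using that unfolding pairwise_def orthogonal_def good_def Re_cdot[symmetric] by simp
      show "0 \<notin> B" using that unfolding good_def by (auto simp: cdot_simps)
    qed
    then show ?thesis by (rule independent_bound)
  qed
  have "good {}" unfolding good_def by simp
  then have "\<exists>B. good B \<and> (\<forall>C. good C \<longrightarrow> card C \<le> card B)"
    using bd by (intro ex_has_greatest_nat[of good "{}" card "Suc (DIM(complex^'n))"]) (simp_all add: less_Suc_eq_le)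
  then obtain B where B: "good B" and max: "\<And>C. good C \<Longrightarrow> card C \<le> card B" by blast
  have fB: "finite B" using bd[OF B] by simp
  define U where "U = {v. \<forall>b\<in>B. cdot b v = 0}"
  have U0: "v = 0" if v: "v \<in> U" for v
  proof (rule ccontr)
    assume v0: "v \<noteq> 0"
    define f where "f v = Re (cdot v (M *v v))" for v
    have sc: "v \<in> U \<Longrightarrow> r *\<^sub>R v \<in> U" for v r unfolding U_def by (simp add: cdot_simps)
    have ad: "v \<in> U \<Longrightarrow> w \<in> U \<Longrightarrow> v - w \<in> U" for v w unfolding U_def by (simp add: cdot_simps)
    have MU: "M *v v \<in> U" if "v \<in> U" for v
      unfolding U_def
    proof (intro CollectI ballI)
      fix b assume b: "b \<in> B"
      then obtain r :: real where "M *v b = of_real r *s b" using B unfolding good_def by blast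
      then show "cdot b (M *v v) = 0"
        using that b unfolding hermitian_cdot[OF M] U_def by (simp add: cdot_simps)
    qed
    have ccd: "continuous_on S (\<lambda>v. cdot b v)" for S b
      using bounded_bilinear.bounded_linear_right[OF bounded_bilinear_cdot] by (rule linear_continuous_on)
    have cM: "continuous_on S (\<lambda>v. M *v v)" for S
      by (rule linear_continuous_on) (simp add: linear_linear linearI matrix_vector_right_distrib matrix_vector_mult_scaleR_complex)
    have "closed U"
    proof -
      have "U = (\<Inter>b\<in>B. {v. cdot b v = 0})" unfolding U_def by auto
      moreover have "closed {v. cdot b v = 0}" for b
        using continuous_closed_preimage[OF ccd[of UNIV b] closed_UNIV closed_singleton[of 0]] by (simp add: vimage_def)
      ultimately show ?thesis by auto
    qed
    then have K: "compact (U \<inter> sphere 0 1)" by (metis closed_Int_compact compact_sphere)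
    have "(1 / norm v) *\<^sub>R v \<in> U \<inter> sphere 0 1" using v v0 sc by simp
    then have ne: "U \<inter> sphere 0 1 \<noteq> {}" by blast
    have "continuous_on (U \<inter> sphere 0 1) f"
      unfolding f_def Re_cdot by (intro continuous_on_inner continuous_on_id cM)
    then obtain e where e: "e \<in> U \<inter> sphere 0 1" and emax: "\<And>w. w \<in> U \<inter> sphere 0 1 \<Longrightarrow> f w \<le> f e"
      using continuous_attains_sup[OF K ne] by blast
    have ne1: "norm e = 1" "e \<in> U" using e by auto
    have fle: "f w \<le> f e * (norm w)\<^sup>2" if "w \<in> U" for w
    proof (cases "w = 0")
      case True then show ?thesis by (simp add: f_def cdot_simps)
    next
      case False
      have "f ((1 / norm w) *\<^sub>R w) \<le> f e" using False sc[OF that] by (intro emax) simp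
      moreover have "f ((1 / norm w) *\<^sub>R w) = f w / (norm w)\<^sup>2"
        unfolding f_def by (simp add: matrix_vector_mult_scaleR_complex cdot_simps power2_eq_square)
      ultimately show ?thesis using False by (simp add: divide_le_eq)
    qed
    \<comment> \<open>The residual of the eigenvalue equation at the maximiser e. It lies in U, so e
      may be moved along r, and the first-order condition gives |r|^2 = 0.\<close>
    define r where "r = f e *\<^sub>R e - M *v e"
    have rU: "r \<in> U" unfolding r_def using ne1 by (intro ad sc MU)
    have "Re (cdot r r) = 0"
    proof (rule linear_nonneg_imp_zero)
      fix t :: real
      have "e + t *\<^sub>R r = e - (- t) *\<^sub>R r" by simp
      then have "e + t *\<^sub>R r \<in> U" using ad[OF ne1(2) sc[OF rU, of "- t"]] by simp
      from fle[OF this] have "0 \<le> f e * (norm (e + t *\<^sub>R r))\<^sup>2 - f (e + t *\<^sub>R r)" by simp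
      also have "(norm (e + t *\<^sub>R r))\<^sup>2 = 1 + 2 * t * Re (cdot r e) + t\<^sup>2 * (norm r)\<^sup>2"
      proof -
        have "e \<bullet> e = 1" using ne1(1) power2_norm_eq_inner[of e] by simp
        then show ?thesis
          unfolding power2_norm_eq_inner Re_cdot
          by (simp add: inner_add_left inner_add_right power2_eq_square inner_commute algebra_simps)
      qed
      also have "f (e + t *\<^sub>R r) = f e + 2 * t * Re (cdot r (M *v e)) + t\<^sup>2 * Re (cdot r (M *v r))"
        unfolding f_def by (rule quadratic_form_add[OF M])
      finally have "0 \<le> 2 * t * (f e * Re (cdot r e) - Re (cdot r (M *v e))) + t\<^sup>2 * (f e * (norm r)\<^sup>2 - Re (cdot r (M *v r)))"
        by (simp add: algebra_simps)
      moreover have "f e * Re (cdot r e) - Re (cdot r (M *v e)) = Re (cdot r r)"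
        unfolding r_def by (simp add: cdot_simps)
      ultimately show "0 \<le> 2 * t * Re (cdot r r) + t\<^sup>2 * (f e * (norm r)\<^sup>2 - Re (cdot r (M *v r)))" by simp
    qed
    then have "r = 0" by (simp add: cdot_self)
    then have eig: "M *v e = of_real (f e) *s e" unfolding r_def
      by (simp add: vec_eq_iff scaleR_conv_of_real[where 'a=complex])
    have eB: "cdot b e = 0" "cdot e b = 0" if "b \<in> B" for b
    proof -
      show "cdot b e = 0" using ne1(2) that unfolding U_def by blast
      then show "cdot e b = 0" using cdot_cnj[of b e] by simp
    qed
    have ee: "cdot e e = 1" using ne1 by (simp add: cdot_self)
    have "good (insert e B)" using B eB ee eig unfolding good_def by auto
    moreover have "e \<notin> B" using eB[of e] ee by auto
    ultimately show False using max[of "insert e B"] fB by simp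
  qed
  obtain \<mu> where \<mu>: "\<And>b. b \<in> B \<Longrightarrow> M *v b = of_real (\<mu> b) *s b"
    using B unfolding good_def by metis
  have "v = (\<Sum>b\<in>B. cdot b v *s b)" for v
  proof -
    have cs: "cdot c (\<Sum>b\<in>B. cdot b v *s b) = (\<Sum>b\<in>B. cdot b v * cdot c b)" for c
      by (induct B rule: infinite_finite_induct) (simp_all add: cdot_simps)
    have "v - (\<Sum>b\<in>B. cdot b v *s b) \<in> U"
      unfolding U_def
    proof (intro CollectI ballI)
      fix c assume c: "c \<in> B"
      have "(\<Sum>b\<in>B. cdot b v * cdot c b) = (\<Sum>b\<in>B. if b = c then cdot c v else 0)"
        using B c unfolding good_def by (intro sum.cong) auto
      then show "cdot c (v - (\<Sum>b\<in>B. cdot b v *s b)) = 0"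
        using c fB unfolding cdot_diff_right cs by simp
    qed
    then show ?thesis using U0 by fastforce
  qed
  with fB B \<mu> show thesis unfolding good_def by (intro that[of B \<mu>]) auto
qed

lemma matrix_eqI: "(\<And>v. M *v v = N *v v) \<Longrightarrow> M = (N :: complex^'n^'m)"
  by (simp add: matrix_eq)

lemma matrix_vector_mult_sum: "(M::complex^'n^'m) *v (\<Sum>b\<in>B. c b *s f b) = (\<Sum>b\<in>B. c b *s (M *v f b))"
  by (induct B rule: infinite_finite_induct) (simp_all add: matrix_vector_right_distrib vector_scalar_commute)

text \<open>The root S multiplies each eigenvector b by sqrt(\<mu> b). Let T be another root. If
  \<mu> b = 0, then |T b|^2 = b^* M b = 0. Otherwise x = T b - m b with m = sqrt(\<mu> b) satisfies
  T x = - m x, and positivity of T forces x = 0. Uniqueness is what gives the definite description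
  \<open>matrix_sqrt\<close> its meaning.\<close>

lemma ex1_matrix_sqrt:
  fixes M :: "complex^'n^'n"
  assumes M: "pos_semidef M"
  shows "\<exists>!S. pos_semidef S \<and> S ** S = M"
proof -
  have h: "hermitian M" using M unfolding pos_semidef_def by blast
  obtain B and \<mu> where fB: "finite B" and B1: "\<And>b. b \<in> B \<Longrightarrow> cdot b b = 1"
    and B0: "\<And>b c. b \<in> B \<Longrightarrow> c \<in> B \<Longrightarrow> b \<noteq> c \<Longrightarrow> cdot b c = 0"
    and eig: "\<And>b. b \<in> B \<Longrightarrow> M *v b = of_real (\<mu> b) *s b"
    and exp: "\<And>v. v = (\<Sum>b\<in>B. cdot b v *s b)"
    by (rule orthonormal_eigenbasis[OF h]) blast
  have \<mu>0: "0 \<le> \<mu> b" if "b \<in> B" for b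
  proof -
    have "0 \<le> Re (cdot b (M *v b))" using M unfolding pos_semidef_def by blast
    then show ?thesis using eig[OF that] B1[OF that] by (simp add: cdot_simps)
  qed
  define S where "S = (\<chi> i j. \<Sum>b\<in>B. of_real (sqrt (\<mu> b)) * b $ i * cnj (b $ j))"
  have Sv: "S *v v = (\<Sum>b\<in>B. (of_real (sqrt (\<mu> b)) * cdot b v) *s b)" for v
  proof (rule vec_eq_iff[THEN iffD2], rule allI)
    fix i
    have "(S *v v) $ i = (\<Sum>j\<in>UNIV. \<Sum>b\<in>B. of_real (sqrt (\<mu> b)) * b $ i * cnj (b $ j) * v $ j)"
      unfolding S_def matrix_vector_mult_def by (simp add: sum_distrib_right)
    also have "\<dots> = (\<Sum>b\<in>B. \<Sum>j\<in>UNIV. of_real (sqrt (\<mu> b)) * b $ i * cnj (b $ j) * v $ j)" by (rule sum.swap)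
    also have "\<dots> = (\<Sum>b\<in>B. (of_real (sqrt (\<mu> b)) * cdot b v) *s b) $ i"
      unfolding cdot_def by (simp add: sum_distrib_left mult_ac)
    finally show "(S *v v) $ i = (\<Sum>b\<in>B. (of_real (sqrt (\<mu> b)) * cdot b v) *s b) $ i" .
  qed
  have Sb: "S *v c = of_real (sqrt (\<mu> c)) *s c" if "c \<in> B" for c
  proof -
    have "(\<Sum>b\<in>B. (of_real (sqrt (\<mu> b)) * cdot b c) *s b) = (\<Sum>b\<in>B. if b = c then of_real (sqrt (\<mu> c)) *s c else 0)"
      using B0 B1 that by (intro sum.cong) auto
    then show ?thesis using fB that unfolding Sv by simp
  qed
  have eqB: "P = N" if "\<And>b. b \<in> B \<Longrightarrow> P *v b = N *v b" for P N :: "complex^'n^'n"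
  proof (rule matrix_eqI)
    fix v
    show "P *v v = N *v v"
      by (subst (1 2) exp) (simp add: matrix_vector_mult_sum that)
  qed
  have SS: "S ** S = M"
  proof (rule eqB)
    fix b assume b: "b \<in> B"
    have "(S ** S) *v b = S *v (S *v b)" by (simp add: matrix_vector_mul_assoc)
    also have "\<dots> = of_real (sqrt (\<mu> b) * sqrt (\<mu> b)) *s b"
      by (simp only: Sb[OF b] vector_scalar_commute vector_smult_assoc of_real_mult)
    also have "\<dots> = M *v b" using \<mu>0[OF b] eig[OF b] by simp
    finally show "(S ** S) *v b = M *v b" .
  qed
  have Sp: "pos_semidef S"
    unfolding pos_semidef_def
  proof
    show "hermitian S" unfolding hermitian_def ctranspose_def S_def by (simp add: vec_eq_iff mult_ac)
    show "\<forall>v. 0 \<le> Re (cdot v (S *v v))"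
    proof
      fix v
      have "cdot v (S *v v) = (\<Sum>b\<in>B. of_real (sqrt (\<mu> b)) * cdot b v * cdot v b)"
        unfolding Sv by (induct B rule: infinite_finite_induct) (simp_all add: cdot_simps)
      also have "\<dots> = (\<Sum>b\<in>B. of_real (sqrt (\<mu> b) * (norm (cdot b v))\<^sup>2))"
        by (intro sum.cong refl) (simp add: cdot_cnj[of _ v, symmetric] mult.assoc complex_norm_square[symmetric] flip: of_real_mult of_real_power)
      finally have "Re (cdot v (S *v v)) = (\<Sum>b\<in>B. sqrt (\<mu> b) * (norm (cdot b v))\<^sup>2)" by (simp flip: of_real_sum)
      then show "0 \<le> Re (cdot v (S *v v))" using \<mu>0 by (simp add: sum_nonneg)
    qed
  qed
  show ?thesis
  proof (rule ex1I[of _ S])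
    show "pos_semidef S \<and> S ** S = M" using Sp SS by blast
    fix T assume T: "pos_semidef T \<and> T ** T = M"
    have hT: "hermitian T" using T unfolding pos_semidef_def by blast
    have TT: "T *v (T *v v) = M *v v" for v using T by (metis matrix_vector_mul_assoc)
    show "T = S"
    proof (rule eqB)
      fix b assume b: "b \<in> B"
      have "T *v b = of_real (sqrt (\<mu> b)) *s b"
      proof (cases "\<mu> b = 0")
        case True
        have "cdot (T *v b) (T *v b) = 0"
          using hermitian_cdot[OF hT, of b "T *v b"] eig[OF b] True by (simp add: TT cdot_simps)
        then show ?thesis using True by (simp add: cdot_self)
      next
        case False
        define m where "m = sqrt (\<mu> b)"
        have m: "m > 0" "m * m = \<mu> b" unfolding m_def using False \<mu>0[OF b] by auto
        define x where "x = T *v b - of_real m *s b"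
        have "T *v x = - (of_real m *s x)"
          unfolding x_def using eig[OF b] m(2)
          by (simp add: matrix_vector_mult_diff_distrib vector_scalar_commute TT vec_eq_iff algebra_simps flip: of_real_mult)
        then have "Re (cdot x (T *v x)) = - (m * (norm x)\<^sup>2)" by (simp add: cdot_simps cdot_self)
        moreover have "0 \<le> Re (cdot x (T *v x))" using T unfolding pos_semidef_def by blast
        ultimately have "x = 0" using m(1) by (simp add: mult_le_0_iff)
        then show ?thesis unfolding x_def m_def by simp
      qed
      then show "T *v b = S *v b" using Sb[OF b] by simp
    qed
  qed
qed

lemma matrix_sqrt_props:
  assumes "pos_semidef M"
  shows "pos_semidef (matrix_sqrt M)" "matrix_sqrt M ** matrix_sqrt M = M"
  using theI'[OF ex1_matrix_sqrt[OF assms]] unfolding matrix_sqrt_def by auto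

lemma invertible_matrix_inv_mult:
  fixes M :: "complex^'n^'n"
  assumes "invertible M"
  shows "M *v (matrix_inv M *v v) = v" "matrix_inv M *v (M *v v) = v"
proof -
  have "M ** matrix_inv M = mat 1 \<and> matrix_inv M ** M = mat 1"
    using assms unfolding invertible_def matrix_inv_def by (rule someI_ex)
  then show "M *v (matrix_inv M *v v) = v" "matrix_inv M *v (M *v v) = v"
    by (simp_all add: matrix_vector_mul_assoc)
qed

lemma pos_def_invertible: "pos_def M \<Longrightarrow> invertible M"
  unfolding pos_def_def matrix_left_invertible_ker invertible_left_inverse by (metis cdot_zero_right less_irrefl zero_complex.sel(1))

text \<open>With S = A^(1/2), T = H^(1/2) and N the product of their inverses, y^* w is the product
  of S^(-1) y = N T y with S w. The norms of T y and S w are the square roots of the two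
  forms.\<close>

lemma onorm_comparison:
  fixes A H :: "complex^'n^'n"
  assumes A: "pos_semidef A" and H: "pos_semidef H" and det: "det (A ** H) \<noteq> 0"
  shows "norm (cdot y w) \<le> onorm (\<lambda>v. (matrix_inv_sqrt A ** matrix_inv_sqrt H) *v v)
      * sqrt (Re (cdot y (H *v y))) * sqrt (Re (cdot w (A *v w)))"
proof -
  define S where "S = matrix_sqrt A"
  define T where "T = matrix_sqrt H"
  have S: "pos_semidef S" "S ** S = A" and T: "pos_semidef T" "T ** T = H"
    unfolding S_def T_def using matrix_sqrt_props[OF A] matrix_sqrt_props[OF H] by auto
  have hS: "hermitian S" and hT: "hermitian T" using S T unfolding pos_semidef_def by auto
  have "det S \<noteq> 0" "det T \<noteq> 0" using det S(2) T(2) by (auto simp: det_mul)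
  then have iS: "invertible S" and iT: "invertible T" by (simp_all add: invertible_det_nz)
  define N where "N = matrix_inv S ** matrix_inv T"
  have nsq: "norm (T *v y) = sqrt (Re (cdot y (H *v y)))" if "hermitian T" "T ** T = H" for T H :: "complex^'n^'n" and y
  proof -
    have "cdot y (H *v y) = cdot (T *v y) (T *v y)"
      unfolding that(2)[symmetric] using hermitian_cdot[OF that(1), of y "T *v y"] by (simp add: matrix_vector_mul_assoc)
    then show ?thesis by (simp add: cdot_self)
  qed
  have "cdot (matrix_inv S *v y) (S *v w) = cdot (S *v (matrix_inv S *v y)) w"
    by (rule hermitian_cdot[OF hS])
  then have "cdot y w = cdot (matrix_inv S *v y) (S *v w)" using invertible_matrix_inv_mult[OF iS] by simp
  also have "matrix_inv S *v y = N *v (T *v y)"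
    unfolding N_def using invertible_matrix_inv_mult[OF iT] by (simp flip: matrix_vector_mul_assoc)
  also have "norm (cdot (N *v (T *v y)) (S *v w)) \<le> norm (N *v (T *v y)) * norm (S *v w)" by (rule norm_cdot_le)
  also have "\<dots> \<le> onorm (\<lambda>v. N *v v) * norm (T *v y) * norm (S *v w)"
    by (intro mult_right_mono onorm)
       (simp_all add: linear_linear linearI matrix_vector_right_distrib matrix_vector_mult_scaleR_complex)
  finally have "norm (cdot y w) \<le> onorm (\<lambda>v. N *v v) * norm (T *v y) * norm (S *v w)" .
  then show ?thesis
    unfolding nsq[OF hS S(2)] nsq[OF hT T(2)] unfolding N_def S_def T_def matrix_inv_sqrt_def .
qed

section \<open>Initial value problems on either half line\<close>

lemma ac_deriv_bounded_linear:
  fixes T :: "'a::euclidean_space \<Rightarrow> 'b::euclidean_space"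
  assumes T: "bounded_linear T" and f: "ac_deriv I f g"
  shows "ac_deriv I (\<lambda>x. T (f x)) (\<lambda>x. T (g x))"
proof (rule ac_derivI)
  interpret bounded_linear T by fact
  fix a b assume ab: "a \<le> b" "{a..b} \<subseteq> I"
  show "(\<lambda>x. T (g x)) absolutely_integrable_on {a..b}"
    using absolutely_integrable_linear[OF ac_derivD(1)[OF f ab(2)] T] by (simp add: o_def)
  show "((\<lambda>x. T (g x)) has_integral T (f b) - T (f a)) {a..b}"
    using has_integral_linear[OF ac_derivD(2)[OF f ab(2,1)] T] by (simp add: o_def diff)
qed

lemma ac_deriv_reflect:
  fixes f g :: "real \<Rightarrow> 'a::euclidean_space"
  assumes f: "ac_deriv I f g" and J: "\<And>x. x \<in> J \<Longrightarrow> - x \<in> I"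
  shows "ac_deriv J (\<lambda>x. f (- x)) (\<lambda>x. - g (- x))"
proof (rule ac_derivI)
  fix a b assume ab: "a \<le> b" "{a..b} \<subseteq> J"
  have sub: "{-b..-a} \<subseteq> I"
  proof
    fix x assume "x \<in> {-b..-a}"
    then have "- x \<in> J" using ab by auto
    then show "x \<in> I" using J[of "- x"] by simp
  qed
  have "(\<lambda>x. g (- x)) absolutely_integrable_on {- (-a)..- (-b)}"
    using ac_derivD(1)[OF f sub] absolutely_integrable_reflect_real[where f=g and a="-b" and b="-a"] by (simp del: absolutely_integrable_reflect_real)
  then show "(\<lambda>x. - g (- x)) absolutely_integrable_on {a..b}"
    using absolutely_integrable_linear[OF _ bounded_linear_minus[OF bounded_linear_ident]] by (simp add: o_def)
  have "(g has_integral (f (-a) - f (-b))) {-b..-a}" using ac_derivD(2)[OF f sub] ab by simp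
  then have "((\<lambda>x. g (- x)) has_integral (f (-a) - f (-b))) {a..b}"
    using has_integral_reflect_real[where f=g and a="-b" and b="-a"] by simp
  from has_integral_neg[OF this] show "((\<lambda>x. - g (- x)) has_integral f (- b) - f (- a)) {a..b}" by simp
qed

lemma caratheodory_ode_exists_pos:
  fixes M :: "real \<Rightarrow> 'e::euclidean_space \<Rightarrow> 'e"
  assumes l: "\<And>a b. {a..b} \<subseteq> {0..} \<Longrightarrow> l absolutely_integrable_on {a..b}" "\<And>t. 0 \<le> l t"
    and lip: "\<And>t u v. t \<in> {0..} \<Longrightarrow> norm (M t u - M t v) \<le> l t * norm (u - v)"
    and M0: "\<And>t. M t 0 = 0"
    and Mint: "\<And>z a b. continuous_on UNIV z \<Longrightarrow> {a..b} \<subseteq> {0..} \<Longrightarrow> (\<lambda>t. M t (z t)) absolutely_integrable_on {a..b}"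
    and h: "h absolutely_integrable_on {0..}"
  obtains z where "z 0 = z0" "ac_deriv {0..} z (\<lambda>t. M t (z t) + h t)"
proof -
  have emp: "f absolutely_integrable_on {0..b}" if "0 \<le> b \<Longrightarrow> f absolutely_integrable_on {0..b}" for f :: "real \<Rightarrow> 'b::euclidean_space" and b :: real
    using that by (cases "0 \<le> b") auto
  have l': "l absolutely_integrable_on {0..b}" for b by (rule emp, rule l(1)) auto
  have Mint': "(\<lambda>t. M t (z t)) absolutely_integrable_on {0..b}" if "continuous_on UNIV z" for z b
    by (rule emp, rule Mint[OF that]) auto
  have h': "h absolutely_integrable_on {a..b}" if "0 \<le> a" for a b
    by (rule set_integrable_subset[OF h]) (use that in auto)
  have hB: "norm (integral {0..b} h) \<le> integral {0..} (\<lambda>t. norm (h t))" for b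
  proof -
    have 1: "h integrable_on {0..b}" "(\<lambda>t. norm (h t)) integrable_on {0..b}"
      using h'[of 0 b] by (auto simp: absolutely_integrable_on_def)
    have 2: "(\<lambda>t. norm (h t)) integrable_on {0..}" using h by (auto simp: absolutely_integrable_on_def)
    have "norm (integral {0..b} h) \<le> integral {0..b} (\<lambda>t. norm (h t))"
      by (rule integral_norm_bound_integral[OF 1]) simp
    also have "\<dots> \<le> integral {0..} (\<lambda>t. norm (h t))"
      by (rule integral_subset_le[OF _ 1(2) 2]) auto
    finally show ?thesis .
  qed
  obtain z where z: "continuous_on UNIV z" "\<And>x. 0 \<le> x \<Longrightarrow> z x = z0 + integral {0..x} (\<lambda>t. M t (z t) + h t)"
    by (rule caratheodory_ode_exists[of l M h _ z0, OF l' l(2) lip M0 Mint' h'[OF order_refl] hB]) auto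
  show thesis
  proof
    show "z 0 = z0" using z(2)[of 0] by simp
    show "ac_deriv {0..} z (\<lambda>t. M t (z t) + h t)"
    proof (rule ac_derivI)
      fix a b :: real assume ab: "a \<le> b" "{a..b} \<subseteq> {0..}"
      then have a: "0 \<le> a" by auto
      show *: "(\<lambda>t. M t (z t) + h t) absolutely_integrable_on {a..b}"
        using Mint[OF z(1) ab(2)] h'[OF a] by (rule set_integral_add)
      have "(\<lambda>t. M t (z t) + h t) absolutely_integrable_on {0..b}"
        using Mint'[OF z(1)] h'[OF order_refl] by (rule set_integral_add)
      then have i: "(\<lambda>t. M t (z t) + h t) integrable_on {0..b}" by (simp add: absolutely_integrable_on_def)
      have "integral {a..b} (\<lambda>t. M t (z t) + h t) = z b - z a"
        using Henstock_Kurzweil_Integration.integral_combine[OF a ab(1) i] z(2)[of a] z(2)[of b] a ab(1)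
        by (simp add: algebra_simps)
      moreover have "(\<lambda>t. M t (z t) + h t) integrable_on {a..b}" using * by (simp add: absolutely_integrable_on_def)
      ultimately show "((\<lambda>t. M t (z t) + h t) has_integral z b - z a) {a..b}"
        by (simp add: has_integral_integrable_integral)
    qed
  qed
qed

text \<open>The left half line is reduced to the right one by t -> -t, which changes the sign of the
  vector field and of the inhomogeneity.\<close>

lemma caratheodory_ode_exists_halfline:
  fixes M :: "real \<Rightarrow> 'e::euclidean_space \<Rightarrow> 'e"
  assumes I: "I = {0..} \<or> I = {..0}"
    and l: "\<And>a b. {a..b} \<subseteq> I \<Longrightarrow> l absolutely_integrable_on {a..b}" "\<And>t. 0 \<le> l t"
    and lip: "\<And>t u v. t \<in> I \<Longrightarrow> norm (M t u - M t v) \<le> l t * norm (u - v)"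
    and M0: "\<And>t. M t 0 = 0"
    and Mint: "\<And>z a b. continuous_on UNIV z \<Longrightarrow> {a..b} \<subseteq> I \<Longrightarrow> (\<lambda>t. M t (z t)) absolutely_integrable_on {a..b}"
    and h: "h absolutely_integrable_on I"
  obtains z where "z 0 = z0" "ac_deriv I z (\<lambda>t. M t (z t) + h t)"
proof (cases "I = {0..}")
  case True
  show thesis
    by (rule caratheodory_ode_exists_pos[of l M h z0]) (use assms that in \<open>simp_all add: True\<close>)
next
  case False
  then have In: "I = {..0}" using I by simp
  have refl: "(\<lambda>t. f (- t)) absolutely_integrable_on {a..b}"
    if "f absolutely_integrable_on {-b..-a}" for f :: "real \<Rightarrow> 'b::euclidean_space" and a b
    using that absolutely_integrable_reflect_real[where f=f and a="-b" and b="-a"] by (simp del: absolutely_integrable_reflect_real)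
  have sub: "{-b..-a} \<subseteq> I" if "{a..b} \<subseteq> {0..}" for a b :: real
    using that unfolding In by (auto simp: subset_iff)
  obtain z where z: "z 0 = z0" "ac_deriv {0..} z (\<lambda>t. - M (- t) (z t) + - h (- t))"
  proof (rule caratheodory_ode_exists_pos[of "\<lambda>t. l (- t)" "\<lambda>t u. - M (- t) u" "\<lambda>t. - h (- t)" z0])
    show "(\<lambda>t. l (- t)) absolutely_integrable_on {a..b}" if "{a..b} \<subseteq> {0..}" for a b
      using l(1)[OF sub[OF that]] by (rule refl)
    show "0 \<le> l (- t)" for t by (rule l(2))
    show "norm (- M (- t) u - - M (- t) v) \<le> l (- t) * norm (u - v)" if "t \<in> {0..}" for t u v
      using lip[of "-t" u v] that unfolding In by (simp add: norm_minus_commute)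
    show "- M (- t) 0 = 0" for t by (simp add: M0)
    show "(\<lambda>t. - M (- t) (z t)) absolutely_integrable_on {a..b}"
      if z: "continuous_on UNIV z" and "{a..b} \<subseteq> {0..}" for z a b
    proof -
      have "continuous_on UNIV (\<lambda>t. z (- t))" by (rule continuous_on_compose2[OF z]) (auto intro: continuous_intros)
      from refl[OF Mint[OF this sub[OF that(2)]]]
      have "(\<lambda>t. M (- t) (z t)) absolutely_integrable_on {a..b}" by simp
      then show ?thesis
        using absolutely_integrable_linear[OF _ bounded_linear_minus[OF bounded_linear_ident]] by (simp add: o_def)
    qed
    show "(\<lambda>t. - h (- t)) absolutely_integrable_on {0..}"
    proof -
      have "set_integrable lebesgue {..0} h" using h In by simp
      then have "(\<lambda>t. h (- t)) absolutely_integrable_on {0..}"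
        using lebesgue_integrable_real_affine[of "\<lambda>x. indicator {..0} x *\<^sub>R h x" "-1" 0]
        unfolding set_integrable_def by (simp add: indicator_def)
      then show ?thesis
        using absolutely_integrable_linear[OF _ bounded_linear_minus[OF bounded_linear_ident]] by (simp add: o_def)
    qed
  qed blast
  show thesis
  proof
    show "z (- 0) = z0" using z(1) by simp
    have "ac_deriv I (\<lambda>x. z (- x)) (\<lambda>x. - (- M (- (- x)) (z (- x)) + - h (- (- x))))"
      by (rule ac_deriv_reflect[OF z(2)]) (simp add: In)
    then show "ac_deriv I (\<lambda>x. z (- x)) (\<lambda>t. M t (z (- t)) + h t)" by (simp add: add.commute)
  qed
qed

lemma bilinear_matrix_vector: "bilinear (\<lambda>(v::complex^'n) (M::complex^'n^'m). M *v v)"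
  unfolding bilinear_def
  by (auto intro!: linearI simp: matrix_vector_right_distrib matrix_vector_mult_scaleR_complex
      matrix_vector_mult_add_rdistrib)
     (simp add: vec_eq_iff matrix_vector_mult_def scaleR_sum_right)

lemma absolutely_integrable_matrix_vector:
  fixes M :: "real \<Rightarrow> complex^'n^'m"
  assumes M: "M absolutely_integrable_on {a..b}" and f: "continuous_on {a..b} f"
  shows "(\<lambda>t. M t *v f t) absolutely_integrable_on {a..b}"
proof (rule absolutely_integrable_bounded_measurable_product[OF bilinear_matrix_vector])
  show "f \<in> borel_measurable (lebesgue_on {a..b})"
    by (rule continuous_imp_measurable_on_sets_lebesgue[OF f]) simp
  show "bounded (f ` {a..b})" by (intro compact_imp_bounded compact_continuous_image f) simp
qed (use M in auto)

lemma absolutely_integrable_Pair: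
  fixes f :: "real \<Rightarrow> 'a::euclidean_space" and g :: "real \<Rightarrow> 'b::euclidean_space"
  assumes f: "f absolutely_integrable_on S" and g: "g absolutely_integrable_on S"
  shows "(\<lambda>t. (f t, g t)) absolutely_integrable_on S"
proof -
  have "(\<lambda>t. (f t, 0::'b)) absolutely_integrable_on S"
    using absolutely_integrable_linear[OF f bounded_linear_Pair[OF bounded_linear_ident bounded_linear_zero]] by (simp add: o_def)
  moreover have "(\<lambda>t. (0::'a, g t)) absolutely_integrable_on S"
    using absolutely_integrable_linear[OF g bounded_linear_Pair[OF bounded_linear_zero bounded_linear_ident]] by (simp add: o_def)
  ultimately show ?thesis using set_integral_add(1)[of lebesgue S "\<lambda>t. (f t, 0::'b)" "\<lambda>t. (0::'a, g t)"] by simp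
qed

lemma bounded_linear_cscale: "bounded_linear (\<lambda>v::complex^'n. c *s v)"
  unfolding linear_conv_bounded_linear[symmetric]
  by (rule linearI) (auto simp: vec_eq_iff algebra_simps scaleR_conv_of_real[where 'a=complex])

lemma bounded_linear_ctranspose: "bounded_linear (ctranspose :: complex^'n^'m \<Rightarrow> _)"
  unfolding linear_conv_bounded_linear[symmetric]
  by (rule linearI) (auto simp: vec_eq_iff ctranspose_def scaleR_conv_of_real[where 'a=complex])

lemma ctranspose_mult: "ctranspose (M ** N) = ctranspose N ** ctranspose (M :: complex^'n^'m)"
  unfolding ctranspose_def matrix_matrix_mult_def by (simp add: vec_eq_iff mult.commute)

section \<open>The quasi-differential system\<close>

text \<open>The hypotheses that turn the equation into a formally symmetric linear system with
  locally integrable coefficients. The function q and the comparison function enter the general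
  theory only through the two assumptions of \<open>sl_limit_point\<close>.\<close>

locale sl_system =
  fixes A Q R H :: "real \<Rightarrow> complex^'n^'n" and I :: "real set"
  assumes I: "I = {0..} \<or> I = {..0}"
    and A_int: "locally_integrable_on I A" and Q_int: "locally_integrable_on I Q"
    and R_int: "locally_integrable_on I R" and H_int: "locally_integrable_on I H"
    and AQ_int: "locally_integrable_on I (\<lambda>x. A x ** Q x)"
    and QAQ_int: "locally_integrable_on I (\<lambda>x. ctranspose (Q x) ** A x ** Q x)"
    and R_herm: "AE x in lebesgue. x \<in> I \<longrightarrow> hermitian (R x)"
    and A_pos: "\<forall>x\<in>I. pos_def (A x)"
    and H_psd: "AE x in lebesgue. x \<in> I \<longrightarrow> pos_semidef (H x)"
begin

lemma I_convex: "convex I"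
  using I by auto

lemma I_0: "0 \<in> I"
  using I by auto

lemma A_herm: "x \<in> I \<Longrightarrow> hermitian (A x)"
  using A_pos unfolding pos_def_def by blast

text \<open>The equation P y = f as a first order system solved for y' and w', in integral form. It
  contains no inverse of A, and the quasi-derivative w is a second unknown on an equal footing with
  y.\<close>

definition solves :: "(real \<Rightarrow> complex^'n) \<Rightarrow> (real \<Rightarrow> complex^'n) \<Rightarrow> (real \<Rightarrow> complex^'n) \<Rightarrow> bool" where
  "solves y w f \<longleftrightarrow>
     ac_deriv I y (\<lambda>x. A x *v (w x - Q x *v y x)) \<and>
     ac_deriv I w (\<lambda>x. ctranspose (Q x) *v (A x *v (w x - Q x *v y x)) + R x *v y x - f x)"

lemma quasi_eq_iff_solves: "quasi_eq A Q R I y w f \<longleftrightarrow> solves y w f"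
proof
  assume q: "quasi_eq A Q R I y w f"
  have lac: "locally_abs_continuous_on I y" "locally_abs_continuous_on I w"
    using q unfolding quasi_eq_def quasi_deriv_def by auto
  have e1: "AE x in lebesgue. x \<in> I \<longrightarrow> w x = matrix_inv (A x) *v vector_derivative y (at x) + Q x *v y x"
    and e2: "AE x in lebesgue. x \<in> I \<longrightarrow>
        - vector_derivative w (at x) + ctranspose (Q x) *v vector_derivative y (at x) + R x *v y x = f x"
    using q unfolding quasi_eq_def quasi_deriv_def by auto
  have d: "AE x in lebesgue. x \<in> I \<longrightarrow> vector_derivative y (at x) = A x *v (w x - Q x *v y x)"
    using e1
  proof eventually_elim
    case (elim x)
    show ?case
    proof
      assume x: "x \<in> I"
      then have "w x - Q x *v y x = matrix_inv (A x) *v vector_derivative y (at x)" using elim by simp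
      then show "vector_derivative y (at x) = A x *v (w x - Q x *v y x)"
        using invertible_matrix_inv_mult(1)[OF pos_def_invertible[OF bspec[OF A_pos x]]] by simp
    qed
  qed
  show "solves y w f"
    unfolding solves_def
  proof
    show "ac_deriv I y (\<lambda>x. A x *v (w x - Q x *v y x))"
    proof (rule locally_ac_imp_ac_deriv[OF lac(1) I_convex])
      show "AE x in lebesgue. x \<in> I \<longrightarrow> (y has_vector_derivative A x *v (w x - Q x *v y x)) (at x)"
        using d locally_ac_vector_derivative(1)[OF lac(1) I_convex] by eventually_elim simp
    qed
    show "ac_deriv I w (\<lambda>x. ctranspose (Q x) *v (A x *v (w x - Q x *v y x)) + R x *v y x - f x)"
    proof (rule locally_ac_imp_ac_deriv[OF lac(2) I_convex])
      show "AE x in lebesgue. x \<in> I \<longrightarrow> (w has_vector_derivative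
          (ctranspose (Q x) *v (A x *v (w x - Q x *v y x)) + R x *v y x - f x)) (at x)"
        using d e2 locally_ac_vector_derivative(1)[OF lac(2) I_convex]
      proof eventually_elim
        case (elim x)
        show ?case
        proof
          assume x: "x \<in> I"
          have solve: "- W + Y + a = b \<Longrightarrow> W = Y + a - b" for W Y a b :: "complex^'n" by (simp add: algebra_simps)
          have "vector_derivative w (at x) = ctranspose (Q x) *v (A x *v (w x - Q x *v y x)) + R x *v y x - f x"
            by (rule solve) (use elim(1,2) x in simp)
          then show "(w has_vector_derivative
            (ctranspose (Q x) *v (A x *v (w x - Q x *v y x)) + R x *v y x - f x)) (at x)" using elim(3) x by simp
        qed
      qed
    qed
  qed
next
  assume s: "solves y w f"
  then have ac: "ac_deriv I y (\<lambda>x. A x *v (w x - Q x *v y x))"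
    "ac_deriv I w (\<lambda>x. ctranspose (Q x) *v (A x *v (w x - Q x *v y x)) + R x *v y x - f x)"
    unfolding solves_def by auto
  have d: "AE x in lebesgue. x \<in> I \<longrightarrow> vector_derivative y (at x) = A x *v (w x - Q x *v y x)"
    using ac_deriv_imp_AE[OF ac(1) I_convex] by eventually_elim (auto simp: vector_derivative_at)
  show "quasi_eq A Q R I y w f"
    unfolding quasi_eq_def quasi_deriv_def
  proof (intro conjI)
    show "locally_abs_continuous_on I y" "locally_abs_continuous_on I w"
      using ac by (auto intro: ac_deriv_imp_locally_ac)
    show "AE x in lebesgue. x \<in> I \<longrightarrow> w x = matrix_inv (A x) *v vector_derivative y (at x) + Q x *v y x"
      using d
    proof eventually_elim
      case (elim x)
      then show ?case using invertible_matrix_inv_mult(2)[OF pos_def_invertible[OF bspec[OF A_pos]]] by simp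
    qed
    show "AE x in lebesgue. x \<in> I \<longrightarrow>
        - vector_derivative w (at x) + ctranspose (Q x) *v vector_derivative y (at x) + R x *v y x = f x"
      using d ac_deriv_imp_AE[OF ac(2) I_convex]
    proof eventually_elim
      case (elim x)
      show ?case
      proof
        assume x: "x \<in> I"
        then have "vector_derivative w (at x) = ctranspose (Q x) *v (A x *v (w x - Q x *v y x)) + R x *v y x - f x"
          using elim(2) by (simp add: vector_derivative_at)
        then show "- vector_derivative w (at x) + ctranspose (Q x) *v vector_derivative y (at x) + R x *v y x = f x"
          using elim(1) x by simp
      qed
    qed
  qed
qed

lemma solves_ac:
  assumes "solves y w f"
  shows "locally_abs_continuous_on I y" "locally_abs_continuous_on I w"
    "AE x in lebesgue. x \<in> I \<longrightarrow> (y has_vector_derivative A x *v (w x - Q x *v y x)) (at x)"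
    "AE x in lebesgue. x \<in> I \<longrightarrow> (w has_vector_derivative
       (ctranspose (Q x) *v (A x *v (w x - Q x *v y x)) + R x *v y x - f x)) (at x)"
  using assms unfolding solves_def
  by (auto intro: ac_deriv_imp_locally_ac ac_deriv_imp_AE[OF _ I_convex])

lemma solvesI:
  assumes "locally_abs_continuous_on I y" "locally_abs_continuous_on I w"
    "AE x in lebesgue. x \<in> I \<longrightarrow> (y has_vector_derivative A x *v (w x - Q x *v y x)) (at x)"
    "AE x in lebesgue. x \<in> I \<longrightarrow> (w has_vector_derivative
       (ctranspose (Q x) *v (A x *v (w x - Q x *v y x)) + R x *v y x - f x)) (at x)"
  shows "solves y w f"
  using assms unfolding solves_def by (auto intro: locally_ac_imp_ac_deriv I_convex)

lemma solves_add:
  assumes 1: "solves y1 w1 f1" and 2: "solves y2 w2 f2"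
  shows "solves (\<lambda>x. y1 x + y2 x) (\<lambda>x. w1 x + w2 x) (\<lambda>x. f1 x + f2 x)"
proof (rule solvesI)
  show "locally_abs_continuous_on I (\<lambda>x. y1 x + y2 x)" "locally_abs_continuous_on I (\<lambda>x. w1 x + w2 x)"
    by (intro locally_ac_add solves_ac[OF 1] solves_ac[OF 2])+
  have s: "A x *v (w1 x + w2 x - Q x *v (y1 x + y2 x)) = A x *v (w1 x - Q x *v y1 x) + A x *v (w2 x - Q x *v y2 x)" for x
    by (simp add: matrix_vector_right_distrib matrix_vector_mult_diff_distrib)
  show "AE x in lebesgue. x \<in> I \<longrightarrow> ((\<lambda>x. y1 x + y2 x) has_vector_derivative
      A x *v (w1 x + w2 x - Q x *v (y1 x + y2 x))) (at x)"
    using solves_ac(3)[OF 1] solves_ac(3)[OF 2]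
  proof eventually_elim
    case (elim x)
    then show ?case unfolding s by (auto intro: has_vector_derivative_add)
  qed
  show "AE x in lebesgue. x \<in> I \<longrightarrow> ((\<lambda>x. w1 x + w2 x) has_vector_derivative
      ctranspose (Q x) *v (A x *v (w1 x + w2 x - Q x *v (y1 x + y2 x))) + R x *v (y1 x + y2 x) - (f1 x + f2 x)) (at x)"
    using solves_ac(4)[OF 1] solves_ac(4)[OF 2]
  proof eventually_elim
    case (elim x)
    have e: "ctranspose (Q x) *v (A x *v (w1 x + w2 x - Q x *v (y1 x + y2 x))) + R x *v (y1 x + y2 x) - (f1 x + f2 x)
      = (ctranspose (Q x) *v (A x *v (w1 x - Q x *v y1 x)) + R x *v y1 x - f1 x)
      + (ctranspose (Q x) *v (A x *v (w2 x - Q x *v y2 x)) + R x *v y2 x - f2 x)"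
      unfolding s by (simp add: matrix_vector_right_distrib)
    show ?case unfolding e using elim by (auto intro: has_vector_derivative_add)
  qed
qed

lemma solves_scale:
  assumes 1: "solves y w f"
  shows "solves (\<lambda>x. c *s y x) (\<lambda>x. c *s w x) (\<lambda>x. c *s f x)"
proof (rule solvesI)
  show "locally_abs_continuous_on I (\<lambda>x. c *s y x)" "locally_abs_continuous_on I (\<lambda>x. c *s w x)"
    by (intro locally_ac_bounded_linear[OF bounded_linear_cscale] solves_ac[OF 1])+
  have s: "N *v (c *s u - Q x *v (c *s v)) = c *s (N *v (u - Q x *v v))" for N :: "complex^'n^'n" and u v x
    by (simp only: vector_scalar_commute vector_ssub_ldistrib[symmetric])
  show "AE x in lebesgue. x \<in> I \<longrightarrow> ((\<lambda>x. c *s y x) has_vector_derivative A x *v (c *s w x - Q x *v (c *s y x))) (at x)"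
    using solves_ac(3)[OF 1]
  proof eventually_elim
    case (elim x)
    then show ?case
      unfolding s using bounded_linear.has_vector_derivative[OF bounded_linear_cscale, of y _ "at x" c] by blast
  qed
  show "AE x in lebesgue. x \<in> I \<longrightarrow> ((\<lambda>x. c *s w x) has_vector_derivative
      ctranspose (Q x) *v (A x *v (c *s w x - Q x *v (c *s y x))) + R x *v (c *s y x) - c *s f x) (at x)"
    using solves_ac(4)[OF 1]
  proof eventually_elim
    case (elim x)
    have e: "ctranspose (Q x) *v (A x *v (c *s w x - Q x *v (c *s y x))) + R x *v (c *s y x) - c *s f x
       = c *s (ctranspose (Q x) *v (A x *v (w x - Q x *v y x)) + R x *v y x - f x)"
      unfolding s by (simp only: vector_scalar_commute vector_ssub_ldistrib vector_add_ldistrib)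
    show ?case
      unfolding e using elim bounded_linear.has_vector_derivative[OF bounded_linear_cscale, of w _ "at x" c] by blast
  qed
qed

text \<open>Lagrange's identity. In terms of s = w - Q u and \<sigma> = \<omega> - Q \<eta> the
  contributions of Q match, those of A and R cancel because both are hermitian, and only the
  right-hand sides remain.\<close>

lemma lagrange:
  assumes e: "solves \<eta> \<omega> f" and u: "solves u w g"
  shows "ac_deriv I (\<lambda>x. cdot (\<eta> x) (w x) - cdot (\<omega> x) (u x)) (\<lambda>x. cdot (f x) (u x) - cdot (\<eta> x) (g x))"
proof (rule locally_ac_imp_ac_deriv[OF _ I_convex])
  note bl = locally_ac_bilinear[OF bounded_bilinear_cdot]
  have "locally_abs_continuous_on I (\<lambda>x. cdot (\<eta> x) (w x) + (- cdot (\<omega> x) (u x)))"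
    by (intro locally_ac_add bl solves_ac[OF e] solves_ac[OF u]
        locally_ac_bounded_linear[OF bounded_linear_minus[OF bounded_linear_ident]])
  then show "locally_abs_continuous_on I (\<lambda>x. cdot (\<eta> x) (w x) - cdot (\<omega> x) (u x))" by simp
  show "AE x in lebesgue. x \<in> I \<longrightarrow> ((\<lambda>x. cdot (\<eta> x) (w x) - cdot (\<omega> x) (u x)) has_vector_derivative
      cdot (f x) (u x) - cdot (\<eta> x) (g x)) (at x)"
    using solves_ac(3,4)[OF e] solves_ac(3,4)[OF u] R_herm
  proof eventually_elim
    case (elim x)
    show ?case
    proof
      assume x: "x \<in> I"
      define s where "s = w x - Q x *v u x"
      define \<sigma> where "\<sigma> = \<omega> x - Q x *v \<eta> x"
      have ws: "w x = s + Q x *v u x" "\<omega> x = \<sigma> + Q x *v \<eta> x" unfolding s_def \<sigma>_def by auto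
      have "((\<lambda>x. cdot (\<eta> x) (w x) - cdot (\<omega> x) (u x)) has_vector_derivative
         (cdot (\<eta> x) (ctranspose (Q x) *v (A x *v s) + R x *v u x - g x) + cdot (A x *v \<sigma>) (w x))
         - (cdot (\<omega> x) (A x *v s) + cdot (ctranspose (Q x) *v (A x *v \<sigma>) + R x *v \<eta> x - f x) (u x))) (at x)"
        using elim x unfolding s_def \<sigma>_def
        by (intro has_vector_derivative_diff bounded_bilinear.has_vector_derivative[OF bounded_bilinear_cdot]) auto
      moreover have "(cdot (\<eta> x) (ctranspose (Q x) *v (A x *v s) + R x *v u x - g x) + cdot (A x *v \<sigma>) (w x))
         - (cdot (\<omega> x) (A x *v s) + cdot (ctranspose (Q x) *v (A x *v \<sigma>) + R x *v \<eta> x - f x) (u x))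
         = cdot (f x) (u x) - cdot (\<eta> x) (g x)"
        unfolding ws cdot_simps
        using hermitian_cdot[OF A_herm[OF x], of \<sigma> s] elim(5) x hermitian_cdot[of "R x" "\<eta> x" "u x"]
        by (simp add: cdot_mult[of "\<eta> x" "ctranspose (Q x)"] cdot_mult_left[of "ctranspose (Q x)"] ctranspose_ctranspose)
      ultimately show "((\<lambda>x. cdot (\<eta> x) (w x) - cdot (\<omega> x) (u x)) has_vector_derivative
        cdot (f x) (u x) - cdot (\<eta> x) (g x)) (at x)" by simp
    qed
  qed
qed

text \<open>With s = w - Q y, the product rule yields (Q y)^* A s + s^* A w + y^* R y - y^* f.
  Replacing s by w - Q y completes the square: the first three terms are w^* A w + y^* (R - Q^* A Q)
  y. This is where V comes from.\<close>

lemma energy: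
  assumes y: "solves y w f"
  shows "locally_abs_continuous_on I (\<lambda>x. cdot (y x) (w x))"
    and "AE x in lebesgue. x \<in> I \<longrightarrow> ((\<lambda>x. cdot (y x) (w x)) has_vector_derivative
      (cdot (w x) (A x *v w x) + cdot (y x) ((R x - ctranspose (Q x) ** A x ** Q x) *v y x) - cdot (y x) (f x))) (at x)"
proof -
  show "locally_abs_continuous_on I (\<lambda>x. cdot (y x) (w x))"
    by (intro locally_ac_bilinear[OF bounded_bilinear_cdot] solves_ac[OF y])
  show "AE x in lebesgue. x \<in> I \<longrightarrow> ((\<lambda>x. cdot (y x) (w x)) has_vector_derivative
      (cdot (w x) (A x *v w x) + cdot (y x) ((R x - ctranspose (Q x) ** A x ** Q x) *v y x) - cdot (y x) (f x))) (at x)"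
    using solves_ac(3,4)[OF y]
  proof eventually_elim
    case (elim x)
    show ?case
    proof
      assume x: "x \<in> I"
      define s where "s = w x - Q x *v y x"
      have ws: "w x = s + Q x *v y x" unfolding s_def by auto
      have "((\<lambda>x. cdot (y x) (w x)) has_vector_derivative
         cdot (y x) (ctranspose (Q x) *v (A x *v s) + R x *v y x - f x) + cdot (A x *v s) (w x)) (at x)"
        using elim x unfolding s_def
        by (intro bounded_bilinear.has_vector_derivative[OF bounded_bilinear_cdot]) auto
      moreover have "cdot (y x) (ctranspose (Q x) *v (A x *v s) + R x *v y x - f x) + cdot (A x *v s) (w x)
         = cdot (w x) (A x *v w x) + cdot (y x) ((R x - ctranspose (Q x) ** A x ** Q x) *v y x) - cdot (y x) (f x)"
        unfolding ws cdot_simps matrix_vector_mult_diff_rdistrib matrix_vector_right_distrib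
        using hermitian_cdot[OF A_herm[OF x], of s "Q x *v y x"] hermitian_cdot[OF A_herm[OF x], of s s]
        by (simp add: cdot_simps cdot_mult[of "y x" "ctranspose (Q x)"] ctranspose_ctranspose flip: matrix_vector_mul_assoc)
      ultimately show "((\<lambda>x. cdot (y x) (w x)) has_vector_derivative
        (cdot (w x) (A x *v w x) + cdot (y x) ((R x - ctranspose (Q x) ** A x ** Q x) *v y x) - cdot (y x) (f x))) (at x)"
        by simp
    qed
  qed
qed

lemma locally_integrableD: "locally_integrable_on I f \<Longrightarrow> {a..b} \<subseteq> I \<Longrightarrow> f absolutely_integrable_on {a..b}"
  unfolding locally_integrable_on_def by blast

text \<open>Expanding the system leaves the coefficients A, A Q, its adjoint and R - Q^* A Q, which
  are locally integrable; the Lipschitz function l is built from their norms and that of H.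
  Integrability of g on all of I provides the bounded primitives required by the fixed point
  argument.\<close>

lemma solves_exists:
  assumes g: "g absolutely_integrable_on I"
  obtains y w where "y 0 = y0" "w 0 = w0" "solves y w (\<lambda>x. lam *s (H x *v y x) + g x)"
proof -
  obtain K where K: "K > 0" and KM: "\<And>(v::complex^'n) (M::complex^'n^'n). norm (M *v v) \<le> K * norm v * norm M"
    using bilinear_bounded_pos[OF bilinear_matrix_vector] by blast
  have cs: "norm (c *s (v::complex^'n)) = norm c * norm v" for c v
  proof -
    have "of_real ((norm (c *s v))\<^sup>2) = (of_real ((norm c * norm v)\<^sup>2) :: complex)"
      unfolding cdot_self[symmetric] cdot_simps
      by (simp add: cdot_self power_mult_distrib complex_norm_square[symmetric] mult.assoc[symmetric] flip: complex_norm_square)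
    then have "(norm (c *s v))\<^sup>2 = (norm c * norm v)\<^sup>2" using of_real_eq_iff by blast
    then show ?thesis by (simp add: power2_eq_iff_nonneg)
  qed
  define V where "V x = R x - ctranspose (Q x) ** A x ** Q x" for x
  define AQ where "AQ x = A x ** Q x" for x
  define M where "M t u = (A t *v snd u - AQ t *v fst u,
      ctranspose (AQ t) *v snd u + V t *v fst u - lam *s (H t *v fst u))" for t and u :: "(complex^'n) \<times> (complex^'n)"
  define l where "l t = K * (norm (A t) + norm (AQ t) + norm (ctranspose (AQ t)) + norm (V t) + norm lam * norm (H t))" for t
  have ii: "A absolutely_integrable_on {a..b}" "AQ absolutely_integrable_on {a..b}"
    "(\<lambda>t. ctranspose (AQ t)) absolutely_integrable_on {a..b}" "V absolutely_integrable_on {a..b}"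
    "H absolutely_integrable_on {a..b}" if ab: "{a..b} \<subseteq> I" for a b
  proof -
    show "A absolutely_integrable_on {a..b}" "H absolutely_integrable_on {a..b}"
      using locally_integrableD[OF A_int ab] locally_integrableD[OF H_int ab] .
    show AQ: "AQ absolutely_integrable_on {a..b}" unfolding AQ_def using locally_integrableD[OF AQ_int ab] .
    show "(\<lambda>t. ctranspose (AQ t)) absolutely_integrable_on {a..b}"
      using absolutely_integrable_linear[OF AQ bounded_linear_ctranspose] by (simp add: o_def)
    show "V absolutely_integrable_on {a..b}"
      unfolding V_def using locally_integrableD[OF R_int ab] locally_integrableD[OF QAQ_int ab] by (rule set_integral_diff)
  qed
  obtain z where z: "z 0 = (y0, w0)" "ac_deriv I z (\<lambda>t. M t (z t) + (0, - g t))"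
  proof (rule caratheodory_ode_exists_halfline[OF I, of l M "\<lambda>t. (0, - g t)" "(y0, w0)"])
    show "l absolutely_integrable_on {a..b}" if "{a..b} \<subseteq> I" for a b
      unfolding l_def using ii[OF that] by (intro set_integrable_mult_right set_integral_add set_integrable_norm)
    show "0 \<le> l t" for t unfolding l_def using K by simp
    show "norm (M t u - M t v) \<le> l t * norm (u - v)" for t u v
    proof -
      define d where "d = u - v"
      have "M t u - M t v = M t d"
        unfolding M_def d_def by (simp add: matrix_vector_mult_diff_distrib vector_ssub_ldistrib algebra_simps)
      moreover have "norm (M t d) \<le> l t * norm d"
      proof -
        have f: "norm (fst d) \<le> norm d" "norm (snd d) \<le> norm d"
          using norm_fst_le[where x="fst d" and y="snd d"] norm_snd_le[where x="fst d" and y="snd d"] by simp_all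
        have b: "norm (N *v fst d) \<le> K * norm N * norm d" "norm (N *v snd d) \<le> K * norm N * norm d" for N :: "complex^'n^'n"
        proof -
          have "K * norm (fst d) * norm N \<le> K * norm d * norm N" "K * norm (snd d) * norm N \<le> K * norm d * norm N"
            using K f by (auto intro!: mult_right_mono mult_left_mono)
          then show "norm (N *v fst d) \<le> K * norm N * norm d" "norm (N *v snd d) \<le> K * norm N * norm d"
            using KM[of N "fst d"] KM[of N "snd d"] by (simp_all add: mult_ac)
        qed
        have "norm (M t d) \<le> norm (A t *v snd d - AQ t *v fst d)
            + norm (ctranspose (AQ t) *v snd d + V t *v fst d - lam *s (H t *v fst d))"
          unfolding M_def by (rule norm_Pair_le)
        also have "\<dots> \<le> (norm (A t *v snd d) + norm (AQ t *v fst d))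
            + (norm (ctranspose (AQ t) *v snd d) + norm (V t *v fst d) + norm lam * norm (H t *v fst d))"
          by (intro add_mono order_trans[OF norm_triangle_ineq4] norm_triangle_ineq order_refl) (simp_all add: cs)
        also have "\<dots> \<le> (K * norm (A t) * norm d + K * norm (AQ t) * norm d)
            + (K * norm (ctranspose (AQ t)) * norm d + K * norm (V t) * norm d + norm lam * (K * norm (H t) * norm d))"
          by (intro add_mono b mult_left_mono) auto
        also have "\<dots> = l t * norm d" unfolding l_def by (simp add: algebra_simps)
        finally show ?thesis .
      qed
      ultimately show ?thesis unfolding d_def by simp
    qed
    show "M t 0 = 0" for t unfolding M_def by (simp add: zero_prod_def)
    show "(\<lambda>t. M t (z t)) absolutely_integrable_on {a..b}" if z: "continuous_on UNIV z" and ab: "{a..b} \<subseteq> I" for z a b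
    proof -
      have c: "continuous_on {a..b} (\<lambda>t. fst (z t))" "continuous_on {a..b} (\<lambda>t. snd (z t))"
        by (intro continuous_intros continuous_on_subset[OF z] subset_UNIV)+
      note mv = absolutely_integrable_matrix_vector
      have s: "(\<lambda>t. lam *s (H t *v fst (z t))) absolutely_integrable_on {a..b}"
        using absolutely_integrable_linear[OF mv[OF ii(5)[OF ab] c(1)] bounded_linear_cscale] by (simp add: o_def)
      show ?thesis unfolding M_def
        by (intro absolutely_integrable_Pair set_integral_diff(1) set_integral_add(1) mv ii[OF ab] c s)
    qed
    show "(\<lambda>t. (0::complex^'n, - g t)) absolutely_integrable_on I"
      using absolutely_integrable_linear[OF g bounded_linear_minus[OF bounded_linear_ident]]
      by (intro absolutely_integrable_Pair) (simp_all add: o_def)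
  qed blast
  show thesis
  proof
    show "fst (z 0) = y0" "snd (z 0) = w0" using z(1) by auto
    have e1: "A t *v (w - Q t *v y) = A t *v w - AQ t *v y" for t y w
      unfolding AQ_def by (simp add: matrix_vector_mult_diff_distrib flip: matrix_vector_mul_assoc)
    have e2: "ctranspose (Q t) *v (A t *v (w - Q t *v y)) + R t *v y - (lam *s (H t *v y) + g t)
       = ctranspose (AQ t) *v w + V t *v y - lam *s (H t *v y) + - g t" if "t \<in> I" for t y w
    proof -
      have "ctranspose (AQ t) = ctranspose (Q t) ** A t"
        unfolding AQ_def ctranspose_mult using A_herm[OF that] unfolding hermitian_def by simp
      then show ?thesis
        unfolding V_def by (simp add: matrix_vector_mult_diff_distrib matrix_vector_mult_diff_rdistrib flip: matrix_vector_mul_assoc)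
    qed
    show "solves (\<lambda>x. fst (z x)) (\<lambda>x. snd (z x)) (\<lambda>x. lam *s (H x *v fst (z x)) + g x)"
    proof (rule solvesI)
      note acf = ac_deriv_bounded_linear[OF bounded_linear_fst z(2)]
      note acs = ac_deriv_bounded_linear[OF bounded_linear_snd z(2)]
      show "locally_abs_continuous_on I (\<lambda>x. fst (z x))" using ac_deriv_imp_locally_ac[OF acf] .
      show "locally_abs_continuous_on I (\<lambda>x. snd (z x))" using ac_deriv_imp_locally_ac[OF acs] .
      show "AE x in lebesgue. x \<in> I \<longrightarrow> ((\<lambda>x. fst (z x)) has_vector_derivative A x *v (snd (z x) - Q x *v fst (z x))) (at x)"
        using ac_deriv_imp_AE[OF acf I_convex] unfolding e1 M_def by simp
      show "AE x in lebesgue. x \<in> I \<longrightarrow> ((\<lambda>x. snd (z x)) has_vector_derivative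
         ctranspose (Q x) *v (A x *v (snd (z x) - Q x *v fst (z x))) + R x *v fst (z x) - (lam *s (H x *v fst (z x)) + g x)) (at x)"
        using ac_deriv_imp_AE[OF acs I_convex]
      proof eventually_elim
        case (elim x)
        show ?case
        proof
          assume x: "x \<in> I"
          show "((\<lambda>x. snd (z x)) has_vector_derivative
            ctranspose (Q x) *v (A x *v (snd (z x) - Q x *v fst (z x))) + R x *v fst (z x) - (lam *s (H x *v fst (z x)) + g x)) (at x)"
            using elim x unfolding e2[OF x] M_def by simp
        qed
      qed
    qed
  qed
qed

end

section \<open>Solutions of the homogeneous equation: Wronskian, flow map, uniqueness\<close>

lemma ac_deriv_zero_imp_const:
  fixes f :: "real \<Rightarrow> 'a::euclidean_space"
  assumes f: "ac_deriv I f g" and g: "AE x in lebesgue. x \<in> I \<longrightarrow> g x = 0" and I: "convex I"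
    and ab: "a \<in> I" "b \<in> I"
  shows "f a = f b"
proof -
  have *: "f a = f b" if "a \<in> I" "b \<in> I" "a \<le> b" for a b
  proof -
    have sub: "{a..b} \<subseteq> I"
      using that I closed_segment_subset[of a I b] by (simp add: closed_segment_eq_real_ivl)
    have "AE x in lebesgue. x \<in> {a..b} \<longrightarrow> g x = 0" using g by eventually_elim (use sub in auto)
    then have "(g has_integral 0) {a..b}" by (rule has_integral_cong_AE) (rule has_integral_0)
    with ac_derivD(2)[OF f sub that(3)] have "f b - f a = 0" by (rule has_integral_unique)
    then show ?thesis by simp
  qed
  show ?thesis
  proof (cases "a \<le> b")
    case True
    then show ?thesis by (rule *[OF ab])
  next
    case False
    then have "b \<le> a" by simp
    then show ?thesis by (rule *[OF ab(2,1), symmetric])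
  qed
qed

lemma scaleR_eq_cscale: "r *\<^sub>R (v::complex^'n) = of_real r *s v"
  by (simp add: vec_eq_iff scaleR_conv_of_real[where 'a=complex])

text \<open>Polarisation for a sign s: the difference of the two squares is 4 s Im (y^* w), their
  sum is 2 (|y|^2 + |w|^2). The first translates the sign of the boundary form into a comparison of
  norms, the second recovers the full initial data.\<close>

lemma norm_add_i_sq:
  fixes y w :: "complex^'n" and s :: real
  assumes "s\<^sup>2 = 1"
  shows "(norm (y + (of_real s * \<i>) *s w))\<^sup>2 = (norm y)\<^sup>2 + (norm w)\<^sup>2 - 2 * s * Im (cdot y w)"
    and "(norm (y - (of_real s * \<i>) *s w))\<^sup>2 = (norm y)\<^sup>2 + (norm w)\<^sup>2 + 2 * s * Im (cdot y w)"
proof -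
  define c where "c = complex_of_real s * \<i>"
  have n: "(norm v)\<^sup>2 = Re (cdot v v)" for v :: "complex^'n" by (simp add: cdot_self)
  have cc: "c * (cnj c * z) = z" for z
  proof -
    have "s * s = 1" using assms by (simp add: power2_eq_square)
    then have "c * cnj c = 1" unfolding c_def by (simp add: complex_eq_iff)
    then show ?thesis by (simp add: mult.assoc[symmetric])
  qed
  have r1: "Re (c * cdot y w) = - s * Im (cdot y w)" unfolding c_def by simp
  have r2: "Re (cnj c * cdot w y) = - s * Im (cdot y w)"
  proof -
    have "cnj c * cdot w y = cnj (c * cdot y w)"
      unfolding cdot_cnj[of y w, symmetric] by (simp only: complex_cnj_mult)
    then show ?thesis using r1 by (simp only: cnj.simps(1))
  qed
  have "cdot (y + c *s w) (y + c *s w) = cdot y y + c * cdot y w + cnj c * cdot w y + cdot w w"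
    unfolding cdot_simps distrib_left cc by (simp only: ac_simps)
  then show "(norm (y + (of_real s * \<i>) *s w))\<^sup>2 = (norm y)\<^sup>2 + (norm w)\<^sup>2 - 2 * s * Im (cdot y w)"
    unfolding n c_def[symmetric] using r1 r2 by simp
  have "cdot (y - c *s w) (y - c *s w) = cdot y y - c * cdot y w - cnj c * cdot w y + cdot w w"
    unfolding cdot_simps right_diff_distrib cc by simp
  then show "(norm (y - (of_real s * \<i>) *s w))\<^sup>2 = (norm y)\<^sup>2 + (norm w)\<^sup>2 + 2 * s * Im (cdot y w)"
    unfolding n c_def[symmetric] using r1 r2 by simp
qed

context sl_system
begin

abbreviation sol :: "complex \<Rightarrow> (real \<Rightarrow> complex^'n) \<Rightarrow> (real \<Rightarrow> complex^'n) \<Rightarrow> bool" where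
  "sol lam y w \<equiv> solves y w (\<lambda>x. lam *s (H x *v y x))"

lemma solves_cong_rhs: "solves y w f \<Longrightarrow> (\<And>x. f x = g x) \<Longrightarrow> solves y w g"
  by (simp add: ext[of f g])

lemma sol_add:
  assumes "sol lam y1 w1" "sol lam y2 w2"
  shows "sol lam (\<lambda>x. y1 x + y2 x) (\<lambda>x. w1 x + w2 x)"
  by (rule solves_cong_rhs[OF solves_add[OF assms]])
     (simp add: matrix_vector_right_distrib vector_add_ldistrib)

lemma sol_scale:
  assumes "sol lam y w"
  shows "sol lam (\<lambda>x. c *s y x) (\<lambda>x. c *s w x)"
  by (rule solves_cong_rhs[OF solves_scale[OF assms]])
     (simp add: vector_scalar_commute vector_smult_assoc mult.commute)

lemma sol_0: "sol lam (\<lambda>x. 0) (\<lambda>x. 0)"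
proof -
  obtain y w where "sol lam y w"
    by (rule solves_exists[of "\<lambda>x. 0" 0 0 lam]) (auto simp: )
  from sol_scale[OF this, of 0] show ?thesis by simp
qed

lemma sol_sum:
  assumes "\<And>i. i \<in> B \<Longrightarrow> sol lam (y i) (w i)"
  shows "sol lam (\<lambda>x. \<Sum>i\<in>B. c i *s y i x) (\<lambda>x. \<Sum>i\<in>B. c i *s w i x)"
  using assms
proof (induction B rule: infinite_finite_induct)
  case (insert b B)
  then show ?case using sol_add[OF sol_scale[where y="y b" and w="w b" and c="c b"] insert.IH] by simp
qed (simp_all add: sol_0[simplified])

text \<open>With conjugate parameters the two right-hand sides in Lagrange's identity cancel,
  because H is hermitian.\<close>

lemma wronskian_const:
  assumes e: "sol (cnj lam) \<eta> \<omega>" and u: "sol lam u w" and ab: "a \<in> I" "b \<in> I"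
  shows "cdot (\<eta> a) (w a) - cdot (\<omega> a) (u a) = cdot (\<eta> b) (w b) - cdot (\<omega> b) (u b)"
proof (rule ac_deriv_zero_imp_const[OF lagrange[OF e u] _ I_convex ab])
  show "AE x in lebesgue. x \<in> I \<longrightarrow> cdot (cnj lam *s (H x *v \<eta> x)) (u x) - cdot (\<eta> x) (lam *s (H x *v u x)) = 0"
    using H_psd by eventually_elim (auto simp: pos_semidef_def cdot_simps hermitian_cdot)
qed

text \<open>Existence alone picks a solution for each initial value without linear dependence on it,
  and uniqueness is not yet known. Hence solutions are chosen only for a real basis of the initial
  data and combined linearly.\<close>

lemma flow_exists:
  obtains \<Phi> :: "(complex^'n) \<times> (complex^'n) \<Rightarrow> real \<Rightarrow> (complex^'n) \<times> (complex^'n)"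
  where "\<And>x. linear (\<lambda>z. \<Phi> z x)" "\<And>z. \<Phi> z 0 = z"
    "\<And>z. sol lam (\<lambda>x. fst (\<Phi> z x)) (\<lambda>x. snd (\<Phi> z x))"
proof -
  have "\<exists>p. fst p 0 = fst b \<and> snd p 0 = snd b \<and> sol lam (fst p) (snd p)" for b :: "(complex^'n) \<times> (complex^'n)"
  proof -
    obtain y w where "y 0 = fst b" "w 0 = snd b" "solves y w (\<lambda>x. lam *s (H x *v y x) + 0)"
      by (rule solves_exists[of "\<lambda>x. 0" "fst b" "snd b" lam]) simp_all
    then show ?thesis by (intro exI[of _ "(y, w)"]) simp
  qed
  then have "\<forall>b::(complex^'n) \<times> (complex^'n). \<exists>p. fst p 0 = fst b \<and> snd p 0 = snd b \<and> sol lam (fst p) (snd p)"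
    by blast
  from choice[OF this] obtain P where
    P: "\<And>b::(complex^'n) \<times> (complex^'n). fst (P b) 0 = fst b \<and> snd (P b) 0 = snd b \<and> sol lam (fst (P b)) (snd (P b))"
    by blast
  define Y W where "Y b = fst (P b)" and "W b = snd (P b)" for b
  have YW: "Y b 0 = fst b \<and> W b 0 = snd b \<and> sol lam (Y b) (W b)" for b
    unfolding Y_def W_def by (rule P)
  define \<Phi> where "\<Phi> z x = (\<Sum>b\<in>Basis. (z \<bullet> b) *\<^sub>R (Y b x, W b x))" for z x
  show thesis
  proof
    show "linear (\<lambda>z. \<Phi> z x)" for x
    proof (rule linearI)
      fix u v show "\<Phi> (u + v) x = \<Phi> u x + \<Phi> v x"
        unfolding \<Phi>_def by (simp only: inner_add_left scaleR_add_left sum.distrib)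
      fix c show "\<Phi> (c *\<^sub>R u) x = c *\<^sub>R \<Phi> u x"
        unfolding \<Phi>_def by (simp only: inner_scaleR_left scaleR_sum_right scaleR_scaleR)
    qed
    show "\<Phi> z 0 = z" for z
      unfolding \<Phi>_def using YW by (simp add: euclidean_representation)
    have "sol lam (\<lambda>x. \<Sum>b\<in>Basis. of_real (z \<bullet> b) *s Y b x) (\<lambda>x. \<Sum>b\<in>Basis. of_real (z \<bullet> b) *s W b x)" for z
      by (rule sol_sum) (use YW in blast)
    moreover have "fst (\<Phi> z x) = (\<Sum>b\<in>Basis. of_real (z \<bullet> b) *s Y b x)" "snd (\<Phi> z x) = (\<Sum>b\<in>Basis. of_real (z \<bullet> b) *s W b x)" for z x
      unfolding \<Phi>_def by (simp_all add: fst_sum snd_sum scaleR_eq_cscale)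
    ultimately show "sol lam (\<lambda>x. fst (\<Phi> z x)) (\<lambda>x. snd (\<Phi> z x))" for z by simp
  qed
qed

text \<open>Instead of Gronwall's inequality: the Wronskian with all solutions for \<open>cnj lam\<close>, whose data at 0 are
  arbitrary, is constant. Hence the flow map is injective, and bijective by dimension.\<close>

lemma sol_zero_back:
  assumes u: "sol lam u w" and x: "x \<in> I" "u x = 0" "w x = 0"
  shows "u 0 = 0" "w 0 = 0"
proof -
  obtain \<eta> \<omega> where e: "\<eta> 0 = w 0" "\<omega> 0 = - u 0" "sol (cnj lam) \<eta> \<omega>"
    by (rule solves_exists[of "\<lambda>x. 0" "w 0" "- u 0" "cnj lam"]) auto
  have "cdot (w 0) (w 0) + cdot (u 0) (u 0) = 0"
    using wronskian_const[OF e(3) u I_0 x(1)] x e by (simp add: cdot_simps)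
  then have "(norm (w 0))\<^sup>2 + (norm (u 0))\<^sup>2 = 0"
    unfolding cdot_self by (metis of_real_add of_real_eq_0_iff)
  then show "u 0 = 0" "w 0 = 0" by (simp_all add: sum_power2_eq_zero_iff)
qed

lemma flow_surj:
  assumes lin: "linear (\<lambda>z. \<Phi> z x)" and \<Phi>0: "\<And>z. \<Phi> z 0 = z"
    and s: "\<And>z. sol lam (\<lambda>x. fst (\<Phi> z x)) (\<lambda>x. snd (\<Phi> z x))" and x: "x \<in> I"
  obtains z where "\<Phi> z x = (v :: (complex^'n) \<times> (complex^'n))"
proof -
  have "inj (\<lambda>z. \<Phi> z x)"
    unfolding linear_injective_0[OF lin]
  proof (intro allI impI)
    fix z assume z: "\<Phi> z x = 0"
    then have "fst (\<Phi> z 0) = 0" "snd (\<Phi> z 0) = 0" using sol_zero_back[OF s[of z] x] by auto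
    then show "z = 0" by (simp add: \<Phi>0 prod_eq_iff)
  qed
  then have "surj (\<lambda>z. \<Phi> z x)" using linear_injective_imp_surjective[OF lin] by blast
  then show thesis using that unfolding surj_def by metis
qed

lemma sol_through:
  assumes x: "x \<in> I"
  obtains \<eta> \<omega> where "\<eta> x = y1" "\<omega> x = w1" "sol lam \<eta> \<omega>"
proof -
  obtain \<Phi> :: "(complex^'n) \<times> (complex^'n) \<Rightarrow> real \<Rightarrow> (complex^'n) \<times> (complex^'n)"
    where \<Phi>: "\<And>x. linear (\<lambda>z. \<Phi> z x)" "\<And>z. \<Phi> z 0 = z"
    "\<And>z. sol lam (\<lambda>x. fst (\<Phi> z x)) (\<lambda>x. snd (\<Phi> z x))" by (rule flow_exists) blast
  obtain z where "\<Phi> z x = (y1, w1)" by (rule flow_surj[OF \<Phi> x])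
  then show thesis using \<Phi>(3)[of z] by (intro that) auto
qed

text \<open>The Wronskian argument once more, now evaluated at a and at x with the solution through
  (w x, - u x) at x. Its existence is the surjectivity of the flow map.\<close>

lemma sol_unique:
  assumes u: "sol lam u w" and a: "a \<in> I" "u a = 0" "w a = 0" and x: "x \<in> I"
  shows "u x = 0" "w x = 0"
proof -
  obtain \<eta> \<omega> where e: "\<eta> x = w x" "\<omega> x = - u x" "sol (cnj lam) \<eta> \<omega>"
    by (rule sol_through[OF x])
  have "cdot (w x) (w x) + cdot (u x) (u x) = 0"
    using wronskian_const[OF e(3) u a(1) x] a e by (simp add: cdot_simps)
  then have "(norm (w x))\<^sup>2 + (norm (u x))\<^sup>2 = 0"
    unfolding cdot_self by (metis of_real_add of_real_eq_0_iff)
  then show "u x = 0" "w x = 0" by (simp_all add: sum_power2_eq_zero_iff)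
qed

lemma sol_continuous:
  assumes "solves y w f"
  shows "continuous_on I y" "continuous_on I w"
proof -
  have *: "continuous_on I u" if u: "locally_abs_continuous_on I u" for u :: "real \<Rightarrow> complex^'n"
    unfolding continuous_on_eq_continuous_within
  proof
    fix x assume x: "x \<in> I"
    define J where "J = (if I = {0..} then {0..\<bar>x\<bar>+1} else {-\<bar>x\<bar>-1..0})"
    have J: "J \<subseteq> I" "x \<in> J" using I x unfolding J_def by auto
    have "continuous_on J u"
      using J(1) unfolding J_def by (cases "I = {0..}") (simp_all add: locally_ac_imp_continuous_on[OF u])
    then have "continuous (at x within J) u" using J unfolding continuous_on_eq_continuous_within by blast
    moreover have "at x within J = at x within I"
    proof (rule at_within_nhd)
      show "open (ball x 1)" "x \<in> ball x 1" by auto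
      show "J \<inter> ball x 1 - {x} = I \<inter> ball x 1 - {x}"
      proof (cases "I = {0..}")
        case True
        then have "J = {0..\<bar>x\<bar>+1}" unfolding J_def by simp
        then show ?thesis using True x by (auto simp: dist_real_def)
      next
        case False
        then have "J = {-\<bar>x\<bar>-1..0}" "I = {..0}" using I unfolding J_def by auto
        then show ?thesis using x by (auto simp: dist_real_def)
      qed
    qed
    ultimately show "continuous (at x within I) u" by (simp add: continuous_within)
  qed
  show "continuous_on I y" "continuous_on I w" using assms by (auto intro: * solves_ac)
qed

text \<open>Both half lines are treated at once: \<open>sg * r\<close> runs through \<open>I\<close> and \<open>seg r\<close> is the interval between
  0 and \<open>sg * r\<close>.\<close>

definition sg :: real where "sg = (if I = {0..} then 1 else -1)"

definition seg :: "real \<Rightarrow> real set" where "seg r = {min 0 (sg * r)..max 0 (sg * r)}"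

lemma sg: "sg = 1 \<and> I = {0..} \<or> sg = -1 \<and> I = {..0}"
  using I unfolding sg_def by (auto simp: set_eq_iff)

lemma seg_sub: "0 \<le> r \<Longrightarrow> seg r \<subseteq> I" "0 \<le> r \<Longrightarrow> sg * r \<in> I"
  using sg unfolding seg_def by auto

lemma seg_mono: "0 \<le> r \<Longrightarrow> r \<le> r' \<Longrightarrow> seg r \<subseteq> seg r'"
  using sg unfolding seg_def by auto

lemma seg_ex: "x \<in> I \<Longrightarrow> x \<in> seg \<bar>x\<bar>"
  using sg unfolding seg_def by auto

lemma ac_deriv_seg:
  fixes f :: "real \<Rightarrow> real"
  assumes f: "ac_deriv I f g" and r: "0 \<le> r"
  shows "g absolutely_integrable_on seg r" "integral (seg r) g = sg * (f (sg * r) - f 0)"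
proof -
  have sub: "{min 0 (sg * r)..max 0 (sg * r)} \<subseteq> I" using seg_sub(1)[OF r] unfolding seg_def .
  show "g absolutely_integrable_on seg r" using ac_derivD(1)[OF f sub] unfolding seg_def .
  show "integral (seg r) g = sg * (f (sg * r) - f 0)"
    using ac_derivD(3)[OF f sub] sg r unfolding seg_def by (auto simp: min_def max_def)
qed

section \<open>Energy identities and Weyl solutions\<close>

abbreviation hh :: "(real \<Rightarrow> complex^'n) \<Rightarrow> real \<Rightarrow> real" where
  "hh y x \<equiv> Re (cdot (y x) (H x *v y x))"

lemma hh_nonneg: "AE x in lebesgue. x \<in> I \<longrightarrow> 0 \<le> hh y x"
  using H_psd by eventually_elim (auto simp: pos_semidef_def)

text \<open>The three forms are real because their matrices are hermitian. Hence the imaginary part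
  of the derivative is due to lam alone.\<close>

lemma sol_energy_deriv:
  assumes y: "sol lam y w"
  shows "AE x in lebesgue. x \<in> I \<longrightarrow> ((\<lambda>x. cdot (y x) (w x)) has_vector_derivative
      (complex_of_real (Re (cdot (w x) (A x *v w x)) + Re (cdot (y x) ((R x - ctranspose (Q x) ** A x ** Q x) *v y x)))
       - lam * complex_of_real (hh y x))) (at x)"
  using energy(2)[OF y] R_herm H_psd
proof eventually_elim
  case (elim x)
  show ?case
  proof
    assume x: "x \<in> I"
    have "hermitian (R x - ctranspose (Q x) ** A x ** Q x)"
    proof -
      have "ctranspose (ctranspose (Q x) ** A x ** Q x) = ctranspose (Q x) ** (ctranspose (A x) ** Q x)"
        unfolding ctranspose_mult by (simp add: ctranspose_ctranspose)
      also have "\<dots> = ctranspose (Q x) ** A x ** Q x"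
        using A_herm[OF x] unfolding hermitian_def by (simp add: matrix_mul_assoc)
      finally show ?thesis using elim(2) x unfolding hermitian_def
        by (simp add: vec_eq_iff ctranspose_def)
    qed
    note e = hermitian_cdot_real[OF this] hermitian_cdot_real[OF A_herm[OF x]]
    have "cdot (y x) (lam *s (H x *v y x)) = lam * complex_of_real (hh y x)"
      using elim(3) x hermitian_cdot_real[of "H x" "y x"] unfolding pos_semidef_def by (simp add: cdot_simps)
    then show "((\<lambda>x. cdot (y x) (w x)) has_vector_derivative
      (complex_of_real (Re (cdot (w x) (A x *v w x)) + Re (cdot (y x) ((R x - ctranspose (Q x) ** A x ** Q x) *v y x)))
       - lam * complex_of_real (hh y x))) (at x)"
      using elim(1) x e[of "y x"] e(2)[of "w x"] by simp
  qed
qed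

lemma sol_im_energy:
  assumes y: "sol lam y w"
  shows "ac_deriv I (\<lambda>x. Im (cdot (y x) (w x))) (\<lambda>x. - Im lam * hh y x)"
proof (rule locally_ac_imp_ac_deriv[OF _ I_convex])
  show "locally_abs_continuous_on I (\<lambda>x. Im (cdot (y x) (w x)))"
    by (rule locally_ac_bounded_linear[OF bounded_linear_Im energy(1)[OF y]])
  show "AE x in lebesgue. x \<in> I \<longrightarrow> ((\<lambda>x. Im (cdot (y x) (w x))) has_vector_derivative - Im lam * hh y x) (at x)"
    using sol_energy_deriv[OF y]
  proof eventually_elim
    case (elim x)
    show ?case
    proof
      assume "x \<in> I"
      from bounded_linear.has_vector_derivative[OF bounded_linear_Im elim[rule_format, OF this]]
      show "((\<lambda>x. Im (cdot (y x) (w x))) has_vector_derivative - Im lam * hh y x) (at x)" by simp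
    qed
  qed
qed

text \<open>For nonreal lam the energy on a segment is a difference of boundary values. The
  integrability of y^* H y comes from the same identity, divided by Im lam; the factor sg accounts
  for the orientation of the segment.\<close>

lemma sol_energy_integral:
  assumes y: "sol lam y w" and lam: "Im lam \<noteq> 0" and r: "0 \<le> r"
  shows "hh y absolutely_integrable_on seg r"
    and "sg * Im lam * integral (seg r) (hh y) = Im (cdot (y 0) (w 0)) - Im (cdot (y (sg * r)) (w (sg * r)))"
proof -
  note * = ac_deriv_seg[OF sol_im_energy[OF y] r]
  have "(\<lambda>x. (- 1 / Im lam) * (- Im lam * hh y x)) absolutely_integrable_on seg r"
    using *(1) by (rule set_integrable_mult_right)
  then show i: "hh y absolutely_integrable_on seg r" using lam by simp
  then have "hh y integrable_on seg r" by (simp add: absolutely_integrable_on_def)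
  then have "integral (seg r) (\<lambda>x. - Im lam * hh y x) = - Im lam * integral (seg r) (hh y)" by simp
  then have "Im lam * integral (seg r) (hh y) = - (sg * (Im (cdot (y (sg * r)) (w (sg * r))) - Im (cdot (y 0) (w 0))))"
    using *(2) by simp
  then have "sg * Im lam * integral (seg r) (hh y)
      = - ((sg * sg) * (Im (cdot (y (sg * r)) (w (sg * r))) - Im (cdot (y 0) (w 0))))"
    by (simp only: mult.assoc mult_minus_right)
  moreover have "sg * sg = 1" using sg by auto
  ultimately show "sg * Im lam * integral (seg r) (hh y) = Im (cdot (y 0) (w 0)) - Im (cdot (y (sg * r)) (w (sg * r)))"
    by simp
qed

lemma hh_integral_nonneg:
  assumes "hh y integrable_on S" "S \<subseteq> I"
  shows "0 \<le> integral S (hh y)"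
proof -
  have "integral S (\<lambda>x. 0) \<le> integral S (hh y)"
    by (rule integral_le_AE[OF integrable_0 assms(1)])
       (use hh_nonneg[of y] assms(2) in \<open>auto elim!: eventually_mono\<close>)
  then show ?thesis by simp
qed

text \<open>The sign \<open>s\<close> is chosen such that \<open>s Im (y\<^sup>* w)\<close> decreases from 0 to the far end of \<open>I\<close>; the solutions
  with \<open>y + s i w = 0\<close> at a far point then have an energy bounded by their data at 0.\<close>

lemma weyl_finite:
  fixes \<xi> :: "complex^'n"
  assumes lin: "\<And>x. linear (\<lambda>z. \<Phi> z x)" and \<Phi>0: "\<And>z. \<Phi> z 0 = z"
    and s\<Phi>: "\<And>z. sol lam (\<lambda>x. fst (\<Phi> z x)) (\<lambda>x. snd (\<Phi> z x))"
    and s: "s\<^sup>2 = 1" "0 < s * (sg * Im lam)" and r: "0 \<le> r"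
  obtains z where "fst z - (of_real s * \<i>) *s snd z = \<xi>" "norm z \<le> norm \<xi>"
    "s * (sg * Im lam) * integral (seg r) (hh (\<lambda>x. fst (\<Phi> z x))) \<le> (norm \<xi>)\<^sup>2 / 4"
proof -
  have lam: "Im lam \<noteq> 0" using s by auto
  define x where "x = sg * r"
  have xI: "x \<in> I" unfolding x_def using seg_sub(2)[OF r] .
  \<comment> \<open>N collects the condition at 0 and the one at the far point x. The bound of |z|
    by |fst (N z)| whenever snd (N z) = 0 makes N injective, so by dimension the value (\<xi>, 0) is
    attained.\<close>
  define N where "N z = (fst z - (of_real s * \<i>) *s snd z, fst (\<Phi> z x) + (of_real s * \<i>) *s snd (\<Phi> z x))" for z
  have en: "s * (sg * Im lam) * integral (seg r) (hh (\<lambda>x. fst (\<Phi> z x))) \<le> (norm (fst (N z)))\<^sup>2 / 4"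
    "norm (fst z + (of_real s * \<i>) *s snd z) \<le> norm (fst (N z))"
    if z: "snd (N z) = 0" for z
  proof -
    define E where "E = integral (seg r) (hh (\<lambda>x. fst (\<Phi> z x)))"
    have E0: "0 \<le> E"
      unfolding E_def using sol_energy_integral(1)[OF s\<Phi> lam r, of z] seg_sub(1)[OF r]
      by (intro hh_integral_nonneg) (simp_all add: absolutely_integrable_on_def)
    have "sg * Im lam * E = Im (cdot (fst z) (snd z)) - Im (cdot (fst (\<Phi> z x)) (snd (\<Phi> z x)))"
      using sol_energy_integral(2)[OF s\<Phi> lam r, of z] unfolding E_def x_def by (simp add: \<Phi>0)
    then have 1: "s * (sg * Im lam) * E = s * Im (cdot (fst z) (snd z)) - s * Im (cdot (fst (\<Phi> z x)) (snd (\<Phi> z x)))"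
      by (simp only: mult.assoc right_diff_distrib)
    \<comment> \<open>At the far point y + s i w = 0, so polarisation expresses 2 s Im (y^* w) as
      |y|^2 + |w|^2. The boundary term there may thus be dropped.\<close>
    have "0 \<le> 4 * (s * Im (cdot (fst (\<Phi> z x)) (snd (\<Phi> z x))))"
    proof -
      have "(norm (fst (\<Phi> z x) + (of_real s * \<i>) *s snd (\<Phi> z x)))\<^sup>2 = 0" using z unfolding N_def by simp
      then have "2 * s * Im (cdot (fst (\<Phi> z x)) (snd (\<Phi> z x))) = (norm (fst (\<Phi> z x)))\<^sup>2 + (norm (snd (\<Phi> z x)))\<^sup>2"
        unfolding norm_add_i_sq(1)[OF s(1)] by simp
      moreover have "0 \<le> (norm (fst (\<Phi> z x)))\<^sup>2" "0 \<le> (norm (snd (\<Phi> z x)))\<^sup>2" by simp_all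
      ultimately show ?thesis by linarith
    qed
    moreover have "4 * (s * Im (cdot (fst z) (snd z))) = (norm (fst (N z)))\<^sup>2 - (norm (fst z + (of_real s * \<i>) *s snd z))\<^sup>2"
      unfolding N_def fst_conv norm_add_i_sq[OF s(1)] by simp
    ultimately have 2: "4 * (s * (sg * Im lam) * E) \<le> (norm (fst (N z)))\<^sup>2 - (norm (fst z + (of_real s * \<i>) *s snd z))\<^sup>2"
      using 1 by linarith
    have "0 \<le> s * (sg * Im lam) * E" using s(2) E0 by simp
    then have "(norm (fst z + (of_real s * \<i>) *s snd z))\<^sup>2 \<le> (norm (fst (N z)))\<^sup>2" using 2 by linarith
    then show "norm (fst z + (of_real s * \<i>) *s snd z) \<le> norm (fst (N z))" by (rule power2_le_imp_le) simp
    have "0 \<le> (norm (fst z + (of_real s * \<i>) *s snd z))\<^sup>2" by simp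
    then show "s * (sg * Im lam) * integral (seg r) (hh (\<lambda>x. fst (\<Phi> z x))) \<le> (norm (fst (N z)))\<^sup>2 / 4"
      using 2 unfolding E_def by linarith
  qed
  \<comment> \<open>The parallelogram identity for y - s i w and y + s i w at 0. As the second is
    not longer than the first, the data z are bounded by \<xi>.\<close>
  have zn: "2 * (norm z)\<^sup>2 = (norm (fst (N z)))\<^sup>2 + (norm (fst z + (of_real s * \<i>) *s snd z))\<^sup>2" for z
    unfolding N_def fst_conv norm_add_i_sq[OF s(1)]
    by (simp add: norm_prod_def)
  have zle: "norm z \<le> norm (fst (N z))" if "snd (N z) = 0" for z
  proof -
    have "(norm (fst z + (of_real s * \<i>) *s snd z))\<^sup>2 \<le> (norm (fst (N z)))\<^sup>2" using en(2)[OF that] by (intro power_mono) auto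
    then have "(norm z)\<^sup>2 \<le> (norm (fst (N z)))\<^sup>2" using zn[of z] by linarith
    then show ?thesis by (rule power2_le_imp_le) simp
  qed
  have linN: "linear N"
  proof (rule linearI)
    fix u v show "N (u + v) = N u + N v"
      unfolding N_def linear_add[OF lin] by (simp add: vector_add_ldistrib algebra_simps)
    fix c show "N (c *\<^sub>R u) = c *\<^sub>R N u"
      unfolding N_def linear_cmul[OF lin]
      by (simp add: scaleR_eq_cscale vector_smult_assoc vector_ssub_ldistrib vector_add_ldistrib mult.commute mult.left_commute)
  qed
  have "inj N"
    unfolding linear_injective_0[OF linN]
  proof (intro allI impI)
    fix z assume "N z = 0"
    then show "z = 0" using zle[of z] by simp
  qed
  then have "surj N" using linear_injective_imp_surjective[OF linN] by blast
  then obtain z where z: "N z = (\<xi>, 0)" unfolding surj_def by metis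
  show thesis
  proof (rule that)
    show "fst z - (of_real s * \<i>) *s snd z = \<xi>" using z unfolding N_def by simp
    show "norm z \<le> norm \<xi>" using zle[of z] z by simp
    show "s * (sg * Im lam) * integral (seg r) (hh (\<lambda>x. fst (\<Phi> z x))) \<le> (norm \<xi>)\<^sup>2 / 4" using en(1)[of z] z by simp
  qed
qed

text \<open>The data of \<open>weyl_finite\<close> stay in a ball as \<open>r\<close> grows, so they have an accumulation point.\<close>

lemma weyl_infinite:
  fixes \<xi> :: "complex^'n"
  assumes s: "s\<^sup>2 = 1" "0 < s * (sg * Im lam)"
  obtains y w where "sol lam y w" "y 0 - (of_real s * \<i>) *s w 0 = \<xi>"
    "\<And>r. 0 \<le> r \<Longrightarrow> s * (sg * Im lam) * integral (seg r) (hh y) \<le> (norm \<xi>)\<^sup>2 / 4"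
proof -
  have lam: "Im lam \<noteq> 0" using s by auto
  obtain \<Phi> :: "(complex^'n) \<times> (complex^'n) \<Rightarrow> real \<Rightarrow> (complex^'n) \<times> (complex^'n)"
    where \<Phi>: "\<And>x. linear (\<lambda>z. \<Phi> z x)" "\<And>z. \<Phi> z 0 = z"
    "\<And>z. sol lam (\<lambda>x. fst (\<Phi> z x)) (\<lambda>x. snd (\<Phi> z x))" by (rule flow_exists) blast
  define good where "good m z \<longleftrightarrow> fst z - (of_real s * \<i>) *s snd z = \<xi> \<and> norm z \<le> norm \<xi> \<and>
    s * (sg * Im lam) * integral (seg (real m)) (hh (\<lambda>x. fst (\<Phi> z x))) \<le> (norm \<xi>)\<^sup>2 / 4" for m z
  have "\<forall>m. \<exists>z. good m z"
  proof
    fix m :: nat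
    show "\<exists>z. good m z"
      by (rule weyl_finite[OF \<Phi> s, of "real m" \<xi>]) (simp, unfold good_def, blast)
  qed
  from choice[OF this] obtain Z where "\<forall>m. good m (Z m)" by blast
  then obtain Z where Z: "\<And>m. fst (Z m) - (of_real s * \<i>) *s snd (Z m) = \<xi>" "\<And>m. norm (Z m) \<le> norm \<xi>"
    "\<And>m. s * (sg * Im lam) * integral (seg (real m)) (hh (\<lambda>x. fst (\<Phi> (Z m) x))) \<le> (norm \<xi>)\<^sup>2 / 4"
    unfolding good_def by blast+
  have "seq_compact (cball (0::(complex^'n) \<times> (complex^'n)) (norm \<xi>))"
    using compact_cball compact_imp_seq_compact by blast
  then obtain z k where zk: "strict_mono (k::nat\<Rightarrow>nat)" "(Z \<circ> k) \<longlonglongrightarrow> z"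
    using seq_compactE[of "cball 0 (norm \<xi>)" Z] Z(2) by (metis mem_cball_0)
  define e where "e z r = s * (sg * Im lam) * integral (seg r) (hh (\<lambda>x. fst (\<Phi> z x)))" for z r
  \<comment> \<open>In terms of boundary values the energy is visibly continuous in z, so no limit
    has to be taken under the integral.\<close>
  have e_eq: "e z r = s * (Im (cdot (fst z) (snd z)) - Im (cdot (fst (\<Phi> z (sg * r))) (snd (\<Phi> z (sg * r)))))"
    if "0 \<le> r" for z r
    using sol_energy_integral(2)[OF \<Phi>(3) lam that, of z] unfolding e_def by (simp add: \<Phi>(2) mult.assoc)
  have e_mono: "e z r \<le> e z r'" if "0 \<le> r" "r \<le> r'" for z r r'
  proof -
    have i: "hh (\<lambda>x. fst (\<Phi> z x)) integrable_on seg r" "hh (\<lambda>x. fst (\<Phi> z x)) integrable_on seg r'"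
      using sol_energy_integral(1)[OF \<Phi>(3) lam, of r z] sol_energy_integral(1)[OF \<Phi>(3) lam, of r' z] that
      by (auto simp: absolutely_integrable_on_def)
    obtain N where N: "negligible N" "\<And>x. x \<notin> N \<Longrightarrow> x \<in> I \<longrightarrow> 0 \<le> hh (\<lambda>x. fst (\<Phi> z x)) x"
      using AE_lebesgue_negligibleE[OF hh_nonneg[of "\<lambda>x. fst (\<Phi> z x)"]] by blast
    define g where "g x = (if x \<in> N then 0 else hh (\<lambda>x. fst (\<Phi> z x)) x)" for x
    have g: "(g has_integral integral (seg r'') (hh (\<lambda>x. fst (\<Phi> z x)))) (seg r'')"
      if "hh (\<lambda>x. fst (\<Phi> z x)) integrable_on seg r''" for r''
      by (rule has_integral_spike[OF N(1) _ integrable_integral[OF that]]) (auto simp: g_def)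
    have "integral (seg r) (hh (\<lambda>x. fst (\<Phi> z x))) \<le> integral (seg r') (hh (\<lambda>x. fst (\<Phi> z x)))"
    proof (rule has_integral_subset_le[OF seg_mono[OF that] g[OF i(1)] g[OF i(2)]])
      have "seg r' \<subseteq> I" using seg_sub(1) that by auto
      then show "\<forall>x\<in>seg r'. 0 \<le> g x" unfolding g_def using N(2) by auto
    qed
    then show ?thesis unfolding e_def using s(2) by (intro mult_left_mono) auto
  qed
  have e_cont: "(\<lambda>m. e ((Z \<circ> k) m) r) \<longlonglongrightarrow> e z r" if r: "0 \<le> r" for r
  proof -
    have "(\<lambda>m. \<Phi> ((Z \<circ> k) m) x) \<longlonglongrightarrow> \<Phi> z x" for x
      using linear_continuous_at[OF \<Phi>(1)[unfolded linear_conv_bounded_linear]] zk(2)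
      by (rule isCont_tendsto_compose)
    then show ?thesis
      unfolding e_eq[OF r] using zk(2)
      by (intro tendsto_mult tendsto_const tendsto_diff tendsto_Im bounded_bilinear.tendsto[OF bounded_bilinear_cdot] tendsto_fst tendsto_snd)
  qed
  show thesis
  proof (rule that[OF \<Phi>(3)])
    have "(\<lambda>m. fst ((Z \<circ> k) m) - (of_real s * \<i>) *s snd ((Z \<circ> k) m)) \<longlonglongrightarrow> fst z - (of_real s * \<i>) *s snd z"
      by (intro tendsto_diff tendsto_fst zk(2) bounded_linear.tendsto[OF bounded_linear_cscale] tendsto_snd)
    then have "fst z - (of_real s * \<i>) *s snd z = \<xi>" using Z(1) by (simp add: LIMSEQ_const_iff)
    then show "fst (\<Phi> z 0) - (of_real s * \<i>) *s snd (\<Phi> z 0) = \<xi>" by (simp add: \<Phi>(2))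
    fix r :: real assume r: "0 \<le> r"
    \<comment> \<open>Once k m >= r, monotonicity in the segment transfers the bound from
      \<open>seg (k m)\<close> to the fixed segment \<open>seg r\<close>, and there the limit in m
      is taken.\<close>
    have "e z r \<le> (norm \<xi>)\<^sup>2 / 4"
    proof (rule tendsto_upperbound[OF e_cont[OF r]])
      obtain n where n: "r \<le> real n" using real_arch_simple by blast
      show "\<forall>\<^sub>F m in sequentially. e ((Z \<circ> k) m) r \<le> (norm \<xi>)\<^sup>2 / 4"
      proof (rule eventually_mono[OF eventually_ge_at_top[of n]])
        fix m assume "n \<le> m"
        then have "n \<le> k m" using seq_suble[OF zk(1), of m] by linarith
        then have "r \<le> real (k m)" using n by linarith
        then have "e (Z (k m)) r \<le> e (Z (k m)) (real (k m))" by (rule e_mono[OF r])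
        also have "\<dots> \<le> (norm \<xi>)\<^sup>2 / 4" unfolding e_def by (rule Z(3))
        finally show "e ((Z \<circ> k) m) r \<le> (norm \<xi>)\<^sup>2 / 4" by simp
      qed
    qed simp
    then show "s * (sg * Im lam) * integral (seg r) (hh (\<lambda>x. fst (\<Phi> z x))) \<le> (norm \<xi>)\<^sup>2 / 4" unfolding e_def .
  qed
qed

end

section \<open>Zero sets, semidefinite forms and dimension counting\<close>

lemma negligible_isolated_points:
  fixes Z :: "real set"
  shows "negligible {x \<in> Z. \<not> x islimpt Z}"
proof -
  define D where "D = {x \<in> Z. \<not> x islimpt Z}"
  have "\<exists>p\<in>\<rat> \<times> \<rat>. Z \<inter> {fst p<..<snd p} = {x}" if x: "x \<in> D" for x
  proof -
    obtain e where e: "e > 0" "\<And>y. y \<in> Z \<Longrightarrow> y \<noteq> x \<Longrightarrow> \<not> dist y x < e"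
      using x unfolding D_def islimpt_approachable by blast
    obtain r where r: "r \<in> \<rat>" "x - e < r" "r < x" using Rats_dense_in_real[of "x - e" x] e by auto
    obtain s where s: "s \<in> \<rat>" "x < s" "s < x + e" using Rats_dense_in_real[of x "x + e"] e by auto
    have "Z \<inter> {r<..<s} = {x}"
    proof (intro equalityI subsetI)
      fix y assume y: "y \<in> Z \<inter> {r<..<s}"
      then have "dist y x < e" using r s unfolding dist_real_def by auto
      then show "y \<in> {x}" using e(2)[of y] y by blast
    next
      fix y assume "y \<in> {x}"
      then show "y \<in> Z \<inter> {r<..<s}" using x r s unfolding D_def by auto
    qed
    then show ?thesis using r s by (intro bexI[of _ "(r, s)"]) auto
  qed
  then have "\<forall>x. \<exists>p. x \<in> D \<longrightarrow> p \<in> \<rat> \<times> \<rat> \<and> Z \<inter> {fst p<..<snd p} = {x}" by blast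
  from choice[OF this] obtain f where f: "\<And>x. x \<in> D \<Longrightarrow> f x \<in> \<rat> \<times> \<rat> \<and> Z \<inter> {fst (f x)<..<snd (f x)} = {x}" by blast
  have "countable D"
  proof (rule countable_image_inj_on[of f])
    have "countable ((\<rat>::real set) \<times> (\<rat>::real set))" by (intro countable_SIGMA countable_rat)
    then show "countable (f ` D)" by (rule countable_subset[rotated]) (use f in blast)
    show "inj_on f D"
    proof (rule inj_onI)
      fix x y assume xy: "x \<in> D" "y \<in> D" "f x = f y"
      have "{x} = Z \<inter> {fst (f x)<..<snd (f x)}" using f[OF xy(1)] by blast
      also have "\<dots> = Z \<inter> {fst (f y)<..<snd (f y)}" unfolding xy(3) ..
      also have "\<dots> = {y}" using f[OF xy(2)] by blast
      finally show "x = y" by (rule singleton_inject)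
    qed
  qed
  then show ?thesis
    unfolding D_def negligible_iff_null_sets
    by (intro null_sets_completionI countable_imp_null_set_lborel)
qed

lemma vector_derivative_zero_of_zeros:
  assumes d: "(y has_vector_derivative v) (at x)" and l: "x islimpt Z" and z: "\<And>t. t \<in> Z \<Longrightarrow> y t = 0" "x \<in> Z"
  shows "v = 0"
proof (rule vector_derivative_unique_within)
  show "at x within Z \<noteq> bot" using l by (simp add: trivial_limit_within)
  show "(y has_vector_derivative v) (at x within Z)" using d by (rule has_vector_derivative_at_within)
  show "(y has_vector_derivative 0) (at x within Z)"
    by (rule has_vector_derivative_transform[OF z(2) _ has_vector_derivative_const[of 0]]) (simp add: z(1))
qed

text \<open>Positivity of the form at v - c w, with a phase c that makes the mixed term real. This
  additive version of Cauchy-Schwarz provides an integrable majorant for mixed products without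
  square roots.\<close>

lemma psd_cross:
  assumes M: "pos_semidef M"
  shows "norm (cdot v (M *v w)) \<le> (Re (cdot v (M *v v)) + Re (cdot w (M *v w))) / 2"
proof (cases "cdot v (M *v w) = 0")
  case True
  then show ?thesis using M unfolding pos_semidef_def by simp
next
  case False
  have h: "hermitian M" using M unfolding pos_semidef_def by blast
  define c where "c = cnj (cdot v (M *v w)) / of_real (norm (cdot v (M *v w)))"
  have c: "c * cdot v (M *v w) = of_real (norm (cdot v (M *v w)))" "cnj c * c = 1"
  proof -
    have "cdot v (M *v w) * cnj (cdot v (M *v w)) = (of_real (norm (cdot v (M *v w))))\<^sup>2"
      using complex_norm_square[of "cdot v (M *v w)"] by simp
    then show "c * cdot v (M *v w) = of_real (norm (cdot v (M *v w)))" "cnj c * c = 1"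
      using False unfolding c_def by (simp_all add: mult.commute power2_eq_square)
  qed
  have "cdot (c *s w) (M *v (c *s w)) = cnj c * c * cdot w (M *v w)"
    by (simp add: vector_scalar_commute cdot_simps mult.left_commute)
  then have cw: "cdot (c *s w) (M *v (c *s w)) = cdot w (M *v w)" using c(2) by simp
  have vcw: "cdot v (M *v (c *s w)) = of_real (norm (cdot v (M *v w)))"
    using c(1) by (simp add: vector_scalar_commute cdot_simps)
  have cwv: "cdot (c *s w) (M *v v) = of_real (norm (cdot v (M *v w)))"
    using arg_cong[OF vcw, of cnj] hermitian_cdot[OF h, of "c *s w" v] cdot_cnj[of v "M *v (c *s w)"] by simp
  have "0 \<le> Re (cdot (v - c *s w) (M *v (v - c *s w)))" using M unfolding pos_semidef_def by blast
  also have "cdot (v - c *s w) (M *v (v - c *s w))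
     = cdot v (M *v v) - cdot v (M *v (c *s w)) - (cdot (c *s w) (M *v v) - cdot (c *s w) (M *v (c *s w)))"
    by (simp add: matrix_vector_mult_diff_distrib cdot_diff_left cdot_diff_right)
  finally show ?thesis unfolding vcw cwv cw by simp
qed

lemma lin_comb_fun:
  "lin_comb fun_add fun_scale (\<lambda>x. 0) a F k = (\<lambda>x. \<Sum>i<k. a i *s F i x)"
  by (induction k) (auto simp: fun_add_def fun_scale_def)

lemma complex_dim_eqI:
  assumes "\<exists>F. (\<forall>i<n. F i \<in> V) \<and> (\<forall>a. lin_comb add scl z a F n = z \<longrightarrow> (\<forall>i<n. a i = 0))"
    and "\<And>k F. n < k \<Longrightarrow> (\<And>i. i < k \<Longrightarrow> F i \<in> V) \<Longrightarrow> \<exists>a. lin_comb add scl z a F k = z \<and> (\<exists>i<k. a i \<noteq> 0)"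
  shows "complex_dim add scl z V = enat n"
  unfolding complex_dim_def
proof (rule antisym)
  show "(SUP k \<in> {k. \<exists>F. (\<forall>i<k. F i \<in> V) \<and> (\<forall>a. lin_comb add scl z a F k = z \<longrightarrow> (\<forall>i<k. a i = 0))}. enat k) \<le> enat n"
  proof (rule SUP_least)
    fix k assume "k \<in> {k. \<exists>F. (\<forall>i<k. F i \<in> V) \<and> (\<forall>a. lin_comb add scl z a F k = z \<longrightarrow> (\<forall>i<k. a i = 0))}"
    then obtain F where F: "\<forall>i<k. F i \<in> V" "\<forall>a. lin_comb add scl z a F k = z \<longrightarrow> (\<forall>i<k. a i = 0)" by blast
    have "\<not> n < k" using assms(2)[of k F] F by blast
    then show "enat k \<le> enat n" by simp
  qed
  show "enat n \<le> (SUP k \<in> {k. \<exists>F. (\<forall>i<k. F i \<in> V) \<and> (\<forall>a. lin_comb add scl z a F k = z \<longrightarrow> (\<forall>i<k. a i = 0))}. enat k)"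
    by (rule SUP_upper) (use assms(1) in blast)
qed

text \<open>\<open>vec.dependent\<close> is a property of a set of vectors. A family with a
  repetition is therefore treated separately, by a relation with coefficients 1 and -1.\<close>

lemma vectors_dependent:
  fixes v :: "nat \<Rightarrow> complex^'n"
  assumes k: "CARD('n) < k"
  shows "\<exists>a. (\<Sum>i<k. a i *s v i) = 0 \<and> (\<exists>i<k. a i \<noteq> 0)"
proof (cases "inj_on v {..<k}")
  case True
  have fin: "finite (v ` {..<k})" by simp
  have "vec.dependent (v ` {..<k})"
  proof (rule ccontr)
    assume "\<not> vec.dependent (v ` {..<k})"
    then have "card (v ` {..<k}) \<le> vec.dim (UNIV :: (complex^'n) set)"
      by (intro vec.independent_card_le_dim) auto
    then show False using k card_image[OF True] vec_dim_card[where ?'a=complex and ?'n='n] by simp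
  qed
  then obtain u where u: "\<exists>x\<in>v ` {..<k}. u x \<noteq> 0" "(\<Sum>x\<in>v ` {..<k}. u x *s x) = 0"
    unfolding vec.dependent_finite[OF fin] by blast
  show ?thesis
  proof (rule exI[of _ "u \<circ> v"], rule conjI)
    show "(\<Sum>i<k. (u \<circ> v) i *s v i) = 0" using u(2) unfolding sum.reindex[OF True] by (simp add: o_def)
    show "\<exists>i<k. (u \<circ> v) i \<noteq> 0" using u(1) by auto
  qed
next
  case False
  then obtain i j where ij: "i < k" "j < k" "i \<noteq> j" "v i = v j" unfolding inj_on_def by blast
  define a where "a m = (if m = i then 1 else if m = j then -1 else 0 :: complex)" for m
  have "(\<Sum>m<k. a m *s v m) = (\<Sum>m<k. (if m = i then v i else 0) + (if m = j then - v j else 0))"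
    using ij by (intro sum.cong) (auto simp: a_def)
  also have "\<dots> = 0" unfolding sum.distrib using ij by simp
  finally show ?thesis using ij(1) by (intro exI[of _ a]) (auto simp: a_def)
qed

context sl_system
begin

text \<open>At an accumulation point of its zeros, \<open>y\<close> and almost everywhere also \<open>y'\<close> vanish, and then so does \<open>w\<close>.\<close>

lemma sol_vanish_imp:
  assumes s: "sol lam y w" and ab: "{a..b} \<subseteq> I"
    and z: "AE x in lebesgue. x \<in> {a..b} \<longrightarrow> y x = 0 \<or> det (H x) = 0"
    and nd: "\<not> (AE x in lebesgue. x \<in> {a..b} \<longrightarrow> det (H x) = 0)"
    and x: "x \<in> I"
  shows "y x = 0 \<and> w x = 0"
proof (rule ccontr)
  assume not0: "\<not> (y x = 0 \<and> w x = 0)"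
  define Z where "Z = {t \<in> {a..b}. y t = 0}"
  have "AE t in lebesgue. t \<notin> {t \<in> Z. \<not> t islimpt Z}"
    by (intro AE_not_in) (simp add: negligible_isolated_points flip: negligible_iff_null_sets)
  then have "AE t in lebesgue. t \<in> {a..b} \<longrightarrow> det (H t) = 0"
    using z solves_ac(3)[OF s]
  proof eventually_elim
    case (elim t)
    show ?case
    proof (intro impI, rule ccontr)
      assume t: "t \<in> {a..b}" "det (H t) \<noteq> 0"
      then have tI: "t \<in> I" and tZ: "t \<in> Z" using elim(2) ab unfolding Z_def by auto
      have "A t *v (w t - Q t *v y t) = 0"
      proof (rule vector_derivative_zero_of_zeros)
        show "(y has_vector_derivative A t *v (w t - Q t *v y t)) (at t)" using elim(3) tI by blast
        show "t islimpt Z" using elim(1) tZ by blast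
      qed (use tZ in \<open>auto simp: Z_def\<close>)
      moreover have "y t = 0" using tZ unfolding Z_def by simp
      ultimately have "A t *v w t = 0" by simp
      then have "w t = 0"
        using invertible_matrix_inv_mult(2)[OF pos_def_invertible[OF bspec[OF A_pos tI]], of "w t"] by simp
      then show False using sol_unique[OF s tI \<open>y t = 0\<close> _ x] not0 by blast
    qed
  qed
  with nd show False by blast
qed

lemma I_closed: "closed I"
  using I by auto

lemma I_sets_borel: "I \<in> sets borel"
  using I_closed by (rule borel_closed)

lemma I_sets: "I \<in> sets lebesgue"
  using I_sets_borel by simp

lemma not_AE_notin_I: "\<not> (AE x in lebesgue. x \<notin> I)"
proof
  assume "AE x in lebesgue. x \<notin> I"
  then have "I \<in> null_sets lebesgue" by (simp add: AE_iff_null_sets I_sets)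
  then have "negligible {min 0 sg..max 0 sg}"
    using seg_sub(1)[of 1] unfolding seg_def negligible_iff_null_sets[symmetric] by (auto intro: negligible_subset)
  then show False using sg by (auto simp: negligible_interval(1)[where 'a=real, simplified])
qed

text \<open>If y = 0 on I, then y' = 0 gives A w = 0 almost everywhere, so w vanishes together with
  y at some point and uniqueness applies. This lets a linear relation among the y parts of solutions
  carry over to the w parts.\<close>

lemma sol_zero_imp:
  assumes s: "sol lam y w" and z: "\<And>x. x \<in> I \<Longrightarrow> y x = 0" and x: "x \<in> I"
  shows "w x = 0"
proof (rule ccontr)
  assume not0: "w x \<noteq> 0"
  have "AE t in lebesgue. t \<notin> {t \<in> I. \<not> t islimpt I}"
    by (intro AE_not_in) (simp add: negligible_isolated_points flip: negligible_iff_null_sets)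
  then have "AE t in lebesgue. t \<notin> I"
    using solves_ac(3)[OF s]
  proof eventually_elim
    case (elim t)
    show ?case
    proof
      assume t: "t \<in> I"
      have "A t *v (w t - Q t *v y t) = 0"
        by (rule vector_derivative_zero_of_zeros[of y _ t I]) (use elim t z in auto)
      then have "A t *v w t = 0" using z[OF t] by simp
      then have "w t = 0"
        using invertible_matrix_inv_mult(2)[OF pos_def_invertible[OF bspec[OF A_pos t]], of "w t"] by simp
      then show False using sol_unique(2)[OF s t z[OF t] _ x] not0 by blast
    qed
  qed
  then show False using not_AE_notin_I by blast
qed

text \<open>Needed because square-integrable functions are made to vanish off I. This can destroy
  the two-sided derivative at the end point 0, but the integral form of the system only sees values
  in I.\<close>

lemma solves_cong:
  assumes s: "solves y w f" and e: "\<And>x. x \<in> I \<Longrightarrow> y' x = y x" "\<And>x. x \<in> I \<Longrightarrow> w' x = w x"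
    "\<And>x. x \<in> I \<Longrightarrow> f' x = f x"
  shows "solves y' w' f'"
proof -
  have cong: "ac_deriv I f' g'" if f: "ac_deriv I f g" and fg: "\<And>x. x \<in> I \<Longrightarrow> f' x = f x" "\<And>x. x \<in> I \<Longrightarrow> g' x = g x"
    for f g f' g' :: "real \<Rightarrow> complex^'n"
  proof (rule ac_derivI)
    fix a b assume ab: "a \<le> b" "{a..b} \<subseteq> I"
    show "g' absolutely_integrable_on {a..b}"
      by (rule absolutely_integrable_cong_AE[OF AE_I2 ac_derivD(1)[OF f ab(2)]]) (use fg ab in auto)
    have "(g' has_integral (f b - f a)) {a..b}"
      by (rule has_integral_cong_AE[OF AE_I2 ac_derivD(2)[OF f ab(2,1)]]) (use fg ab in auto)
    moreover have "f' b = f b" "f' a = f a" using fg(1) ab by auto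
    ultimately show "(g' has_integral (f' b - f' a)) {a..b}" by simp
  qed
  have s1: "ac_deriv I y (\<lambda>x. A x *v (w x - Q x *v y x))"
    and s2: "ac_deriv I w (\<lambda>x. ctranspose (Q x) *v (A x *v (w x - Q x *v y x)) + R x *v y x - f x)"
    using s unfolding solves_def by blast+
  show ?thesis
    unfolding solves_def
  proof
    show "ac_deriv I y' (\<lambda>x. A x *v (w' x - Q x *v y' x))"
      by (rule cong[OF s1]) (simp_all only: e)
    show "ac_deriv I w' (\<lambda>x. ctranspose (Q x) *v (A x *v (w' x - Q x *v y' x)) + R x *v y' x - f' x)"
      by (rule cong[OF s2]) (simp_all only: e)
  qed
qed

lemma sol_cong:
  assumes s: "sol lam y w" and e: "\<And>x. x \<in> I \<Longrightarrow> y' x = y x" "\<And>x. x \<in> I \<Longrightarrow> w' x = w x"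
  shows "sol lam y' w'"
  by (rule solves_cong[OF s]) (simp_all only: e)

section \<open>Measurability and linear structure of the weighted space\<close>

lemma H_measurable: "(\<lambda>x. indicator I x *\<^sub>R H x) \<in> borel_measurable lebesgue"
proof (rule borel_measurable_LIMSEQ_metric)
  show "(\<lambda>x. indicator (seg (real m)) x *\<^sub>R H x) \<in> borel_measurable lebesgue" for m
    using locally_integrableD[OF H_int, of "min 0 (sg * real m)" "max 0 (sg * real m)"] seg_sub(1)[of "real m"]
    unfolding seg_def set_integrable_def by auto
  fix x :: real
  obtain n where n: "\<bar>x\<bar> \<le> real n" using real_arch_simple by blast
  have "\<forall>\<^sub>F m in sequentially. indicator (seg (real m)) x *\<^sub>R H x = indicator I x *\<^sub>R H x"
  proof (rule eventually_mono[OF eventually_ge_at_top[of n]])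
    fix m assume "n \<le> m"
    then have "\<bar>x\<bar> \<le> real m" using n by linarith
    then have "x \<in> seg (real m) \<longleftrightarrow> x \<in> I"
      using seg_ex[of x] seg_mono[of "\<bar>x\<bar>" "real m"] seg_sub(1)[of "real m"] by auto
    then show "indicator (seg (real m)) x *\<^sub>R H x = indicator I x *\<^sub>R H x" by (simp add: indicator_def)
  qed
  then show "(\<lambda>m. indicator (seg (real m)) x *\<^sub>R H x) \<longlonglongrightarrow> indicator I x *\<^sub>R H x" by (rule tendsto_eventually)
qed

lemma cross_measurable:
  assumes f: "f \<in> borel_measurable borel" and g: "g \<in> borel_measurable borel"
  shows "set_borel_measurable lebesgue I (\<lambda>x. cdot (f x) (H x *v g x))"
proof -
  have fl: "f \<in> borel_measurable lebesgue" "g \<in> borel_measurable lebesgue"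
    using f g by (auto intro: measurable_completion)
  have bmv: "bounded_bilinear (\<lambda>(v::complex^'n) (M::complex^'n^'n). M *v v)"
    using bilinear_matrix_vector bilinear_conv_bounded_bilinear by blast
  have "(\<lambda>x. (indicator I x *\<^sub>R H x) *v g x) \<in> borel_measurable lebesgue"
    by (rule borel_measurable_continuous_Pair[OF H_measurable fl(2)])
       (intro bounded_bilinear.continuous_on[OF bmv] continuous_intros)
  then have "(\<lambda>x. cdot (f x) ((indicator I x *\<^sub>R H x) *v g x)) \<in> borel_measurable lebesgue"
    by (rule borel_measurable_continuous_Pair[OF fl(1)])
       (intro bounded_bilinear.continuous_on[OF bounded_bilinear_cdot] continuous_intros)
  moreover have "cdot (f x) ((indicator I x *\<^sub>R H x) *v g x) = indicator I x *\<^sub>R cdot (f x) (H x *v g x)" for x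
    by (simp add: indicator_def cdot_simps)
  ultimately show ?thesis unfolding set_borel_measurable_def by simp
qed

lemma L2_hh: "f \<in> L2fun I H \<Longrightarrow> set_integrable lebesgue I (hh f)"
  unfolding L2fun_def set_integrable_def using integrable_Re by fastforce

lemma L2_cross:
  assumes f: "f \<in> L2fun I H" and g: "g \<in> L2fun I H"
  shows "set_integrable lebesgue I (\<lambda>x. cdot (f x) (H x *v g x))"
proof (rule set_integrable_bound)
  show "set_integrable lebesgue I (\<lambda>x. (hh f x + hh g x) / 2)"
    by (intro set_integrable_divide set_integral_add(1) L2_hh f g)
  show "set_borel_measurable lebesgue I (\<lambda>x. cdot (f x) (H x *v g x))"
    by (rule cross_measurable) (use f g in \<open>auto simp: L2fun_def\<close>)
  show "AE x in lebesgue. x \<in> I \<longrightarrow> norm (cdot (f x) (H x *v g x)) \<le> norm ((hh f x + hh g x) / 2)"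
    using H_psd
  proof eventually_elim
    case (elim x)
    then show ?case using psd_cross[of "H x" "f x" "g x"] by (auto intro: order_trans)
  qed
qed

lemma L2_add:
  assumes f: "f \<in> L2fun I H" and g: "g \<in> L2fun I H"
  shows "(\<lambda>x. f x + g x) \<in> L2fun I H"
proof -
  have "set_integrable lebesgue I (\<lambda>x. (cdot (f x) (H x *v f x) + cdot (f x) (H x *v g x)) + (cdot (g x) (H x *v f x) + cdot (g x) (H x *v g x)))"
    by (intro set_integral_add(1) L2_cross f g)
  then have "set_integrable lebesgue I (\<lambda>x. cdot (f x + g x) (H x *v (f x + g x)))"
    by (simp add: cdot_simps matrix_vector_right_distrib algebra_simps)
  then show ?thesis using f g unfolding L2fun_def by auto
qed

lemma L2_scale:
  assumes f: "f \<in> L2fun I H"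
  shows "(\<lambda>x. c *s f x) \<in> L2fun I H"
proof -
  have "set_integrable lebesgue I (\<lambda>x. (cnj c * c) * cdot (f x) (H x *v f x))"
    by (intro set_integrable_mult_right) (use f in \<open>simp add: L2fun_def\<close>)
  then have "set_integrable lebesgue I (\<lambda>x. cdot (c *s f x) (H x *v (c *s f x)))"
    by (simp add: cdot_simps vector_scalar_commute mult_ac)
  moreover have "(\<lambda>x. c *s f x) \<in> borel_measurable borel"
  proof -
    have "(\<lambda>v::complex^'n. c *s v) \<in> borel_measurable borel"
      by (intro borel_measurable_continuous_onI linear_continuous_on bounded_linear_cscale)
    then show ?thesis using f unfolding L2fun_def by (auto intro: measurable_compose)
  qed
  ultimately show ?thesis using f unfolding L2fun_def by auto
qed

lemma L2_0: "(\<lambda>x. 0) \<in> L2fun I H"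
  unfolding L2fun_def by (simp add: cdot_simps set_integrable_def)

lemma L2_diff:
  assumes f: "f \<in> L2fun I H" and g: "g \<in> L2fun I H"
  shows "(\<lambda>x. f x - g x) \<in> L2fun I H"
  using L2_add[OF f L2_scale[OF g, of "-1"]] by simp

lemma L2_sum:
  assumes "\<And>i. i < (k::nat) \<Longrightarrow> F i \<in> L2fun I H"
  shows "(\<lambda>x. \<Sum>i<k. a i *s F i x) \<in> L2fun I H"
  using assms
proof (induction k)
  case (Suc k)
  then have "(\<lambda>x. \<Sum>i<k. a i *s F i x) \<in> L2fun I H" "F k \<in> L2fun I H" by simp_all
  from L2_add[OF this(1) L2_scale[OF this(2)]] show ?case by simp
qed (simp add: L2_0)

lemma restrict_measurable:
  fixes y :: "real \<Rightarrow> complex^'n"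
  assumes "continuous_on I y"
  shows "(\<lambda>x. if x \<in> I then y x else 0) \<in> borel_measurable borel"
proof -
  have "(\<lambda>x. if x \<in> I then y x else 0) = (\<lambda>x. indicator I x *\<^sub>R y x)" by (auto simp: indicator_def)
  then show ?thesis using borel_measurable_continuous_on_indicator[OF I_sets_borel assms] by simp
qed

lemma L2_of_hh:
  assumes m: "f \<in> borel_measurable borel" and 0: "\<And>x. x \<notin> I \<Longrightarrow> f x = 0"
    and i: "set_integrable lebesgue I (hh f)"
  shows "f \<in> L2fun I H"
proof -
  have "set_integrable lebesgue I (\<lambda>x. cdot (f x) (H x *v f x))"
  proof (rule set_integrable_bound[OF i cross_measurable[OF m m]])
    show "AE x in lebesgue. x \<in> I \<longrightarrow> norm (cdot (f x) (H x *v f x)) \<le> norm (hh f x)"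
      using H_psd
    proof eventually_elim
      case (elim x)
      show ?case
      proof
        assume "x \<in> I"
        then have "hermitian (H x)" using elim unfolding pos_semidef_def by blast
        from hermitian_cdot_real[OF this, of "f x"] show "norm (cdot (f x) (H x *v f x)) \<le> norm (hh f x)"
          by (metis norm_of_real order_refl real_norm_def)
      qed
    qed
  qed
  then show ?thesis using m 0 unfolding L2fun_def by auto
qed

text \<open>Monotone convergence along the segments \<open>seg m\<close>. The integrand is
  nonnegative only almost everywhere, so it is first set to 0 on a negligible set and off I.\<close>

lemma bounded_energy_L2:
  assumes s: "sol lam y w" and lam: "Im lam \<noteq> 0" and B: "\<And>r. 0 \<le> r \<Longrightarrow> integral (seg r) (hh y) \<le> B"
  shows "(\<lambda>x. if x \<in> I then y x else 0) \<in> L2fun I H"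
proof (rule L2_of_hh[OF restrict_measurable[OF sol_continuous(1)[OF s]]])
  obtain N where N: "negligible N" "\<And>x. x \<notin> N \<Longrightarrow> x \<in> I \<longrightarrow> 0 \<le> hh y x"
    by (rule AE_lebesgue_negligibleE[OF hh_nonneg[of y]]) blast
  define g where "g x = (if x \<in> I - N then hh y x else 0)" for x
  have g0: "0 \<le> g x" for x unfolding g_def using N(2) by auto
  have hi: "hh y integrable_on seg r" if "0 \<le> r" for r
    using sol_energy_integral(1)[OF s lam that] by (simp add: absolutely_integrable_on_def)
  have gi: "(g has_integral integral (seg r) (hh y)) (seg r)" if r: "0 \<le> r" for r
    by (rule has_integral_spike[OF N(1) _ integrable_integral[OF hi[OF r]]]) (use seg_sub(1)[OF r] in \<open>auto simp: g_def\<close>)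
  define f where "f m x = (if x \<in> seg (real m) then g x else 0)" for m :: nat and x
  have fi: "(f m has_integral integral (seg (real m)) (hh y)) UNIV" for m
    using gi[of "real m"] unfolding f_def by (simp add: has_integral_restrict_UNIV)
  have "g integrable_on UNIV \<and> (\<lambda>m. integral UNIV (f m)) \<longlonglongrightarrow> integral UNIV g"
  proof (rule monotone_convergence_increasing)
    show "f m integrable_on UNIV" for m using fi by (rule has_integral_integrable)
    show "f m x \<le> f (Suc m) x" for m x
      using seg_mono[of "real m" "real (Suc m)"] g0[of x] unfolding f_def by auto
    show "(\<lambda>m. f m x) \<longlonglongrightarrow> g x" for x
    proof (rule tendsto_eventually)
      obtain n where n: "\<bar>x\<bar> \<le> real n" using real_arch_simple by blast
      show "\<forall>\<^sub>F m in sequentially. f m x = g x"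
      proof (rule eventually_mono[OF eventually_ge_at_top[of n]])
        fix m assume "n \<le> m"
        then have "\<bar>x\<bar> \<le> real m" using n by linarith
        then show "f m x = g x"
          using seg_ex[of x] seg_mono[of "\<bar>x\<bar>" "real m"] unfolding f_def g_def by auto
      qed
    qed
    show "bounded (range (\<lambda>m. integral UNIV (f m)))"
      unfolding bounded_iff
    proof (intro exI ballI)
      fix v assume "v \<in> range (\<lambda>m. integral UNIV (f m))"
      then obtain m where v: "v = integral UNIV (f m)" by blast
      have "v = integral (seg (real m)) (hh y)" unfolding v using fi by (rule integral_unique)
      moreover have "0 \<le> v" unfolding v by (rule integral_nonneg[OF has_integral_integrable[OF fi]]) (simp add: f_def g0)
      ultimately show "norm v \<le> B" using B[of "real m"] by simp
    qed
  qed
  then have "g absolutely_integrable_on UNIV" using g0 by (intro nonnegative_absolutely_integrable_1) auto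
  then have gI: "g absolutely_integrable_on I" by (rule set_integrable_subset) (use I_sets_borel in auto)
  have eq: "AE x in lebesgue. x \<in> I \<longrightarrow> hh (\<lambda>x. if x \<in> I then y x else 0) x = g x"
  proof -
    have "AE x in lebesgue. x \<notin> N" by (intro AE_not_in) (use N(1) in \<open>simp add: negligible_iff_null_sets\<close>)
    then show ?thesis by eventually_elim (simp add: g_def)
  qed
  show "set_integrable lebesgue I (hh (\<lambda>x. if x \<in> I then y x else 0))"
    by (rule absolutely_integrable_cong_AE[OF eq gI])
qed auto

end

section \<open>Square-integrable solutions\<close>

text \<open>\<open>limit_point\<close> bounds the number of square-integrable solutions from above.
  \<open>definite\<close> ensures that a solution is determined by its class, and that the Gram
  matrix of the solutions restricted to a large interval is invertible.\<close>

locale sl_limit_point = sl_system A Q R H I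
  for A Q R H :: "real \<Rightarrow> complex^'n^'n" and I +
  assumes limit_point: "\<And>lam y w \<epsilon>. sol lam y w \<Longrightarrow> set_integrable lebesgue I (hh y) \<Longrightarrow> 0 < \<epsilon> \<Longrightarrow>
      \<exists>x\<in>I. norm (cdot (y x) (w x)) < \<epsilon>"
    and definite: "\<not> (AE x in lebesgue. x \<in> I \<longrightarrow> det (H x) = 0)"
begin

text \<open>The energy identity makes s Im (y^* w) decrease away from 0. If it were negative at 0,
  its modulus would stay at least that large on I, which \<open>limit_point\<close> excludes; a
  single point with small y^* w suffices, wherever it lies.\<close>

lemma L2_sol_sign:
  assumes y: "sol lam y w" and L2: "y \<in> L2fun I H" and s: "s\<^sup>2 = 1" "0 < s * (sg * Im lam)"
  shows "0 \<le> s * Im (cdot (y 0) (w 0))"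
proof (rule ccontr)
  assume neg: "\<not> 0 \<le> s * Im (cdot (y 0) (w 0))"
  define \<epsilon> where "\<epsilon> = - (s * Im (cdot (y 0) (w 0)))"
  have lam: "Im lam \<noteq> 0" using s by auto
  have "\<epsilon> > 0" using neg unfolding \<epsilon>_def by simp
  from limit_point[OF y L2_hh[OF L2] this] obtain x where x: "x \<in> I" "norm (cdot (y x) (w x)) < \<epsilon>" by blast
  have r: "0 \<le> \<bar>x\<bar>" "sg * \<bar>x\<bar> = x" using sg x(1) by auto
  have "0 \<le> integral (seg \<bar>x\<bar>) (hh y)"
    using sol_energy_integral(1)[OF y lam r(1)] seg_sub(1)[OF r(1)]
    by (intro hh_integral_nonneg) (simp_all add: absolutely_integrable_on_def)
  then have "0 \<le> s * (sg * Im lam) * integral (seg \<bar>x\<bar>) (hh y)" using s(2) by simp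
  also have "\<dots> = s * (sg * Im lam * integral (seg \<bar>x\<bar>) (hh y))" by (simp only: mult.assoc)
  also have "\<dots> = s * (Im (cdot (y 0) (w 0)) - Im (cdot (y x) (w x)))"
    unfolding sol_energy_integral(2)[OF y lam r(1)] r(2) ..
  finally have "\<epsilon> \<le> - (s * Im (cdot (y x) (w x)))" unfolding \<epsilon>_def by (simp add: algebra_simps)
  also have "\<dots> \<le> \<bar>s * Im (cdot (y x) (w x))\<bar>" by simp
  also have "\<dots> = \<bar>Im (cdot (y x) (w x))\<bar>"
  proof -
    have "\<bar>s\<bar> = 1" using s(1) by (simp add: power2_eq_1_iff) auto
    then show ?thesis by (simp add: abs_mult)
  qed
  also have "\<dots> \<le> norm (cdot (y x) (w x))" by (rule abs_Im_le_cmod)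
  finally show False using x(2) by simp
qed

definition L2_solutions :: "complex \<Rightarrow> (real \<Rightarrow> complex^'n) set" where
  "L2_solutions lam = {y \<in> L2fun I H. is_solution A Q R H I lam y}"

lemma L2_solutions_iff: "y \<in> L2_solutions lam \<longleftrightarrow> y \<in> L2fun I H \<and> (\<exists>w. sol lam y w)"
  unfolding L2_solutions_def is_solution_def quasi_eq_iff_solves by simp

lemma sign_exists:
  assumes "Im lam \<noteq> 0"
  obtains s :: real where "s\<^sup>2 = 1" "0 < s * (sg * Im lam)"
proof
  have "sg * Im lam \<noteq> 0" using sg assms by auto
  moreover have "sgn (sg * Im lam) * (sg * Im lam) = \<bar>sg * Im lam\<bar>" by (metis abs_sgn mult.commute)
  ultimately show "(sgn (sg * Im lam))\<^sup>2 = 1" "0 < sgn (sg * Im lam) * (sg * Im lam)"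
    by (simp_all add: sgn_if)
qed

lemma L2_solutions_dependent:
  assumes lam: "Im lam \<noteq> 0" and k: "CARD('n) < k" and F: "\<And>i. i < k \<Longrightarrow> F i \<in> L2_solutions lam"
  obtains a where "(\<lambda>x. \<Sum>i<k. a i *s F i x) = (\<lambda>x. 0)" "\<exists>i<k. a i \<noteq> 0"
proof -
  obtain s where s: "s\<^sup>2 = 1" "0 < s * (sg * Im lam)" by (rule sign_exists[OF lam])
  have "\<forall>i. \<exists>w. i < k \<longrightarrow> sol lam (F i) w" using F unfolding L2_solutions_iff by blast
  from choice[OF this] obtain W where W: "\<And>i. i < k \<Longrightarrow> sol lam (F i) (W i)" by blast
  obtain a where a: "(\<Sum>i<k. a i *s (F i 0 - (of_real s * \<i>) *s W i 0)) = 0" "\<exists>i<k. a i \<noteq> 0"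
    using vectors_dependent[OF k, of "\<lambda>i. F i 0 - (of_real s * \<i>) *s W i 0"] by blast
  define Y where "Y x = (\<Sum>i<k. a i *s F i x)" for x
  define V where "V x = (\<Sum>i<k. a i *s W i x)" for x
  have sol: "sol lam Y V" unfolding Y_def V_def by (rule sol_sum) (use W in simp)
  have YL2: "Y \<in> L2fun I H" unfolding Y_def by (rule L2_sum) (use F in \<open>simp add: L2_solutions_iff\<close>)
  have "Y 0 - (of_real s * \<i>) *s V 0 = (\<Sum>i<k. a i *s (F i 0 - (of_real s * \<i>) *s W i 0))"
    unfolding Y_def V_def vec.scale_sum_right sum_subtractf[symmetric]
    by (intro sum.cong refl) (simp add: vector_ssub_ldistrib vector_smult_assoc mult.commute)
  then have YV: "Y 0 - (of_real s * \<i>) *s V 0 = 0" using a(1) by simp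
  have "0 \<le> s * Im (cdot (Y 0) (V 0))" by (rule L2_sol_sign[OF sol YL2 s])
  \<comment> \<open>Since Y - s i V = 0 at 0, polarisation makes a sum of three nonnegative terms
    vanish, so all initial data are 0.\<close>
  moreover have "(norm (Y 0))\<^sup>2 + (norm (V 0))\<^sup>2 + 2 * s * Im (cdot (Y 0) (V 0)) = 0"
    using norm_add_i_sq(2)[OF s(1), of "Y 0" "V 0"] YV by simp
  moreover have "0 \<le> (norm (Y 0))\<^sup>2" "0 \<le> (norm (V 0))\<^sup>2" by simp_all
  ultimately have "(norm (Y 0))\<^sup>2 = 0" "(norm (V 0))\<^sup>2 = 0" by linarith+
  then have "Y x = 0" if "x \<in> I" for x using sol_unique(1)[OF sol I_0 _ _ that] by simp
  moreover have "Y x = 0" if "x \<notin> I" for x using YL2 that unfolding L2fun_def by blast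
  ultimately have "Y = (\<lambda>x. 0)" by blast
  then show thesis using that[of a] a(2) unfolding Y_def by simp
qed

text \<open>The Weyl solutions whose value of y - s i w at 0 is a unit vector. A relation among
  their y parts holds for the w parts as well by \<open>sol_zero_imp\<close>, and evaluation at 0
  turns it into a relation among the unit vectors.\<close>

lemma L2_solutions_independent:
  assumes lam: "Im lam \<noteq> 0"
  obtains F where "\<And>i. i < CARD('n) \<Longrightarrow> F i \<in> L2_solutions lam"
    "\<And>a. (\<lambda>x. \<Sum>i<CARD('n). a i *s F i x) = (\<lambda>x. 0) \<Longrightarrow> \<forall>i<CARD('n). a i = 0"
proof -
  obtain s where s: "s\<^sup>2 = 1" "0 < s * (sg * Im lam)" by (rule sign_exists[OF lam])
  obtain h where h: "bij_betw h {..<CARD('n)} (UNIV :: 'n set)"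
    using ex_bij_betw_nat_finite[of "UNIV :: 'n set"] by (auto simp: atLeast0LessThan)
  define good where "good i p \<longleftrightarrow> sol lam (fst p) (snd p) \<and> fst p 0 - (of_real s * \<i>) *s snd p 0 = axis (h i) 1 \<and>
     (\<exists>B. \<forall>r\<ge>0. integral (seg r) (hh (fst p)) \<le> B)" for i p
  have "\<forall>i. \<exists>p. good i p"
  proof
    fix i
    obtain y w where yw: "sol lam y w" "y 0 - (of_real s * \<i>) *s w 0 = axis (h i) 1"
      "\<And>r. 0 \<le> r \<Longrightarrow> s * (sg * Im lam) * integral (seg r) (hh y) \<le> (norm (axis (h i) (1::complex)))\<^sup>2 / 4"
      by (rule weyl_infinite[OF s, where \<xi>="axis (h i) 1"]) blast
    have "integral (seg r) (hh y) \<le> ((norm (axis (h i) (1::complex)))\<^sup>2 / 4) / (s * (sg * Im lam))" if "0 \<le> r" for r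
      using yw(3)[OF that] s(2) by (simp add: pos_le_divide_eq mult.commute)
    then show "\<exists>p. good i p" unfolding good_def using yw(1,2) by (intro exI[of _ "(y, w)"]) auto
  qed
  from choice[OF this] obtain P where P: "\<And>i. good i (P i)" by blast
  define F where "F i x = (if x \<in> I then fst (P i) x else 0)" for i x
  have P1: "sol lam (fst (P i)) (snd (P i))" and P2: "fst (P i) 0 - (of_real s * \<i>) *s snd (P i) 0 = axis (h i) 1"
    and P3: "\<exists>B. \<forall>r\<ge>0. integral (seg r) (hh (fst (P i))) \<le> B" for i
    using P[of i] unfolding good_def by blast+
  have solF: "sol lam (F i) (snd (P i))" for i
    by (rule sol_cong[OF P1[of i]]) (simp_all add: F_def)
  have "F i \<in> L2_solutions lam" for i
  proof -
    obtain B where "\<forall>r\<ge>0. integral (seg r) (hh (fst (P i))) \<le> B" using P3[of i] by blast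
    then have "F i \<in> L2fun I H"
      unfolding F_def by (intro bounded_energy_L2[OF P1[of i] lam, of B]) blast
    then show ?thesis using solF unfolding L2_solutions_iff by blast
  qed
  moreover have "\<forall>i<CARD('n). a i = 0" if a: "(\<lambda>x. \<Sum>i<CARD('n). a i *s F i x) = (\<lambda>x. 0)" for a
  proof -
    define V where "V x = (\<Sum>i<CARD('n). a i *s snd (P i) x)" for x
    have S: "sol lam (\<lambda>x. \<Sum>i<CARD('n). a i *s F i x) V" unfolding V_def by (rule sol_sum) (rule solF)
    have "sol lam (\<lambda>x. 0) V" by (rule sol_cong[OF S]) (use a in \<open>simp_all add: fun_eq_iff\<close>)
    then have V0: "V 0 = 0" using sol_zero_imp[where y="\<lambda>x. 0" and w=V and x=0] I_0 by simp
    have "(\<Sum>i<CARD('n). a i *s axis (h i) 1) = (\<Sum>i<CARD('n). a i *s F i 0) - (of_real s * \<i>) *s V 0"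
    proof -
      have "axis (h i) 1 = F i 0 - (of_real s * \<i>) *s snd (P i) 0" for i
        using P2[of i] I_0 unfolding F_def by simp
      then show ?thesis
        unfolding V_def vec.scale_sum_right sum_subtractf[symmetric]
        by (intro sum.cong refl) (simp add: vector_ssub_ldistrib vector_smult_assoc mult.commute)
    qed
    also have "\<dots> = 0" using V0 fun_cong[OF a, of 0] by simp
    finally have z: "(\<Sum>i<CARD('n). a i *s (axis (h i) 1 :: complex^'n)) = 0" .
    show ?thesis
    proof (intro allI impI)
      fix j assume j: "j < CARD('n)"
      have "(\<Sum>i<CARD('n). a i *s (axis (h i) 1 :: complex^'n)) $ h j = (\<Sum>i<CARD('n). if i = j then a j else 0)"
        unfolding sum_component
      proof (rule sum.cong[OF refl])
        fix i assume "i \<in> {..<CARD('n)}"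
        then have "h i = h j \<longleftrightarrow> i = j" using h j unfolding bij_betw_def inj_on_def by auto
        then show "(a i *s (axis (h i) 1 :: complex^'n)) $ h j = (if i = j then a j else 0)"
          by (auto simp: axis_def)
      qed
      then show "a j = 0" using z j by simp
    qed
  qed
  ultimately show thesis using that by blast
qed

lemma formal_deficiency_eq:
  assumes lam: "Im lam \<noteq> 0"
  shows "formal_deficiency A Q R H I lam = enat CARD('n)"
  unfolding formal_deficiency_def L2_solutions_def[symmetric]
proof (rule complex_dim_eqI)
  show "\<exists>F. (\<forall>i<CARD('n). F i \<in> L2_solutions lam) \<and>
     (\<forall>a. lin_comb fun_add fun_scale (\<lambda>x. 0) a F CARD('n) = (\<lambda>x. 0) \<longrightarrow> (\<forall>i<CARD('n). a i = 0))"
    unfolding lin_comb_fun by (rule L2_solutions_independent[OF lam]) blast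
  show "\<exists>a. lin_comb fun_add fun_scale (\<lambda>x. 0) a F k = (\<lambda>x. 0) \<and> (\<exists>i<k. a i \<noteq> 0)"
    if "CARD('n) < k" "\<And>i. i < k \<Longrightarrow> F i \<in> L2_solutions lam" for k F
    unfolding lin_comb_fun
    by (rule L2_solutions_dependent[OF lam that]) (assumption, rule exI, rule conjI, assumption+)
qed

end

context sl_limit_point
begin

section \<open>The quotient by null functions\<close>

lemma ip_add_right:
  assumes "f \<in> L2fun I H" "g \<in> L2fun I H" "h \<in> L2fun I H"
  shows "ip I H f (\<lambda>x. g x + h x) = ip I H f g + ip I H f h"
  using set_integral_add(2)[OF L2_cross[OF assms(1,2)] L2_cross[OF assms(1,3)]]
  unfolding ip_def by (simp add: matrix_vector_right_distrib cdot_simps)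

lemma ip_add_left:
  assumes "f \<in> L2fun I H" "g \<in> L2fun I H" "h \<in> L2fun I H"
  shows "ip I H (\<lambda>x. f x + g x) h = ip I H f h + ip I H g h"
  using set_integral_add(2)[OF L2_cross[OF assms(1,3)] L2_cross[OF assms(2,3)]]
  unfolding ip_def by (simp add: cdot_simps)

lemma ip_scale_right: "ip I H f (\<lambda>x. c *s g x) = c * ip I H f g"
  unfolding ip_def by (simp add: vector_scalar_commute cdot_simps)

lemma ip_scale_left: "ip I H (\<lambda>x. c *s f x) g = cnj c * ip I H f g"
  unfolding ip_def by (simp add: cdot_simps)

text \<open>For square-integrable f this is the vanishing of the seminorm, by
  \<open>ip_self_zero_iff\<close>. In this form the condition is linear in f and can be restricted
  to subintervals.\<close>

definition null :: "(real \<Rightarrow> complex^'n) \<Rightarrow> bool" where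
  "null f \<longleftrightarrow> (AE x in lebesgue. x \<in> I \<longrightarrow> H x *v f x = 0)"

lemma ip_cong_null:
  assumes "null (\<lambda>x. f x - f' x)" "null (\<lambda>x. g x - g' x)"
  shows "ip I H f g = ip I H f' g'"
proof -
  have "AE x in lebesgue. x \<in> I \<longrightarrow> cdot (f x) (H x *v g x) = cdot (f' x) (H x *v g' x)"
    using assms[unfolded null_def] H_psd
  proof eventually_elim
    case (elim x)
    show ?case
    proof
      assume x: "x \<in> I"
      have h: "hermitian (H x)" using elim(3) x unfolding pos_semidef_def by blast
      have e: "H x *v f x = H x *v f' x" "H x *v g x = H x *v g' x"
        using elim(1,2) x by (simp_all add: matrix_vector_mult_diff_distrib)
      show "cdot (f x) (H x *v g x) = cdot (f' x) (H x *v g' x)"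
        using hermitian_cdot[OF h, of "f x" "g' x"] hermitian_cdot[OF h, of "f' x" "g' x"] e by simp
    qed
  qed
  then have ae: "AE x in lebesgue. x \<in> I \<longrightarrow> cdot (f x) (H x *v g x) = cdot (f' x) (H x *v g' x)" .
  show ?thesis
    unfolding ip_def set_lebesgue_integral_def
  proof (cases "integrable lebesgue (\<lambda>x. indicator I x *\<^sub>R cdot (f x) (H x *v g x))")
    case True
    then have i: "(\<lambda>x. cdot (f x) (H x *v g x)) absolutely_integrable_on I" unfolding set_integrable_def .
    have i': "(\<lambda>x. cdot (f' x) (H x *v g' x)) absolutely_integrable_on I"
      by (rule absolutely_integrable_cong_AE[OF _ i]) (use ae in \<open>auto elim!: eventually_mono\<close>)
    show "(LINT x|lebesgue. indicator I x *\<^sub>R cdot (f x) (H x *v g x)) = (LINT x|lebesgue. indicator I x *\<^sub>R cdot (f' x) (H x *v g' x))"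
      by (rule integral_cong_AE)
         (use i i' ae in \<open>auto simp: set_integrable_def indicator_def elim!: eventually_mono\<close>)
  next
    \<comment> \<open>No integrability is assumed of the arguments. If one side is not integrable,
      neither is the other, and both integrals have the default value 0.\<close>
    case False
    have "\<not> integrable lebesgue (\<lambda>x. indicator I x *\<^sub>R cdot (f' x) (H x *v g' x))"
    proof
      assume "integrable lebesgue (\<lambda>x. indicator I x *\<^sub>R cdot (f' x) (H x *v g' x))"
      then have i: "(\<lambda>x. cdot (f' x) (H x *v g' x)) absolutely_integrable_on I" unfolding set_integrable_def .
      have "(\<lambda>x. cdot (f x) (H x *v g x)) absolutely_integrable_on I"
        by (rule absolutely_integrable_cong_AE[OF ae i])
      then show False using False unfolding set_integrable_def by blast
    qed
    then show "(LINT x|lebesgue. indicator I x *\<^sub>R cdot (f x) (H x *v g x)) = (LINT x|lebesgue. indicator I x *\<^sub>R cdot (f' x) (H x *v g' x))"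
      using False by (simp add: not_integrable_integral_eq)
  qed
qed

lemma ip_self_zero_iff:
  assumes f: "f \<in> L2fun I H"
  shows "ip I H f f = 0 \<longleftrightarrow> null f"
proof
  assume "null f"
  then have n: "null (\<lambda>x. f x - 0)" by simp
  have "ip I H f f = ip I H (\<lambda>x. 0) (\<lambda>x. 0)" by (rule ip_cong_null[OF n n])
  then show "ip I H f f = 0" by (simp add: ip_def cdot_simps)
next
  assume z: "ip I H f f = 0"
  have i: "integrable lebesgue (\<lambda>x. indicator I x *\<^sub>R cdot (f x) (H x *v f x))"
    using L2_cross[OF f f] unfolding set_integrable_def .
  have "(LINT x|lebesgue. Re (indicator I x *\<^sub>R cdot (f x) (H x *v f x))) = Re (ip I H f f)"
    unfolding ip_def set_lebesgue_integral_def by (rule integral_Re[OF i])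
  then have "(LINT x|lebesgue. Re (indicator I x *\<^sub>R cdot (f x) (H x *v f x))) = 0" using z by simp
  moreover have "AE x in lebesgue. 0 \<le> Re (indicator I x *\<^sub>R cdot (f x) (H x *v f x))"
    using hh_nonneg[of f] by eventually_elim (auto simp: indicator_def)
  ultimately have "AE x in lebesgue. Re (indicator I x *\<^sub>R cdot (f x) (H x *v f x)) = 0"
    using integral_nonneg_eq_0_iff_AE[OF integrable_Re[OF i]] by blast
  then show "null f"
    unfolding null_def using H_psd
    by eventually_elim (auto intro: pos_semidef_null)
qed

lemma null_add: "null f \<Longrightarrow> null g \<Longrightarrow> null (\<lambda>x. f x + g x)"
  unfolding null_def by (auto elim!: eventually_elim2 simp: matrix_vector_right_distrib)

lemma null_scale: "null f \<Longrightarrow> null (\<lambda>x. c *s f x)"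
  unfolding null_def by (auto elim!: eventually_mono simp: vector_scalar_commute)

lemma L2rel_iff: "(f, g) \<in> L2rel I H \<longleftrightarrow> f \<in> L2fun I H \<and> g \<in> L2fun I H \<and> null (\<lambda>x. f x - g x)"
  unfolding L2rel_def using ip_self_zero_iff[OF L2_diff] by auto

lemma null_sym: "null (\<lambda>x. f x - g x) \<Longrightarrow> null (\<lambda>x. g x - f x)"
  using null_scale[of "\<lambda>x. f x - g x" "-1"] by simp

lemma null_trans: "null (\<lambda>x. f x - g x) \<Longrightarrow> null (\<lambda>x. g x - h x) \<Longrightarrow> null (\<lambda>x. f x - h x)"
  using null_add[of "\<lambda>x. f x - g x" "\<lambda>x. g x - h x"] by simp

lemma null_refl: "null (\<lambda>x. f x - f x)"
  unfolding null_def by simp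

lemma mem_cls: "g \<in> cls I H f \<longleftrightarrow> f \<in> L2fun I H \<and> g \<in> L2fun I H \<and> null (\<lambda>x. f x - g x)"
  unfolding cls_def by (simp add: L2rel_iff)

lemma cls_self: "f \<in> L2fun I H \<Longrightarrow> f \<in> cls I H f"
  unfolding mem_cls using null_refl by blast

lemma cls_eqI:
  assumes "f \<in> L2fun I H" "g \<in> L2fun I H" "null (\<lambda>x. f x - g x)"
  shows "cls I H f = cls I H g"
proof (rule set_eqI)
  fix h
  show "h \<in> cls I H f \<longleftrightarrow> h \<in> cls I H g"
    unfolding mem_cls
  proof
    assume "f \<in> L2fun I H \<and> h \<in> L2fun I H \<and> null (\<lambda>x. f x - h x)"
    then show "g \<in> L2fun I H \<and> h \<in> L2fun I H \<and> null (\<lambda>x. g x - h x)"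
      using assms(2) null_trans[OF null_sym[OF assms(3)]] by simp
  next
    assume "g \<in> L2fun I H \<and> h \<in> L2fun I H \<and> null (\<lambda>x. g x - h x)"
    then show "f \<in> L2fun I H \<and> h \<in> L2fun I H \<and> null (\<lambda>x. f x - h x)"
      using assms(1) null_trans[OF assms(3)] by simp
  qed
qed

lemma cls_eqD:
  assumes "f \<in> L2fun I H" "cls I H f = cls I H g"
  shows "null (\<lambda>x. f x - g x)"
proof -
  have "f \<in> cls I H g" using cls_self[OF assms(1)] unfolding assms(2) .
  then have "null (\<lambda>x. g x - f x)" by (simp add: mem_cls)
  then show ?thesis by (rule null_sym)
qed

lemma L2space_iff: "F \<in> L2space I H \<longleftrightarrow> (\<exists>f\<in>L2fun I H. F = cls I H f)"
  unfolding L2space_def quotient_def cls_def by blast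

lemma cls_add_cls:
  assumes f: "f \<in> L2fun I H" and g: "g \<in> L2fun I H"
  shows "cls_add I H (cls I H f) (cls I H g) = cls I H (\<lambda>x. f x + g x)"
proof -
  have "cls I H (fun_add f' g') = cls I H (\<lambda>x. f x + g x)" if "f' \<in> cls I H f" "g' \<in> cls I H g" for f' g'
  proof -
    have m: "f' \<in> L2fun I H" "g' \<in> L2fun I H" "null (\<lambda>x. f' x - f x)" "null (\<lambda>x. g' x - g x)"
      using that null_sym unfolding mem_cls by blast+
    show ?thesis
      unfolding fun_add_def
    proof (rule cls_eqI[OF L2_add[OF m(1,2)] L2_add[OF f g]])
      show "null (\<lambda>x. f' x + g' x - (f x + g x))" using null_add[OF m(3,4)] by (simp add: algebra_simps)
    qed
  qed
  then show ?thesis unfolding cls_add_def using cls_self[OF f] cls_self[OF g] by blast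
qed

lemma cls_scale_cls:
  assumes f: "f \<in> L2fun I H"
  shows "cls_scale I H c (cls I H f) = cls I H (\<lambda>x. c *s f x)"
proof -
  have "cls I H (fun_scale c f') = cls I H (\<lambda>x. c *s f x)" if "f' \<in> cls I H f" for f'
  proof -
    have m: "f' \<in> L2fun I H" "null (\<lambda>x. f' x - f x)" using that null_sym unfolding mem_cls by blast+
    show ?thesis
      unfolding fun_scale_def
    proof (rule cls_eqI[OF L2_scale[OF m(1)] L2_scale[OF f]])
      show "null (\<lambda>x. c *s f' x - c *s f x)" using null_scale[OF m(2), of c] by (simp add: vector_ssub_ldistrib)
    qed
  qed
  then show ?thesis unfolding cls_scale_def using cls_self[OF f] by blast
qed

lemma cls_ip_cls:
  assumes f: "f \<in> L2fun I H" and g: "g \<in> L2fun I H"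
  shows "cls_ip I H (cls I H f) (cls I H g) = ip I H f g"
proof -
  have "ip I H f' g' = ip I H f g" if "f' \<in> cls I H f" "g' \<in> cls I H g" for f' g'
    using that ip_cong_null[OF null_sym null_sym] unfolding mem_cls by blast
  then have "(\<Union>f\<in>cls I H f. \<Union>g\<in>cls I H g. {ip I H f g}) = {ip I H f g}"
    using cls_self[OF f] cls_self[OF g] by blast
  then show ?thesis unfolding cls_ip_def by simp
qed

lemma lin_comb_cls:
  assumes "\<And>i. i < k \<Longrightarrow> F i \<in> L2fun I H"
  shows "lin_comb (cls_add I H) (cls_scale I H) (cls I H (\<lambda>x. 0)) a (\<lambda>i. cls I H (F i)) k
       = cls I H (\<lambda>x. \<Sum>i<k. a i *s F i x)"
  using assms
proof (induction k)
  case (Suc k)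
  have 1: "(\<lambda>x. \<Sum>i<k. a i *s F i x) \<in> L2fun I H" by (rule L2_sum) (use Suc.prems in simp)
  have 2: "F k \<in> L2fun I H" using Suc.prems by simp
  show ?case
    using Suc.IH Suc.prems cls_add_cls[OF 1 L2_scale[OF 2]] cls_scale_cls[OF 2] by simp
qed simp

section \<open>The minimal relation and its adjoint\<close>

definition restr :: "real set \<Rightarrow> (real \<Rightarrow> complex^'n) \<Rightarrow> real \<Rightarrow> complex^'n" where
  "restr K y x = (if x \<in> K then y x else 0)"

lemma restr_continuous_L2:
  assumes ab: "{a..b} \<subseteq> I" and y: "continuous_on I y"
  shows "restr {a..b} y \<in> L2fun I H"
proof -
  have yc: "continuous_on {a..b} y" using continuous_on_subset[OF y ab] .
  have "(\<lambda>x. indicator {a..b} x *\<^sub>R y x) \<in> borel_measurable borel"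
    by (rule borel_measurable_continuous_on_indicator[OF _ yc]) simp
  moreover have "(\<lambda>x. indicator {a..b} x *\<^sub>R y x) = restr {a..b} y" by (auto simp: restr_def indicator_def)
  ultimately have m: "restr {a..b} y \<in> borel_measurable borel" by simp
  have "(\<lambda>x. cdot (y x) (H x *v y x)) absolutely_integrable_on {a..b}"
  proof (rule absolutely_integrable_bounded_measurable_product[where h=cdot and f=y and g="\<lambda>x. H x *v y x"])
    show "bilinear (cdot :: complex^'n \<Rightarrow> _)" using bounded_bilinear_cdot bilinear_conv_bounded_bilinear by blast
    show "y \<in> borel_measurable (lebesgue_on {a..b})"
      by (rule continuous_imp_measurable_on_sets_lebesgue[OF yc]) simp
    show "bounded (y ` {a..b})" by (intro compact_imp_bounded compact_continuous_image yc) simp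
    show "(\<lambda>x. H x *v y x) absolutely_integrable_on {a..b}"
      by (rule absolutely_integrable_matrix_vector[OF locally_integrableD[OF H_int ab] yc])
  qed simp
  moreover have "indicator {a..b} x *\<^sub>R cdot (y x) (H x *v y x)
     = indicator I x *\<^sub>R cdot (restr {a..b} y x) (H x *v restr {a..b} y x)" for x
    using ab by (auto simp: indicator_def restr_def cdot_simps)
  ultimately have "set_integrable lebesgue I (\<lambda>x. cdot (restr {a..b} y x) (H x *v restr {a..b} y x))"
    unfolding set_integrable_def by simp
  moreover have "restr {a..b} y x = 0" if "x \<notin> I" for x using that ab by (auto simp: restr_def)
  ultimately show ?thesis using m unfolding L2fun_def by blast
qed

lemma restr_L2:
  assumes f: "f \<in> L2fun I H" and K: "{a..b} \<subseteq> I"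
  shows "restr {a..b} f \<in> L2fun I H"
proof (rule L2_of_hh)
  have fm: "f \<in> borel_measurable borel" using f unfolding L2fun_def by blast
  have "(\<lambda>x. indicator {a..b} x *\<^sub>R f x) \<in> borel_measurable borel" using fm by measurable
  moreover have "(\<lambda>x. indicator {a..b} x *\<^sub>R f x) = restr {a..b} f" by (auto simp: restr_def indicator_def)
  ultimately show "restr {a..b} f \<in> borel_measurable borel" by simp
  show "restr {a..b} f x = 0" if "x \<notin> I" for x using that K by (auto simp: restr_def)
  have "set_integrable lebesgue {a..b} (hh f)" by (rule set_integrable_subset[OF L2_hh[OF f] _ K]) simp
  moreover have "indicator {a..b} x *\<^sub>R hh f x = indicator I x *\<^sub>R hh (restr {a..b} f) x" for x
    using K by (auto simp: indicator_def restr_def cdot_simps)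
  ultimately show "set_integrable lebesgue I (hh (restr {a..b} f))" unfolding set_integrable_def by simp
qed

text \<open>\<open>|e\<^sub>i\<^sup>* H g| \<le> (H\<^sub>i\<^sub>i + g\<^sup>* H g) / 2\<close> since \<open>H \<ge> 0\<close>.\<close>

lemma H_mult_integrable:
  assumes g: "g \<in> L2fun I H" and K: "{a..b} \<subseteq> I" "\<And>x. x \<notin> {a..b} \<Longrightarrow> g x = 0"
  shows "(\<lambda>x. H x *v g x) absolutely_integrable_on I"
proof -
  define B where "B x = (\<Sum>i\<in>(UNIV::'n set). (norm (H x $ i $ i) + hh g x) / 2)" for x
  have gl: "g \<in> borel_measurable lebesgue" using g unfolding L2fun_def by (auto intro: measurable_completion)
  have bmv: "bounded_bilinear (\<lambda>(v::complex^'n) (M::complex^'n^'n). M *v v)"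
    using bilinear_matrix_vector bilinear_conv_bounded_bilinear by blast
  have m: "(\<lambda>x. (indicator I x *\<^sub>R H x) *v g x) \<in> borel_measurable lebesgue"
    by (rule borel_measurable_continuous_Pair[OF H_measurable gl])
       (intro bounded_bilinear.continuous_on[OF bmv] continuous_intros)
  moreover have e: "(indicator I x *\<^sub>R H x) *v g x = indicator {a..b} x *\<^sub>R (H x *v g x)" for x
    using K by (cases "x \<in> {a..b}") (auto simp: indicator_def subset_iff)
  ultimately have m': "set_borel_measurable lebesgue {a..b} (\<lambda>x. H x *v g x)"
    unfolding set_borel_measurable_def by simp
  have Hii: "(\<lambda>x. H x $ i $ i) absolutely_integrable_on {a..b}" for i
  proof -
    have "bounded_linear (\<lambda>M::complex^'n^'n. M $ i $ i)"
      unfolding linear_conv_bounded_linear[symmetric] by (rule linearI) auto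
    from absolutely_integrable_linear[OF locally_integrableD[OF H_int K(1)] this] show ?thesis by (simp add: o_def)
  qed
  have Bi: "B absolutely_integrable_on {a..b}"
    unfolding B_def
    by (intro absolutely_integrable_sum set_integrable_divide set_integral_add(1) set_integrable_norm Hii
        set_integrable_subset[OF L2_hh[OF g] _ K(1)]) auto
  have "(\<lambda>x. H x *v g x) absolutely_integrable_on {a..b}"
  proof (rule set_integrable_bound[OF Bi m'])
    show "AE x in lebesgue. x \<in> {a..b} \<longrightarrow> norm (H x *v g x) \<le> norm (B x)"
      using H_psd
    proof eventually_elim
      case (elim x)
      show ?case
      proof
        assume "x \<in> {a..b}"
        then have P: "pos_semidef (H x)" using elim K(1) by blast
        have ax: "cdot (axis i 1) v = v $ i" for i and v :: "complex^'n"
          unfolding cdot_def axis_def by (simp add: if_distrib[of cnj] if_distrib[of "\<lambda>c. c * _"] cong: if_cong)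
        have Hi: "(H x *v axis i 1) $ i = H x $ i $ i" for i
          unfolding matrix_vector_mult_def axis_def by (simp add: if_distrib cong: if_cong)
        have "norm (H x *v g x) \<le> (\<Sum>i\<in>UNIV. norm ((H x *v g x) $ i))"
          unfolding norm_vec_def by (rule L2_set_le_sum) simp
        also have "\<dots> \<le> B x"
          unfolding B_def
        proof (rule sum_mono)
          fix i
          have "norm ((H x *v g x) $ i) \<le> (Re (H x $ i $ i) + hh g x) / 2"
            using psd_cross[OF P, of "axis i 1" "g x"] unfolding ax Hi .
          also have "\<dots> \<le> (norm (H x $ i $ i) + hh g x) / 2" using complex_Re_le_cmod[of "H x $ i $ i"] by simp
          finally show "norm ((H x *v g x) $ i) \<le> (norm (H x $ i $ i) + hh g x) / 2" .
        qed
        finally show "norm (H x *v g x) \<le> norm (B x)" by simp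
      qed
    qed
  qed
  then have "set_integrable lebesgue I (\<lambda>x. H x *v g x)"
  proof -
    assume i: "(\<lambda>x. H x *v g x) absolutely_integrable_on {a..b}"
    have e: "indicator {a..b} x *\<^sub>R (H x *v g x) = indicator I x *\<^sub>R (H x *v g x)" for x
      using K by (cases "x \<in> {a..b}") (auto simp: indicator_def subset_iff)
    show ?thesis using i unfolding set_integrable_def e .
  qed
  then show ?thesis .
qed

lemma ac_deriv_seg_zero:
  fixes f :: "real \<Rightarrow> complex"
  assumes f: "ac_deriv I f g" and r: "0 \<le> r"
  shows "g absolutely_integrable_on seg r" "(LINT x:seg r|lebesgue. g x) = of_real sg * (f (sg * r) - f 0)"
proof -
  have sub: "{min 0 (sg * r)..max 0 (sg * r)} \<subseteq> I" using seg_sub(1)[OF r] unfolding seg_def .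
  show i: "g absolutely_integrable_on seg r" using ac_derivD(1)[OF f sub] unfolding seg_def .
  show "(LINT x:seg r|lebesgue. g x) = of_real sg * (f (sg * r) - f 0)"
    unfolding set_lebesgue_integral_eq_integral(2)[OF i]
    using ac_derivD(3)[OF f sub] sg r unfolding seg_def by (auto simp: min_def max_def)
qed

lemma set_integral_seg_eq:
  fixes g :: "real \<Rightarrow> complex"
  assumes "\<And>x. x \<in> I \<Longrightarrow> x \<notin> seg r \<Longrightarrow> g x = 0" "0 \<le> r"
  shows "(LINT x:I|lebesgue. g x) = (LINT x:seg r|lebesgue. g x)"
proof -
  have e: "indicator I x *\<^sub>R g x = indicator (seg r) x *\<^sub>R g x" for x
    using assms(1)[of x] seg_sub(1)[OF assms(2)] by (auto simp: indicator_def)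
  show ?thesis unfolding set_lebesgue_integral_def e ..
qed

text \<open>No boundary terms arise in Lagrange's identity, because the pairs of the minimal relation have
  compact support in the interior of \<open>I\<close>.\<close>

lemma solution_in_adjoint:
  assumes y: "y \<in> L2_solutions z"
  shows "(cls I H y, cls_scale I H z (cls I H y)) \<in> adjoint_relation I H (min_relation A Q R H I)"
proof -
  have yL2: "y \<in> L2fun I H" using y unfolding L2_solutions_iff by blast
  obtain w where sol: "sol z y w" using y unfolding L2_solutions_iff by blast
  have "cls_ip I H (cls I H y) \<Psi> = cls_ip I H (cls_scale I H z (cls I H y)) \<Phi>"
    if T: "(\<Phi>, \<Psi>) \<in> min_relation A Q R H I" for \<Phi> \<Psi>
  proof -
    obtain u v wu K where uv: "\<Phi> = cls I H u" "\<Psi> = cls I H v" "v \<in> L2fun I H"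
      "compact K" "K \<subseteq> interior I" "\<And>x. x \<notin> K \<Longrightarrow> u x = 0 \<and> wu x = 0 \<and> v x = 0"
      "quasi_eq A Q R I u wu (\<lambda>x. H x *v v x)"
      using T unfolding min_relation_def by blast
    have su: "solves u wu (\<lambda>x. H x *v v x)" using uv(7) unfolding quasi_eq_iff_solves .
    have "bounded K" using uv(4) by (rule compact_imp_bounded)
    then obtain r0 where r0: "\<And>x. x \<in> K \<Longrightarrow> \<bar>x\<bar> \<le> r0" unfolding bounded_iff real_norm_def by blast
    \<comment> \<open>The added 1 puts the far end sg r of the segment outside K, so that u and its
      quasi-derivative vanish there.\<close>
    define r where "r = max r0 0 + 1"
    have r: "0 \<le> r" "\<And>x. x \<in> K \<Longrightarrow> \<bar>x\<bar> < r" using r0 unfolding r_def by force+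
    have Kseg: "K \<subseteq> seg r"
    proof
      fix x assume x: "x \<in> K"
      then have "x \<in> I" using uv(5) interior_subset by blast
      then show "x \<in> seg r" using seg_ex[of x] seg_mono[of "\<bar>x\<bar>" r] r(2)[OF x] by auto
    qed
    have "sg * r \<notin> K" using r(2)[of "sg * r"] r(1) sg by auto
    moreover have "0 \<notin> K"
    proof
      assume "0 \<in> K"
      then have "0 \<in> interior I" using uv(5) by blast
      then show False using I by auto
    qed
    ultimately have bd: "u (sg * r) = 0" "wu (sg * r) = 0" "u 0 = 0" "wu 0 = 0" using uv(6) by blast+
    have uL2: "u \<in> L2fun I H"
    proof -
      have "u = restr (seg r) u" using uv(6) Kseg unfolding restr_def by (intro ext) auto
      moreover have "restr (seg r) u \<in> L2fun I H"
        using restr_continuous_L2[OF _ sol_continuous(1)[OF su]] seg_sub(1)[OF r(1)] unfolding seg_def by blast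
      ultimately show ?thesis by simp
    qed
    note lag = lagrange[OF sol su]
    note 1 = ac_deriv_seg_zero[OF lag r(1)]
    have "(LINT x:seg r|lebesgue. cdot (z *s (H x *v y x)) (u x) - cdot (y x) (H x *v v x)) = 0"
      unfolding 1(2) bd by (simp add: cdot_simps)
    then have "(LINT x:I|lebesgue. cdot (z *s (H x *v y x)) (u x) - cdot (y x) (H x *v v x)) = 0"
    proof (subst set_integral_seg_eq[OF _ r(1)])
      fix x assume "x \<notin> seg r"
      then have "u x = 0" "v x = 0" using uv(6) Kseg by blast+
      then show "cdot (z *s (H x *v y x)) (u x) - cdot (y x) (H x *v v x) = 0" by (simp add: cdot_simps)
    qed
    moreover have "(LINT x:I|lebesgue. cdot (z *s (H x *v y x)) (u x) - cdot (y x) (H x *v v x))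
       = (LINT x:I|lebesgue. cdot (z *s y x) (H x *v u x) - cdot (y x) (H x *v v x))"
    proof -
      have ae: "AE x in lebesgue. x \<in> I \<longrightarrow> cdot (z *s (H x *v y x)) (u x) - cdot (y x) (H x *v v x)
          = cdot (z *s y x) (H x *v u x) - cdot (y x) (H x *v v x)"
        using H_psd
      proof eventually_elim
        case (elim x)
        then show ?case unfolding pos_semidef_def by (auto simp: cdot_simps hermitian_cdot)
      qed
      have i: "set_integrable lebesgue I (\<lambda>x. cdot (z *s y x) (H x *v u x) - cdot (y x) (H x *v v x))"
        by (intro set_integral_diff(1) L2_cross L2_scale yL2 uL2 uv(3))
      have i': "set_integrable lebesgue I (\<lambda>x. cdot (z *s (H x *v y x)) (u x) - cdot (y x) (H x *v v x))"
        by (rule absolutely_integrable_cong_AE[OF ae i])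
      show ?thesis
        unfolding set_lebesgue_integral_def
        by (rule integral_cong_AE)
           (use i i' ae in \<open>auto simp: set_integrable_def indicator_def elim!: eventually_mono\<close>)
    qed
    ultimately have "ip I H (\<lambda>x. z *s y x) u - ip I H y v = 0"
      unfolding ip_def using set_integral_diff(2)[OF L2_cross[OF L2_scale[OF yL2] uL2] L2_cross[OF yL2 uv(3)], of z] by simp
    then show ?thesis
      unfolding uv(1,2) cls_scale_cls[OF yL2] cls_ip_cls[OF yL2 uv(3)] cls_ip_cls[OF L2_scale[OF yL2] uL2] by simp
  qed
  moreover have "cls I H y \<in> L2space I H" "cls_scale I H z (cls I H y) \<in> L2space I H"
    unfolding cls_scale_cls[OF yL2] L2space_iff using yL2 L2_scale[OF yL2] by blast+
  ultimately show ?thesis unfolding adjoint_relation_def by blast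
qed

text \<open>Solve with zero data at 0 and let x in I lie outside [a, b]. Lagrange's identity with
  the solution \<eta> through (w x, - u x) at x expresses |w x|^2 + |u x|^2, up to sign, as the
  integral of \<eta>^* H g over \<open>seg\<close> of |x|. This integral is 0, by the support of g
  or by orthogonality.\<close>

lemma compact_solution:
  assumes g: "g \<in> L2fun I H" and ab: "a \<le> b" "{a..b} \<subseteq> interior I" and g0: "\<And>x. x \<notin> {a..b} \<Longrightarrow> g x = 0"
    and orth: "\<And>\<eta> \<omega>. sol z \<eta> \<omega> \<Longrightarrow> (LINT x:I|lebesgue. cdot (\<eta> x) (H x *v g x)) = 0"
  obtains u w where "\<And>x. x \<notin> {a..b} \<Longrightarrow> u x = 0 \<and> w x = 0"
    "solves u w (\<lambda>x. H x *v (g x + cnj z *s u x))"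
proof -
  have abI: "{a..b} \<subseteq> I" using ab(2) interior_subset by blast
  obtain u w where u: "u 0 = 0" "w 0 = 0" "solves u w (\<lambda>x. cnj z *s (H x *v u x) + H x *v g x)"
    by (rule solves_exists[OF H_mult_integrable[OF g abI g0], of 0 0 "cnj z"])
  have zero: "u x = 0 \<and> w x = 0" if x: "x \<in> I" "x \<notin> {a..b}" for x
  proof -
    obtain \<eta> \<omega> where e: "\<eta> x = w x" "\<omega> x = - u x" "sol z \<eta> \<omega>" by (rule sol_through[OF x(1)])
    have r: "0 \<le> \<bar>x\<bar>" "sg * \<bar>x\<bar> = x" using sg x(1) by auto
    note lag = ac_deriv_seg_zero[OF lagrange[OF e(3) u(3)] r(1)]
    have ae: "AE t in lebesgue. t \<in> seg \<bar>x\<bar> \<longrightarrow>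
        cdot (z *s (H t *v \<eta> t)) (u t) - cdot (\<eta> t) (cnj z *s (H t *v u t) + H t *v g t) = - cdot (\<eta> t) (H t *v g t)"
      using H_psd
    proof eventually_elim
      case (elim t)
      show ?case
      proof
        assume "t \<in> seg \<bar>x\<bar>"
        then have "hermitian (H t)" using elim seg_sub(1)[OF r(1)] unfolding pos_semidef_def by blast
        from hermitian_cdot[OF this, of "\<eta> t" "u t"]
        show "cdot (z *s (H t *v \<eta> t)) (u t) - cdot (\<eta> t) (cnj z *s (H t *v u t) + H t *v g t) = - cdot (\<eta> t) (H t *v g t)"
          by (simp add: cdot_simps)
      qed
    qed
    have i: "(\<lambda>t. - cdot (\<eta> t) (H t *v g t)) absolutely_integrable_on seg \<bar>x\<bar>"
      by (rule absolutely_integrable_cong_AE[OF _ lag(1)]) (use ae in \<open>auto elim!: eventually_mono\<close>)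
    have "(LINT t:seg \<bar>x\<bar>|lebesgue. cdot (z *s (H t *v \<eta> t)) (u t) - cdot (\<eta> t) (cnj z *s (H t *v u t) + H t *v g t))
       = (LINT t:seg \<bar>x\<bar>|lebesgue. - cdot (\<eta> t) (H t *v g t))"
      unfolding set_lebesgue_integral_def
      by (rule integral_cong_AE)
         (use i lag(1) ae in \<open>auto simp: set_integrable_def indicator_def elim!: eventually_mono\<close>)
    \<comment> \<open>Seen from 0, the point x lies before or beyond [a, b]. Hence the segment
      misses [a, b], or contains it and the integral is the full one in \<open>orth\<close>.\<close>
    moreover have "(LINT t:seg \<bar>x\<bar>|lebesgue. - cdot (\<eta> t) (H t *v g t)) = 0"
    proof (cases "{a..b} \<subseteq> seg \<bar>x\<bar>")
      case True
      have "(LINT t:I|lebesgue. - cdot (\<eta> t) (H t *v g t)) = (LINT t:seg \<bar>x\<bar>|lebesgue. - cdot (\<eta> t) (H t *v g t))"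
      proof (rule set_integral_seg_eq[OF _ r(1)])
        fix t assume "t \<notin> seg \<bar>x\<bar>"
        then have "g t = 0" using True g0 by blast
        then show "- cdot (\<eta> t) (H t *v g t) = 0" by (simp add: cdot_simps)
      qed
      moreover have "(LINT t:I|lebesgue. - cdot (\<eta> t) (H t *v g t)) = 0"
        using orth[OF e(3)] unfolding set_lebesgue_integral_def by simp
      ultimately show ?thesis by simp
    next
      case False
      have "{a..b} \<inter> seg \<bar>x\<bar> = {}"
      proof -
        have abm: "a \<in> I" "b \<in> I" using abI ab(1) by auto
        from sg show ?thesis
        proof
          assume s: "sg = 1 \<and> I = {0..}"
          then have S: "seg \<bar>x\<bar> = {0..x}" using x(1) unfolding seg_def by auto
          have "0 \<le> a" using s abm by auto
          then have "\<not> b \<le> x" using False unfolding S by auto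
          then have "x < a" using x(2) by auto
          then show ?thesis unfolding S by auto
        next
          assume s: "sg = -1 \<and> I = {..0}"
          then have S: "seg \<bar>x\<bar> = {x..0}" using x(1) unfolding seg_def by auto
          have "b \<le> 0" using s abm by auto
          then have "\<not> x \<le> a" using False unfolding S by auto
          then have "b < x" using x(2) by auto
          then show ?thesis unfolding S by auto
        qed
      qed
      then have e: "indicator (seg \<bar>x\<bar>) t *\<^sub>R (- cdot (\<eta> t) (H t *v g t)) = 0" for t
        using g0[of t] by (cases "t \<in> {a..b}") (auto simp: indicator_def cdot_simps)
      show ?thesis unfolding set_lebesgue_integral_def e by simp
    qed
    ultimately have "of_real sg * (cdot (\<eta> x) (w x) - cdot (\<omega> x) (u x)) = 0"
      using lag(2) u(1,2) r(2) by (simp add: cdot_simps)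
    then have "cdot (w x) (w x) + cdot (u x) (u x) = 0"
      using sg e by (auto simp: cdot_simps)
    then have "(norm (w x))\<^sup>2 + (norm (u x))\<^sup>2 = 0"
      unfolding cdot_self by (metis of_real_add of_real_eq_0_iff)
    then show ?thesis by (simp add: sum_power2_eq_zero_iff)
  qed
  show thesis
  \<comment> \<open>The solution is arbitrary off I, whereas elements of the minimal relation vanish
    off a compact set. By \<open>zero\<close> the cut-off changes nothing on I.\<close>
  proof (rule that[of "restr {a..b} u" "restr {a..b} w"])
    show "restr {a..b} u x = 0 \<and> restr {a..b} w x = 0" if "x \<notin> {a..b}" for x using that unfolding restr_def by auto
    have eu: "restr {a..b} u x = u x" "restr {a..b} w x = w x" if "x \<in> I" for x
      using zero[OF that] unfolding restr_def by auto
    show "solves (restr {a..b} u) (restr {a..b} w) (\<lambda>x. H x *v (g x + cnj z *s restr {a..b} u x))"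
      by (rule solves_cong[OF u(3)])
         (simp_all add: eu matrix_vector_right_distrib vector_scalar_commute add.commute)
  qed
qed

end

context sl_limit_point
begin

text \<open>The intervals \<open>[klo m, khi m]\<close> exhaust the interior of \<open>I\<close>.\<close>

definition klo :: "nat \<Rightarrow> real" where "klo m = min (sg * (1 / real (Suc m))) (sg * real (Suc m))"
definition khi :: "nat \<Rightarrow> real" where "khi m = max (sg * (1 / real (Suc m))) (sg * real (Suc m))"

lemma inv_Suc_le: "1 / real (Suc m) \<le> real (Suc m)"
proof -
  have "1 / real (Suc m) \<le> 1" "1 \<le> real (Suc m)" by simp_all
  then show ?thesis by (rule order_trans)
qed

lemma k_interval:
  "klo m \<le> khi m" "{klo m..khi m} \<subseteq> interior I" "m \<le> m' \<Longrightarrow> {klo m..khi m} \<subseteq> {klo m'..khi m'}"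
proof -
  show "klo m \<le> khi m" unfolding klo_def khi_def by simp
  have p: "0 < 1 / real (Suc m)" by simp
  have "{min (sg * p) (sg * q)..max (sg * p) (sg * q)} \<subseteq> interior I" if "0 < p" "p \<le> q" for p q :: real
    using sg
  proof
    assume s: "sg = 1 \<and> I = {0..}"
    have i: "interior I = {0<..}" unfolding conjunct2[OF s] by simp
    show ?thesis unfolding conjunct1[OF s] i using that by auto
  next
    assume s: "sg = -1 \<and> I = {..0}"
    have i: "interior I = {..<0}" unfolding conjunct2[OF s] by simp
    show ?thesis unfolding conjunct1[OF s] i using that by auto
  qed
  from this[OF p inv_Suc_le] show "{klo m..khi m} \<subseteq> interior I" unfolding klo_def khi_def .
  assume m: "m \<le> m'"
  have m': "1 / real (Suc m') \<le> 1 / real (Suc m)" "real (Suc m) \<le> real (Suc m')" using m by (simp_all add: frac_le)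
  have "{min (sg * p) (sg * q)..max (sg * p) (sg * q)} \<subseteq> {min (sg * p') (sg * q')..max (sg * p') (sg * q')}"
    if "p' \<le> p" "p \<le> q" "q \<le> q'" for p q p' q' :: real
  proof -
    consider "sg = 1" | "sg = -1" using sg by blast
    then show ?thesis by cases (use that in \<open>simp_all add: min_def max_def\<close>)
  qed
  from this[OF m'(1) inv_Suc_le m'(2)] show "{klo m..khi m} \<subseteq> {klo m'..khi m'}" unfolding klo_def khi_def .
qed

lemma k_interval_I: "{klo m..khi m} \<subseteq> I"
  using k_interval(2) interior_subset by blast

lemma k_interval_ex:
  assumes x: "x \<in> interior I"
  obtains m where "x \<in> {klo m..khi m}"
proof -
  have x0: "0 < \<bar>x\<bar>" "x = sg * \<bar>x\<bar>" using x sg by auto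
  obtain m1 where m1: "1 / real (Suc m1) < \<bar>x\<bar>" using reals_Archimedean[OF x0(1)] by (auto simp: inverse_eq_divide)
  obtain m2 where m2: "\<bar>x\<bar> \<le> real m2" using real_arch_simple by blast
  define m where "m = max m1 m2"
  have "1 / real (Suc m) \<le> 1 / real (Suc m1)" unfolding m_def by (simp add: frac_le)
  then have "1 / real (Suc m) \<le> \<bar>x\<bar>" "\<bar>x\<bar> \<le> real (Suc m)" using m1 m2 unfolding m_def by auto
  then have "x \<in> {klo m..khi m}"
    using sg x0(2) unfolding klo_def khi_def by (auto simp: min_def max_def)
  then show thesis by (rule that)
qed

lemma AE_I_of_k_intervals:
  assumes "\<And>m. m0 \<le> m \<Longrightarrow> AE x in lebesgue. x \<in> {klo m..khi m} \<longrightarrow> P x"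
  shows "AE x in lebesgue. x \<in> I \<longrightarrow> P x"
proof -
  have "AE x in lebesgue. \<forall>m. m0 \<le> m \<longrightarrow> x \<in> {klo m..khi m} \<longrightarrow> P x"
    unfolding AE_all_countable using assms by (intro allI AE_impI)
  moreover have "AE x in lebesgue. x \<notin> {0::real}" by (intro AE_not_in) (simp flip: negligible_iff_null_sets)
  ultimately show ?thesis
  proof eventually_elim
    case (elim x)
    show ?case
    proof
      assume "x \<in> I"
      then have "x \<in> interior I" using elim(2) sg by auto
      then obtain m where "x \<in> {klo m..khi m}" by (rule k_interval_ex)
      then have "x \<in> {klo (max m m0)..khi (max m m0)}" using k_interval(3)[of m "max m m0"] by auto
      then show "P x" using elim(1)[rule_format, of "max m m0"] by auto
    qed
  qed
qed

text \<open>If det H vanished almost everywhere on every interval of the exhaustion, it would do so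
  on I. As the intervals increase, the property passes from one of them to all later ones.\<close>

lemma definite_interval:
  obtains m0 where "\<And>m. m0 \<le> m \<Longrightarrow> \<not> (AE x in lebesgue. x \<in> {klo m..khi m} \<longrightarrow> det (H x) = 0)"
proof -
  obtain m0 where m0: "\<not> (AE x in lebesgue. x \<in> {klo m0..khi m0} \<longrightarrow> det (H x) = 0)"
    using AE_I_of_k_intervals[of 0 "\<lambda>x. det (H x) = 0"] definite by blast
  show thesis
  proof (rule that[of m0])
    fix m assume "m0 \<le> m"
    show "\<not> (AE x in lebesgue. x \<in> {klo m..khi m} \<longrightarrow> det (H x) = 0)"
    proof
      assume "AE x in lebesgue. x \<in> {klo m..khi m} \<longrightarrow> det (H x) = 0"
      then have "AE x in lebesgue. x \<in> {klo m0..khi m0} \<longrightarrow> det (H x) = 0"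
        by eventually_elim (use k_interval(3)[OF \<open>m0 \<le> m\<close>] in auto)
      then show False using m0 by blast
    qed
  qed
qed

lemma null_imp_zero_or_det:
  assumes "AE x in lebesgue. x \<in> S \<longrightarrow> H x *v y x = 0"
  shows "AE x in lebesgue. x \<in> S \<longrightarrow> y x = 0 \<or> det (H x) = 0"
  using assms
proof eventually_elim
  case (elim x)
  show ?case
  proof (intro impI, rule disjCI)
    assume "x \<in> S" "det (H x) \<noteq> 0"
    then have "H x *v y x = 0" "invertible (H x)" using elim by (simp_all add: invertible_det_nz)
    then show "y x = 0" using invertible_matrix_inv_mult(2)[of "H x" "y x"] by simp
  qed
qed

lemma sol_null_zero:
  assumes s: "sol z y w" and ab: "{a..b} \<subseteq> I"
    and n: "AE x in lebesgue. x \<in> {a..b} \<longrightarrow> H x *v y x = 0"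
    and nd: "\<not> (AE x in lebesgue. x \<in> {a..b} \<longrightarrow> det (H x) = 0)" and x: "x \<in> I"
  shows "y x = 0 \<and> w x = 0"
  by (rule sol_vanish_imp[OF s ab null_imp_zero_or_det[OF n] nd x])

text \<open>The element \<open>f\<close> is projected onto the solutions restricted to \<open>[a, b]\<close>; the remainder \<open>g\<close> is
  orthogonal to them, hence the right-hand side of a pair in the minimal relation.\<close>

lemma adjoint_locally_solution:
  assumes f: "f \<in> L2fun I H"
    and adj: "(cls I H f, cls_scale I H z (cls I H f)) \<in> adjoint_relation I H (min_relation A Q R H I)"
    and \<Phi>: "\<And>x. linear (\<lambda>e. \<Phi> e x)" "\<And>e. \<Phi> e 0 = e"
      "\<And>e. sol z (\<lambda>x. fst (\<Phi> e x)) (\<lambda>x. snd (\<Phi> e x))"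
    and ab: "a \<le> b" "{a..b} \<subseteq> interior I"
    and nd: "\<not> (AE x in lebesgue. x \<in> {a..b} \<longrightarrow> det (H x) = 0)"
  obtains e :: "(complex^'n) \<times> (complex^'n)"
  where "AE x in lebesgue. x \<in> {a..b} \<longrightarrow> H x *v (f x - fst (\<Phi> e x)) = 0"
proof -
  have abI: "{a..b} \<subseteq> I" using ab(2) interior_subset by blast
  define Y where "Y e = restr {a..b} (\<lambda>x. fst (\<Phi> e x))" for e
  have YL2: "Y e \<in> L2fun I H" for e
    unfolding Y_def by (rule restr_continuous_L2[OF abI sol_continuous(1)[OF \<Phi>(3)]])
  have Yadd: "Y (u + v) = (\<lambda>x. Y u x + Y v x)" for u v
    unfolding Y_def restr_def linear_add[OF \<Phi>(1)] by auto
  have Ysc: "Y (r *\<^sub>R u) = (\<lambda>x. of_real r *s Y u x)" for r u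
    unfolding Y_def restr_def linear_cmul[OF \<Phi>(1)] by (auto simp: scaleR_eq_cscale)
  have lin_left: "linear (\<lambda>e. Re (ip I H (Y e) h))" if h: "h \<in> L2fun I H" for h
  proof (rule linearI)
    fix u v show "Re (ip I H (Y (u + v)) h) = Re (ip I H (Y u) h) + Re (ip I H (Y v) h)"
      unfolding Yadd ip_add_left[OF YL2 YL2 h] by simp
    fix r show "Re (ip I H (Y (r *\<^sub>R u)) h) = r *\<^sub>R Re (ip I H (Y u) h)"
      unfolding Ysc ip_scale_left by simp
  qed
  \<comment> \<open>The vector of initial data that represents the functional e -> Re <Y e, h>. Thus
    e -> \<Gamma> (Y e) is the real Gram operator of the restricted solutions, and projecting means
    inverting it.\<close>
  define \<Gamma> where "\<Gamma> h = (\<Sum>e\<in>Basis. Re (ip I H (Y e) h) *\<^sub>R e)" for h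
  have \<Gamma>_inner: "\<Gamma> h \<bullet> e = Re (ip I H (Y e) h)" if h: "h \<in> L2fun I H" for h e
  proof -
    have "(\<lambda>e. \<Gamma> h \<bullet> e) = (\<lambda>e. Re (ip I H (Y e) h))"
    proof (rule linear_eq_stdbasis)
      show "linear (\<lambda>e. \<Gamma> h \<bullet> e)" by (rule linearI) (simp_all add: inner_add_right)
      show "linear (\<lambda>e. Re (ip I H (Y e) h))" by (rule lin_left[OF h])
      fix b :: "(complex^'n) \<times> (complex^'n)" assume "b \<in> Basis"
      then show "\<Gamma> h \<bullet> b = Re (ip I H (Y b) h)"
        unfolding \<Gamma>_def by simp
    qed
    then show ?thesis by (rule fun_cong)
  qed
  have lin\<Gamma>: "linear (\<lambda>e. \<Gamma> (Y e))"
  proof (rule linearI)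
    fix u v show "\<Gamma> (Y (u + v)) = \<Gamma> (Y u) + \<Gamma> (Y v)"
      unfolding \<Gamma>_def Yadd ip_add_right[OF YL2 YL2 YL2] by (simp add: scaleR_add_left sum.distrib)
    fix r show "\<Gamma> (Y (r *\<^sub>R u)) = r *\<^sub>R \<Gamma> (Y u)"
      unfolding \<Gamma>_def Ysc ip_scale_right by (simp add: scaleR_sum_right)
  qed
  \<comment> \<open>A solution in the kernel of the Gram operator is null on [a, b]. There det H
    does not vanish almost everywhere, so the solution is 0 and so are its data.\<close>
  have "inj (\<lambda>e. \<Gamma> (Y e))"
    unfolding linear_injective_0[OF lin\<Gamma>]
  proof (intro allI impI)
    fix e assume "\<Gamma> (Y e) = 0"
    then have re: "Re (ip I H (Y e) (Y e)) = 0" using \<Gamma>_inner[OF YL2, of e e] by simp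
    have "ip I H (Y e) (Y e) = cnj (ip I H (Y e) (Y e))"
    proof -
      have ae: "AE x in lebesgue. x \<in> I \<longrightarrow> cdot (Y e x) (H x *v Y e x) = cnj (cdot (Y e x) (H x *v Y e x))"
        using H_psd
      proof eventually_elim
        case (elim x)
        then show ?case using hermitian_cdot[of "H x" "Y e x" "Y e x"] unfolding pos_semidef_def by (auto simp: cdot_cnj)
      qed
      have i: "integrable lebesgue (\<lambda>x. indicator I x *\<^sub>R cdot (Y e x) (H x *v Y e x))"
        using L2_cross[OF YL2 YL2] unfolding set_integrable_def .
      have "cnj (ip I H (Y e) (Y e)) = (LINT x|lebesgue. cnj (indicator I x *\<^sub>R cdot (Y e x) (H x *v Y e x)))"
        unfolding ip_def set_lebesgue_integral_def by (rule integral_bounded_linear[OF bounded_linear_cnj i, symmetric])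
      also have "\<dots> = ip I H (Y e) (Y e)"
        unfolding ip_def set_lebesgue_integral_def
      proof (rule integral_cong_AE)
        show "AE x in lebesgue. cnj (indicator I x *\<^sub>R cdot (Y e x) (H x *v Y e x)) = indicator I x *\<^sub>R cdot (Y e x) (H x *v Y e x)"
          using ae by eventually_elim (auto simp: indicator_def)
        show "(\<lambda>x. cnj (indicator I x *\<^sub>R cdot (Y e x) (H x *v Y e x))) \<in> borel_measurable lebesgue"
          using integrable_cnj[OF i] by (rule borel_measurable_integrable)
      qed (use i in auto)
      finally show ?thesis by simp
    qed
    then have "Im (ip I H (Y e) (Y e)) = 0" by (metis cnj.simps(2) equation_minus_iff neg_equal_zero)
    with re have "ip I H (Y e) (Y e) = 0" by (simp add: complex_eq_iff)
    then have "null (Y e)" using ip_self_zero_iff[OF YL2] by blast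
    then have "AE x in lebesgue. x \<in> {a..b} \<longrightarrow> H x *v fst (\<Phi> e x) = 0"
      unfolding null_def
    proof eventually_elim
      case (elim x)
      show ?case using elim abI by (auto simp: Y_def restr_def)
    qed
    from sol_null_zero[OF \<Phi>(3) abI this nd I_0] show "e = 0" by (simp add: \<Phi>(2) prod_eq_iff)
  qed
  then have "surj (\<lambda>e. \<Gamma> (Y e))" using linear_injective_imp_surjective[OF lin\<Gamma>] by blast
  define f1 where "f1 = restr {a..b} f"
  have f1L2: "f1 \<in> L2fun I H" unfolding f1_def by (rule restr_L2[OF f abI])
  obtain e where e: "\<Gamma> (Y e) = \<Gamma> f1" using \<open>surj (\<lambda>e. \<Gamma> (Y e))\<close> unfolding surj_def by metis
  define g where "g x = f1 x - Y e x" for x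
  have gL2: "g \<in> L2fun I H" unfolding g_def by (rule L2_diff[OF f1L2 YL2])
  have g0: "g x = 0" if "x \<notin> {a..b}" for x using that unfolding g_def f1_def Y_def restr_def by auto
  have ipg: "ip I H h g = ip I H h f1 - ip I H h (Y e)" if "h \<in> L2fun I H" for h
    using set_integral_diff(2)[OF L2_cross[OF that f1L2] L2_cross[OF that YL2]]
    unfolding ip_def g_def by (simp add: cdot_simps matrix_vector_mult_diff_distrib)
  have re0: "Re (ip I H (Y e') g) = 0" for e'
    using \<Gamma>_inner[OF f1L2, of e'] \<Gamma>_inner[OF YL2, of e e'] unfolding ipg[OF YL2] e by simp
  have sol_ip: "ip I H (restr {a..b} \<eta>) g = 0" if s: "sol z \<eta> \<omega>" for \<eta> \<omega>
  proof -
    have eq: "restr {a..b} y = Y (y 0, w 0)" if s: "sol z y w" for y w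
    proof -
      have "sol z (\<lambda>x. y x + (-1) *s fst (\<Phi> (y 0, w 0) x)) (\<lambda>x. w x + (-1) *s snd (\<Phi> (y 0, w 0) x))"
        by (rule sol_add[OF s sol_scale[OF \<Phi>(3)]])
      from sol_unique(1)[OF this I_0] have "y x = fst (\<Phi> (y 0, w 0) x)" if "x \<in> I" for x
        using that by (simp add: \<Phi>(2))
      then show ?thesis unfolding Y_def restr_def using abI by (intro ext) auto
    qed
    \<comment> \<open>The projection was made over the reals. Orthogonality to the solution i \<eta>
      supplies the imaginary part.\<close>
    have "Re (ip I H (restr {a..b} \<eta>) g) = 0" unfolding eq[OF s] by (rule re0)
    moreover have "Re (ip I H (restr {a..b} (\<lambda>x. \<i> *s \<eta> x)) g) = 0"
      unfolding eq[OF sol_scale[OF s, of \<i>]] by (rule re0)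
    moreover have "restr {a..b} (\<lambda>x. \<i> *s \<eta> x) = (\<lambda>x. \<i> *s restr {a..b} \<eta> x)" unfolding restr_def by auto
    ultimately show ?thesis by (simp add: ip_scale_left complex_eq_iff)
  qed
  have ip_restr: "ip I H (restr {a..b} \<eta>) g = (LINT x:I|lebesgue. cdot (\<eta> x) (H x *v g x))" for \<eta>
  proof -
    have "cdot (restr {a..b} \<eta> x) (H x *v g x) = cdot (\<eta> x) (H x *v g x)" for x
      using g0[of x] unfolding restr_def by (auto simp: cdot_simps)
    then show ?thesis unfolding ip_def by simp
  qed
  obtain u wu where u: "\<And>x. x \<notin> {a..b} \<Longrightarrow> u x = 0 \<and> wu x = 0"
    "solves u wu (\<lambda>x. H x *v (g x + cnj z *s u x))"
    by (rule compact_solution[OF gL2 ab g0, of z]) (use sol_ip in \<open>auto simp: ip_restr\<close>)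
  have uL2: "u \<in> L2fun I H"
  proof -
    have "u = restr {a..b} u" using u(1) unfolding restr_def by (intro ext) auto
    then show ?thesis using restr_continuous_L2[OF abI sol_continuous(1)[OF u(2)]] by simp
  qed
  \<comment> \<open>The choice v = g + cnj z u makes (u, v) an element of the minimal relation for
    which v - cnj z u is the given g.\<close>
  define v where "v x = g x + cnj z *s u x" for x
  have vL2: "v \<in> L2fun I H" unfolding v_def by (rule L2_add[OF gL2 L2_scale[OF uL2]])
  have "(cls I H u, cls I H v) \<in> min_relation A Q R H I"
    unfolding min_relation_def
  proof (intro CollectI exI conjI)
    show "(cls I H u, cls I H v) = (cls I H u, cls I H v)" ..
    show "v \<in> L2fun I H" by (rule vL2)
    show "compact {a..b}" by simp
    show "{a..b} \<subseteq> interior I" by (rule ab(2))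
    show "\<forall>x. x \<notin> {a..b} \<longrightarrow> u x = 0 \<and> wu x = 0 \<and> v x = 0" using u(1) g0 unfolding v_def by simp
    show "quasi_eq A Q R I u wu (\<lambda>x. H x *v v x)" unfolding quasi_eq_iff_solves v_def by (rule u(2))
  qed
  then have "cls_ip I H (cls I H f) (cls I H v) = cls_ip I H (cls_scale I H z (cls I H f)) (cls I H u)"
    using adj unfolding adjoint_relation_def by blast
  \<comment> \<open>The adjoint relation tested with (u, v) says <f, v> = cnj z <f, u>, hence <f, g>
    = 0. As g is also orthogonal to the solutions, <g, g> = 0.\<close>
  then have "ip I H f v = cnj z * ip I H f u"
    unfolding cls_scale_cls[OF f] cls_ip_cls[OF f vL2] cls_ip_cls[OF L2_scale[OF f] uL2] ip_scale_left .
  moreover have "ip I H f v = ip I H f g + cnj z * ip I H f u"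
    unfolding v_def ip_add_right[OF f gL2 L2_scale[OF uL2]] ip_scale_right ..
  ultimately have "ip I H f g = 0" by simp
  then have "ip I H f1 g = 0" unfolding f1_def using ip_restr[of f] by (simp add: ip_def)
  moreover have "ip I H (Y e) g = 0" unfolding Y_def by (rule sol_ip[OF \<Phi>(3)])
  moreover have "ip I H g g = ip I H f1 g - ip I H (Y e) g"
    using set_integral_diff(2)[OF L2_cross[OF f1L2 gL2] L2_cross[OF YL2 gL2]]
    unfolding ip_def by (subst (1) g_def) (simp add: cdot_simps)
  ultimately have "ip I H g g = 0" by simp
  then have "null g" using ip_self_zero_iff[OF gL2] by blast
  then have "AE x in lebesgue. x \<in> {a..b} \<longrightarrow> H x *v (f x - fst (\<Phi> e x)) = 0"
    unfolding null_def
  proof eventually_elim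
    case (elim x)
    show ?case using elim abI by (auto simp: g_def f1_def Y_def restr_def)
  qed
  then show thesis by (rule that)
qed

text \<open>On each interval of the exhaustion f agrees, up to a null function, with a solution. Two
  such solutions differ by a solution that is null on the smallest interval considered, hence by 0,
  so one solution serves all intervals.\<close>

lemma adjoint_is_solution:
  assumes f: "f \<in> L2fun I H"
    and adj: "(cls I H f, cls_scale I H z (cls I H f)) \<in> adjoint_relation I H (min_relation A Q R H I)"
  obtains y where "y \<in> L2_solutions z" "cls I H y = cls I H f"
proof -
  obtain \<Phi> :: "(complex^'n) \<times> (complex^'n) \<Rightarrow> real \<Rightarrow> (complex^'n) \<times> (complex^'n)"
    where \<Phi>: "\<And>x. linear (\<lambda>e. \<Phi> e x)" "\<And>e. \<Phi> e 0 = e"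
    "\<And>e. sol z (\<lambda>x. fst (\<Phi> e x)) (\<lambda>x. snd (\<Phi> e x))" by (rule flow_exists) blast
  obtain m0 where m0: "\<And>m. m0 \<le> m \<Longrightarrow> \<not> (AE x in lebesgue. x \<in> {klo m..khi m} \<longrightarrow> det (H x) = 0)"
    by (rule definite_interval) blast
  have "\<exists>e. AE x in lebesgue. x \<in> {klo m..khi m} \<longrightarrow> H x *v (f x - fst (\<Phi> e x)) = 0" if "m0 \<le> m" for m
    by (rule adjoint_locally_solution[OF f adj \<Phi> k_interval(1,2) m0[OF that]]) blast
  then have "\<forall>m. \<exists>e. m0 \<le> m \<longrightarrow> (AE x in lebesgue. x \<in> {klo m..khi m} \<longrightarrow> H x *v (f x - fst (\<Phi> e x)) = 0)" by blast
  from choice[OF this] obtain e where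
    e: "\<And>m. m0 \<le> m \<Longrightarrow> AE x in lebesgue. x \<in> {klo m..khi m} \<longrightarrow> H x *v (f x - fst (\<Phi> (e m) x)) = 0" by blast
  have eq: "e m = e m0" if m: "m0 \<le> m" for m
  proof -
    have ae: "AE x in lebesgue. x \<in> {klo m0..khi m0} \<longrightarrow> H x *v fst (\<Phi> (e m - e m0) x) = 0"
      using e[OF m] e[OF order_refl]
    proof eventually_elim
      case (elim x)
      show ?case
      proof
        assume x: "x \<in> {klo m0..khi m0}"
        then have "x \<in> {klo m..khi m}" using k_interval(3)[OF m] by blast
        then show "H x *v fst (\<Phi> (e m - e m0) x) = 0"
          using elim x unfolding linear_diff[OF \<Phi>(1)] by (simp add: matrix_vector_mult_diff_distrib)
      qed
    qed
    from sol_null_zero[OF \<Phi>(3) k_interval_I ae m0[OF order_refl] I_0]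
    have "e m - e m0 = 0" by (simp add: \<Phi>(2) prod_eq_iff)
    then show ?thesis by simp
  qed
  define y where "y x = (if x \<in> I then fst (\<Phi> (e m0) x) else 0)" for x
  have nul: "AE x in lebesgue. x \<in> I \<longrightarrow> H x *v (f x - fst (\<Phi> (e m0) x)) = 0"
  proof (rule AE_I_of_k_intervals[of m0])
    fix m assume m: "m0 \<le> m"
    show "AE x in lebesgue. x \<in> {klo m..khi m} \<longrightarrow> H x *v (f x - fst (\<Phi> (e m0) x)) = 0"
      using e[OF m] unfolding eq[OF m] .
  qed
  then have n: "null (\<lambda>x. f x - y x)" unfolding null_def by eventually_elim (simp add: y_def)
  have yL2: "y \<in> L2fun I H"
  proof (rule L2_of_hh)
    show "y \<in> borel_measurable borel"
      unfolding y_def by (rule restrict_measurable[OF sol_continuous(1)[OF \<Phi>(3)]])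
    show "y x = 0" if "x \<notin> I" for x using that unfolding y_def by simp
    have ae: "AE x in lebesgue. x \<in> I \<longrightarrow> hh y x = hh f x"
      using n[unfolded null_def] H_psd
    proof eventually_elim
      case (elim x)
      show ?case
      proof
        assume x: "x \<in> I"
        have h: "hermitian (H x)" using elim(2) x unfolding pos_semidef_def by blast
        have "H x *v y x = H x *v f x" using elim(1) x by (simp add: matrix_vector_mult_diff_distrib)
        then show "hh y x = hh f x"
          using hermitian_cdot[OF h, of "y x" "f x"] hermitian_cdot[OF h, of "f x" "f x"] by simp
      qed
    qed
    show "set_integrable lebesgue I (hh y)" by (rule absolutely_integrable_cong_AE[OF ae L2_hh[OF f]])
  qed
  have "sol z y (\<lambda>x. snd (\<Phi> (e m0) x))" by (rule sol_cong[OF \<Phi>(3)[of "e m0"]]) (simp_all add: y_def)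
  then have "y \<in> L2_solutions z" using yL2 unfolding L2_solutions_iff by blast
  moreover have "cls I H y = cls I H f" by (rule cls_eqI[OF yL2 f null_sym[OF n]])
  ultimately show thesis by (rule that)
qed

lemma L2_solution_null_zero:
  assumes y: "y \<in> L2fun I H" "sol z y w" and n: "null y"
  shows "y = (\<lambda>x. 0)"
proof
  fix x
  obtain m0 where m0: "\<And>m. m0 \<le> m \<Longrightarrow> \<not> (AE x in lebesgue. x \<in> {klo m..khi m} \<longrightarrow> det (H x) = 0)"
    by (rule definite_interval) blast
  have "AE x in lebesgue. x \<in> {klo m0..khi m0} \<longrightarrow> H x *v y x = 0"
    using n[unfolded null_def] by eventually_elim (use k_interval_I in blast)
  from sol_null_zero[OF y(2) k_interval_I this m0[OF order_refl]] show "y x = 0"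
    using y(1) unfolding L2fun_def by blast
qed

text \<open>Taking classes maps \<open>L2_solutions z\<close> into the defect space by
  \<open>solution_in_adjoint\<close>, onto it by \<open>adjoint_is_solution\<close>, and injectively
  by \<open>L2_solution_null_zero\<close>. Dependence and independence therefore transfer from
  functions to classes.\<close>

lemma deficiency_index_eq:
  assumes z: "Im z \<noteq> 0"
  shows "deficiency_index A Q R H I z = enat CARD('n)"
  unfolding deficiency_index_def
proof (rule complex_dim_eqI)
  let ?D = "{F \<in> L2space I H. (F, cls_scale I H z F) \<in> adjoint_relation I H (min_relation A Q R H I)}"
  let ?lc = "lin_comb (cls_add I H) (cls_scale I H) (cls I H (\<lambda>x. 0))"
  obtain F where F: "\<And>i. i < CARD('n) \<Longrightarrow> F i \<in> L2_solutions z"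
    "\<And>a. (\<lambda>x. \<Sum>i<CARD('n). a i *s F i x) = (\<lambda>x. 0) \<Longrightarrow> \<forall>i<CARD('n). a i = 0"
    by (rule L2_solutions_independent[OF z]) blast
  have FL2: "F i \<in> L2fun I H" if "i < CARD('n)" for i using F(1)[OF that] unfolding L2_solutions_iff by blast
  have "cls I H (F i) \<in> ?D" if "i < CARD('n)" for i
    using solution_in_adjoint[OF F(1)[OF that]] FL2[OF that] unfolding L2space_iff by blast
  moreover have "\<forall>i<CARD('n). a i = 0" if a: "?lc a (\<lambda>i. cls I H (F i)) CARD('n) = cls I H (\<lambda>x. 0)" for a
  proof -
    define Y where "Y x = (\<Sum>i<CARD('n). a i *s F i x)" for x
    have YL2: "Y \<in> L2fun I H" unfolding Y_def by (rule L2_sum[OF FL2])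
    have c: "cls I H Y = cls I H (\<lambda>x. 0)"
      unfolding Y_def using lin_comb_cls[OF FL2, where a=a] a by simp
    have "null Y" using cls_eqD[OF YL2 c] by simp
    have "\<forall>i. \<exists>w. i < CARD('n) \<longrightarrow> sol z (F i) w" using F(1) unfolding L2_solutions_iff by blast
    from choice[OF this] obtain W where W: "\<And>i. i < CARD('n) \<Longrightarrow> sol z (F i) (W i)" by blast
    have "sol z Y (\<lambda>x. \<Sum>i<CARD('n). a i *s W i x)" unfolding Y_def by (rule sol_sum) (use W in simp)
    then have "Y = (\<lambda>x. 0)" using L2_solution_null_zero[OF YL2 _ \<open>null Y\<close>] by blast
    then show ?thesis unfolding Y_def by (rule F(2))
  qed
  ultimately show "\<exists>G. (\<forall>i<CARD('n). G i \<in> ?D) \<and> (\<forall>a. ?lc a G CARD('n) = cls I H (\<lambda>x. 0) \<longrightarrow> (\<forall>i<CARD('n). a i = 0))"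
    by (intro exI[of _ "\<lambda>i. cls I H (F i)"] conjI allI impI) blast+
next
  let ?D = "{F \<in> L2space I H. (F, cls_scale I H z F) \<in> adjoint_relation I H (min_relation A Q R H I)}"
  let ?lc = "lin_comb (cls_add I H) (cls_scale I H) (cls I H (\<lambda>x. 0))"
  fix k and G :: "nat \<Rightarrow> (real \<Rightarrow> complex^'n) set"
  assume k: "CARD('n) < k" and G: "\<And>i. i < k \<Longrightarrow> G i \<in> ?D"
  have ex: "\<exists>y. y \<in> L2_solutions z \<and> cls I H y = G i" if i: "i < k" for i
  proof -
    obtain f where f: "f \<in> L2fun I H" "G i = cls I H f" using G[OF i] unfolding L2space_iff by blast
    have "(cls I H f, cls_scale I H z (cls I H f)) \<in> adjoint_relation I H (min_relation A Q R H I)"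
      using G[OF i] f(2) by simp
    then show ?thesis by (rule adjoint_is_solution[OF f(1)]) (use f(2) in blast)
  qed
  then have "\<forall>i. \<exists>y. i < k \<longrightarrow> y \<in> L2_solutions z \<and> cls I H y = G i" by blast
  from choice[OF this] obtain F where F: "\<And>i. i < k \<Longrightarrow> F i \<in> L2_solutions z \<and> cls I H (F i) = G i" by blast
  obtain a where a: "(\<lambda>x. \<Sum>i<k. a i *s F i x) = (\<lambda>x. 0)" "\<exists>i<k. a i \<noteq> 0"
    by (rule L2_solutions_dependent[OF z k, of F]) (use F in blast)+
  have FL2: "F i \<in> L2fun I H" if "i < k" for i using F[OF that] unfolding L2_solutions_iff by blast
  have lc_cong: "?lc a G j = ?lc a (\<lambda>i. cls I H (F i)) j" if "j \<le> k" for j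
    using that by (induction j) (simp_all add: F)
  have "?lc a G k = cls I H (\<lambda>x. 0)" using lc_cong[OF order_refl] lin_comb_cls[OF FL2, where a=a] a(1) by simp
  then show "\<exists>a. ?lc a G k = cls I H (\<lambda>x. 0) \<and> (\<exists>i<k. a i \<noteq> 0)" using a(2) by blast
qed

end

section \<open>The limit point condition\<close>

lemma AE_lebesgue_reflect:
  fixes P :: "real \<Rightarrow> bool"
  assumes "AE x in lebesgue. P x"
  shows "AE x in lebesgue. P (- x)"
proof -
  obtain N where N: "negligible N" "\<And>x. x \<notin> N \<Longrightarrow> P x"
    by (rule AE_lebesgue_negligibleE[OF assms]) blast
  have "negligible (uminus ` N)"
    by (rule negligible_differentiable_image_negligible[OF order_refl N(1)])
       (intro differentiable_on_minus differentiable_on_id[unfolded id_def] | simp)+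
  then have "AE x in lebesgue. x \<notin> uminus ` N" by (intro AE_not_in) (simp add: negligible_iff_null_sets)
  then show ?thesis
  proof eventually_elim
    case (elim x)
    have "- x \<notin> N"
    proof
      assume "- x \<in> N"
      then have "- (- x) \<in> uminus ` N" by (rule imageI)
      then show False using elim by simp
    qed
    then show ?case by (rule N(2))
  qed
qed

text \<open>Needed because \<^const>\<open>c_fun\<close> and \<open>q\<close> are not assumed to be measurable: the integral of a nonmeasurable
  function is the supremum of the integrals of its simple minorants.\<close>

lemma nn_integral_infinite_minorant:
  assumes f: "integral\<^sup>N M f = \<infinity>"
  obtains k where "k \<in> borel_measurable M" "\<And>x. k x \<le> f x" "integral\<^sup>N M k = \<infinity>"
proof -
  have sup: "(SUP g \<in> {g. simple_function M g \<and> g \<le> f}. integral\<^sup>S M g) = top"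
    using f unfolding nn_integral_def by simp
  have "\<exists>g. simple_function M g \<and> g \<le> f \<and> of_nat n < integral\<^sup>S M g" for n :: nat
  proof -
    have "of_nat n < (SUP g \<in> {g. simple_function M g \<and> g \<le> f}. integral\<^sup>S M g)"
      unfolding sup by (simp add: of_nat_less_top)
    then show ?thesis unfolding less_SUP_iff by blast
  qed
  then have "\<forall>n::nat. \<exists>g. simple_function M g \<and> g \<le> f \<and> of_nat n < integral\<^sup>S M g" by blast
  from choice[OF this] obtain g where
    g: "\<And>n. simple_function M (g n)" "\<And>n. g n \<le> f" "\<And>n. of_nat n < integral\<^sup>S M (g n)" by blast
  define k where "k x = (SUP n. g n x)" for x
  have km: "k \<in> borel_measurable M"
    unfolding k_def by (intro borel_measurable_SUP) (auto intro: borel_measurable_simple_function g(1))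
  have kf: "k x \<le> f x" for x unfolding k_def using g(2) by (intro SUP_least) (auto simp: le_fun_def)
  have "of_nat n \<le> integral\<^sup>N M k" for n :: nat
  proof -
    have "of_nat n \<le> integral\<^sup>N M (g n)" using g(3)[of n] nn_integral_eq_simple_integral[OF g(1)[of n]] by simp
    also have "\<dots> \<le> integral\<^sup>N M k" unfolding k_def by (intro nn_integral_mono SUP_upper) simp
    finally show ?thesis .
  qed
  then have "integral\<^sup>N M k = \<infinity>"
    by (metis ennreal_Ex_less_of_nat infinity_ennreal_def not_less top.not_eq_extremum)
  then show thesis using km kf by (intro that)
qed

lemma scaleR_matrix_vector: "(r *\<^sub>R (M::complex^'n^'m)) *v v = r *\<^sub>R (M *v v)"
  by (simp add: vec_eq_iff matrix_vector_mult_def scaleR_sum_right)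

context sl_system
begin

section \<open>Reflection to the right half line and the scalar estimate\<close>

lemma sg_mem: "0 \<le> t \<Longrightarrow> sg * t \<in> I"
  by (rule seg_sub(2))

lemma AE_sg:
  assumes "AE x in lebesgue. x \<in> I \<longrightarrow> P x"
  shows "AE t in lebesgue. 0 \<le> t \<longrightarrow> P (sg * t)"
proof -
  consider "sg = 1" | "sg = -1" using sg by blast
  then show ?thesis
  proof cases
    case 1
    show ?thesis using assms
    proof eventually_elim
      case (elim t)
      then show ?case using sg_mem[of t] by (simp add: 1)
    qed
  next
    case 2
    show ?thesis using AE_lebesgue_reflect[OF assms]
    proof eventually_elim
      case (elim t)
      then show ?case using sg_mem[of t] by (simp add: 2)
    qed
  qed
qed

lemma locally_ac_sg:
  fixes f :: "real \<Rightarrow> 'a::euclidean_space"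
  assumes f: "locally_abs_continuous_on I f"
  shows "locally_abs_continuous_on {0..} (\<lambda>t. f (sg * t))"
proof -
  note v = locally_ac_vector_derivative(2)[OF f I_convex]
  from sg show ?thesis
  proof
    assume s: "sg = 1 \<and> I = {0..}"
    show ?thesis using f unfolding conjunct1[OF s] unfolding conjunct2[OF s] by simp
  next
    assume s: "sg = -1 \<and> I = {..0}"
    have "ac_deriv {0..} (\<lambda>x. f (- x)) (\<lambda>x. - vector_derivative f (at (- x)))"
      by (rule ac_deriv_reflect[OF v]) (simp add: conjunct2[OF s])
    from ac_deriv_imp_locally_ac[OF this] show ?thesis unfolding conjunct1[OF s] by simp
  qed
qed

lemma has_vector_derivative_sg:
  assumes "(f has_vector_derivative D) (at (sg * t))"
  shows "((\<lambda>t. f (sg * t)) has_vector_derivative sg *\<^sub>R D) (at t)"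
proof -
  have "((\<lambda>t. sg * t) has_vector_derivative sg) (at t)"
    unfolding has_real_derivative_iff_has_vector_derivative[symmetric] by (auto intro!: derivative_eq_intros)
  from vector_diff_chain_at[OF this assms] show ?thesis by (simp add: o_def)
qed

lemma sg_sq: "sg * sg = 1"
  using sg by auto

lemma set_integrable_sg:
  fixes h :: "real \<Rightarrow> real"
  assumes "set_integrable lebesgue I h"
  shows "(\<lambda>t. h (sg * t)) absolutely_integrable_on {0..}"
  using sg
proof
  assume s: "sg = 1 \<and> I = {0..}"
  show ?thesis using assms unfolding conjunct1[OF s] unfolding conjunct2[OF s] by simp
next
  assume s: "sg = -1 \<and> I = {..0}"
  have "integrable lebesgue (\<lambda>x. indicator {..0} x *\<^sub>R h x)" using assms unfolding conjunct2[OF s] set_integrable_def .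
  from lebesgue_integrable_real_affine[OF this, of "-1" 0]
  show ?thesis unfolding conjunct1[OF s] set_integrable_def by (simp add: indicator_def)
qed

lemma integral_sg:
  fixes k :: "real \<Rightarrow> real"
  assumes r: "0 \<le> r"
  shows "integral {0..r} (\<lambda>t. k (sg * t)) = integral (seg r) k"
    "(\<lambda>t. k (sg * t)) integrable_on {0..r} \<longleftrightarrow> k integrable_on seg r"
proof -
  consider "sg = 1" | "sg = -1" using sg by blast
  then have "integral {0..r} (\<lambda>t. k (sg * t)) = integral (seg r) k \<and>
     ((\<lambda>t. k (sg * t)) integrable_on {0..r} \<longleftrightarrow> k integrable_on seg r)"
  proof cases
    case 1
    then show ?thesis using r unfolding seg_def by simp
  next
    case 2
    have "seg r = {-r..0}" using r unfolding seg_def 2 by simp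
    then show ?thesis
      using Henstock_Kurzweil_Integration.integral_reflect_real[where f=k and a="-r" and b=0]
        Henstock_Kurzweil_Integration.integrable_reflect_real[where f=k and a="-r" and b=0]
      by (simp add: 2)
  qed
  then show "integral {0..r} (\<lambda>t. k (sg * t)) = integral (seg r) k"
    "(\<lambda>t. k (sg * t)) integrable_on {0..r} \<longleftrightarrow> k integrable_on seg r" by auto
qed

text \<open>The scalar estimate applied to F t = sg y^* w at sg t. The reflection changes the sign
  of the derivative and the factor sg restores it, so F' has the same form on both half lines; the
  modulus of F is unaffected.\<close>

lemma limit_pointI:
  fixes k q :: "real \<Rightarrow> real"
  assumes k: "\<And>r. 0 \<le> r \<Longrightarrow> k integrable_on seg r" "\<And>x. 0 \<le> k x" "\<And>M. \<exists>r\<ge>0. integral (seg r) k > M"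
    and d: "0 < d" "\<And>x. x \<in> I \<Longrightarrow> d \<le> q x"
    and V: "AE x in lebesgue. x \<in> I \<longrightarrow>
           loewner_le (- (q x *\<^sub>R H x)) (R x - ctranspose (Q x) ** A x ** Q x)"
    and kc: "AE x in lebesgue. x \<in> I \<longrightarrow> (\<forall>y w. k x * norm (cdot y w)
        \<le> (1 / sqrt (q x)) * sqrt (Re (cdot w (A x *v w)) * Re (cdot y (H x *v y))))"
    and cases: "(locally_abs_continuous_on I (\<lambda>x. 1 / sqrt (q x)) \<and>
        (\<exists>C\<ge>0. AE x in lebesgue. x \<in> I \<longrightarrow> (\<forall>y w. \<bar>vector_derivative (\<lambda>x. 1 / sqrt (q x)) (at x)\<bar> * norm (cdot y w)
          \<le> C * sqrt (Re (cdot w (A x *v w)) * Re (cdot y (H x *v y))))))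
      \<or> (I = {0..} \<and> mono_on I q) \<or> (I = {..0} \<and> antimono_on I q)"
    and y: "sol lam y w" "set_integrable lebesgue I (hh y)" and \<epsilon>: "0 < \<epsilon>"
  shows "\<exists>x\<in>I. norm (cdot (y x) (w x)) < \<epsilon>"
proof (rule ccontr)
  assume "\<not> (\<exists>x\<in>I. norm (cdot (y x) (w x)) < \<epsilon>)"
  then have lb: "\<epsilon> \<le> norm (cdot (y x) (w x))" if "x \<in> I" for x using that by (simp add: not_less)
  define F where "F t = sg *\<^sub>R cdot (y (sg * t)) (w (sg * t))" for t
  have asg: "\<bar>sg\<bar> = 1" using sg by auto
  have nF: "norm (F t) = norm (cdot (y (sg * t)) (w (sg * t)))" for t unfolding F_def by (simp add: asg)
  define a where "a t = Re (cdot (w (sg * t)) (A (sg * t) *v w (sg * t)))" for t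
  define v where "v t = Re (cdot (y (sg * t)) ((R (sg * t) - ctranspose (Q (sg * t)) ** A (sg * t) ** Q (sg * t)) *v y (sg * t)))" for t
  define h where "h t = hh y (sg * t)" for t
  define p where "p t = 1 / sqrt (q (sg * t))" for t
  show False
  proof (rule scalar_limit_point[of F a v lam h "\<lambda>t. q (sg * t)" d p "\<lambda>t. k (sg * t)" \<epsilon> 0])
    show "locally_abs_continuous_on {0..} F"
      unfolding F_def
      by (rule locally_ac_bounded_linear[OF bounded_linear_scaleR_right locally_ac_sg[OF energy(1)[OF y(1)]]])
    show "AE t in lebesgue. 0 \<le> t \<longrightarrow>
      (F has_vector_derivative (complex_of_real (a t + v t) - lam * complex_of_real (h t))) (at t)"
      using AE_sg[OF sol_energy_deriv[OF y(1)]]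
    proof eventually_elim
      case (elim t)
      show ?case
      proof
        assume "0 \<le> t"
        from has_vector_derivative_sg[OF elim[rule_format, OF this]]
        have "((\<lambda>t. cdot (y (sg * t)) (w (sg * t))) has_vector_derivative
           sg *\<^sub>R (complex_of_real (a t + v t) - lam * complex_of_real (h t))) (at t)"
          unfolding a_def v_def h_def by simp
        from bounded_linear.has_vector_derivative[OF bounded_linear_scaleR_right this, of sg]
        show "(F has_vector_derivative (complex_of_real (a t + v t) - lam * complex_of_real (h t))) (at t)"
          unfolding F_def scaleR_scaleR sg_sq scaleR_one .
      qed
    qed
    show "AE t in lebesgue. 0 \<le> t \<longrightarrow> 0 \<le> a t \<and> 0 \<le> h t \<and> - (q (sg * t) * h t) \<le> v t"
    proof -
      have "AE x in lebesgue. x \<in> I \<longrightarrow> 0 \<le> Re (cdot (w x) (A x *v w x)) \<and> 0 \<le> hh y x \<and>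
        - (q x * hh y x) \<le> Re (cdot (y x) ((R x - ctranspose (Q x) ** A x ** Q x) *v y x))"
        using hh_nonneg[of y] V
      proof eventually_elim
        case (elim x)
        show ?case
        proof
          assume x: "x \<in> I"
          have "pos_semidef (A x)" using A_pos x by (blast intro: pos_def_imp_pos_semidef)
          moreover have "0 \<le> Re (cdot (y x) ((R x - ctranspose (Q x) ** A x ** Q x - - (q x *\<^sub>R H x)) *v y x))"
            using elim(2) x unfolding loewner_le_def pos_semidef_def by blast
          ultimately show "0 \<le> Re (cdot (w x) (A x *v w x)) \<and> 0 \<le> hh y x \<and>
            - (q x * hh y x) \<le> Re (cdot (y x) ((R x - ctranspose (Q x) ** A x ** Q x) *v y x))"
            using elim(1) x unfolding pos_semidef_def
            by (simp add: matrix_vector_mult_add_rdistrib cdot_simps scaleR_matrix_vector)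
        qed
      qed
      from AE_sg[OF this] show ?thesis unfolding a_def h_def v_def .
    qed
    show "h absolutely_integrable_on {0..}" unfolding h_def by (rule set_integrable_sg[OF y(2)])
    show "0 < d" by (rule d)
    show "d \<le> q (sg * t)" if "0 \<le> t" for t by (rule d(2)[OF sg_mem[OF that]])
    show "p t = 1 / sqrt (q (sg * t))" for t by (simp add: p_def)
    show "(\<lambda>t. k (sg * t)) integrable_on {0..x}" if "0 \<le> x" for x
      unfolding integral_sg(2)[OF that] by (rule k(1)[OF that])
    show "\<exists>x\<ge>0. M < integral {0..x} (\<lambda>t. k (sg * t))" for M
      using k(3)[of M] integral_sg(1) by (metis (no_types, lifting))
    show "0 \<le> k (sg * x)" for x by (rule k(2))
    show "AE t in lebesgue. 0 \<le> t \<longrightarrow> k (sg * t) * norm (F t) \<le> p t * sqrt (a t * h t)"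
      using AE_sg[OF kc] unfolding nF p_def a_def h_def by eventually_elim blast
    show "(locally_abs_continuous_on {0..} p \<and>
        (\<exists>C\<ge>0. AE t in lebesgue. 0 \<le> t \<longrightarrow> \<bar>vector_derivative p (at t)\<bar> * norm (F t) \<le> C * sqrt (a t * h t)))
      \<or> mono_on {0..} (\<lambda>t. q (sg * t))"
      using cases
    proof (elim disjE conjE)
      assume lac: "locally_abs_continuous_on I (\<lambda>x. 1 / sqrt (q x))"
        and "\<exists>C\<ge>0. AE x in lebesgue. x \<in> I \<longrightarrow> (\<forall>y w. \<bar>vector_derivative (\<lambda>x. 1 / sqrt (q x)) (at x)\<bar> * norm (cdot y w)
          \<le> C * sqrt (Re (cdot w (A x *v w)) * Re (cdot y (H x *v y))))"
      then obtain C where C: "0 \<le> C" and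
        ae: "AE x in lebesgue. x \<in> I \<longrightarrow> (\<forall>y w. \<bar>vector_derivative (\<lambda>x. 1 / sqrt (q x)) (at x)\<bar> * norm (cdot y w)
          \<le> C * sqrt (Re (cdot w (A x *v w)) * Re (cdot y (H x *v y))))" by blast
      have "AE t in lebesgue. 0 \<le> t \<longrightarrow> \<bar>vector_derivative p (at t)\<bar> * norm (F t) \<le> C * sqrt (a t * h t)"
        using AE_sg[OF ae] AE_sg[OF locally_ac_vector_derivative(1)[OF lac I_convex]]
      proof eventually_elim
        case (elim t)
        show ?case
        proof
          assume t: "0 \<le> t"
          have "(p has_vector_derivative sg *\<^sub>R vector_derivative (\<lambda>x. 1 / sqrt (q x)) (at (sg * t))) (at t)"
            unfolding p_def by (rule has_vector_derivative_sg[OF elim(2)[rule_format, OF t]])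
          then have "\<bar>vector_derivative p (at t)\<bar> = \<bar>vector_derivative (\<lambda>x. 1 / sqrt (q x)) (at (sg * t))\<bar>"
            using asg by (simp add: vector_derivative_at abs_mult)
          then show "\<bar>vector_derivative p (at t)\<bar> * norm (F t) \<le> C * sqrt (a t * h t)"
            using elim(1) t unfolding nF a_def h_def by simp
        qed
      qed
      moreover have "locally_abs_continuous_on {0..} p" unfolding p_def by (rule locally_ac_sg[OF lac])
      ultimately show ?thesis using C by blast
    next
      assume I0: "I = {0..}" and m: "mono_on I q"
      have "sg = 1" unfolding sg_def using I0 by simp
      then show ?thesis using m I0 by simp
    next
      assume I0: "I = {..0}" and m: "antimono_on I q"
      have "(1::real) \<notin> I" unfolding I0 by simp
      then have "I \<noteq> {0..}" by auto
      then have "sg = -1" unfolding sg_def by simp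
      moreover have "mono_on {0..} (\<lambda>t. q (- t))"
      proof (rule mono_onI)
        fix r s :: real assume rs: "r \<in> {0..}" "s \<in> {0..}" "r \<le> s"
        then have "- s \<in> I" "- r \<in> I" "- s \<le> - r" unfolding I0 by auto
        then show "q (- r) \<le> q (- s)" using m unfolding monotone_on_def by blast
      qed
      ultimately show ?thesis by simp
    qed
    show "0 < \<epsilon>" "(0::real) \<le> 0" using \<epsilon> by auto
    show "\<epsilon> \<le> norm (F x)" if "0 \<le> x" for x unfolding nF by (rule lb[OF sg_mem[OF that]])
  qed
qed

text \<open>Passage from an infinite Lebesgue integral of an extended-valued function to divergent
  integrals of a real one: the bound B makes k real-valued and integrable on segments, and monotone
  convergence along \<open>seg m\<close> gives the divergence.\<close>

lemma seg_integrals_unbounded: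
  fixes K :: "real \<Rightarrow> ennreal"
  assumes K: "K \<in> borel_measurable lebesgue" "integral\<^sup>N lebesgue K = \<infinity>" "\<And>x. x \<notin> I \<Longrightarrow> K x = 0" "\<And>x. K x \<le> ennreal B"
  defines "k \<equiv> \<lambda>x. enn2real (K x)"
  shows "0 \<le> r \<Longrightarrow> k integrable_on seg r" "\<exists>r\<ge>0. integral (seg r) k > M"
proof -
  have kK: "ennreal (k x) = K x" for x
    unfolding k_def using K(4)[of x] by (simp add: le_less_trans less_top)
  have kB: "k x \<le> max B 0" for x
    unfolding k_def using K(4)[of x] by (cases "0 \<le> B") (auto simp: enn2real_leI ennreal_neg max_def intro: enn2real_leI)
  have km: "k \<in> borel_measurable lebesgue" unfolding k_def using K(1) by measurable
  have ki: "k absolutely_integrable_on seg r" for r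
  proof (rule set_integrable_bound)
    show "(\<lambda>x. max B 0) absolutely_integrable_on seg r" unfolding seg_def by simp
    show "set_borel_measurable lebesgue (seg r) k"
      unfolding set_borel_measurable_def seg_def
      by (rule borel_measurable_scaleR[OF borel_measurable_indicator km]) simp
    show "AE x in lebesgue. x \<in> seg r \<longrightarrow> norm (k x) \<le> norm (max B 0)"
      using kB by (intro AE_I2) (auto simp: k_def)
  qed
  show ki': "k integrable_on seg r" for r using ki by (simp add: absolutely_integrable_on_def)
  show "\<exists>r\<ge>0. integral (seg r) k > M"
  proof (rule ccontr)
    assume "\<not> (\<exists>r\<ge>0. integral (seg r) k > M)"
    then have le: "integral (seg (real m)) k \<le> M" for m by (simp add: not_less)
    define f where "f m x = K x * indicator (seg (real m)) x" for m :: nat and x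
    have fm: "integral\<^sup>N lebesgue (f m) = ennreal (integral (seg (real m)) k)" for m
    proof -
      have "integral\<^sup>N lebesgue (f m) = (\<integral>\<^sup>+x. ennreal (k x) * indicator (seg (real m)) x \<partial>lborel)"
        unfolding f_def by (simp add: kK nn_integral_completion)
      also have "\<dots> = ennreal (integral (seg (real m)) k)"
        by (rule nn_integral_has_integral_lebesgue') (use ki' in \<open>auto simp: k_def\<close>)
      finally show ?thesis .
    qed
    have "(\<integral>\<^sup>+x. (SUP m. f m x) \<partial>lebesgue) = (SUP m. integral\<^sup>N lebesgue (f m))"
    proof (rule nn_integral_monotone_convergence_SUP)
      show "incseq f"
      proof (rule incseq_SucI, rule le_funI)
        fix m x
        show "f m x \<le> f (Suc m) x"
          unfolding f_def using seg_mono[of "real m" "real (Suc m)"] by (auto simp: indicator_def)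
      qed
      show "f m \<in> borel_measurable lebesgue" for m unfolding f_def seg_def
        by (intro borel_measurable_times_ennreal[OF K(1)] borel_measurable_indicator) simp
    qed
    moreover have "(SUP m. f m x) = K x" for x
    proof (rule antisym)
      show "(SUP m. f m x) \<le> K x" unfolding f_def by (intro SUP_least) (auto simp: indicator_def)
      obtain n where n: "\<bar>x\<bar> \<le> real n" using real_arch_simple by blast
      have "K x = f n x"
      proof (cases "x \<in> I")
        case True
        then have "x \<in> seg (real n)" using seg_ex[of x] seg_mono[OF _ n] by auto
        then show ?thesis unfolding f_def by simp
      qed (simp add: f_def K(3))
      then show "K x \<le> (SUP m. f m x)" by (metis SUP_upper UNIV_I)
    qed
    ultimately have "\<infinity> = (SUP m. integral\<^sup>N lebesgue (f m))" using K(2) by simp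
    also have "\<dots> \<le> ennreal M" unfolding fm by (intro SUP_least ennreal_leI le)
    finally show False by (simp add: top_unique)
  qed
qed

end

section \<open>The comparison function and the conclusion\<close>

lemma c_fun_finite:
  assumes "det (A x ** H x) \<noteq> 0"
  shows "c_fun A H x = ennreal (max 1 (onorm (\<lambda>v. (matrix_inv_sqrt (A x) ** matrix_inv_sqrt (H x)) *v v)))"
proof -
  have "max 1 (ennreal r) = ennreal (max 1 r)" for r
  proof (cases "1 \<le> r")
    case True
    then show ?thesis using ennreal_leI[OF True] by (simp add: max_absorb2)
  next
    case False
    then have "ennreal r \<le> 1" using ennreal_leI[of r 1] by simp
    then show ?thesis using False by (simp add: max_absorb1)
  qed
  then show ?thesis using assms unfolding c_fun_def by simp
qed

theorem theorem5p9:
  fixes A Q R H :: "real \<Rightarrow> complex^'n^'n" and q :: "real \<Rightarrow> real" and I :: "real set" and d :: real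
  assumes "I = {0..} \<or> I = {..0}"
    and "locally_integrable_on I A" "locally_integrable_on I Q"
    and "locally_integrable_on I R" "locally_integrable_on I H"
    and "locally_integrable_on I (\<lambda>x. A x ** Q x)"
    and "locally_integrable_on I (\<lambda>x. ctranspose (Q x) ** A x ** Q x)"
    and "AE x in lebesgue. x \<in> I \<longrightarrow> hermitian (R x)"
    and "\<forall>x\<in>I. pos_def (A x)"
    and "AE x in lebesgue. x \<in> I \<longrightarrow> pos_semidef (H x)"
    and "0 < d" and "\<forall>x\<in>I. d \<le> q x"
    and "AE x in lebesgue. x \<in> I \<longrightarrow>
           loewner_le (- (q x *\<^sub>R H x)) (R x - ctranspose (Q x) ** A x ** Q x)"
    and "(\<integral>\<^sup>+x\<in>I. 1 / (c_fun A H x * ennreal (sqrt (q x))) \<partial>lebesgue) = \<infinity>"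
    and "(locally_abs_continuous_on I (\<lambda>x. 1 / sqrt (q x)) \<and>
            (\<exists>C1::real. AE x in lebesgue. x \<in> I \<longrightarrow>
               ennreal \<bar>deriv (\<lambda>t. 1 / sqrt (q t)) x\<bar> * c_fun A H x \<le> ennreal C1))
         \<or> (I = {0..} \<and> mono_on I q)
         \<or> (I = {..0} \<and> antimono_on I q)"
  shows "(\<forall>lam. 0 < Im lam \<longrightarrow> formal_deficiency A Q R H I lam = enat CARD('n))
       \<and> (\<forall>lam. Im lam < 0 \<longrightarrow> formal_deficiency A Q R H I lam = enat CARD('n))
       \<and> deficiency_index A Q R H I \<i> = enat CARD('n)
       \<and> deficiency_index A Q R H I (- \<i>) = enat CARD('n)"
proof -
  interpret sl_system A Q R H I
    using assms(1-10) by unfold_locales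
  define o' where "o' x = onorm (\<lambda>v. (matrix_inv_sqrt (A x) ** matrix_inv_sqrt (H x)) *v v)" for x
  define c where "c x = max 1 (o' x)" for x
  have c1: "1 \<le> c x" "o' x \<le> c x" for x unfolding c_def by auto
  have cf: "c_fun A H x = ennreal (c x)" if "det (A x ** H x) \<noteq> 0" for x
    using c_fun_finite[of A x H] that unfolding c_def o'_def .
  have cinf: "c_fun A H x = \<infinity>" if "det (A x ** H x) = 0" for x
    using that unfolding c_fun_def by simp
  have q0: "0 < q x" "sqrt d \<le> sqrt (q x)" "0 < sqrt (q x)" if "x \<in> I" for x
    using assms(11,12) that by force+
  define f where "f x = 1 / (c_fun A H x * ennreal (sqrt (q x))) * indicator I x" for x
  have f_fin: "f x = ennreal (1 / (c x * sqrt (q x)))" if "x \<in> I" "det (A x ** H x) \<noteq> 0" for x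
  proof -
    have "c_fun A H x * ennreal (sqrt (q x)) = ennreal (c x * sqrt (q x))"
      unfolding cf[OF that(2)] using c1(1)[of x] q0[OF that(1)] by (simp add: ennreal_mult)
    moreover have "0 < c x * sqrt (q x)" using c1(1)[of x] q0(3)[OF that(1)] by (intro mult_pos_pos) auto
    ultimately show ?thesis
      unfolding f_def using that(1) divide_ennreal[of 1 "c x * sqrt (q x)"] by simp
  qed
  have f_inf: "f x = 0" if "x \<notin> I \<or> det (A x ** H x) = 0" for x
  proof (cases "x \<in> I")
    case True
    then have "c_fun A H x = \<infinity>" using cinf that by blast
    moreover have "ennreal (sqrt (q x)) \<noteq> 0" using q0[OF True] by simp
    ultimately show ?thesis unfolding f_def by simp
  qed (simp add: f_def)
  have f_inf': "integral\<^sup>N lebesgue f = \<infinity>" using assms(14) unfolding f_def .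
  \<comment> \<open>From c >= 1 and q >= d. This uniform bound makes the measurable minorant of f
    integrable on segments.\<close>
  have f_le: "f x \<le> ennreal (1 / sqrt d)" for x
  proof (cases "x \<notin> I \<or> det (A x ** H x) = 0")
    case False
    have "sqrt d \<le> 1 * sqrt (q x)" using q0 False by simp
    also have "\<dots> \<le> c x * sqrt (q x)" using c1(1)[of x] q0(3)[of x] False by (intro mult_right_mono) auto
    finally have le: "sqrt d \<le> c x * sqrt (q x)" .
    have "1 / (c x * sqrt (q x)) \<le> 1 / sqrt d"
      using le less_le_trans[of 0 "sqrt d" "c x * sqrt (q x)"] assms(11) by (simp add: frac_le)
    then show ?thesis using f_fin False by (simp add: ennreal_leI)
  qed (simp add: f_inf)
  \<comment> \<open>Below, k is used only through upper bounds, which it inherits from f, and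
    through the divergence of its integrals. A measurable minorant can therefore replace 1 / (c sqrt
    q).\<close>
  obtain K where K: "K \<in> borel_measurable lebesgue" "\<And>x. K x \<le> f x" "integral\<^sup>N lebesgue K = \<infinity>"
    by (rule nn_integral_infinite_minorant[OF f_inf']) blast
  define k where "k x = enn2real (K x)" for x
  have K0: "K x = 0" if "x \<notin> I" for x using K(2)[of x] f_inf[of x] that by simp
  have KB: "K x \<le> ennreal (1 / sqrt d)" for x using K(2) f_le by (rule order_trans)
  note seg_k = seg_integrals_unbounded[OF K(1,3) K0 KB, folded k_def]
  have comparison: "AE x in lebesgue. x \<in> I \<longrightarrow> det (A x ** H x) \<noteq> 0 \<longrightarrow>
      (\<forall>y w. norm (cdot y w) \<le> c x * sqrt (Re (cdot w (A x *v w)) * Re (cdot y (H x *v y))))"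
    using assms(10)
  proof eventually_elim
    case (elim x)
    show ?case
    proof (intro impI allI)
      fix y w assume x: "x \<in> I" "det (A x ** H x) \<noteq> 0"
      have Ap: "pos_semidef (A x)" using assms(9) x by (blast intro: pos_def_imp_pos_semidef)
      have Hp: "pos_semidef (H x)" using elim x by blast
      have "norm (cdot y w) \<le> o' x * sqrt (Re (cdot y (H x *v y))) * sqrt (Re (cdot w (A x *v w)))"
        unfolding o'_def by (rule onorm_comparison[OF Ap Hp x(2)])
      also have "\<dots> = o' x * sqrt (Re (cdot w (A x *v w)) * Re (cdot y (H x *v y)))"
        by (simp add: real_sqrt_mult)
      also have "\<dots> \<le> c x * sqrt (Re (cdot w (A x *v w)) * Re (cdot y (H x *v y)))"
        using c1(2) Ap Hp unfolding pos_semidef_def by (intro mult_right_mono) auto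
      finally show "norm (cdot y w) \<le> c x * sqrt (Re (cdot w (A x *v w)) * Re (cdot y (H x *v y)))" .
    qed
  qed
  have nonneg: "AE x in lebesgue. x \<in> I \<longrightarrow> (\<forall>y w. 0 \<le> Re (cdot w (A x *v w)) * Re (cdot y (H x *v y)))"
    using assms(10)
  proof eventually_elim
    case (elim x)
    show ?case
      using elim assms(9) pos_def_imp_pos_semidef[of "A x"] unfolding pos_semidef_def by auto
  qed
  \<comment> \<open>The factor c cancels between k <= 1 / (c sqrt q) and the comparison inequality.
    Where det (A H) = 0, the convention 1/\<infinity> = 0 gives k = 0.\<close>
  have kc: "AE x in lebesgue. x \<in> I \<longrightarrow> (\<forall>y w. k x * norm (cdot y w)
        \<le> (1 / sqrt (q x)) * sqrt (Re (cdot w (A x *v w)) * Re (cdot y (H x *v y))))"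
    using comparison nonneg
  proof eventually_elim
    case (elim x)
    show ?case
    proof (intro impI allI)
      fix y w assume x: "x \<in> I"
      define B where "B = sqrt (Re (cdot w (A x *v w)) * Re (cdot y (H x *v y)))"
      have B0: "0 \<le> B" unfolding B_def using elim(2) x by simp
      have "k x * norm (cdot y w) \<le> (1 / sqrt (q x)) * B"
      proof (cases "det (A x ** H x) = 0")
        case True
        then have "k x = 0" unfolding k_def using K(2)[of x] f_inf[of x] by simp
        then show ?thesis using B0 q0[OF x] by simp
      next
        case False
        have "k x \<le> 1 / (c x * sqrt (q x))"
          unfolding k_def using K(2)[of x] f_fin[OF x False] c1(1)[of x] q0[OF x] by (intro enn2real_leI) auto
        moreover have "norm (cdot y w) \<le> c x * B" unfolding B_def using elim(1) x False by blast
        ultimately have "k x * norm (cdot y w) \<le> 1 / (c x * sqrt (q x)) * (c x * B)"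
          using c1(1)[of x] q0[OF x] by (intro mult_mono) auto
        also have "\<dots> = (1 / sqrt (q x)) * B" using c1(1)[of x] by simp
        finally show ?thesis .
      qed
      then show "k x * norm (cdot y w) \<le> (1 / sqrt (q x)) * sqrt (Re (cdot w (A x *v w)) * Re (cdot y (H x *v y)))"
        unfolding B_def .
    qed
  qed
  have cases: "(locally_abs_continuous_on I (\<lambda>x. 1 / sqrt (q x)) \<and>
        (\<exists>C\<ge>0. AE x in lebesgue. x \<in> I \<longrightarrow> (\<forall>y w. \<bar>vector_derivative (\<lambda>x. 1 / sqrt (q x)) (at x)\<bar> * norm (cdot y w)
          \<le> C * sqrt (Re (cdot w (A x *v w)) * Re (cdot y (H x *v y))))))
      \<or> (I = {0..} \<and> mono_on I q) \<or> (I = {..0} \<and> antimono_on I q)"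
    using assms(15)
  proof (elim disjE)
    assume "locally_abs_continuous_on I (\<lambda>x. 1 / sqrt (q x)) \<and>
            (\<exists>C1::real. AE x in lebesgue. x \<in> I \<longrightarrow>
               ennreal \<bar>deriv (\<lambda>t. 1 / sqrt (q t)) x\<bar> * c_fun A H x \<le> ennreal C1)"
    then obtain C1 :: real where lac: "locally_abs_continuous_on I (\<lambda>x. 1 / sqrt (q x))"
      and C1: "AE x in lebesgue. x \<in> I \<longrightarrow>
               ennreal \<bar>deriv (\<lambda>t. 1 / sqrt (q t)) x\<bar> * c_fun A H x \<le> ennreal C1" by blast
    \<comment> \<open>A negative C1 is read as 0 by \<open>ennreal\<close>, hence the constant max
      C1 0.\<close>
    have "AE x in lebesgue. x \<in> I \<longrightarrow> (\<forall>y w. \<bar>vector_derivative (\<lambda>x. 1 / sqrt (q x)) (at x)\<bar> * norm (cdot y w)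
          \<le> max C1 0 * sqrt (Re (cdot w (A x *v w)) * Re (cdot y (H x *v y))))"
      using C1 locally_ac_vector_derivative(1)[OF lac I_convex] comparison nonneg
    proof eventually_elim
      case (elim x)
      show ?case
      proof (intro impI allI)
        fix y w assume x: "x \<in> I"
        define B where "B = sqrt (Re (cdot w (A x *v w)) * Re (cdot y (H x *v y)))"
        have B0: "0 \<le> B" unfolding B_def using elim(4) x by simp
        define D where "D = vector_derivative (\<lambda>x. 1 / sqrt (q x)) (at x)"
        have "((\<lambda>t. 1 / sqrt (q t)) has_real_derivative D) (at x)"
          using elim(2) x unfolding D_def has_real_derivative_iff_has_vector_derivative by blast
        then have "deriv (\<lambda>t. 1 / sqrt (q t)) x = D" by (rule DERIV_imp_deriv)
        then have DC: "ennreal \<bar>D\<bar> * c_fun A H x \<le> ennreal C1" using elim(1) x by simp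
        have "\<bar>D\<bar> * norm (cdot y w) \<le> max C1 0 * B"
        proof (cases "det (A x ** H x) = 0")
          \<comment> \<open>Here c is infinite, and a finite product with it forces the derivative
            of 1 / sqrt q to vanish.\<close>
          case True
          have "ennreal \<bar>D\<bar> = 0"
          proof (rule ccontr)
            assume "ennreal \<bar>D\<bar> \<noteq> 0"
            then have "ennreal \<bar>D\<bar> * c_fun A H x = \<infinity>" unfolding cinf[OF True] by simp
            then show False using DC by (simp add: top_unique)
          qed
          then have "D = 0" by simp
          then show ?thesis using B0 by simp
        next
          case False
          have "ennreal (\<bar>D\<bar> * c x) \<le> ennreal (max C1 0)"
            using order_trans[OF DC ennreal_leI[of C1 "max C1 0"]] c1(1)[of x]
            unfolding cf[OF False] by (simp add: ennreal_mult)
          then have Dc: "\<bar>D\<bar> * c x \<le> max C1 0" by (simp add: ennreal_le_iff)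
          have "\<bar>D\<bar> * norm (cdot y w) \<le> \<bar>D\<bar> * (c x * B)"
            unfolding B_def using elim(3) x False by (intro mult_left_mono) auto
          also have "\<dots> = (\<bar>D\<bar> * c x) * B" by simp
          also have "\<dots> \<le> max C1 0 * B" using Dc B0 by (intro mult_right_mono)
          finally show ?thesis .
        qed
        then show "\<bar>vector_derivative (\<lambda>x. 1 / sqrt (q x)) (at x)\<bar> * norm (cdot y w)
          \<le> max C1 0 * sqrt (Re (cdot w (A x *v w)) * Re (cdot y (H x *v y)))" unfolding B_def D_def .
      qed
    qed
    then show ?thesis using lac by (intro disjI1 conjI exI[of _ "max C1 0"]) auto
  qed blast+
  have H_definite: "\<not> (AE x in lebesgue. x \<in> I \<longrightarrow> det (H x) = 0)"
  proof
    assume "AE x in lebesgue. x \<in> I \<longrightarrow> det (H x) = 0"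
    then have "AE x in lebesgue. f x = 0" by eventually_elim (rule f_inf, auto simp: det_mul)
    then have "integral\<^sup>N lebesgue f = integral\<^sup>N lebesgue (\<lambda>x::real. 0)"
      using nn_integral_cong_AE[of f "\<lambda>x. 0" lebesgue] by blast
    then show False using f_inf' by simp
  qed
  interpret sl_limit_point A Q R H I
  proof
    show "\<exists>x\<in>I. norm (cdot (y x) (w x)) < \<epsilon>"
      if "sol lam y w" "set_integrable lebesgue I (hh y)" "0 < \<epsilon>" for lam y w \<epsilon>
    proof (rule limit_pointI[where k=k and q=q and d=d and y=y and w=w and lam=lam])
      show "0 \<le> k x" for x unfolding k_def by simp
      show "d \<le> q x" if "x \<in> I" for x using assms(12) that by blast
      show "k integrable_on seg r" if "0 \<le> r" for r using seg_k(1)[of r] that by simp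
      show "\<exists>r\<ge>0. M < integral (seg r) k" for M using seg_k(2)[of M] by simp
    qed (use assms(11,13) kc cases that in blast)+
    show "\<not> (AE x in lebesgue. x \<in> I \<longrightarrow> det (H x) = 0)" by (rule H_definite)
  qed
  show ?thesis
    using formal_deficiency_eq deficiency_index_eq[of \<i>] deficiency_index_eq[of "- \<i>"] by auto
qed

end
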